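(* Let $T>0$, $X$ a real Banach space, $Y,Z$ real normed spaces, $\Omega\subset X$ and $U\subset Y$ non-empty open subsets, $\xi_0\in\Omega$, $m,q\ge1$ integers, and let $f^0:[0,T]\times\Omega\times U\times Z\to\mathbb R$, $f:[0,T]\times\Omega\times U\times Z\to X$, $g^i:\Omega\times Z\to\mathbb R$ ($0\le i\le m$), $h^j:\Omega\times Z\to\mathbb R$ ($1\le j\le q$) be mappings. For $\pi\in Z$ let $(\mathcal B,\pi)$ be the Bolza problem and $V[\pi]$ its value, as in the context. Fix $\pi_0\in Z$ and assume: (SO) There is an open neighborhood $P$ of $\pi_0$ in $Z$ such that for every $\pi\in P$ there is a solution $(x[\pi],u[\pi])\in PC^1([0,T],\Omega)\times NPC^0_R([0,T],U)$ of $(\mathcal B,\pi)$. (SO-ter) The functions $[\pi\mapsto x[\pi]]$ and $[\pi\mapsto u[\pi]]$ are continuous at $\pi_0$ and, for all $\pi\in P$ and all $\delta\pi\in Z$, $D_G^+x[\pi;\delta\pi]$ and $D_G^+u[\pi;\delta\pi]$ exist. (IC1) $f^0\in C^0([0,T]\times\Omega\times U\times P,\mathbb R)$; $D_{G,2}f^0(t,\xi,\zeta,\pi)$ exists for all $(t,\xi,\zeta,\pi)\in[0,T]\times\Omega\times U\times P$; and for all $\pi\in P$ and all non-empty compact $K\subset\Omega\times U$, $\sup_{(t,\xi,\zeta)\in[0,T]\times K}\|D_{G,2}f^0(t,\xi,\zeta,\pi)\|<+\infty$. (IC2) For all $t\in[0,T]$, $D_{H,(2,3,4)}f^0(t,x[\pi_0](t),u[\pi_0](t),\pi_0)$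 exists; for all $\pi\in P$, $D_{H,3}f^0(T,x[\pi](T),u[\pi](T),\pi)$ exists, and $[\pi\mapsto D_{H,3}f^0(T,x[\pi](T),u[\pi](T),\pi)]\in C^0(P,Y^* )$. (IC3) There are $\kappa\in\mathcal L^1(([0,T],\mathcal B([0,T])),\mathfrak m_1;\mathbb R_+)$ and $\rho>0$ such that for all $t\in[0,T]$ and all $(\xi_1,\zeta_1,\pi_1),(\xi_2,\zeta_2,\pi_2)\in B_{\|\cdot\|_1}((x[\pi_0](t),u[\pi_0](t),\pi_0),\rho)$, $|f^0(t,\xi_1,\zeta_1,\pi_1)-f^0(t,\xi_2,\zeta_2,\pi_2)|\le\kappa(t)\|(\xi_1,\zeta_1,\pi_1)-(\xi_2,\zeta_2,\pi_2)\|$. (IC4) For all $(t,\zeta,\pi)\in[0,T]\times U\times P$, $D_{F,2}f^0(t,x[\pi](t),\zeta,\pi)$ exists, and for all $\pi\in P$, $[(t,\zeta)\mapsto D_{F,2}f^0(t,x[\pi](t),\zeta,\pi)]\in C^0([0,T]\times U,X^* )$. (IC5) For all $\pi\in P$ and $t\in[0,T]$, $D_{H,(2,3,4)}f^0(t,x[\pi](t),u[\pi](t),\pi)$ exists, and for all $t\in[0,T]$, $[\pi\mapsto D_{H,(2,4)}f^0(t,x[\pi](t),u[\pi](t),\pi)]\in C^0(P,(X\times Z)^* )$. (IC6) For all $\pi\in P$, $[t\mapsto D_{H,4}f^0(t,x[\pi](t),u[\pi](t),\pi)]\in\mathcal L^0(([0,T],\mathcal B([0,T])),(Z^*,\mathcal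 B(Z^* )))$. (V1) For all $\pi\in P$, $[(t,\xi,\zeta)\mapsto f(t,\xi,\zeta,\pi)]\in C^0([0,T]\times\Omega\times U,X)$; $D_{G,2}f(t,\xi,\zeta,\pi)$ exists for all $(t,\xi,\zeta,\pi)\in[0,T]\times\Omega\times U\times P$; and for all $\pi\in P$ and all non-empty compact $K\subset\Omega\times U$, $\sup_{(t,\xi,\zeta)\in[0,T]\times K}\|D_{G,2}f(t,\xi,\zeta,\pi)\|<+\infty$. (V2) For all $t\in[0,T]$, $D_{H,(2,3,4)}f(t,x[\pi_0](t),u[\pi_0](t),\pi_0)$ exists; for all $\pi\in P$, $D_{H,3}f(T,x[\pi](T),u[\pi](T),\pi)$ exists. (V3) For all $(t,\zeta,\pi)\in[0,T]\times U\times P$, $D_{F,2}f(t,x[\pi](t),\zeta,\pi)$ exists, and for all $\pi\in P$, $[(t,\zeta)\mapsto D_{F,2}f(t,x[\pi](t),\zeta,\pi)]\in C^0([0,T]\times U,\mathcal L(X,X))$. (V4) There is $\underline c\in\mathcal L^1(([0,T],\mathcal B([0,T])),\mathfrak m_1;\mathbb R_+)$ such that for all $t\in[0,T]$, $\|D_{H,4}f(t,x[\pi_0](t),u[\pi_0](t),\pi_0)\|\le\underline c(t)$. (V5) For all $\pi\in P$ and $t\in[0,T]$, $D_{H,(2,3,4)}f(t,x[\pi](t),u[\pi](t),\pi)$ exists, and for all $t\in[0,T]$, $[\pi\mapsto D_{H,(2,4)}f(t,x[\pi](t),u[\pi](t),\pi)]\in C^0(P,\mathcal L(X\times Z,X))$.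 (V6) For all $\pi\in P$, $[t\mapsto D_{H,4}f(t,x[\pi](t),u[\pi](t),\pi)]\in\mathcal L^0(([0,T],\mathcal B([0,T])),(\mathcal L(Z,X),\mathcal B(\mathcal L(Z,X))))$, and there is $c\in\mathcal L^1(([0,T],\mathcal B([0,T])),\mathfrak m_1;\mathbb R_+)$ such that for all $t\in[0,T]$ and $\pi\in P$, $\|D_{H,(2,4)}f(t,x[\pi](t),u[\pi](t),\pi)\|\le c(t)$. (CT1) For all $\phi\in\{g^i:0\le i\le m\}\cup\{h^j:1\le j\le q\}$, $D_H\phi(x[\pi_0](T),\pi_0)$ exists and, for all $\pi\in P$, $D_{H,1}\phi(x[\pi](T),\pi)$ exists. (CT2) For all $\pi\in P$ and $j\in\{1,\dots,q\}$, $h^j(\cdot,\pi)$ is continuous on a neighborhood of $x[\pi](T)$. (CT3) For all $\phi\in\{g^i:0\le i\le m\}\cup\{h^j:1\le j\le q\}$ and all $\pi\in P$, $\phi$ is Hadamard differentiable at $(x[\pi](T),\pi)$, and $[\pi\mapsto D_H\phi(x[\pi](T),\pi)]\in C^0(P,(X\times Z)^* )$. (CVT1) The family consisting of $D_{H,1}g^i(x[\pi_0](T),\pi_0)\circ D_{H,3}f(T,x[\pi_0](T),u[\pi_0](T),\pi_0)$ ($1\le i\le m$) and $D_{H,1}h^j(x[\pi_0](T),\pi_0)\circ D_{H,3}f(T,x[\pi_0](T),u[\pi_0](T),\pi_0)$ ($1\le j\le q$) is linearly independent. (CVT2) For all $\phi\in\{g^i:0\le i\le m\}\cup\{h^j:1\le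 j\le q\}$, $[\pi\mapsto D_{H,1}\phi(x[\pi](T),\pi)\circ D_{H,3}f(T,x[\pi](T),u[\pi](T),\pi)]\in C^0(P,Y^* )$. (ESP) There is an inner product $(\cdot|\cdot)$ on $Y^*$ which is continuous on $(Y^*,\|\cdot\|_{Y^*})^2$. Then there is an open neighborhood $\mathfrak W$ of $\pi_0$ such that $V$ is continuously Fréchet differentiable on $\mathfrak W$ and, for all $\pi\in\mathfrak W$ and all $\delta\pi\in Z$, $$\begin{aligned}D_FV[\pi]\cdot\delta\pi={}&D_{H,2}g^0(x[\pi](T),\pi)\cdot\delta\pi+\sum_{i=1}^m\lambda_i[\pi]D_{H,2}g^i(x[\pi](T),\pi)\cdot\delta\pi\\&+\sum_{j=1}^q\mu_j[\pi]D_{H,2}h^j(x[\pi](T),\pi)\cdot\delta\pi\\&+\int_{[0,T]}D_{H,4}f^0(t,x[\pi](t),u[\pi](t),\pi)\cdot\delta\pi\,d\mathfrak m_1(t)\\&+\int_{[0,T]}p[\pi](t)\cdot D_{H,4}f(t,x[\pi](t),u[\pi](t),\pi)\cdot\delta\pi\,d\mathfrak m_1(t),\end{aligned}$$ where $((\lambda_i[\pi])_{0\le i\le m},(\mu_j[\pi])_{1\le j\le q},p[\pi])$ is the unique Pontryagin triple, with $\lambda_0[\pi]=1$, of the solution $(x[\pi],u[\pi])$ of $(\mathcal B,\pi)$.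
   Context: Function spaces. For a Hausdorff topological space $W$, $PC^0([0,T],W)$ is the set of $x:[0,T]\to W$ which are continuous, or for which there is a subdivision $0=\tau_0<\dots<\tau_{k+1}=T$ such that $x$ is continuous at every $t\notin\{\tau_i\}$, the right limit $x(\tau_i+)$ exists in $W$ for $0\le i\le k$ and the left limit $x(\tau_i-)$ exists in $W$ for $1\le i\le k+1$. $NPC^0_R([0,T],W)$ is the set of $x\in PC^0([0,T],W)$ right-continuous on $[0,T[$ and left-continuous at $T$. For $W$ a subset of a real normed space, $PC^1([0,T],W)$ is the set of continuous $x:[0,T]\to W$ which are continuously differentiable, or for which there is a subdivision $0=\tau_0<\dots<\tau_{k+1}=T$ such that $x$ is continuously differentiable at every $t\notin\{\tau_i\}$, $x'_R(\tau_i)=x'(\tau_i+)$ exists for $0\le i\le k$ and $x'_L(\tau_i)=x'(\tau_i-)$ exists for $1\le i\le k+1$. The extended derivative is $\underline d x(t):=x'(t)$ if $t\notin\{\tau_i\}$, $\underline d x(\tau_i):=x'_R(\tau_i)$ for $0\le i\le k$, $\underline d x(T):=x'_L(T)$. For a normed space $W$, $NPC^0_R([0,T],W)$ has the sup norm $\|\cdot\|_\infty$, and $PC^1([0,T],W)$ has the norm $\|x\|_\infty+\|\underline dx\|_\infty$; continuity of, and the variations $D_G^+x[\pi;\delta\pi]$, $D_G^+u[\pi;\delta\pi]$ of, $\pi\mapsto x[\pi]$ and $\pi\mapsto u[\pi]$ are taken in $PC^1([0,T],X)$ and $NPC^0_R([0,T],Y)$. Differentials. $D_G^+\mathfrak f(x;v)=\lim_{\theta\to0+}(\mathfrak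 f(x+\theta v)-\mathfrak f(x))/\theta$ is the right Gâteaux variation. $D_G,D_H,D_F$ are the Gâteaux, Hadamard, Fréchet differentials (continuous linear maps): $D_G\mathfrak f(x)\cdot v=D^+_G\mathfrak f(x;v)$ for all $v$; $\mathfrak f$ is Hadamard differentiable at $x$ when moreover $\lim_{\theta\to0+,\,w\to v}(\mathfrak f(x+\theta w)-\mathfrak f(x))/\theta=D_H\mathfrak f(x)\cdot v$ for all $v$. Subscripts $i$ denote partial differentials in the $i$-th variable; $D_{H,(2,3,4)}$ (resp. $D_{H,(2,4)}$) is the Hadamard differential jointly in the 2nd, 3rd, 4th (resp. 2nd and 4th) variables. $\mathfrak m_1$ is Lebesgue measure on the Borel $\sigma$-algebra $\mathcal B([0,T])$, $\mathcal L^1$ the integrable functions, $\mathcal L^0$ the measurable functions, $\mathcal B(W)$ the Borel $\sigma$-algebra of $W$. On $X\times Y\times Z$, $\|(\xi,\zeta,\pi)\|_1=\|\xi\|+\|\zeta\|+\|\pi\|$; balls in (IC3) are understood to be in $\Omega\times U\times P$. Problem $(\mathcal B,\pi)$: maximize $\int_0^Tf^0(t,x(t),u(t),\pi)\,dt+g^0(x(T),\pi)$ over the pairs $(x,u)\in PC^1([0,T],\Omega)\times NPC^0_R([0,T],U)$ with $\underline dx(t)=f(t,x(t),u(t),\pi)$ for all $t\in[0,T]$, $x(0)=\xi_0$, $g^i(x(T),\pi)\ge0$ ($1\le i\le m$), $h^j(x(T),\pi)=0$ ($1\le j\le q$). A solution attains the maximum; $V[\pi]$ is the value (supremum). Pontryagin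 triple: let $H_\pi(t,\xi,\zeta,p,\lambda):=p\cdot f(t,\xi,\zeta,\pi)+\lambda f^0(t,\xi,\zeta,\pi)$. A Pontryagin triple of a solution $(x[\pi],u[\pi])$ of $(\mathcal B,\pi)$ is $((\lambda_i)_{0\le i\le m},(\mu_j)_{1\le j\le q},p)\in\mathbb R^{1+m}\times\mathbb R^q\times PC^1([0,T],X^* )$ with: $((\lambda_i),(\mu_j))\ne0$; $\lambda_i\ge0$ for all $i$; $\lambda_ig^i(x[\pi](T),\pi)=0$ for $1\le i\le m$; $\sum_{i=0}^m\lambda_iD_{H,1}g^i(x[\pi](T),\pi)+\sum_{j=1}^q\mu_jD_{H,1}h^j(x[\pi](T),\pi)=p(T)$; $\underline dp(t)=-D_{F,2}H_\pi(t,x[\pi](t),u[\pi](t),p(t),\lambda_0)$ for all $t$; $H_\pi(t,x[\pi](t),u[\pi](t),p(t),\lambda_0)\ge H_\pi(t,x[\pi](t),\zeta,p(t),\lambda_0)$ for all $t\in[0,T]$, $\zeta\in U$; and $t\mapsto H_\pi(t,x[\pi](t),u[\pi](t),p(t),\lambda_0)$ continuous on $[0,T]$. Under the assumptions of the claim, the triple with $\lambda_0=1$ exists and is unique for $\pi$ near $\pi_0$. *)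

theory Defs
  imports "HOL-Analysis.Analysis"
begin

text \<open>A function on $[0,T]$ is represented by a total function on the reals; every notion below
  depends only on its values on \<open>{0..T}\<close>.\<close>

definition subdivision :: "real \<Rightarrow> nat \<Rightarrow> (nat \<Rightarrow> real) \<Rightarrow> bool" where
  "subdivision T k \<tau> \<longleftrightarrow> \<tau> 0 = 0 \<and> \<tau> (k + 1) = T \<and> (\<forall>i\<le>k. \<tau> i < \<tau> (i + 1))"

definition PC0 :: "real \<Rightarrow> 'a::t2_space set \<Rightarrow> (real \<Rightarrow> 'a) set" where
  "PC0 T W = {x. x ` {0..T} \<subseteq> W \<and>
     (continuous_on {0..T} x \<or>
      (\<exists>k \<tau>. subdivision T k \<tau> \<and>
         (\<forall>t\<in>{0..T} - \<tau> ` {0..k + 1}. continuous (at t within {0..T}) x) \<and>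
         (\<forall>i\<in>{0..k}. \<exists>l\<in>W. (x \<longlongrightarrow> l) (at_right (\<tau> i))) \<and>
         (\<forall>i\<in>{1..k + 1}. \<exists>l\<in>W. (x \<longlongrightarrow> l) (at_left (\<tau> i)))))}"

definition NPC0R :: "real \<Rightarrow> 'a::t2_space set \<Rightarrow> (real \<Rightarrow> 'a) set" where
  "NPC0R T W = {x \<in> PC0 T W.
     (\<forall>t\<in>{0..<T}. (x \<longlongrightarrow> x t) (at_right t)) \<and> (x \<longlongrightarrow> x T) (at_left T)}"

definition deriv_on :: "real \<Rightarrow> (real \<Rightarrow> 'a::real_normed_vector) \<Rightarrow> real \<Rightarrow> 'a" where
  "deriv_on T x t = vector_derivative x (at t within {0..T})"

definition PC1 :: "real \<Rightarrow> 'a::real_normed_vector set \<Rightarrow> (real \<Rightarrow> 'a) set" where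
  "PC1 T W = {x. x ` {0..T} \<subseteq> W \<and> continuous_on {0..T} x \<and>
     (((\<forall>t\<in>{0..T}. x differentiable (at t within {0..T})) \<and> continuous_on {0..T} (deriv_on T x)) \<or>
      (\<exists>k \<tau>. subdivision T k \<tau> \<and>
         (\<forall>t\<in>{0..T} - \<tau> ` {0..k + 1}.
            x differentiable (at t within {0..T}) \<and> continuous (at t within {0..T}) (deriv_on T x)) \<and>
         (\<forall>i\<in>{0..k}. \<exists>d. (x has_vector_derivative d) (at (\<tau> i) within {\<tau> i..T}) \<and>
            (deriv_on T x \<longlongrightarrow> d) (at_right (\<tau> i))) \<and>
         (\<forall>i\<in>{1..k + 1}. \<exists>d. (x has_vector_derivative d) (at (\<tau> i) within {0..\<tau> i}) \<and>
            (deriv_on T x \<longlongrightarrow> d) (at_left (\<tau> i)))))}"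

text \<open>The extended derivative. Away from the subdivision points (and $T$) the ordinary derivative
  coincides with the right derivative, so no reference to the subdivision is needed.\<close>

definition ext_deriv :: "real \<Rightarrow> (real \<Rightarrow> 'a::real_normed_vector) \<Rightarrow> real \<Rightarrow> 'a" where
  "ext_deriv T x t = (if t < T then vector_derivative x (at t within {t..T})
                      else vector_derivative x (at t within {0..t}))"

definition sup_norm :: "real \<Rightarrow> (real \<Rightarrow> 'a::real_normed_vector) \<Rightarrow> real" where
  "sup_norm T x = (SUP t\<in>{0..T}. norm (x t))"

definition PC1_norm :: "real \<Rightarrow> (real \<Rightarrow> 'a::real_normed_vector) \<Rightarrow> real" where
  "PC1_norm T x = sup_norm T x + sup_norm T (ext_deriv T x)"

text \<open>Continuity at a point and existence of the right Gateaux variation, for a map \<open>F\<close> into a set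
  \<open>S\<close> of functions on $[0,T]$ that is a vector space normed by \<open>N\<close>.\<close>

definition path_continuous_at ::
  "((real \<Rightarrow> 'a::real_normed_vector) \<Rightarrow> real) \<Rightarrow> ('p::topological_space \<Rightarrow> real \<Rightarrow> 'a) \<Rightarrow> 'p \<Rightarrow> bool"
  where "path_continuous_at N F \<pi> \<longleftrightarrow> ((\<lambda>\<pi>'. N (\<lambda>t. F \<pi>' t - F \<pi> t)) \<longlongrightarrow> 0) (at \<pi>)"

definition path_variation_exists ::
  "(real \<Rightarrow> 'a::real_normed_vector) set \<Rightarrow> ((real \<Rightarrow> 'a) \<Rightarrow> real) \<Rightarrow>
   ('p::real_normed_vector \<Rightarrow> real \<Rightarrow> 'a) \<Rightarrow> 'p \<Rightarrow> 'p \<Rightarrow> bool"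
  where "path_variation_exists S N F \<pi> \<delta> \<longleftrightarrow>
    (\<exists>v\<in>S. ((\<lambda>\<theta>. N (\<lambda>t. (1 / \<theta>) *\<^sub>R (F (\<pi> + \<theta> *\<^sub>R \<delta>) t - F \<pi> t) - v t)) \<longlongrightarrow> 0) (at_right 0))"

definition has_right_variation ::
  "('a::real_normed_vector \<Rightarrow> 'b::real_normed_vector) \<Rightarrow> 'a \<Rightarrow> 'a \<Rightarrow> 'b \<Rightarrow> bool" where
  "has_right_variation F a v l \<longleftrightarrow>
     ((\<lambda>\<theta>. (1 / \<theta>) *\<^sub>R (F (a + \<theta> *\<^sub>R v) - F a)) \<longlongrightarrow> l) (at_right 0)"

definition has_gateaux ::
  "('a::real_normed_vector \<Rightarrow> 'b::real_normed_vector) \<Rightarrow> ('a \<Rightarrow>\<^sub>L 'b) \<Rightarrow> 'a \<Rightarrow> bool" where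
  "has_gateaux F D a \<longleftrightarrow> (\<forall>v. has_right_variation F a v (blinfun_apply D v))"

definition has_hadamard ::
  "('a::real_normed_vector \<Rightarrow> 'b::real_normed_vector) \<Rightarrow> ('a \<Rightarrow>\<^sub>L 'b) \<Rightarrow> 'a \<Rightarrow> bool" where
  "has_hadamard F D a \<longleftrightarrow> has_gateaux F D a \<and>
     (\<forall>v. ((\<lambda>(\<theta>, w). (1 / \<theta>) *\<^sub>R (F (a + \<theta> *\<^sub>R w) - F a)) \<longlongrightarrow> blinfun_apply D v)
            (at_right 0 \<times>\<^sub>F nhds v))"

definition gateaux_differentiable ::
  "('a::real_normed_vector \<Rightarrow> 'b::real_normed_vector) \<Rightarrow> 'a \<Rightarrow> bool" where
  "gateaux_differentiable F a \<longleftrightarrow> (\<exists>D. has_gateaux F D a)"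

definition hadamard_differentiable ::
  "('a::real_normed_vector \<Rightarrow> 'b::real_normed_vector) \<Rightarrow> 'a \<Rightarrow> bool" where
  "hadamard_differentiable F a \<longleftrightarrow> (\<exists>D. has_hadamard F D a)"

text \<open>Differentials are unique when they exist. Joint (partial) differentials are taken on product
  types, whose library norm is Euclidean; it is equivalent to the sum norm, so differentiability, continuity
  of the differential, and domination of its norm by some integrable function are the same for both.\<close>

definition DG :: "('a::real_normed_vector \<Rightarrow> 'b::real_normed_vector) \<Rightarrow> 'a \<Rightarrow> ('a \<Rightarrow>\<^sub>L 'b)" where
  "DG F a = (THE D. has_gateaux F D a)"

definition DH :: "('a::real_normed_vector \<Rightarrow> 'b::real_normed_vector) \<Rightarrow> 'a \<Rightarrow> ('a \<Rightarrow>\<^sub>L 'b)" where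
  "DH F a = (THE D. has_hadamard F D a)"

definition DF :: "('a::real_normed_vector \<Rightarrow> 'b::real_normed_vector) \<Rightarrow> 'a \<Rightarrow> ('a \<Rightarrow>\<^sub>L 'b)" where
  "DF F a = (THE D. (F has_derivative blinfun_apply D) (at a))"

definition m1 :: "real \<Rightarrow> real measure" where
  "m1 T = restrict_space lborel {0..T}"

definition bolza_objective ::
  "real \<Rightarrow> (real \<Rightarrow> 'x \<Rightarrow> 'y \<Rightarrow> 'z \<Rightarrow> real) \<Rightarrow> (nat \<Rightarrow> 'x \<Rightarrow> 'z \<Rightarrow> real) \<Rightarrow> 'z \<Rightarrow>
   (real \<Rightarrow> 'x) \<Rightarrow> (real \<Rightarrow> 'y) \<Rightarrow> real" where
  "bolza_objective T f0 g \<pi> x u = (\<integral>t. f0 t (x t) (u t) \<pi> \<partial>(m1 T)) + g 0 (x T) \<pi>"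

definition bolza_admissible ::
  "real \<Rightarrow> 'x::real_normed_vector set \<Rightarrow> 'y::t2_space set \<Rightarrow> 'x \<Rightarrow> nat \<Rightarrow> nat \<Rightarrow>
   (real \<Rightarrow> 'x \<Rightarrow> 'y \<Rightarrow> 'z \<Rightarrow> 'x) \<Rightarrow> (nat \<Rightarrow> 'x \<Rightarrow> 'z \<Rightarrow> real) \<Rightarrow> (nat \<Rightarrow> 'x \<Rightarrow> 'z \<Rightarrow> real) \<Rightarrow> 'z \<Rightarrow>
   ((real \<Rightarrow> 'x) \<times> (real \<Rightarrow> 'y)) set" where
  "bolza_admissible T \<Omega> U \<xi>0 m q f g h \<pi> =
     {(x, u). x \<in> PC1 T \<Omega> \<and> u \<in> NPC0R T U \<and>
        (\<forall>t\<in>{0..T}. ext_deriv T x t = f t (x t) (u t) \<pi>) \<and> x 0 = \<xi>0 \<and>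
        (\<forall>i\<in>{1..m}. g i (x T) \<pi> \<ge> 0) \<and> (\<forall>j\<in>{1..q}. h j (x T) \<pi> = 0)}"

definition bolza_solution ::
  "real \<Rightarrow> 'x::real_normed_vector set \<Rightarrow> 'y::t2_space set \<Rightarrow> 'x \<Rightarrow> nat \<Rightarrow> nat \<Rightarrow>
   (real \<Rightarrow> 'x \<Rightarrow> 'y \<Rightarrow> 'z \<Rightarrow> real) \<Rightarrow> (real \<Rightarrow> 'x \<Rightarrow> 'y \<Rightarrow> 'z \<Rightarrow> 'x) \<Rightarrow>
   (nat \<Rightarrow> 'x \<Rightarrow> 'z \<Rightarrow> real) \<Rightarrow> (nat \<Rightarrow> 'x \<Rightarrow> 'z \<Rightarrow> real) \<Rightarrow> 'z \<Rightarrow>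
   (real \<Rightarrow> 'x) \<Rightarrow> (real \<Rightarrow> 'y) \<Rightarrow> bool" where
  "bolza_solution T \<Omega> U \<xi>0 m q f0 f g h \<pi> x u \<longleftrightarrow>
     (x, u) \<in> bolza_admissible T \<Omega> U \<xi>0 m q f g h \<pi> \<and>
     (\<forall>(y, w)\<in>bolza_admissible T \<Omega> U \<xi>0 m q f g h \<pi>.
        bolza_objective T f0 g \<pi> y w \<le> bolza_objective T f0 g \<pi> x u)"

text \<open>A real supremum: it is meaningful whenever the problem has a solution, and is then the
  maximum.\<close>

definition bolza_value ::
  "real \<Rightarrow> 'x::real_normed_vector set \<Rightarrow> 'y::t2_space set \<Rightarrow> 'x \<Rightarrow> nat \<Rightarrow> nat \<Rightarrow>
   (real \<Rightarrow> 'x \<Rightarrow> 'y \<Rightarrow> 'z \<Rightarrow> real) \<Rightarrow> (real \<Rightarrow> 'x \<Rightarrow> 'y \<Rightarrow> 'z \<Rightarrow> 'x) \<Rightarrow>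
   (nat \<Rightarrow> 'x \<Rightarrow> 'z \<Rightarrow> real) \<Rightarrow> (nat \<Rightarrow> 'x \<Rightarrow> 'z \<Rightarrow> real) \<Rightarrow> 'z \<Rightarrow> real" where
  "bolza_value T \<Omega> U \<xi>0 m q f0 f g h \<pi> =
     (SUP (x, u)\<in>bolza_admissible T \<Omega> U \<xi>0 m q f g h \<pi>. bolza_objective T f0 g \<pi> x u)"

definition hamiltonian ::
  "(real \<Rightarrow> 'x::real_normed_vector \<Rightarrow> 'y \<Rightarrow> 'z \<Rightarrow> real) \<Rightarrow> (real \<Rightarrow> 'x \<Rightarrow> 'y \<Rightarrow> 'z \<Rightarrow> 'x) \<Rightarrow> 'z \<Rightarrow>
   real \<Rightarrow> 'x \<Rightarrow> 'y \<Rightarrow> ('x \<Rightarrow>\<^sub>L real) \<Rightarrow> real \<Rightarrow> real" where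
  "hamiltonian f0 f \<pi> t \<xi> \<zeta> p l = blinfun_apply p (f t \<xi> \<zeta> \<pi>) + l * f0 t \<xi> \<zeta> \<pi>"

text \<open>The triple is \<open>((l i)\<^bsub>i = 0..m\<^esub>, (\<mu> j)\<^bsub>j = 1..q\<^esub>, p on {0..T})\<close>; other values of \<open>l\<close>, \<open>\<mu>\<close>, \<open>p\<close>
  are irrelevant, so uniqueness of a triple means agreement on these index sets.\<close>

definition pontryagin_triple ::
  "real \<Rightarrow> 'y set \<Rightarrow> nat \<Rightarrow> nat \<Rightarrow>
   (real \<Rightarrow> 'x::real_normed_vector \<Rightarrow> 'y \<Rightarrow> 'z \<Rightarrow> real) \<Rightarrow> (real \<Rightarrow> 'x \<Rightarrow> 'y \<Rightarrow> 'z \<Rightarrow> 'x) \<Rightarrow>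
   (nat \<Rightarrow> 'x \<Rightarrow> 'z \<Rightarrow> real) \<Rightarrow> (nat \<Rightarrow> 'x \<Rightarrow> 'z \<Rightarrow> real) \<Rightarrow> 'z \<Rightarrow>
   (real \<Rightarrow> 'x) \<Rightarrow> (real \<Rightarrow> 'y) \<Rightarrow>
   (nat \<Rightarrow> real) \<Rightarrow> (nat \<Rightarrow> real) \<Rightarrow> (real \<Rightarrow> ('x \<Rightarrow>\<^sub>L real)) \<Rightarrow> bool" where
  "pontryagin_triple T U m q f0 f g h \<pi> x u l \<mu> p \<longleftrightarrow>
     p \<in> PC1 T UNIV \<and>
     ((\<exists>i\<in>{0..m}. l i \<noteq> 0) \<or> (\<exists>j\<in>{1..q}. \<mu> j \<noteq> 0)) \<and>
     (\<forall>i\<in>{0..m}. l i \<ge> 0) \<and>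
     (\<forall>i\<in>{1..m}. l i * g i (x T) \<pi> = 0) \<and>
     (\<Sum>i\<in>{0..m}. l i *\<^sub>R DH (\<lambda>\<xi>. g i \<xi> \<pi>) (x T)) +
       (\<Sum>j\<in>{1..q}. \<mu> j *\<^sub>R DH (\<lambda>\<xi>. h j \<xi> \<pi>) (x T)) = p T \<and>
     (\<forall>t\<in>{0..T}. ext_deriv T p t =
        - DF (\<lambda>\<xi>. hamiltonian f0 f \<pi> t \<xi> (u t) (p t) (l 0)) (x t)) \<and>
     (\<forall>t\<in>{0..T}. \<forall>\<zeta>\<in>U. hamiltonian f0 f \<pi> t (x t) (u t) (p t) (l 0)
        \<ge> hamiltonian f0 f \<pi> t (x t) \<zeta> (p t) (l 0)) \<and>
     continuous_on {0..T} (\<lambda>t. hamiltonian f0 f \<pi> t (x t) (u t) (p t) (l 0))"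

definition lin_indep_family :: "'i set \<Rightarrow> ('i \<Rightarrow> 'a::real_vector) \<Rightarrow> bool" where
  "lin_indep_family I v \<longleftrightarrow>
     finite I \<and> (\<forall>c. (\<Sum>i\<in>I. c i *\<^sub>R v i) = 0 \<longrightarrow> (\<forall>i\<in>I. c i = 0))"

definition is_inner_product :: "('a::real_vector \<Rightarrow> 'a \<Rightarrow> real) \<Rightarrow> bool" where
  "is_inner_product b \<longleftrightarrow> bilinear b \<and> (\<forall>v w. b v w = b w v) \<and> (\<forall>v. v \<noteq> 0 \<longrightarrow> b v v > 0)"

end

theory Submission imports Defs "HOL-Analysis.Analysis" begin

text \<open>At a fixed parameter, the necessary conditions come from needle variations: the endpoint displacements of
  finitely many needles generate a convex cone, and if no multiplier separated this cone from the improving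
  directions, Brouwer's theorem would produce an admissible pair with a larger value. The Hamiltonian is
  stationary in the control at $T$, so independence of the endpoint functionals gives \<open>\<lambda>\<^sub>0 \<noteq> 0\<close> and the uniqueness
  of the triple with \<open>\<lambda>\<^sub>0 = 1\<close>. A lower bound for the functionals that is uniform near \<open>\<pi>\<^sub>0\<close> makes the multipliers,
  and by Gronwall's inequality the adjoint arc, continuous in the parameter. When the objective is differentiated
  along $x[\pi]$, $u[\pi]$, the adjoint equation and complementary slackness eliminate the unknown variations of the
  state and the control; what remains is linear in the direction and, by dominated convergence, continuous in
  operator norm. A function with a continuous Gateaux differential is continuously Frechet differentiable.\<close>

section \<open>Piecewise continuous functions\<close>

text \<open>The state space is a general Banach space and the endpoint data are only Hadamard
  differentiable, so first-order expansions hold only along convergent directions. Needle weights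
  are therefore divided by their sum: up to a vanishing error the directions are convex combinations
  of finitely many vectors, and a subsequence converges. Compactness and Brouwer's theorem act on
  finitely many endpoint values only; in the state space Picard iteration and Gronwall estimates do
  the work. Brouwer's theorem uses continuity of the equality constraints near the endpoint, whereas
  the cost and the inequalities are controlled by their expansions. The difference quotients of f0
  get an integrable majorant from the Lipschitz bound (IC3); those of f converge because the
  variation of the state is taken in the norm of \<open>PC1\<close>. As U is open, the Hamiltonian
  is stationary in the control at every time, which removes the unknown variation of the control.
  Inequality constraints drop out because a nonzero multiplier stays nonzero nearby and so keeps its
  constraint active.\<close>

text \<open>Subdivision-free form of \<open>PC0\<close>: one-sided limits are required at all points, not only at the nodes.\<close>

definition pcw :: "real \<Rightarrow> 'a::t2_space set \<Rightarrow> (real \<Rightarrow> 'a) \<Rightarrow> bool" where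
  "pcw T W f \<longleftrightarrow> f ` {0..T} \<subseteq> W \<and> (\<exists>S. finite S \<and> (\<forall>t\<in>{0<..<T} - S. isCont f t)) \<and>
     (\<forall>t\<in>{0..<T}. \<exists>l\<in>W. (f \<longlongrightarrow> l) (at_right t)) \<and>
     (\<forall>t\<in>{0<..T}. \<exists>l\<in>W. (f \<longlongrightarrow> l) (at_left t))"

text \<open>The normalisation that turns \<open>PC0\<close> into \<open>NPC0R\<close>. It also fixes
  the value of an extended derivative at its jumps, so that derivatives of trajectories are
  normalised functions too.\<close>

definition rcont :: "real \<Rightarrow> (real \<Rightarrow> 'a::t2_space) \<Rightarrow> bool" where
  "rcont T f \<longleftrightarrow> (\<forall>t\<in>{0..<T}. (f \<longlongrightarrow> f t) (at_right t)) \<and> (f \<longlongrightarrow> f T) (at_left T)"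

locale pos_time =
  fixes T :: real
  assumes T_pos: "0 < T"
begin

lemma subdivision_points:
  assumes "subdivision T k \<tau>"
  shows "i \<le> k + 1 \<Longrightarrow> \<tau> i \<in> {0..T}" "i \<le> k \<Longrightarrow> \<tau> i < T" "1 \<le> i \<Longrightarrow> i \<le> k + 1 \<Longrightarrow> 0 < \<tau> i"
proof -
  have step: "\<tau> i < \<tau> (Suc i)" if "i \<le> k" for i
    using assms that by (auto simp: subdivision_def)
  have lt: "\<tau> i < \<tau> j" if "i < j" "j \<le> k + 1" for i j
    using that
  proof (induction j)
    case (Suc j)
    then show ?case using step[of j] by (cases "i = j") auto
  qed simp
  have ends: "\<tau> 0 = 0" "\<tau> (k + 1) = T" using assms by (auto simp: subdivision_def)
  show "\<tau> i < T" if "i \<le> k" using lt[of i "k + 1"] that ends by simp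
  show "0 < \<tau> i" if "1 \<le> i" "i \<le> k + 1" using lt[of 0 i] that ends by simp
  show "\<tau> i \<in> {0..T}" if "i \<le> k + 1"
    using lt[of 0 i] lt[of i "k + 1"] that ends T_pos
    by (cases "i = 0"; cases "i = k + 1") (auto simp: less_imp_le)
qed

lemma subdivision_exists:
  assumes "finite S"
  shows "\<exists>k \<tau>. subdivision T k \<tau> \<and> \<tau> ` {0..k + 1} = {0, T} \<union> (S \<inter> {0<..<T})"
proof -
  define A where "A = {0, T} \<union> (S \<inter> {0<..<T})"
  define L where "L = sorted_list_of_set A"
  have fin: "finite A" using assms by (auto simp: A_def)
  have setL: "set L = A" and dL: "distinct L" and sL: "sorted_wrt (<) L"
    using fin by (auto simp: L_def)
  have lenL: "length L = card A" using setL dL by (metis distinct_card)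
  have "card {0, T} \<le> card A" by (rule card_mono[OF fin]) (auto simp: A_def)
  then have "2 \<le> length L" using T_pos lenL by simp
  \<comment> \<open>The nodes of a subdivision are numbered from 0 to k + 1, hence the offset 2; 0
    and T are distinct nodes because T is positive.\<close>
  then obtain k where k: "length L = k + 2" by (metis add.commute le_Suc_ex)
  have lt: "L ! i < L ! j" if "i < j" "j < k + 2" for i j
    using sL that k sorted_wrt_nth_less by fastforce
  have inA: "L ! i \<in> {0..T}" if "i < k + 2" for i
    using nth_mem[of i L] that k setL T_pos by (auto simp: A_def)
  have "0 \<in> set L" "T \<in> set L" by (auto simp: setL A_def)
  then obtain i0 i1 where i: "i0 < k + 2" "L ! i0 = 0" "i1 < k + 2" "L ! i1 = T"
    by (metis in_set_conv_nth k)
  have "L ! 0 = 0" using lt[of 0 i0] inA[of 0] i by (cases "i0 = 0") auto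
  moreover have "L ! (k + 1) = T" using lt[of i1 "k + 1"] inA[of "k + 1"] i by (cases "i1 = k + 1") auto
  ultimately have "subdivision T k (\<lambda>i. L ! i)"
    using lt by (auto simp: subdivision_def)
  moreover have "(\<lambda>i. L ! i) ` {0..k + 1} = set L"
    unfolding set_conv_nth k by (auto simp: image_iff) 
  ultimately show ?thesis using setL A_def by metis
qed

lemma within_imp_one_sided:
  assumes "(f \<longlongrightarrow> l) (at t within {0..T})"
  shows "t \<in> {0..<T} \<Longrightarrow> (f \<longlongrightarrow> l) (at_right t)" "t \<in> {0<..T} \<Longrightarrow> (f \<longlongrightarrow> l) (at_left t)"
proof -
  assume "t \<in> {0..<T}"
  then have "at_right t = at t within {t..T}" by (simp add: at_within_Icc_at_right)
  moreover have "(f \<longlongrightarrow> l) (at t within {t..T})"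
    by (rule tendsto_within_subset[OF assms]) (use \<open>t \<in> {0..<T}\<close> in auto)
  ultimately show "(f \<longlongrightarrow> l) (at_right t)" by simp
next
  assume "t \<in> {0<..T}"
  then have "at_left t = at t within {0..t}" by (simp add: at_within_Icc_at_left)
  moreover have "(f \<longlongrightarrow> l) (at t within {0..t})"
    by (rule tendsto_within_subset[OF assms]) (use \<open>t \<in> {0<..T}\<close> in auto)
  ultimately show "(f \<longlongrightarrow> l) (at_left t)" by simp
qed

lemma continuous_pcw:
  assumes "continuous_on {0..T} f" "f ` {0..T} \<subseteq> W"
  shows "pcw T W f" "rcont T f"
proof -
  have lim: "(f \<longlongrightarrow> f t) (at t within {0..T})" if "t \<in> {0..T}" for t
    using assms(1) that by (auto simp: continuous_on_def)
  have "isCont f t" if "t \<in> {0<..<T}" for t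
    by (rule continuous_on_interior[OF assms(1)]) (use that in simp)
  moreover have "f t \<in> W" if "t \<in> {0..T}" for t using assms(2) that by auto
  ultimately show "pcw T W f"
    unfolding pcw_def
  proof (intro conjI exI[of _ "{}"] ballI)
    show "\<exists>l\<in>W. (f \<longlongrightarrow> l) (at_right t)" if "t \<in> {0..<T}" for t
      by (rule bexI[of _ "f t"], rule within_imp_one_sided, rule lim) (use that \<open>f ` {0..T} \<subseteq> W\<close> in auto)
    show "\<exists>l\<in>W. (f \<longlongrightarrow> l) (at_left t)" if "t \<in> {0<..T}" for t
      by (rule bexI[of _ "f t"], rule within_imp_one_sided, rule lim) (use that \<open>f ` {0..T} \<subseteq> W\<close> in auto)
  qed (use assms(2) in auto)
  show "rcont T f"
    unfolding rcont_def
    using within_imp_one_sided(1)[OF lim] within_imp_one_sided(2)[OF lim[of T]] T_pos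
    by (simp add: Ball_def)
qed

lemma PC0_imp_pcw:
  assumes "f \<in> PC0 T W"
  shows "pcw T W f"
proof (cases "continuous_on {0..T} f")
  case True
  then show ?thesis using assms continuous_pcw(1) by (auto simp: PC0_def)
next
  case False
  then obtain k \<tau> where s: "subdivision T k \<tau>"
    and c: "\<And>t. t \<in> {0..T} - \<tau> ` {0..k + 1} \<Longrightarrow> continuous (at t within {0..T}) f"
    and r: "\<And>i. i \<in> {0..k} \<Longrightarrow> \<exists>l\<in>W. (f \<longlongrightarrow> l) (at_right (\<tau> i))"
    and l: "\<And>i. i \<in> {1..k + 1} \<Longrightarrow> \<exists>l\<in>W. (f \<longlongrightarrow> l) (at_left (\<tau> i))"
    and W: "f ` {0..T} \<subseteq> W"
    using assms unfolding PC0_def by blast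
  have ends: "\<tau> 0 = 0" "\<tau> (k + 1) = T" using s by (auto simp: subdivision_def)
  have c': "(f \<longlongrightarrow> f t) (at t within {0..T})" if "t \<in> {0..T} - \<tau> ` {0..k + 1}" for t
    using c[OF that] by (simp add: continuous_within)
  have "isCont f t" if "t \<in> {0<..<T} - \<tau> ` {0..k + 1}" for t
    using c[of t] that at_within_Icc_at[of 0 t T] by auto
  moreover have "\<exists>l\<in>W. (f \<longlongrightarrow> l) (at_right t)" if "t \<in> {0..<T}" for t
  proof (cases "t \<in> \<tau> ` {0..k + 1}")
    case True
    then obtain i where i: "t = \<tau> i" "i \<le> k + 1" by auto
    then have "i \<le> k" using that ends by (cases "i = k + 1") auto
    then show ?thesis using r i by auto
  next
    case False
    then show ?thesis using c'[of t] within_imp_one_sided(1)[of f "f t" t] that W by fastforce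
  qed
  moreover have "\<exists>l\<in>W. (f \<longlongrightarrow> l) (at_left t)" if "t \<in> {0<..T}" for t
  proof (cases "t \<in> \<tau> ` {0..k + 1}")
    case True
    then obtain i where i: "t = \<tau> i" "i \<le> k + 1" by auto
    then have "1 \<le> i" using that ends by (cases i) auto
    then show ?thesis using l i by auto
  next
    case False
    then show ?thesis using c'[of t] within_imp_one_sided(2)[of f "f t" t] that W by fastforce
  qed
  ultimately show ?thesis unfolding pcw_def using W
    by (intro conjI exI[of _ "\<tau> ` {0..k + 1}"]) auto
qed

lemma pcw_imp_PC0:
  assumes "pcw T W f"
  shows "f \<in> PC0 T W"
proof -
  obtain S where S: "finite S" "\<And>t. t \<in> {0<..<T} - S \<Longrightarrow> isCont f t"
    using assms unfolding pcw_def by blast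
  obtain k \<tau> where s: "subdivision T k \<tau>" and \<tau>: "\<tau> ` {0..k + 1} = {0, T} \<union> (S \<inter> {0<..<T})"
    using subdivision_exists[OF S(1)] by blast
  have "continuous (at t within {0..T}) f" if "t \<in> {0..T} - \<tau> ` {0..k + 1}" for t
    by (rule continuous_at_imp_continuous_at_within, rule S(2)) (use that \<tau> in force)
  moreover have "\<exists>l\<in>W. (f \<longlongrightarrow> l) (at_right (\<tau> i))" if "i \<in> {0..k}" for i
    using assms subdivision_points(1,2)[OF s, of i] that unfolding pcw_def by force
  moreover have "\<exists>l\<in>W. (f \<longlongrightarrow> l) (at_left (\<tau> i))" if "i \<in> {1..k + 1}" for i
    using assms subdivision_points(1,3)[OF s, of i] that unfolding pcw_def by force
  ultimately show ?thesis using s assms unfolding PC0_def pcw_def by blast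
qed

lemma NPC0R_iff: "f \<in> NPC0R T W \<longleftrightarrow> pcw T W f \<and> rcont T f"
  using PC0_imp_pcw pcw_imp_PC0 unfolding NPC0R_def rcont_def by blast

lemma pcw_mono: "pcw T W f \<Longrightarrow> W \<subseteq> W' \<Longrightarrow> pcw T W' f"
  unfolding pcw_def by (intro conjI) blast+

lemma pcw_Pair:
  assumes "pcw T A f" "pcw T B g"
  shows "pcw T (A \<times> B) (\<lambda>t. (f t, g t))"
proof -
  obtain S S' where "finite S" "\<forall>t\<in>{0<..<T} - S. isCont f t" "finite S'" "\<forall>t\<in>{0<..<T} - S'. isCont g t"
    using assms unfolding pcw_def by blast
  then have "finite (S \<union> S')" "\<forall>t\<in>{0<..<T} - (S \<union> S'). isCont (\<lambda>t. (f t, g t)) t"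
    by (auto intro!: isCont_Pair)
  moreover have "\<exists>l\<in>A \<times> B. ((\<lambda>t. (f t, g t)) \<longlongrightarrow> l) (at_right t)" if t: "t \<in> {0..<T}" for t
  proof -
    obtain a b where "a \<in> A" "b \<in> B" "(f \<longlongrightarrow> a) (at_right t)" "(g \<longlongrightarrow> b) (at_right t)"
      using assms t unfolding pcw_def by meson
    then show ?thesis by (intro bexI[of _ "(a, b)"] tendsto_Pair) auto
  qed
  moreover have "\<exists>l\<in>A \<times> B. ((\<lambda>t. (f t, g t)) \<longlongrightarrow> l) (at_left t)" if t: "t \<in> {0<..T}" for t
  proof -
    obtain a b where "a \<in> A" "b \<in> B" "(f \<longlongrightarrow> a) (at_left t)" "(g \<longlongrightarrow> b) (at_left t)"
      using assms t unfolding pcw_def by meson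
    then show ?thesis by (intro bexI[of _ "(a, b)"] tendsto_Pair) auto
  qed
  moreover have "(\<lambda>t. (f t, g t)) ` {0..T} \<subseteq> A \<times> B" using assms unfolding pcw_def by auto
  ultimately show ?thesis unfolding pcw_def by blast
qed

lemma rcont_Pair: "rcont T f \<Longrightarrow> rcont T g \<Longrightarrow> rcont T (\<lambda>t. (f t, g t))"
  unfolding rcont_def by (auto intro!: tendsto_Pair)

text \<open>One-sided limits of u lie in U itself and not merely in its closure, so G can be
  evaluated there although it is continuous on U only. This is why \<open>pcw\<close> asks for
  limits inside the target set.\<close>

lemma pcw_compose:
  assumes u: "pcw T U u" and G: "continuous_on ({0..T} \<times> U) G"
  shows "pcw T UNIV (\<lambda>t. G (t, u t))" "rcont T u \<Longrightarrow> rcont T (\<lambda>t. G (t, u t))"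
    "\<And>t. t \<in> {0<..<T} \<Longrightarrow> isCont u t \<Longrightarrow> isCont (\<lambda>t. G (t, u t)) t"
proof -
  have key: "((\<lambda>t. G (t, u t)) \<longlongrightarrow> G (t, l)) F"
    if "((\<lambda>s. s) \<longlongrightarrow> t) F" "(u \<longlongrightarrow> l) F" "t \<in> {0..T}" "l \<in> U" "eventually (\<lambda>s. s \<in> {0..T}) F" for t l F
  proof (rule continuous_on_tendsto_compose[OF G])
    show "((\<lambda>s. (s, u s)) \<longlongrightarrow> (t, l)) F" by (intro tendsto_Pair that)
    show "\<forall>\<^sub>F s in F. (s, u s) \<in> {0..T} \<times> U"
      using that(5) by eventually_elim (use u in \<open>auto simp: pcw_def\<close>)
  qed (use that in auto)
  have evr: "eventually (\<lambda>s. s \<in> {0..T}) (at_right t)" if "t \<in> {0..<T}" for t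
    unfolding eventually_at_right_field using that by (intro exI[of _ T]) auto
  have evl: "eventually (\<lambda>s. s \<in> {0..T}) (at_left t)" if "t \<in> {0<..T}" for t
    unfolding eventually_at_left_field using that by (intro exI[of _ 0]) auto
  have eva: "eventually (\<lambda>s. s \<in> {0..T}) (at t)" if "t \<in> {0<..<T}" for t
    using eventually_at_in_open'[of "{0<..<T}" t] that by (auto elim: eventually_mono)
  have uU: "u t \<in> U" if "t \<in> {0..T}" for t using u that by (auto simp: pcw_def)
  show c: "isCont (\<lambda>t. G (t, u t)) t" if "t \<in> {0<..<T}" "isCont u t" for t
    unfolding isCont_def by (rule key) (use that eva uU in \<open>auto simp: isCont_def\<close>)
  obtain S where S: "finite S" "\<And>t. t \<in> {0<..<T} - S \<Longrightarrow> isCont u t"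
    using u unfolding pcw_def by blast
  have "\<exists>l\<in>UNIV. ((\<lambda>t. G (t, u t)) \<longlongrightarrow> l) (at_right t)" if t: "t \<in> {0..<T}" for t
  proof -
    obtain l where "l \<in> U" "(u \<longlongrightarrow> l) (at_right t)" using u t unfolding pcw_def by blast
    then show ?thesis using key[of t "at_right t" l] evr[OF t] t by fastforce
  qed
  moreover have "\<exists>l\<in>UNIV. ((\<lambda>t. G (t, u t)) \<longlongrightarrow> l) (at_left t)" if t: "t \<in> {0<..T}" for t
  proof -
    obtain l where "l \<in> U" "(u \<longlongrightarrow> l) (at_left t)" using u t unfolding pcw_def by blast
    then show ?thesis using key[of t "at_left t" l] evl[OF t] t by fastforce
  qed
  ultimately show "pcw T UNIV (\<lambda>t. G (t, u t))"
    unfolding pcw_def using c S by blast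
  show "rcont T (\<lambda>t. G (t, u t))" if r: "rcont T u"
  proof -
    have "((\<lambda>t. G (t, u t)) \<longlongrightarrow> G (t, u t)) (at_right t)" if "t \<in> {0..<T}" for t
      by (rule key) (use r that evr[OF that] uU in \<open>auto simp: rcont_def\<close>)
    moreover have "((\<lambda>t. G (t, u t)) \<longlongrightarrow> G (T, u T)) (at_left T)"
      by (rule key) (use r T_pos evl[of T] uU in \<open>auto simp: rcont_def\<close>)
    ultimately show ?thesis unfolding rcont_def by blast
  qed
qed

lemma pcw_map:
  assumes "pcw T U u" "continuous_on U G"
  shows "pcw T UNIV (\<lambda>t. G (u t))" "rcont T u \<Longrightarrow> rcont T (\<lambda>t. G (u t))"
proof -
  have "continuous_on ({0..T} \<times> U) (\<lambda>x. G (snd x))"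
    by (rule continuous_on_compose2[OF assms(2)]) (auto intro: continuous_intros)
  from pcw_compose[OF assms(1) this]
  show "pcw T UNIV (\<lambda>t. G (u t))" "rcont T u \<Longrightarrow> rcont T (\<lambda>t. G (u t))" by auto
qed

lemma pcw_map2:
  assumes "pcw T UNIV f" "pcw T UNIV g" "continuous_on UNIV (\<lambda>z. G (fst z) (snd z))"
  shows "pcw T UNIV (\<lambda>t. G (f t) (g t))" "rcont T f \<Longrightarrow> rcont T g \<Longrightarrow> rcont T (\<lambda>t. G (f t) (g t))"
  using pcw_map[OF pcw_Pair[OF assms(1,2)], of "\<lambda>z. G (fst z) (snd z)"] assms(3) rcont_Pair
  by auto

section \<open>Induction over intervals: integrability and compact ranges\<close>

lemma pcw_interval_induct:
  assumes f: "pcw T W f"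
    and trans: "\<And>a b c. 0 \<le> a \<Longrightarrow> a \<le> b \<Longrightarrow> b \<le> c \<Longrightarrow> c \<le> T \<Longrightarrow> Q a b \<Longrightarrow> Q b c \<Longrightarrow> Q a c"
    and refl: "\<And>a. 0 \<le> a \<Longrightarrow> a \<le> T \<Longrightarrow> Q a a"
    and cont: "\<And>a b \<phi>. 0 \<le> a \<Longrightarrow> a < b \<Longrightarrow> b \<le> T \<Longrightarrow> continuous_on {a..b} \<phi> \<Longrightarrow> \<phi> ` {a..b} \<subseteq> W \<Longrightarrow>
        (\<And>t. t \<in> {a<..<b} \<Longrightarrow> f t = \<phi> t) \<Longrightarrow> Q a b"
  shows "Q 0 T"
proof -
  obtain S where S: "finite S" "\<And>t. t \<in> {0<..<T} - S \<Longrightarrow> isCont f t"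
    using f unfolding pcw_def by blast
  have W: "f t \<in> W" if "t \<in> {0..T}" for t using f that by (auto simp: pcw_def)
  have piece: "Q a b" if ab: "0 \<le> a" "a < b" "b \<le> T" and S0: "S \<inter> {a<..<b} = {}" for a b
  proof -
    obtain l where l: "l \<in> W" "(f \<longlongrightarrow> l) (at_right a)" using f ab unfolding pcw_def by force
    obtain r where r: "r \<in> W" "(f \<longlongrightarrow> r) (at_left b)" using f ab unfolding pcw_def by force
    \<comment> \<open>Between two consecutive exceptional points, replacing the end values by the
      one-sided limits makes the function continuous on the closed interval. The original end values
      may differ, so \<open>cont\<close> speaks of agreement in the interior only.\<close>
    define \<phi> where "\<phi> = (\<lambda>t. if t = a then l else if t = b then r else f t)"
    have "continuous_on {a..b} \<phi>"
    proof (rule continuous_on_IccI[OF _ _ _ ab(2)])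
      have "eventually (\<lambda>t. f t = \<phi> t) (at_right a)"
        unfolding eventually_at_right_field \<phi>_def using ab by (intro exI[of _ b]) auto
      then show "(\<phi> \<longlongrightarrow> \<phi> a) (at_right a)"
        using l(2) by (simp add: \<phi>_def[of] tendsto_cong) 
      have "eventually (\<lambda>t. f t = \<phi> t) (at_left b)"
        unfolding eventually_at_left_field \<phi>_def using ab by (intro exI[of _ a]) auto
      then show "(\<phi> \<longlongrightarrow> \<phi> b) (at_left b)"
        using r(2) ab by (simp add: \<phi>_def tendsto_cong)
      fix t assume t: "a < t" "t < b"
      have "eventually (\<lambda>s. f s = \<phi> s) (at t)"
        using eventually_at_in_open'[of "{a<..<b}" t] t by (auto elim!: eventually_mono simp: \<phi>_def)
      moreover have "f \<midarrow>t\<rightarrow> f t" using S(2)[of t] S0 t ab by (auto simp: isCont_def disjoint_iff)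
      ultimately show "\<phi> \<midarrow>t\<rightarrow> \<phi> t" using t by (simp add: \<phi>_def tendsto_cong)
    qed
    moreover have "\<phi> ` {a..b} \<subseteq> W" using l r W ab by (auto simp: \<phi>_def)
    ultimately show ?thesis by (rule cont[OF ab]) (simp add: \<phi>_def)
  qed
  have "0 \<le> T" using T_pos by simp
  \<comment> \<open>Bisection asks for arbitrarily short intervals around each point, which may
    leave [0,T]; the bounds are therefore carried inside the predicate.\<close>
  then have "0 \<le> (0::real) \<and> T \<le> T \<longrightarrow> Q 0 T"
  proof (induction rule: Bolzano[where P = "\<lambda>a b. 0 \<le> a \<and> b \<le> T \<longrightarrow> Q a b"])
    case (trans a b c)
    then show ?case using assms(2)[of a b c] by auto
  next
    case (local x)
    \<comment> \<open>An interval shorter than d around x meets S at most in x, so cutting it at x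
      leaves two pieces without interior exceptions.\<close>
    obtain d where d: "d > 0" "\<And>y. y \<in> S \<Longrightarrow> y \<noteq> x \<Longrightarrow> d \<le> dist x y"
      using finite_set_avoid[OF S(1), of x] by metis
    show ?case
    proof (intro exI[of _ d] conjI allI impI)
      fix a b assume a: "a \<le> x \<and> x \<le> b \<and> b - a < d" "0 \<le> a \<and> b \<le> T"
      have e: "S \<inter> {a<..<x} = {}" "S \<inter> {x<..<b} = {}" using d(2) a by (fastforce simp: dist_real_def)+
      have "Q a x" using piece[of a x] refl[of x] a e by (cases "a = x") auto
      moreover have "Q x b" using piece[of x b] refl[of x] a e by (cases "b = x") auto
      ultimately show "Q a b" using assms(2)[of a x b] a by auto
    qed (use d in auto)
  qed
  then show ?thesis by simp
qed

lemma pcw_integrable: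
  fixes f :: "real \<Rightarrow> 'a::banach"
  assumes "pcw T W f"
  shows "f integrable_on {0..T}"
proof (rule pcw_interval_induct[OF assms, where Q = "\<lambda>a b. f integrable_on {a..b}"])
  show "f integrable_on {a..c}" if "a \<le> b" "b \<le> c" "f integrable_on {a..b}" "f integrable_on {b..c}" for a b c
    using Henstock_Kurzweil_Integration.integrable_combine[OF that] .
  show "f integrable_on {a..b}" if "continuous_on {a..b} \<phi>" "\<And>t. t \<in> {a<..<b} \<Longrightarrow> f t = \<phi> t" for a b \<phi>
    by (rule integrable_spike_finite[of "{a, b}" _ _ \<phi>]) (use that integrable_continuous_real in auto)
  show "f integrable_on {a..a}" for a :: real
    using integrable_on_refl[of f a] by simp
qed

text \<open>Each continuous piece has a compact image, to which only the two end values have to be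
  added. Controls thus stay in a compact subset of U, on which Lipschitz constants and bounds of the
  field are uniform.\<close>

lemma pcw_compact_range:
  assumes "pcw T W f"
  obtains C where "compact C" "C \<subseteq> W" "f ` {0..T} \<subseteq> C"
proof -
  have W: "f t \<in> W" if "t \<in> {0..T}" for t using assms that by (auto simp: pcw_def)
  have "\<exists>C. compact C \<and> C \<subseteq> W \<and> f ` {0..T} \<subseteq> C"
  proof (rule pcw_interval_induct[OF assms, where Q = "\<lambda>a b. \<exists>C. compact C \<and> C \<subseteq> W \<and> f ` {a..b} \<subseteq> C"])
    fix a b c :: real
    assume "a \<le> b" "b \<le> c" "\<exists>C. compact C \<and> C \<subseteq> W \<and> f ` {a..b} \<subseteq> C" "\<exists>C. compact C \<and> C \<subseteq> W \<and> f ` {b..c} \<subseteq> C"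
    then obtain C D where "compact C" "C \<subseteq> W" "f ` {a..b} \<subseteq> C" "compact D" "D \<subseteq> W" "f ` {b..c} \<subseteq> D"
      by blast
    then show "\<exists>C. compact C \<and> C \<subseteq> W \<and> f ` {a..c} \<subseteq> C"
      using ivl_disj_un_two_touch(4)[OF \<open>a \<le> b\<close> \<open>b \<le> c\<close>] 
      by (intro exI[of _ "C \<union> D"]) (auto simp flip: ivl_disj_un_two_touch(4)[OF \<open>a \<le> b\<close> \<open>b \<le> c\<close>])
  next
    show "\<exists>C. compact C \<and> C \<subseteq> W \<and> f ` {a..a} \<subseteq> C" if "0 \<le> a" "a \<le> T" for a
      using W[of a] that by (intro exI[of _ "{f a}"]) auto
  next
    fix a b \<phi> assume h: "0 \<le> a" "a < b" "b \<le> T" "continuous_on {a..b} \<phi>" "\<phi> ` {a..b} \<subseteq> W"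
        "\<And>t. t \<in> {a<..<b} \<Longrightarrow> f t = \<phi> t"
    show "\<exists>C. compact C \<and> C \<subseteq> W \<and> f ` {a..b} \<subseteq> C"
    proof (intro exI[of _ "insert (f a) (insert (f b) (\<phi> ` {a..b}))"] conjI)
      show "compact (insert (f a) (insert (f b) (\<phi> ` {a..b})))"
        by (intro compact_insert compact_continuous_image h) simp
      show "f ` {a..b} \<subseteq> insert (f a) (insert (f b) (\<phi> ` {a..b}))"
      proof
        fix y assume "y \<in> f ` {a..b}"
        then obtain t where t: "t \<in> {a..b}" "y = f t" by auto
        then show "y \<in> insert (f a) (insert (f b) (\<phi> ` {a..b}))"
          using h(6)[of t] by (cases "t = a \<or> t = b") auto
      qed
    qed (use h W in auto)
  qed
  then show ?thesis using that by blast
qed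

lemma pcw_bounded:
  fixes f :: "real \<Rightarrow> 'a::real_normed_vector"
  assumes "pcw T W f"
  obtains B where "B > 0" "\<And>t. t \<in> {0..T} \<Longrightarrow> norm (f t) \<le> B"
proof -
  obtain C where C: "compact C" "f ` {0..T} \<subseteq> C" using pcw_compact_range[OF assms] by metis
  then obtain B where "B > 0" "\<And>x. x \<in> C \<Longrightarrow> norm x \<le> B"
    using compact_imp_bounded bounded_pos by metis
  then show ?thesis by (intro that[of B]) (use C in blast)+
qed

section \<open>Piecewise continuously differentiable functions and Gronwall's inequality\<close>

lemma antiderivative_eq_integral:
  fixes y :: "real \<Rightarrow> 'a::banach"
  assumes "finite S" "continuous_on {0..T} y" "\<And>t. t \<in> {0<..<T} - S \<Longrightarrow> (y has_vector_derivative k t) (at t)"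
    "0 \<le> a" "a \<le> b" "b \<le> T"
  shows "(k has_integral (y b - y a)) {a..b}"
  by (rule fundamental_theorem_of_calculus_interior_strong[OF assms(1,5)])
    (use assms in \<open>auto intro: continuous_on_subset\<close>)

text \<open>Changing k at the single point t leaves the integrals alone and makes the integrand
  continuous there, so the indefinite integral has derivative l at t. One-sided derivatives at the
  nodes arise in this way from one-sided limits of k.\<close>

lemma antiderivative_within:
  fixes y :: "real \<Rightarrow> 'a::banach"
  assumes S: "finite S" and y: "continuous_on {0..T} y"
    "\<And>t. t \<in> {0<..<T} - S \<Longrightarrow> (y has_vector_derivative k t) (at t)"
    and ab: "0 \<le> a" "b \<le> T" "t \<in> {a..b}" and l: "(k \<longlongrightarrow> l) (at t within {a..b})"
  shows "(y has_vector_derivative l) (at t within {a..b})"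
proof -
  define k' where "k' = k(t := l)"
  have k': "(k' has_integral (y s - y a)) {a..s}" if "s \<in> {a..b}" for s
    by (rule has_integral_spike_finite[of "{t}" _ _ k])
      (use antiderivative_eq_integral[OF S y, of a s] that ab in \<open>auto simp: k'_def\<close>)
  have "continuous (at t within {a..b}) k'"
    unfolding continuous_within k'_def using l
    by (simp, intro Lim_transform_within[OF l, of 1]) auto
  then have "((\<lambda>u. integral {a..u} k') has_vector_derivative k' t) (at t within ({a..b} - {}))"
    using k'[of b] ab by (intro integral_has_vector_derivative_continuous_at) auto
  then have "((\<lambda>u. integral {a..u} k' + y a) has_vector_derivative l) (at t within {a..b})"
    by (auto simp: k'_def intro!: derivative_eq_intros)
  have "integral {a..u} k' + y a = y u" if "u \<in> {a..b}" for u
    using integral_unique[OF k'[OF that]] by simp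
  then show ?thesis
    by (intro has_vector_derivative_transform[OF ab(3) _ \<open>(_ has_vector_derivative l) _\<close>]) simp
qed

lemma ext_deriv_eqI:
  fixes y :: "real \<Rightarrow> 'a::banach"
  assumes "t \<in> {0..T}" "t < T \<Longrightarrow> (y has_vector_derivative d) (at t within {t..T})"
    "t = T \<Longrightarrow> (y has_vector_derivative d) (at t within {0..T})"
  shows "ext_deriv T y t = d"
proof (cases "t < T")
  case True
  then show ?thesis unfolding ext_deriv_def
    using vector_derivative_within_cbox[of t T t y d] assms(2) by simp
next
  case False
  then show ?thesis unfolding ext_deriv_def
    using vector_derivative_within_cbox[of 0 T T y d] assms T_pos by simp
qed

text \<open>A continuous function whose derivative is known off a finite set inherits all one-sided
  derivatives from the one-sided limits of k. Every solution of a differential equation below enters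
  \<open>PC1\<close> through this criterion.\<close>

lemma PC1_I:
  fixes y :: "real \<Rightarrow> 'a::banach"
  assumes W: "y ` {0..T} \<subseteq> W" and S: "finite S" and y: "continuous_on {0..T} y"
    "\<And>t. t \<in> {0<..<T} - S \<Longrightarrow> (y has_vector_derivative k t) (at t)"
    and k: "pcw T UNIV k" "rcont T k"
  shows "y \<in> PC1 T W" "\<And>t. t \<in> {0..T} \<Longrightarrow> ext_deriv T y t = k t"
proof -
  note within = antiderivative_within[OF S y]
  have right: "(y has_vector_derivative l) (at t within {t..T})" if "t \<in> {0..<T}" "(k \<longlongrightarrow> l) (at_right t)" for t l
    by (rule within) (use that in \<open>auto simp: at_within_Icc_at_right\<close>)
  have left: "(y has_vector_derivative l) (at t within {0..t})" if "t \<in> {0<..T}" "(k \<longlongrightarrow> l) (at_left t)" for t l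
    by (rule within) (use that in \<open>auto simp: at_within_Icc_at_left\<close>)
  show "ext_deriv T y t = k t" if "t \<in> {0..T}" for t
    by (rule ext_deriv_eqI[OF that]) (use right[of t "k t"] left[of t "k t"] that T_pos k(2) in \<open>auto simp: rcont_def\<close>)
  obtain S' where S': "finite S'" "\<And>t. t \<in> {0<..<T} - S' \<Longrightarrow> isCont k t"
    using k(1) unfolding pcw_def by blast
  obtain n \<tau> where s: "subdivision T n \<tau>" and \<tau>: "\<tau> ` {0..n + 1} = {0, T} \<union> (S' \<inter> {0<..<T})"
    using subdivision_exists[OF S'(1)] by blast
  \<comment> \<open>The set S does not enter the nodes: where k is continuous, y has the derivative
    k t even at points of S.\<close>
  define R where "R = {0, T} \<union> (S' \<inter> {0<..<T})"
  have R: "finite R" using S' by (simp add: R_def)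
  have cont: "(k \<longlongrightarrow> k t) (at t within {0..T})" if "t \<in> {0..T} - R" for t
  proof -
    have "0 < t" "t < T" using that by (auto simp: R_def less_le)
    moreover from this have "t \<notin> S'" using that by (auto simp: R_def)
    ultimately have "isCont k t" using S'(2)[of t] by simp
    then show ?thesis unfolding isCont_def by (rule tendsto_within_subset) simp
  qed
  have dv: "(y has_vector_derivative k t) (at t within {0..T})" if "t \<in> {0..T} - R" for t
    by (rule within[OF _ _ _ _ cont[OF that]]) (use that in auto)
  have deriv_on: "deriv_on T y t = k t" if "t \<in> {0..T} - R" for t
    unfolding deriv_on_def using vector_derivative_within_cbox[of 0 T t y "k t"] dv[OF that] that T_pos by auto
  have ev: "eventually (\<lambda>s. s \<notin> R) (at t)" for t
    using islimpt_finite[OF R] islimpt_iff_eventually by blast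
  have evw: "eventually (\<lambda>s. deriv_on T y s = k s) (at t within {0..T})" for t
  proof -
    have "eventually (\<lambda>s. s \<notin> R) (at t within {0..T})"
      using ev by (rule filter_leD[OF at_le, rotated]) simp
    moreover have "eventually (\<lambda>s. s \<in> {0..T}) (at t within {0..T})" by (simp add: eventually_at_filter)
    ultimately show ?thesis by eventually_elim (simp add: deriv_on)
  qed
  have evr: "eventually (\<lambda>s. deriv_on T y s = k s) (at_right t)" if "t \<in> {0..<T}" for t
    using evw[of t] filter_leD[OF at_le[of "{t..T}" "{0..T}" t]] that by (auto simp: at_within_Icc_at_right)
  have evl: "eventually (\<lambda>s. deriv_on T y s = k s) (at_left t)" if "t \<in> {0<..T}" for t
    using evw[of t] filter_leD[OF at_le[of "{0..t}" "{0..T}" t]] that by (auto simp: at_within_Icc_at_left)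
  show "y \<in> PC1 T W"
    unfolding PC1_def
  proof (intro CollectI conjI disjI2 exI[of _ n] exI[of _ \<tau>] ballI)
    fix t assume t: "t \<in> {0..T} - \<tau> ` {0..n + 1}"
    then have t': "t \<in> {0..T} - R" unfolding \<tau> R_def .
    show "y differentiable at t within {0..T}"
      using dv[OF t'] by (rule differentiableI_vector)
    show "continuous (at t within {0..T}) (deriv_on T y)"
      unfolding continuous_within deriv_on[OF t'] using cont[OF t'] tendsto_cong[OF evw] by blast
  next
    fix i assume "i \<in> {0..n}"
    then have t: "\<tau> i \<in> {0..<T}" using subdivision_points(1,2)[OF s, of i] by auto
    then obtain l where "(k \<longlongrightarrow> l) (at_right (\<tau> i))" using k(1) unfolding pcw_def by blast
    then show "\<exists>d. (y has_vector_derivative d) (at (\<tau> i) within {\<tau> i..T}) \<and> (deriv_on T y \<longlongrightarrow> d) (at_right (\<tau> i))"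
      using right[OF t] tendsto_cong[OF evr[OF t]] by blast
  next
    fix i assume "i \<in> {1..n + 1}"
    then have t: "\<tau> i \<in> {0<..T}" using subdivision_points(1,3)[OF s, of i] by auto
    then obtain l where "(k \<longlongrightarrow> l) (at_left (\<tau> i))" using k(1) unfolding pcw_def by blast
    then show "\<exists>d. (y has_vector_derivative d) (at (\<tau> i) within {0..\<tau> i}) \<and> (deriv_on T y \<longlongrightarrow> d) (at_left (\<tau> i))"
      using left[OF t] tendsto_cong[OF evl[OF t]] by blast
  qed (use W y s in auto)
qed

text \<open>The converse of the criterion above: the extended derivative takes the role of k,
  because at every time it is the limit of the ordinary derivative from the side prescribed by the
  normalisation.\<close>

lemma PC1_D:
  fixes y :: "real \<Rightarrow> 'a::banach"
  assumes "y \<in> PC1 T W"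
  shows "continuous_on {0..T} y" "y ` {0..T} \<subseteq> W" "pcw T UNIV (ext_deriv T y)" "rcont T (ext_deriv T y)"
    "\<exists>S. finite S \<and> (\<forall>t\<in>{0<..<T} - S. (y has_vector_derivative ext_deriv T y t) (at t))"
    "\<And>t. t \<in> {0..<T} \<Longrightarrow> (y has_vector_derivative ext_deriv T y t) (at t within {t..T})"
    "(y has_vector_derivative ext_deriv T y T) (at T within {0..T})"
proof -
  show y: "continuous_on {0..T} y" "y ` {0..T} \<subseteq> W" using assms by (auto simp: PC1_def)
  \<comment> \<open>Both alternatives in the definition of \<open>PC1\<close> are brought into one
    form with a finite node set R, which is empty in the continuously differentiable case.\<close>
  have "\<exists>R. finite R \<and> (\<forall>t\<in>{0..T} - R.
            y differentiable (at t within {0..T}) \<and> continuous (at t within {0..T}) (deriv_on T y)) \<and>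
         (\<forall>t\<in>R\<inter>{0..<T}. \<exists>d. (y has_vector_derivative d) (at t within {t..T}) \<and>
            (deriv_on T y \<longlongrightarrow> d) (at_right t)) \<and>
         (\<forall>t\<in>R\<inter>{0<..T}. \<exists>d. (y has_vector_derivative d) (at t within {0..t}) \<and>
            (deriv_on T y \<longlongrightarrow> d) (at_left t))"
  proof (cases "(\<forall>t\<in>{0..T}. y differentiable (at t within {0..T})) \<and> continuous_on {0..T} (deriv_on T y)")
    case True
    then show ?thesis
      by (intro exI[of _ "{}"]) (auto simp: continuous_on_eq_continuous_within)
  next
    case False
    then obtain k \<tau> where s: "subdivision T k \<tau>" and
      h: "\<forall>t\<in>{0..T} - \<tau> ` {0..k + 1}.
            y differentiable (at t within {0..T}) \<and> continuous (at t within {0..T}) (deriv_on T y)"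
        "\<forall>i\<in>{0..k}. \<exists>d. (y has_vector_derivative d) (at (\<tau> i) within {\<tau> i..T}) \<and>
            (deriv_on T y \<longlongrightarrow> d) (at_right (\<tau> i))"
        "\<forall>i\<in>{1..k + 1}. \<exists>d. (y has_vector_derivative d) (at (\<tau> i) within {0..\<tau> i}) \<and>
            (deriv_on T y \<longlongrightarrow> d) (at_left (\<tau> i))"
      using assms unfolding PC1_def by blast
    have ends: "\<tau> 0 = 0" "\<tau> (k + 1) = T" using s by (auto simp: subdivision_def)
    show ?thesis
    proof (intro exI[of _ "\<tau> ` {0..k + 1}"] conjI)
      show "\<forall>t\<in>\<tau> ` {0..k + 1} \<inter> {0..<T}. \<exists>d. (y has_vector_derivative d) (at t within {t..T}) \<and>
            (deriv_on T y \<longlongrightarrow> d) (at_right t)"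
      proof
        fix t assume "t \<in> \<tau> ` {0..k + 1} \<inter> {0..<T}"
        then obtain i where i: "i \<le> k + 1" "t = \<tau> i" "t < T" by auto
        then have "i \<le> k" using ends by (cases "i = k + 1") auto
        then show "\<exists>d. (y has_vector_derivative d) (at t within {t..T}) \<and> (deriv_on T y \<longlongrightarrow> d) (at_right t)"
          using h(2) i by auto
      qed
      show "\<forall>t\<in>\<tau> ` {0..k + 1} \<inter> {0<..T}. \<exists>d. (y has_vector_derivative d) (at t within {0..t}) \<and>
            (deriv_on T y \<longlongrightarrow> d) (at_left t)"
      proof
        fix t assume "t \<in> \<tau> ` {0..k + 1} \<inter> {0<..T}"
        then obtain i where i: "i \<le> k + 1" "t = \<tau> i" "0 < t" by auto
        then have "1 \<le> i" using ends by (cases i) auto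
        then show "\<exists>d. (y has_vector_derivative d) (at t within {0..t}) \<and> (deriv_on T y \<longlongrightarrow> d) (at_left t)"
          using h(3) i by auto
      qed
    qed (use h(1) in auto)
  qed
  then obtain R where R: "finite R"
    and c: "\<And>t. t \<in> {0..T} - R \<Longrightarrow> y differentiable (at t within {0..T})"
      "\<And>t. t \<in> {0..T} - R \<Longrightarrow> (deriv_on T y \<longlongrightarrow> deriv_on T y t) (at t within {0..T})"
    and r: "\<And>t. t \<in> R \<inter> {0..<T} \<Longrightarrow> \<exists>d. (y has_vector_derivative d) (at t within {t..T}) \<and>
            (deriv_on T y \<longlongrightarrow> d) (at_right t)"
    and l: "\<And>t. t \<in> R \<inter> {0<..T} \<Longrightarrow> \<exists>d. (y has_vector_derivative d) (at t within {0..t}) \<and>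
            (deriv_on T y \<longlongrightarrow> d) (at_left t)"
    by (auto simp: continuous_within)
  have dv: "(y has_vector_derivative deriv_on T y t) (at t within {0..T})" if "t \<in> {0..T} - R" for t
    using c(1)[OF that] vector_derivative_works unfolding deriv_on_def by blast
  have right: "(y has_vector_derivative ext_deriv T y t) (at t within {t..T}) \<and>
      (deriv_on T y \<longlongrightarrow> ext_deriv T y t) (at_right t)" if t: "t \<in> {0..<T}" for t
  proof -
    have "\<exists>d. (y has_vector_derivative d) (at t within {t..T}) \<and> (deriv_on T y \<longlongrightarrow> d) (at_right t)"
    proof (cases "t \<in> R")
      case False
      then have "(y has_vector_derivative deriv_on T y t) (at t within {t..T})"
        by (intro has_vector_derivative_within_subset[OF dv]) (use t in auto)
      then show ?thesis using within_imp_one_sided(1)[OF c(2) t] False t by auto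
    qed (use r t in auto)
    then obtain d where d: "(y has_vector_derivative d) (at t within {t..T})" "(deriv_on T y \<longlongrightarrow> d) (at_right t)"
      by blast
    then show ?thesis using ext_deriv_eqI[of t y d] t by auto
  qed
  have left: "\<exists>d. (y has_vector_derivative d) (at t within {0..t}) \<and> (deriv_on T y \<longlongrightarrow> d) (at_left t)"
    if t: "t \<in> {0<..T}" for t
  proof (cases "t \<in> R")
    case False
    then have "(y has_vector_derivative deriv_on T y t) (at t within {0..t})"
      by (intro has_vector_derivative_within_subset[OF dv]) (use t in auto)
    then show ?thesis using within_imp_one_sided(2)[OF c(2) t] False t by auto
  qed (use l t in auto)
  obtain d where d: "(y has_vector_derivative d) (at T within {0..T})" "(deriv_on T y \<longlongrightarrow> d) (at_left T)"
    using left[of T] T_pos by auto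
  then have dT: "ext_deriv T y T = d" using ext_deriv_eqI[of T y d] T_pos by auto
  show "\<And>t. t \<in> {0..<T} \<Longrightarrow> (y has_vector_derivative ext_deriv T y t) (at t within {t..T})"
    using right by blast
  show "(y has_vector_derivative ext_deriv T y T) (at T within {0..T})" using d dT by simp
  have ext: "ext_deriv T y t = deriv_on T y t" if "t \<in> {0..T} - R" for t
  proof (rule ext_deriv_eqI)
    show "(y has_vector_derivative deriv_on T y t) (at t within {t..T})"
      by (intro has_vector_derivative_within_subset[OF dv]) (use that in auto)
  qed (use that dv in auto)
  have ev: "eventually (\<lambda>s. s \<notin> R) (at t)" for t
    using islimpt_finite[OF R] islimpt_iff_eventually by blast
  have evw: "eventually (\<lambda>s. deriv_on T y s = ext_deriv T y s) (at t within {0..T})" for t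
  proof -
    have "eventually (\<lambda>s. s \<notin> R) (at t within {0..T})"
      using ev by (rule filter_leD[OF at_le, rotated]) simp
    moreover have "eventually (\<lambda>s. s \<in> {0..T}) (at t within {0..T})" by (simp add: eventually_at_filter)
    ultimately show ?thesis by eventually_elim (simp add: ext)
  qed
  have evr: "eventually (\<lambda>s. deriv_on T y s = ext_deriv T y s) (at_right t)" if "t \<in> {0..<T}" for t
    using evw[of t] filter_leD[OF at_le[of "{t..T}" "{0..T}" t]] that by (auto simp: at_within_Icc_at_right)
  have evl: "eventually (\<lambda>s. deriv_on T y s = ext_deriv T y s) (at_left t)" if "t \<in> {0<..T}" for t
    using evw[of t] filter_leD[OF at_le[of "{0..t}" "{0..T}" t]] that by (auto simp: at_within_Icc_at_left)
  show "rcont T (ext_deriv T y)"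
    unfolding rcont_def using right tendsto_cong[OF evr] d dT tendsto_cong[OF evl[of T]] T_pos by auto
  have interior: "at t within {0..T} = at t" if "t \<in> {0<..<T}" for t using that at_within_Icc_at by auto
  have "isCont (ext_deriv T y) t" if "t \<in> {0<..<T} - R" for t
    using c(2)[of t] ext[of t] tendsto_cong[OF evw[of t]] interior that by (auto simp: isCont_def)
  then show "pcw T UNIV (ext_deriv T y)"
    unfolding pcw_def using R right left tendsto_cong[OF evr] tendsto_cong[OF evl]
    by (intro conjI) blast+
  have "(y has_vector_derivative ext_deriv T y t) (at t)" if "t \<in> {0<..<T} - R" for t
    using dv[of t] ext[of t] interior[of t] that by auto
  then show "\<exists>S. finite S \<and> (\<forall>t\<in>{0<..<T} - S. (y has_vector_derivative ext_deriv T y t) (at t))"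
    using R by blast
qed

lemma integral_pcw_antiderivative:
  fixes k :: "real \<Rightarrow> 'a::banach"
  assumes k: "pcw T W k"
  shows "continuous_on {0..T} (\<lambda>t. integral {0..t} k)"
    "\<exists>S. finite S \<and> (\<forall>t\<in>{0<..<T} - S. ((\<lambda>t. integral {0..t} k) has_vector_derivative k t) (at t))"
proof -
  have i: "k integrable_on {0..T}" by (rule pcw_integrable[OF k])
  show "continuous_on {0..T} (\<lambda>t. integral {0..t} k)" by (rule indefinite_integral_continuous_1[OF i])
  obtain S where S: "finite S" "\<And>t. t \<in> {0<..<T} - S \<Longrightarrow> isCont k t"
    using k unfolding pcw_def by blast
  have "((\<lambda>t. integral {0..t} k) has_vector_derivative k t) (at t)" if t: "t \<in> {0<..<T} - S" for t
  proof -
    have "((\<lambda>t. integral {0..t} k) has_vector_derivative k t) (at t within ({0..T} - {}))"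
      by (rule integral_has_vector_derivative_continuous_at[OF i])
        (use t S(2)[OF t] continuous_at_imp_continuous_at_within in auto)
    then show ?thesis using t at_within_Icc_at[of 0 t T] by auto
  qed
  then show "\<exists>S. finite S \<and> (\<forall>t\<in>{0<..<T} - S. ((\<lambda>t. integral {0..t} k) has_vector_derivative k t) (at t))"
    using S by blast
qed

section \<open>Growth estimates and Gronwall's inequality in both time directions\<close>

lemma norm_increment_le:
  fixes y :: "real \<Rightarrow> 'a::banach"
  assumes "finite S" "continuous_on {0..T} y" "\<And>t. t \<in> {0<..<T} - S \<Longrightarrow> (y has_vector_derivative k t) (at t)"
    "0 \<le> a" "a \<le> b" "b \<le> T" "\<beta> integrable_on {a..b}" "finite S'" "\<And>t. t \<in> {a<..<b} - S' \<Longrightarrow> norm (k t) \<le> \<beta> t"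
  shows "norm (y b - y a) \<le> integral {a..b} \<beta>"
proof -
  \<comment> \<open>Setting both functions to zero on a finite set makes the pointwise inequality
    hold everywhere without changing the integrals.\<close>
  define R where "R = {a, b} \<union> S'"
  define k' where "k' t = (if t \<in> R then 0 else k t)" for t
  define \<beta>' where "\<beta>' t = (if t \<in> R then 0 else \<beta> t)" for t
  have R: "finite R" using assms by (simp add: R_def)
  have "(k' has_integral (y b - y a)) {a..b}"
    by (rule has_integral_spike_finite[OF R _ antiderivative_eq_integral[OF assms(1-6)]]) (auto simp: k'_def)
  moreover have "(\<beta>' has_integral integral {a..b} \<beta>) {a..b}"
    by (rule has_integral_spike_finite[OF R _ integrable_integral[OF assms(7)]]) (auto simp: \<beta>'_def)
  ultimately have "norm (integral {a..b} k') \<le> integral {a..b} \<beta>'"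
    using assms(9) by (intro Henstock_Kurzweil_Integration.integral_norm_bound_integral)
      (auto simp: k'_def \<beta>'_def R_def)
  then show ?thesis using \<open>(k' has_integral _) _\<close> \<open>(\<beta>' has_integral _) _\<close> by (auto simp: integral_unique)
qed

text \<open>The norm of w is dominated by Y, the constant \<open>\<alpha>\<close> plus the integral
  of \<beta> times the norm of w, and Y times the exponential of minus the integral of \<beta> does
  not increase. The constant \<open>\<alpha>\<close> absorbs the whole integral of \<gamma> at once,
  so \<gamma> is never differentiated and integrability is all that is asked of it.\<close>

lemma gronwall:
  fixes w :: "real \<Rightarrow> 'a::banach"
  assumes S: "finite S" and w: "continuous_on {0..T} w"
    "\<And>t. t \<in> {0<..<T} - S \<Longrightarrow> (w has_vector_derivative k t) (at t)"
    and \<beta>: "pcw T UNIV \<beta>" "\<And>t. t \<in> {0..T} \<Longrightarrow> 0 \<le> \<beta> t"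
    and \<gamma>: "\<gamma> integrable_on {0..T}" "\<And>t. t \<in> {0..T} \<Longrightarrow> 0 \<le> \<gamma> t"
    and le: "\<And>t. t \<in> {0<..<T} - S \<Longrightarrow> norm (k t) \<le> \<beta> t * norm (w t) + \<gamma> t"
    and t: "t \<in> {0..T}"
  shows "norm (w t) \<le> (norm (w 0) + integral {0..T} \<gamma>) * exp (integral {0..T} \<beta>)"
proof -
  define \<alpha> where "\<alpha> = norm (w 0) + integral {0..T} \<gamma>"
  define b where "b s = \<beta> s * norm (w s)" for s
  define B where "B s = integral {0..s} \<beta>" for s
  define Y where "Y s = \<alpha> + integral {0..s} b" for s
  have nw: "pcw T UNIV (\<lambda>s. norm (w s))"
    by (rule continuous_pcw(1)) (use w(1) in \<open>auto intro: continuous_intros\<close>)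
  have b: "pcw T UNIV b" unfolding b_def
    by (rule pcw_map2[OF \<beta>(1) nw]) (intro continuous_intros)
  have bint: "b integrable_on {0..s}" if "s \<in> {0..T}" for s
    using pcw_integrable[OF b] integrable_on_subinterval[of b "{0..T}" 0 s] that by auto
  have \<gamma>int: "\<gamma> integrable_on {0..s}" if "s \<in> {0..T}" for s
    using \<gamma>(1) integrable_on_subinterval[of \<gamma> "{0..T}" 0 s] that by auto
  have \<alpha>0: "0 \<le> \<alpha>" unfolding \<alpha>_def using \<gamma> by (auto intro!: add_nonneg_nonneg integral_nonneg)
  have wY: "norm (w s) \<le> Y s" if s: "s \<in> {0..T}" for s
  proof -
    have "norm (w s - w 0) \<le> integral {0..s} (\<lambda>r. b r + \<gamma> r)"
      by (rule norm_increment_le[OF S w _ _ _ integrable_add[OF bint[OF s] \<gamma>int[OF s]] S])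
        (use s le in \<open>auto simp: b_def\<close>)
    also have "\<dots> = integral {0..s} b + integral {0..s} \<gamma>"
      by (rule Henstock_Kurzweil_Integration.integral_add[OF bint[OF s] \<gamma>int[OF s]])
    also have "integral {0..s} \<gamma> \<le> integral {0..T} \<gamma>"
      by (rule integral_subset_le) (use s \<gamma> \<gamma>int in auto)
    finally show ?thesis unfolding Y_def \<alpha>_def using norm_triangle_sub[of "w s" "w 0"] by linarith
  qed
  have Y0: "0 \<le> Y s" if "s \<in> {0..T}" for s using wY[OF that] norm_ge_zero order_trans by blast
  obtain S1 where S1: "finite S1" "\<And>s. s \<in> {0<..<T} - S1 \<Longrightarrow> (B has_vector_derivative \<beta> s) (at s)"
    using integral_pcw_antiderivative(2)[OF \<beta>(1)] unfolding B_def by blast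
  obtain S2 where S2: "finite S2" "\<And>s. s \<in> {0<..<T} - S2 \<Longrightarrow> ((\<lambda>s. integral {0..s} b) has_vector_derivative b s) (at s)"
    using integral_pcw_antiderivative(2)[OF b] by blast
  define Z where "Z s = Y s * exp (- B s)" for s
  have Zc: "continuous_on {0..T} Z" unfolding Z_def Y_def B_def
    by (intro continuous_intros integral_pcw_antiderivative(1)[OF \<beta>(1)] integral_pcw_antiderivative(1)[OF b])
  have Zd: "(Z has_vector_derivative ((b s - \<beta> s * Y s) * exp (- B s))) (at s)"
    if "s \<in> {0<..<T} - (S1 \<union> S2)" for s
  proof -
    have "(B has_real_derivative \<beta> s) (at s)" "((\<lambda>s. integral {0..s} b) has_real_derivative b s) (at s)"
      using S1(2)[of s] S2(2)[of s] that by (auto simp: has_real_derivative_iff_has_vector_derivative)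
    then have "(Z has_real_derivative ((b s - \<beta> s * Y s) * exp (- B s))) (at s)"
      unfolding Z_def Y_def by (auto intro!: derivative_eq_intros simp: algebra_simps)
    then show ?thesis by (simp add: has_real_derivative_iff_has_vector_derivative)
  qed
  have "((\<lambda>s. (b s - \<beta> s * Y s) * exp (- B s)) has_integral (Z t - Z 0)) {0..t}"
    by (rule antiderivative_eq_integral[of "S1 \<union> S2", OF _ Zc Zd]) (use t S1 S2 in auto)
  moreover have "(b s - \<beta> s * Y s) * exp (- B s) \<le> 0" if "s \<in> {0..t}" for s
    unfolding b_def using that t wY[of s] \<beta>(2)[of s]
    by (auto intro!: mult_nonpos_nonneg mult_left_mono)
  ultimately have "Z t - Z 0 \<le> 0" using has_integral_le[of _ "Z t - Z 0" "{0..t}" "\<lambda>_. 0" 0] by simp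
  moreover have "Z 0 = \<alpha>" unfolding Z_def Y_def B_def by simp
  ultimately have "Y t * exp (- B t) \<le> \<alpha>" by (simp add: Z_def)
  then have "Y t \<le> \<alpha> * exp (B t)" by (simp add: exp_minus field_simps)
  also have "B t \<le> B T" unfolding B_def
    by (rule integral_subset_le) (use t \<beta> pcw_integrable[OF \<beta>(1)] integrable_on_subinterval[of \<beta> "{0..T}" 0 t] in auto)
  finally show ?thesis using wY[OF t] \<alpha>0 by (auto simp: B_def \<alpha>_def intro: order_trans mult_left_mono)
qed

lemma isCont_reverse:
  fixes f :: "real \<Rightarrow> 'a::t2_space"
  assumes "isCont f (T - t)"
  shows "isCont (\<lambda>s. f (T - s)) t"
  using isCont_o2[of t "\<lambda>s. T - s" f] assms by auto

lemma pcw_reverse: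
  assumes "pcw T W f"
  shows "pcw T W (\<lambda>t. f (T - t))"
proof -
  obtain S where S: "finite S" "\<And>t. t \<in> {0<..<T} - S \<Longrightarrow> isCont f t"
    using assms unfolding pcw_def by blast
  have "finite ((\<lambda>s. T - s) ` S)" using S by simp
  moreover have "isCont (\<lambda>s. f (T - s)) t" if "t \<in> {0<..<T} - (\<lambda>s. T - s) ` S" for t
    by (rule isCont_reverse, rule S(2)) (use that in \<open>auto simp: image_iff\<close>)
  moreover have "\<exists>l\<in>W. ((\<lambda>s. f (T - s)) \<longlongrightarrow> l) (at_right t)" if "t \<in> {0..<T}" for t
  proof -
    have "T - t \<in> {0<..T}" using that by auto
    obtain l where l: "l \<in> W" "(f \<longlongrightarrow> l) (at_left (T - t))"
      using assms \<open>T - t \<in> _\<close> unfolding pcw_def by blast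
    have "filterlim (\<lambda>s. T - s) (at_left (T - t)) (at_right t)"
      unfolding filterlim_at
      by (intro conjI tendsto_diff tendsto_const tendsto_ident_at) (simp add: eventually_at_filter)
    then show ?thesis using l filterlim_compose[OF l(2)] by blast
  qed
  moreover have "\<exists>l\<in>W. ((\<lambda>s. f (T - s)) \<longlongrightarrow> l) (at_left t)" if "t \<in> {0<..T}" for t
  proof -
    have "T - t \<in> {0..<T}" using that by auto
    obtain l where l: "l \<in> W" "(f \<longlongrightarrow> l) (at_right (T - t))"
      using assms \<open>T - t \<in> _\<close> unfolding pcw_def by blast
    have "filterlim (\<lambda>s. T - s) (at_right (T - t)) (at_left t)"
      unfolding filterlim_at
      by (intro conjI tendsto_diff tendsto_const tendsto_ident_at) (simp add: eventually_at_filter)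
    then show ?thesis using l filterlim_compose[OF l(2)] by blast
  qed
  moreover have "(\<lambda>t. f (T - t)) ` {0..T} \<subseteq> W" using assms by (auto simp: pcw_def)
  ultimately show ?thesis unfolding pcw_def by (intro conjI) blast+
qed

lemma vector_derivative_reverse:
  fixes w :: "real \<Rightarrow> 'a::real_normed_vector"
  assumes "(w has_vector_derivative d) (at (T - t))"
  shows "((\<lambda>s. w (T - s)) has_vector_derivative - d) (at t)"
proof -
  have "((\<lambda>s. T - s) has_vector_derivative -1) (at t)"
    unfolding has_real_derivative_iff_has_vector_derivative[symmetric]
    by (auto intro!: derivative_eq_intros)
  from vector_diff_chain_at[OF this assms] show ?thesis by (simp add: o_def)
qed

text \<open>Time reversal reduces this to the forward estimate. It serves the adjoint equation,
  whose data are given at T.\<close>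

lemma gronwall_backward:
  fixes w :: "real \<Rightarrow> 'a::banach"
  assumes S: "finite S" and w: "continuous_on {0..T} w"
    "\<And>t. t \<in> {0<..<T} - S \<Longrightarrow> (w has_vector_derivative k t) (at t)"
    and \<beta>: "pcw T UNIV \<beta>" "\<And>t. t \<in> {0..T} \<Longrightarrow> 0 \<le> \<beta> t"
    and \<gamma>: "\<gamma> integrable_on {0..T}" "\<And>t. t \<in> {0..T} \<Longrightarrow> 0 \<le> \<gamma> t"
    and le: "\<And>t. t \<in> {0<..<T} - S \<Longrightarrow> norm (k t) \<le> \<beta> t * norm (w t) + \<gamma> t"
    and t: "t \<in> {0..T}"
  shows "norm (w t) \<le> (norm (w T) + integral {0..T} \<gamma>) * exp (integral {0..T} \<beta>)"
proof -
  have refl: "((\<lambda>s. f (T - s)) has_integral integral {0..T} f) {0..T}" if "f integrable_on {0..T}" for f :: "real \<Rightarrow> real"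
  proof -
    have "(\<lambda>x. T - x) ` {0..T} = {0..T}" by (auto simp: image_iff intro: bexI[of _ "T - _"])
    then show ?thesis
      using has_integral_affinity[of f "integral {0..T} f" 0 T "-1" T] integrable_integral[OF that]
      by (simp add: algebra_simps)
  qed
  have "norm (w (T - (T - t))) \<le> (norm (w (T - 0)) + integral {0..T} (\<lambda>s. \<gamma> (T - s))) * exp (integral {0..T} (\<lambda>s. \<beta> (T - s)))"
  proof (rule gronwall[where w = "\<lambda>s. w (T - s)" and k = "\<lambda>s. - k (T - s)" and S = "(\<lambda>s. T - s) ` S"])
    show "continuous_on {0..T} (\<lambda>s. w (T - s))"
      by (rule continuous_on_compose2[OF w(1)]) (auto intro: continuous_intros)
    show "pcw T UNIV (\<lambda>s. \<beta> (T - s))" by (rule pcw_reverse[OF \<beta>(1)])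
    show "(\<lambda>s. \<gamma> (T - s)) integrable_on {0..T}" using refl[OF \<gamma>(1)] by blast
    fix s assume s: "s \<in> {0<..<T} - (\<lambda>s. T - s) ` S"
    then have "T - s \<in> {0<..<T} - S" by (auto simp: image_iff)
    from w(2)[OF this] le[OF this]
    show "((\<lambda>s. w (T - s)) has_vector_derivative - k (T - s)) (at s)"
      "norm (- k (T - s)) \<le> \<beta> (T - s) * norm (w (T - s)) + \<gamma> (T - s)"
      using vector_derivative_reverse by auto
  qed (use S \<beta> \<gamma> t in auto)
  then show ?thesis
    using integral_unique[OF refl[OF \<gamma>(1)]] integral_unique[OF refl[OF pcw_integrable[OF \<beta>(1)]]] by simp
qed

end

section \<open>Differential equations with piecewise continuous data\<close>

text \<open>The radial retraction onto the closed ball of radius r. It extends a field that is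
  Lipschitz only in a tube around a trajectory to a globally Lipschitz one.\<close>

definition radial :: "real \<Rightarrow> 'a::real_normed_vector \<Rightarrow> 'a" where
  "radial r w = (r / max r (norm w)) *\<^sub>R w"

lemma radial_id: "0 < r \<Longrightarrow> norm w \<le> r \<Longrightarrow> radial r w = w"
  by (simp add: radial_def max_def)

lemma norm_radial_le: "0 < r \<Longrightarrow> norm (radial r w) \<le> r"
  by (auto simp: radial_def max_def field_simps)

text \<open>The difference splits into a rescaled x - y and a change of the scaling factor acting on
  y. Each part costs at most the norm of x - y, whence the constant 2.\<close>

lemma radial_lipschitz:
  assumes "0 < r"
  shows "norm (radial r x - radial r y) \<le> 2 * norm (x - y)"
proof -
  define a b where "a = max r (norm x)" and "b = max r (norm y)"
  have ab: "0 < a" "0 < b" "r \<le> a" "norm y \<le> b" using assms by (auto simp: a_def b_def)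
  have "radial r x - radial r y = (r / a) *\<^sub>R (x - y) + (r / a - r / b) *\<^sub>R y"
    by (simp add: radial_def a_def b_def algebra_simps)
  then have "norm (radial r x - radial r y) \<le> \<bar>r / a\<bar> * norm (x - y) + \<bar>r / a - r / b\<bar> * norm y"
    by (metis norm_triangle_ineq norm_scaleR)
  also have "\<bar>r / a\<bar> * norm (x - y) \<le> 1 * norm (x - y)"
    by (rule mult_right_mono) (use assms ab in auto)
  also have "\<bar>r / a - r / b\<bar> * norm y = (r / a) * (norm y / b) * \<bar>b - a\<bar>"
  proof -
    have "r / a - r / b = r * (b - a) / (a * b)" using ab by (simp add: field_simps)
    then show ?thesis using ab assms by (simp add: abs_mult abs_divide)
  qed
  also have "\<dots> \<le> 1 * \<bar>b - a\<bar>"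
    using ab assms by (intro mult_right_mono mult_le_one) auto
  also have "\<bar>b - a\<bar> \<le> \<bar>norm x - norm y\<bar>" by (auto simp: a_def b_def)
  also have "\<dots> \<le> norm (x - y)" by (rule norm_triangle_ineq3)
  finally show ?thesis by simp
qed

lemma continuous_on_radial:
  assumes "0 < r" "continuous_on A f"
  shows "continuous_on A (\<lambda>t. radial r (f t))"
  unfolding radial_def using assms by (auto intro!: continuous_intros)

context pos_time
begin

text \<open>Picard iteration is a contraction for the weighted norm $\sup_t e^{-2Lt}\|y(t)\|$.\<close>

lemma ode_exists:
  fixes G :: "real \<Rightarrow> 'a::banach \<Rightarrow> 'a"
  assumes int: "\<And>y. continuous_on {0..T} y \<Longrightarrow> (\<lambda>t. G t (y t)) integrable_on {0..T}"
    and lip: "\<And>t x y. t \<in> {0..T} \<Longrightarrow> norm (G t x - G t y) \<le> L * norm (x - y)" and L: "0 < L"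
  obtains y where "continuous_on {0..T} y" "\<And>t. t \<in> {0..T} \<Longrightarrow> y t = y0 + integral {0..t} (\<lambda>s. G s (y s))"
proof -
  \<comment> \<open>Clamping the time to [0,T] extends a continuous function on the interval to a
    bounded continuous function on the line, so that the complete space of all such functions can
    carry the fixed point argument.\<close>
  define c where "c t = max 0 (min T t)" for t
  have c: "c t \<in> {0..T}" "t \<in> {0..T} \<Longrightarrow> c t = t" for t using T_pos by (auto simp: c_def)
  have c_cont: "continuous_on UNIV c" unfolding c_def by (intro continuous_intros)
  \<comment> \<open>The unknown w is the solution multiplied by exp (- 2 L t); the plain sup
    distance of w is then the weighted distance of the solution.\<close>
  define F where "F w s = G s (exp (2 * L * s) *\<^sub>R w s)" for w s
  define \<phi> where "\<phi> w t = exp (- (2 * L * t)) *\<^sub>R (y0 + integral {0..t} (F w))" for w t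
  have F_int: "F w integrable_on {0..t}" if "continuous_on {0..T} w" "t \<in> {0..T}" for w t
  proof -
    have "F w integrable_on {0..T}" unfolding F_def
      by (rule int) (use that in \<open>auto intro!: continuous_intros\<close>)
    then show ?thesis using integrable_on_subinterval[of "F w" "{0..T}" 0 t] that by auto
  qed
  have \<phi>_cont: "continuous_on {0..T} (\<phi> w)" if "continuous_on {0..T} w" for w
    unfolding \<phi>_def
    by (intro continuous_intros indefinite_integral_continuous_1 F_int[OF that]) (use T_pos in auto)
  define \<Phi> where "\<Phi> w = Bcontfun (\<lambda>t. \<phi> (apply_bcontfun w) (c t))" for w
  have \<Phi>: "apply_bcontfun (\<Phi> w) t = \<phi> (apply_bcontfun w) (c t)" for w t
  proof -
    have cont: "continuous_on {0..T} (\<phi> (apply_bcontfun w))" by (rule \<phi>_cont) simp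
    then have "bounded (\<phi> (apply_bcontfun w) ` {0..T})"
      by (intro compact_imp_bounded compact_continuous_image) auto
    then obtain b where "\<And>t. t \<in> {0..T} \<Longrightarrow> norm (\<phi> (apply_bcontfun w) t) \<le> b"
      unfolding bounded_iff by (metis imageI)
    then have "(\<lambda>t. \<phi> (apply_bcontfun w) (c t)) \<in> bcontfun"
      by (intro bcontfun_normI[of _ b] continuous_on_compose2[OF cont c_cont]) (use c in auto)
    then show ?thesis by (simp add: \<Phi>_def Bcontfun_inverse)
  qed
  have "dist (\<Phi> w) (\<Phi> w') \<le> (1/2) * dist w w'" for w w'
  proof (rule dist_bound)
    fix t
    define s where "s = c t"
    have s: "s \<in> {0..T}" using c s_def by auto
    define d where "d = dist w w'"
    have i: "F (apply_bcontfun w) integrable_on {0..s}" "F (apply_bcontfun w') integrable_on {0..s}"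
      using F_int s by auto
    \<comment> \<open>The integral of L exp (2 L r) up to s is less than exp (2 L s) / 2. The weight
      cancels the exponential and leaves the contraction factor 1/2.\<close>
    have E: "((\<lambda>r. d * (L * exp (2 * L * r))) has_integral (d * (exp (2 * L * s) / 2 - exp (2 * L * 0) / 2))) {0..s}"
      using s L by (intro has_integral_mult_right fundamental_theorem_of_calculus)
        (auto intro!: derivative_eq_intros simp flip: has_real_derivative_iff_has_vector_derivative)
    have "norm (integral {0..s} (\<lambda>r. F (apply_bcontfun w) r - F (apply_bcontfun w') r))
      \<le> integral {0..s} (\<lambda>r. d * (L * exp (2 * L * r)))"
    proof (rule Henstock_Kurzweil_Integration.integral_norm_bound_integral)
      show "(\<lambda>r. F (apply_bcontfun w) r - F (apply_bcontfun w') r) integrable_on {0..s}"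
        using i by (rule integrable_diff)
      show "(\<lambda>r. d * (L * exp (2 * L * r))) integrable_on {0..s}" using E by blast
      fix r assume r: "r \<in> {0..s}"
      have "norm (F (apply_bcontfun w) r - F (apply_bcontfun w') r)
          \<le> L * norm (exp (2 * L * r) *\<^sub>R apply_bcontfun w r - exp (2 * L * r) *\<^sub>R apply_bcontfun w' r)"
        unfolding F_def by (rule lip) (use r s in auto)
      also have "\<dots> = L * exp (2 * L * r) * dist (apply_bcontfun w r) (apply_bcontfun w' r)"
        by (simp add: dist_norm flip: scaleR_diff_right)
      also have "\<dots> \<le> L * exp (2 * L * r) * d"
        unfolding d_def by (rule mult_left_mono[OF dist_bounded]) (use L in auto)
      finally show "norm (F (apply_bcontfun w) r - F (apply_bcontfun w') r) \<le> d * (L * exp (2 * L * r))"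
        by (simp add: mult.commute)
    qed
    also have "\<dots> = d * (exp (2 * L * s) / 2 - exp (2 * L * 0) / 2)" using E by (rule integral_unique)
    also have "\<dots> \<le> d * (exp (2 * L * s) / 2)" by (rule mult_left_mono) (auto simp: d_def)
    finally have *: "norm (integral {0..s} (F (apply_bcontfun w)) - integral {0..s} (F (apply_bcontfun w')))
        \<le> d * (exp (2 * L * s) / 2)"
      using Henstock_Kurzweil_Integration.integral_diff[OF i] by simp
    have "dist (apply_bcontfun (\<Phi> w) t) (apply_bcontfun (\<Phi> w') t)
        = exp (- (2 * L * s)) * norm (integral {0..s} (F (apply_bcontfun w)) - integral {0..s} (F (apply_bcontfun w')))"
      unfolding \<Phi> \<phi>_def s_def[symmetric] dist_norm by (simp flip: scaleR_diff_right)
    also have "\<dots> \<le> exp (- (2 * L * s)) * (d * (exp (2 * L * s) / 2))"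
      by (rule mult_left_mono[OF *]) simp
    also have "\<dots> = (1/2) * dist w w'" by (simp add: d_def exp_minus field_simps)
    finally show "dist (apply_bcontfun (\<Phi> w) t) (apply_bcontfun (\<Phi> w') t) \<le> (1/2) * dist w w'" .
  qed
  then obtain w where w: "\<Phi> w = w" using banach_fix_type[of "1/2" \<Phi>] by auto
  define y where "y t = exp (2 * L * t) *\<^sub>R apply_bcontfun w t" for t
  have "continuous_on {0..T} y" unfolding y_def by (intro continuous_intros) auto
  moreover have "y t = y0 + integral {0..t} (\<lambda>s. G s (y s))" if "t \<in> {0..T}" for t
  proof -
    have "y t = exp (2 * L * t) *\<^sub>R \<phi> (apply_bcontfun w) t"
      unfolding y_def using \<Phi>[of w t] w c(2)[OF that] by simp
    also have "\<dots> = y0 + integral {0..t} (F (apply_bcontfun w))"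
      unfolding \<phi>_def by (simp flip: exp_add)
    finally show ?thesis unfolding F_def y_def .
  qed
  ultimately show ?thesis by (rule that)
qed

text \<open>\<open>P t\<close> transports a displacement of the state at time t to the endpoint
  along the linearised equation: the stated equation makes P applied to a solution of the equation
  with coefficient A constant in time. It is built by solving forward for the time-reversed unknown,
  whose equation is linear and hence globally Lipschitz.\<close>

lemma adjoint_resolvent_exists:
  fixes A :: "real \<Rightarrow> 'a::banach \<Rightarrow>\<^sub>L 'a"
  assumes A: "pcw T UNIV A"
  obtains P S where "continuous_on {0..T} P" "P T = id_blinfun" "finite S"
    "\<And>t. t \<in> {0<..<T} - S \<Longrightarrow> (P has_vector_derivative - (P t o\<^sub>L A t)) (at t)"
proof -
  obtain B where B: "B > 0" "\<And>t. t \<in> {0..T} \<Longrightarrow> norm (A t) \<le> B" using pcw_bounded[OF A] by blast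
  have comp: "continuous_on UNIV (\<lambda>z. fst z o\<^sub>L snd z :: 'a \<Rightarrow>\<^sub>L 'a)"
    by (intro bounded_bilinear.continuous_on[OF bounded_bilinear_blinfun_compose] continuous_intros)
  define G where "G s Q = Q o\<^sub>L A (T - s)" for s and Q :: "'a \<Rightarrow>\<^sub>L 'a"
  have pcwG: "pcw T UNIV (\<lambda>s. G s (y s))" if "continuous_on {0..T} y" for y
    unfolding G_def by (rule pcw_map2(1)[OF continuous_pcw(1)[OF that] pcw_reverse[OF A] comp]) simp
  have "norm (G t x - G t y) \<le> B * norm (x - y)" if "t \<in> {0..T}" for t x y
  proof -
    have "G t x - G t y = (x - y) o\<^sub>L A (T - t)"
      by (rule blinfun_eqI) (simp add: G_def blinfun.diff_left)
    then have "norm (G t x - G t y) \<le> norm (x - y) * norm (A (T - t))"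
      using norm_blinfun_compose by metis
    also have "\<dots> \<le> norm (x - y) * B" by (rule mult_left_mono) (use B that in auto)
    finally show ?thesis by (simp add: mult.commute)
  qed
  then obtain Q where Q: "continuous_on {0..T} Q"
    "\<And>t. t \<in> {0..T} \<Longrightarrow> Q t = id_blinfun + integral {0..t} (\<lambda>s. G s (Q s))"
    using ode_exists[of G B id_blinfun] pcw_integrable[OF pcwG] B(1) by blast
  obtain S where S: "finite S" "\<And>t. t \<in> {0<..<T} - S \<Longrightarrow>
      ((\<lambda>t. integral {0..t} (\<lambda>s. G s (Q s))) has_vector_derivative G t (Q t)) (at t)"
    using integral_pcw_antiderivative(2)[OF pcwG[OF Q(1)]] by blast
  have Qd: "(Q has_vector_derivative G t (Q t)) (at t)" if "t \<in> {0<..<T} - S" for t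
  proof -
    have "((\<lambda>t. id_blinfun + integral {0..t} (\<lambda>s. G s (Q s))) has_vector_derivative 0 + G t (Q t)) (at t)"
      by (intro has_vector_derivative_add has_vector_derivative_const S(2) that)
    then show ?thesis
      using has_vector_derivative_transform_within_open[of _ _ t "{0<..<T}" Q] Q(2) that by auto
  qed
  show ?thesis
  proof (rule that[of "\<lambda>t. Q (T - t)" "(\<lambda>s. T - s) ` S"])
    show "continuous_on {0..T} (\<lambda>t. Q (T - t))"
      by (rule continuous_on_compose2[OF Q(1)]) (auto intro: continuous_intros)
    show "Q (T - T) = id_blinfun" using Q(2)[of 0] T_pos by simp
    show "((\<lambda>t. Q (T - t)) has_vector_derivative - (Q (T - t) o\<^sub>L A t)) (at t)"
      if "t \<in> {0<..<T} - (\<lambda>s. T - s) ` S" for t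
    proof -
      have "T - t \<in> {0<..<T} - S" using that by (auto simp: image_iff)
      from vector_derivative_reverse[OF Qd[OF this]] show ?thesis by (simp add: G_def)
    qed
  qed (use S in auto)
qed

section \<open>Controls changed on short intervals\<close>

lemma pcw_update:
  assumes w: "pcw T U w" "rcont T w" and v: "v \<in> U" and cd: "0 \<le> c" "c \<le> d" "d < T"
  defines "w' \<equiv> \<lambda>t. if c \<le> t \<and> t < d then v else w t"
  shows "pcw T U w'" "rcont T w'"
proof -
  obtain S where S: "finite S" "\<And>t. t \<in> {0<..<T} - S \<Longrightarrow> isCont w t"
    using w unfolding pcw_def by blast
  have wU: "w t \<in> U" if "t \<in> {0..T}" for t using w(1) that by (auto simp: pcw_def)
  \<comment> \<open>The interval is closed on the left and open on the right: immediately after t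
    the new value is seen for c \<le> t < d, immediately before t for c < t \<le> d. With d < T this
    keeps right-continuity and leaves the end at T untouched.\<close>
  have evr: "if c \<le> t \<and> t < d then eventually (\<lambda>s. w' s = v) (at_right t)
      else eventually (\<lambda>s. w' s = w s) (at_right t)" for t
  proof -
    have gt: "eventually (\<lambda>s. s > t) (at_right t)" by (simp add: eventually_at_filter)
    consider "t < c" | "c \<le> t" "t < d" | "c \<le> t" "d \<le> t" by linarith
    then show ?thesis
    proof cases
      case 1
      then have "eventually (\<lambda>s. s < c) (at_right t)"
        unfolding eventually_at_right_field by (intro exI[of _ c]) auto
      then have "eventually (\<lambda>s. w' s = w s) (at_right t)" by eventually_elim (simp add: w'_def)
      then show ?thesis using 1 by simp
    next
      case 2
      then have "eventually (\<lambda>s. s < d) (at_right t)"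
        unfolding eventually_at_right_field by (intro exI[of _ d]) auto
      then have "eventually (\<lambda>s. w' s = v) (at_right t)" using gt by eventually_elim (use 2 in \<open>simp add: w'_def\<close>)
      then show ?thesis using 2 by simp
    next
      case 3
      have "eventually (\<lambda>s. w' s = w s) (at_right t)" using gt by eventually_elim (use 3 in \<open>simp add: w'_def\<close>)
      then show ?thesis using 3 by simp
    qed
  qed
  have evl: "if c < t \<and> t \<le> d then eventually (\<lambda>s. w' s = v) (at_left t)
      else eventually (\<lambda>s. w' s = w s) (at_left t)" for t
  proof -
    have lt: "eventually (\<lambda>s. s < t) (at_left t)" by (simp add: eventually_at_filter)
    consider "d < t" | "t \<le> d" "c < t" | "t \<le> c" "t \<le> d" using cd by linarith
    then show ?thesis
    proof cases
      case 1
      then have "eventually (\<lambda>s. s > d) (at_left t)"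
        unfolding eventually_at_left_field by (intro exI[of _ d]) auto
      then have "eventually (\<lambda>s. w' s = w s) (at_left t)" by eventually_elim (simp add: w'_def)
      then show ?thesis using 1 by simp
    next
      case 2
      then have "eventually (\<lambda>s. s > c) (at_left t)"
        unfolding eventually_at_left_field by (intro exI[of _ c]) auto
      then have "eventually (\<lambda>s. w' s = v) (at_left t)" using lt by eventually_elim (use 2 in \<open>simp add: w'_def\<close>)
      then show ?thesis using 2 by simp
    next
      case 3
      have "eventually (\<lambda>s. w' s = w s) (at_left t)" using lt by eventually_elim (use 3 in \<open>simp add: w'_def\<close>)
      then show ?thesis using 3 by simp
    qed
  qed
  have R: "((w' \<longlongrightarrow> l) (at_right t)) = (if c \<le> t \<and> t < d then ((\<lambda>_. v) \<longlongrightarrow> l) (at_right t) else (w \<longlongrightarrow> l) (at_right t))" for t l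
    using evr[of t] tendsto_cong[of w' "\<lambda>_. v" "at_right t" l] tendsto_cong[of w' w "at_right t" l]
    by (simp split: if_splits)
  have L: "((w' \<longlongrightarrow> l) (at_left t)) = (if c < t \<and> t \<le> d then ((\<lambda>_. v) \<longlongrightarrow> l) (at_left t) else (w \<longlongrightarrow> l) (at_left t))" for t l
    using evl[of t] tendsto_cong[of w' "\<lambda>_. v" "at_left t" l] tendsto_cong[of w' w "at_left t" l]
    by (simp split: if_splits)
  show "rcont T w'"
    unfolding rcont_def R L using w(2) cd by (auto simp: rcont_def w'_def)
  have "isCont w' t" if t: "t \<in> {0<..<T} - (S \<union> {c, d})" for t
  proof -
    have "isCont w t" using S t by auto
    then have "(w \<longlongrightarrow> w t) (at_left t)" "(w \<longlongrightarrow> w t) (at_right t)"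
      unfolding isCont_def by (auto simp: filterlim_at_split)
    moreover have "(c \<le> t \<and> t < d) = (c < t \<and> t < d)" "(c < t \<and> t \<le> d) = (c < t \<and> t < d)" "t \<noteq> c" "c \<noteq> t"
      using t by auto
    ultimately show ?thesis
      unfolding isCont_def filterlim_at_split R L by (cases "c < t \<and> t < d") (auto simp: w'_def)
  qed
  moreover have "\<exists>l\<in>U. (w' \<longlongrightarrow> l) (at_right t)" if "t \<in> {0..<T}" for t
    unfolding R using v w(1) that by (cases "c \<le> t \<and> t < d") (auto simp: pcw_def)
  moreover have "\<exists>l\<in>U. (w' \<longlongrightarrow> l) (at_left t)" if "t \<in> {0<..T}" for t
    unfolding L using v w(1) that by (cases "c < t \<and> t \<le> d") (auto simp: pcw_def)
  moreover have "w' ` {0..T} \<subseteq> U" using v wU by (auto simp: w'_def)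
  ultimately show "pcw T U w'" unfolding pcw_def using S(1)
    by (intro conjI exI[of _ "S \<union> {c, d}"]) auto
qed

text \<open>Needles are inserted one at a time; because the intervals are disjoint, a later
  insertion leaves the earlier values intact.\<close>

lemma needle_control_exists:
  assumes u: "pcw T U u" "rcont T u" and N: "finite N"
    and v: "\<And>i. i \<in> N \<Longrightarrow> v i \<in> U" and cd: "\<And>i. i \<in> N \<Longrightarrow> 0 \<le> c i \<and> c i \<le> d i \<and> d i < T"
    and disj: "\<And>i j t. i \<in> N \<Longrightarrow> j \<in> N \<Longrightarrow> i \<noteq> j \<Longrightarrow> c i \<le> t \<Longrightarrow> t < d i \<Longrightarrow> c j \<le> t \<Longrightarrow> t < d j \<Longrightarrow> False"
  shows "\<exists>w. pcw T U w \<and> rcont T w \<and> (\<forall>i\<in>N. \<forall>t. c i \<le> t \<and> t < d i \<longrightarrow> w t = v i) \<and>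
     (\<forall>t. (\<forall>i\<in>N. \<not> (c i \<le> t \<and> t < d i)) \<longrightarrow> w t = u t)"
  using N v cd disj
proof (induction N)
  case empty
  then show ?case using u by auto
next
  case (insert j N)
  have "\<exists>w. pcw T U w \<and> rcont T w \<and> (\<forall>i\<in>N. \<forall>t. c i \<le> t \<and> t < d i \<longrightarrow> w t = v i) \<and>
     (\<forall>t. (\<forall>i\<in>N. \<not> (c i \<le> t \<and> t < d i)) \<longrightarrow> w t = u t)"
    by (rule insert.IH) (use insert.prems in blast)+
  then obtain w where w: "pcw T U w" "rcont T w" "\<And>i t. i \<in> N \<Longrightarrow> c i \<le> t \<Longrightarrow> t < d i \<Longrightarrow> w t = v i"
    "\<And>t. (\<And>i. i \<in> N \<Longrightarrow> \<not> (c i \<le> t \<and> t < d i)) \<Longrightarrow> w t = u t"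
    by blast
  define w' where "w' = (\<lambda>t. if c j \<le> t \<and> t < d j then v j else w t)"
  have cdj: "v j \<in> U" "0 \<le> c j" "c j \<le> d j" "d j < T" using insert.prems by auto
  have "pcw T U w'" "rcont T w'"
    unfolding w'_def by (rule pcw_update[OF w(1,2) cdj])+
  moreover have "w' t = v i" if "i \<in> insert j N" "c i \<le> t" "t < d i" for i t
    using that w(3)[of i t] insert.prems(3)[of i j t] insert.hyps by (auto simp: w'_def)
  moreover have "w' t = u t" if "\<And>i. i \<in> insert j N \<Longrightarrow> \<not> (c i \<le> t \<and> t < d i)" for t
    using that[of j] w(4)[of t] that by (auto simp: w'_def)
  ultimately show ?case by (intro exI[of _ w']) blast
qed

text \<open>The primitive of the indicator of [c,d[: the length of needle already passed at time
  t.\<close>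

definition ramp :: "real \<Rightarrow> real \<Rightarrow> real \<Rightarrow> real" where
  "ramp c d t = max 0 (min (d - c) (t - c))"

lemma ramp:
  assumes "0 \<le> c" "c \<le> d" "d \<le> T"
  shows "continuous_on A (ramp c d)" "ramp c d 0 = 0" "ramp c d T = d - c"
    "t \<notin> {c, d} \<Longrightarrow> (ramp c d has_vector_derivative (if c \<le> t \<and> t < d then 1 else 0)) (at t)"
    "((\<lambda>t. if c \<le> t \<and> t < d then 1 else 0) has_integral (d - c)) {0..T}"
proof -
  show cont: "continuous_on A (ramp c d)" for A unfolding ramp_def by (intro continuous_intros)
  show e: "ramp c d 0 = 0" "ramp c d T = d - c" using assms by (auto simp: ramp_def)
  show dv: "(ramp c d has_vector_derivative (if c \<le> t \<and> t < d then 1 else 0)) (at t)" if nt: "t \<notin> {c, d}" for t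
  proof -
    consider "t < c" | "c < t" "t < d" | "d < t"
      using nt by (cases t c rule: linorder_cases; cases t d rule: linorder_cases) auto
    then show ?thesis
    proof cases
      case 1
      have "((\<lambda>_. 0::real) has_vector_derivative 0) (at t)" by (rule has_vector_derivative_const)
      then have "(ramp c d has_vector_derivative 0) (at t)"
        by (rule has_vector_derivative_transform_within_open[of _ _ _ "{..<c}"])
          (use 1 assms in \<open>simp_all add: ramp_def max_def min_def\<close>)
      then show ?thesis using 1 assms by simp
    next
      case 2
      have "((\<lambda>s. s - c) has_vector_derivative 1) (at t)"
        unfolding has_real_derivative_iff_has_vector_derivative[symmetric] by (auto intro!: derivative_eq_intros)
      then have "(ramp c d has_vector_derivative 1) (at t)"
        by (rule has_vector_derivative_transform_within_open[of _ _ _ "{c<..<d}"])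
          (use 2 assms in \<open>simp_all add: ramp_def max_def min_def\<close>)
      then show ?thesis using 2 assms by simp
    next
      case 3
      have "((\<lambda>_. d - c) has_vector_derivative 0) (at t)" by (rule has_vector_derivative_const)
      then have "(ramp c d has_vector_derivative 0) (at t)"
        by (rule has_vector_derivative_transform_within_open[of _ _ _ "{d<..}"])
          (use 3 assms in \<open>simp_all add: ramp_def max_def min_def\<close>)
      then show ?thesis using 3 assms by simp
    qed
  qed
  have "((\<lambda>t. if c \<le> t \<and> t < d then 1 else 0) has_integral (ramp c d T - ramp c d 0)) {0..T}"
    by (rule antiderivative_eq_integral[of "{c, d}", OF _ cont dv]) (use T_pos in auto)
  then show "((\<lambda>t. if c \<le> t \<and> t < d then 1 else 0) has_integral (d - c)) {0..T}" using e by simp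
qed

text \<open>The finite set E collects the ends of needle intervals, where pointwise convergence may
  fail; the integrands are reset to zero there before dominated convergence is applied.\<close>

lemma dominated_tendsto_0:
  fixes f :: "nat \<Rightarrow> real \<Rightarrow> real"
  assumes "\<And>n. f n integrable_on {0..T}" "finite E" "\<And>n t. t \<in> {0..T} \<Longrightarrow> \<bar>f n t\<bar> \<le> B"
    "\<And>t. t \<in> {0..T} - E \<Longrightarrow> (\<lambda>n. f n t) \<longlonglongrightarrow> 0"
  shows "(\<lambda>n. integral {0..T} (f n)) \<longlonglongrightarrow> 0"
proof -
  define g where "g n t = (if t \<in> E then 0 else f n t)" for n t
  have "(\<lambda>n. integral {0..T} (g n)) \<longlonglongrightarrow> integral {0..T} (\<lambda>_. 0)"
  proof (rule dominated_convergence(2)[where h = "\<lambda>_. \<bar>B\<bar>"])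
    show "g n integrable_on {0..T}" for n
      by (rule integrable_spike_finite[OF assms(2) _ assms(1)[of n]]) (simp add: g_def)
    show "norm (g n t) \<le> \<bar>B\<bar>" if "t \<in> {0..T}" for n t
      using assms(3)[OF that, of n] by (auto simp: g_def)
    show "(\<lambda>n. g n t) \<longlonglongrightarrow> 0" if "t \<in> {0..T}" for t
      using assms(4)[of t] that by (cases "t \<in> E") (auto simp: g_def)
  qed auto
  moreover have "integral {0..T} (g n) = integral {0..T} (f n)" for n
    by (rule integral_spike[of E]) (use assms(2) negligible_finite in \<open>auto simp: g_def\<close>)
  ultimately show ?thesis by simp
qed

end

text \<open>A reference trajectory together with what is known of the field near it: a Lipschitz
  tube for each compact set of control values, and differentiability in the state exactly on the
  trajectory, for every control value. The running cost is absent here; it enters later as one more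
  coordinate of the state.\<close>

locale control_system = pos_time T for T :: real +
  fixes \<Omega> :: "'e::banach set" and U :: "'y::real_normed_vector set"
    and F :: "real \<Rightarrow> 'e \<Rightarrow> 'y \<Rightarrow> 'e" and z :: "real \<Rightarrow> 'e" and u :: "real \<Rightarrow> 'y"
    and A :: "real \<Rightarrow> 'y \<Rightarrow> 'e \<Rightarrow>\<^sub>L 'e" and P :: "real \<Rightarrow> 'e \<Rightarrow>\<^sub>L 'e" and SP :: "real set"
  assumes F_cont: "continuous_on ({0..T} \<times> \<Omega> \<times> U) (\<lambda>(t, \<xi>, \<zeta>). F t \<xi> \<zeta>)"
    and F_lip: "\<And>C. compact C \<Longrightarrow> C \<subseteq> U \<Longrightarrow> C \<noteq> {} \<Longrightarrow> \<exists>r>0. \<exists>M\<ge>0. \<forall>t\<in>{0..T}. cball (z t) r \<subseteq> \<Omega> \<and>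
       (\<forall>\<zeta>\<in>C. \<forall>\<xi>1\<in>cball (z t) r. \<forall>\<xi>2\<in>cball (z t) r. norm (F t \<xi>1 \<zeta> - F t \<xi>2 \<zeta>) \<le> M * norm (\<xi>1 - \<xi>2))"
    and F_deriv: "\<And>t \<zeta>. t \<in> {0..T} \<Longrightarrow> \<zeta> \<in> U \<Longrightarrow> ((\<lambda>\<xi>. F t \<xi> \<zeta>) has_derivative A t \<zeta>) (at (z t))"
    and A_cont: "continuous_on ({0..T} \<times> U) (\<lambda>(t, \<zeta>). A t \<zeta>)"
    and z_PC1: "z \<in> PC1 T \<Omega>" and u_NPC: "u \<in> NPC0R T U"
    and z_ode: "\<And>t. t \<in> {0..T} \<Longrightarrow> ext_deriv T z t = F t (z t) (u t)"
    and P_cont: "continuous_on {0..T} P" and P_T: "P T = id_blinfun" and SP: "finite SP"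
    and P_deriv: "\<And>t. t \<in> {0<..<T} - SP \<Longrightarrow> (P has_vector_derivative - (P t o\<^sub>L A t (u t))) (at t)"
begin

lemma z_cont: "continuous_on {0..T} z" and z_in: "t \<in> {0..T} \<Longrightarrow> z t \<in> \<Omega>"
  using PC1_D(1,2)[OF z_PC1] by auto

lemma u_pcw: "pcw T U u" and u_rcont: "rcont T u" and u_in: "t \<in> {0..T} \<Longrightarrow> u t \<in> U"
  using u_NPC by (auto simp: NPC0R_iff pcw_def)

lemma F_along_cont:
  assumes "continuous_on {0..T} y" "y ` {0..T} \<subseteq> \<Omega>"
  shows "continuous_on ({0..T} \<times> U) (\<lambda>x. F (fst x) (y (fst x)) (snd x))"
proof -
  have "continuous_on ({0..T} \<times> U) (\<lambda>x. (\<lambda>(t, \<xi>, \<zeta>). F t \<xi> \<zeta>) (fst x, y (fst x), snd x))"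
    by (rule continuous_on_compose2[OF F_cont])
      (use assms in \<open>auto intro!: continuous_intros continuous_on_compose2[OF assms(1)]\<close>)
  then show ?thesis by simp
qed

lemma F_along_pcw:
  assumes "continuous_on {0..T} y" "y ` {0..T} \<subseteq> \<Omega>" "pcw T U w"
  shows "pcw T UNIV (\<lambda>t. F t (y t) (w t))" "rcont T w \<Longrightarrow> rcont T (\<lambda>t. F t (y t) (w t))"
  using pcw_compose(1,2)[OF assms(3) F_along_cont[OF assms(1,2)]] by auto

lemma A_pcw: "pcw T UNIV (\<lambda>t. A t (u t))"
  using pcw_compose(1)[OF u_pcw A_cont] by simp

text \<open>The defect of the old trajectory under the new control. It is the source term in the
  Gronwall estimate for the deviation, and it vanishes wherever the controls agree.\<close>

definition excess :: "(real \<Rightarrow> 'y) \<Rightarrow> real \<Rightarrow> real" where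
  "excess w t = norm (F t (z t) (w t) - F t (z t) (u t))"

lemma excess_integrable:
  assumes "pcw T U w"
  shows "excess w integrable_on {0..T}"
proof (rule pcw_integrable)
  show "pcw T UNIV (excess w)" unfolding excess_def
    by (rule pcw_map2(1)[OF F_along_pcw(1)[OF z_cont _ assms] F_along_pcw(1)[OF z_cont _ u_pcw], where G = "\<lambda>a b. norm (a - b)"])
      (use z_in in \<open>auto intro!: continuous_intros\<close>)
qed

text \<open>The field composed with the retraction onto the ball of radius r around
  \<open>z t\<close> is globally Lipschitz, so a solution exists on all of [0,T]. Gronwall's
  inequality and \<open>small\<close> keep it inside that ball, where the retraction is the
  identity, and so it solves the original equation.\<close>

lemma flow_exists:
  assumes C: "compact C" "C \<subseteq> U" and r: "0 < r" "0 \<le> M"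
    and ball: "\<And>t. t \<in> {0..T} \<Longrightarrow> cball (z t) r \<subseteq> \<Omega>"
    and lip: "\<And>t \<zeta> \<xi>1 \<xi>2. t \<in> {0..T} \<Longrightarrow> \<zeta> \<in> C \<Longrightarrow> \<xi>1 \<in> cball (z t) r \<Longrightarrow> \<xi>2 \<in> cball (z t) r \<Longrightarrow>
        norm (F t \<xi>1 \<zeta> - F t \<xi>2 \<zeta>) \<le> M * norm (\<xi>1 - \<xi>2)"
    and w: "pcw T U w" "rcont T w" "w ` {0..T} \<subseteq> C"
    and small: "integral {0..T} (excess w) * exp (2 * M * T) \<le> r"
  shows "\<exists>y. y \<in> PC1 T \<Omega> \<and> (\<forall>t\<in>{0..T}. ext_deriv T y t = F t (y t) (w t)) \<and> y 0 = z 0 \<and>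
    (\<forall>t\<in>{0..T}. norm (y t - z t) \<le> integral {0..T} (excess w) * exp (2 * M * T))"
proof -
  define R where "R t \<xi> = z t + radial r (\<xi> - z t)" for t \<xi>
  define G where "G t \<xi> = F t (R t \<xi>) (w t)" for t \<xi>
  have R_ball: "R t \<xi> \<in> cball (z t) r" for t \<xi>
    using norm_radial_le[OF r(1)] by (simp add: R_def dist_norm)
  have G_pcw: "pcw T UNIV (\<lambda>t. G t (y t))" "rcont T (\<lambda>t. G t (y t))" if "continuous_on {0..T} y" for y
  proof -
    have "continuous_on {0..T} (\<lambda>t. R t (y t))" unfolding R_def
      by (intro continuous_intros continuous_on_radial r z_cont that)
    moreover have "(\<lambda>t. R t (y t)) ` {0..T} \<subseteq> \<Omega>" using R_ball ball by blast
    ultimately show "pcw T UNIV (\<lambda>t. G t (y t))" "rcont T (\<lambda>t. G t (y t))"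
      unfolding G_def using F_along_pcw[of "\<lambda>t. R t (y t)" w] w by auto
  qed
  \<comment> \<open>The retraction doubles the Lipschitz constant M. The version with 2 M + 1
    supplies the strictly positive constant needed for the Picard iteration, the sharper one enters
    the estimate.\<close>
  have G_lip: "norm (G t \<xi>1 - G t \<xi>2) \<le> (2 * M + 1) * norm (\<xi>1 - \<xi>2)" "norm (G t \<xi>1 - G t \<xi>2) \<le> 2 * M * norm (\<xi>1 - \<xi>2)"
    if "t \<in> {0..T}" for t \<xi>1 \<xi>2
  proof -
    have "norm (G t \<xi>1 - G t \<xi>2) \<le> M * norm (R t \<xi>1 - R t \<xi>2)"
      unfolding G_def by (rule lip) (use that R_ball w in auto)
    also have "norm (R t \<xi>1 - R t \<xi>2) \<le> 2 * norm (\<xi>1 - \<xi>2)"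
      using radial_lipschitz[OF r(1), of "\<xi>1 - z t" "\<xi>2 - z t"] by (simp add: R_def)
    finally show 2: "norm (G t \<xi>1 - G t \<xi>2) \<le> 2 * M * norm (\<xi>1 - \<xi>2)" using r by (simp add: mult_left_mono)
    show "norm (G t \<xi>1 - G t \<xi>2) \<le> (2 * M + 1) * norm (\<xi>1 - \<xi>2)"
      by (rule order_trans[OF 2]) (simp add: mult_right_mono)
  qed
  obtain y where y: "continuous_on {0..T} y" "\<And>t. t \<in> {0..T} \<Longrightarrow> y t = z 0 + integral {0..t} (\<lambda>s. G s (y s))"
    using ode_exists[of G "2 * M + 1" "z 0"] pcw_integrable[OF G_pcw(1)] G_lip(1) r by auto
  obtain S where S: "finite S" "\<And>t. t \<in> {0<..<T} - S \<Longrightarrow>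
      ((\<lambda>t. integral {0..t} (\<lambda>s. G s (y s))) has_vector_derivative G t (y t)) (at t)"
    using integral_pcw_antiderivative(2)[OF G_pcw(1)[OF y(1)]] by blast
  have yd: "(y has_vector_derivative G t (y t)) (at t)" if "t \<in> {0<..<T} - S" for t
  proof -
    have "((\<lambda>t. z 0 + integral {0..t} (\<lambda>s. G s (y s))) has_vector_derivative 0 + G t (y t)) (at t)"
      by (intro has_vector_derivative_add has_vector_derivative_const S(2) that)
    then show ?thesis
      using has_vector_derivative_transform_within_open[of _ _ t "{0<..<T}" y] y(2) that by auto
  qed
  obtain Sz where Sz: "finite Sz" "\<And>t. t \<in> {0<..<T} - Sz \<Longrightarrow> (z has_vector_derivative F t (z t) (u t)) (at t)"
    using PC1_D(5)[OF z_PC1] z_ode by force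
  have y0: "y 0 = z 0" using y(2)[of 0] T_pos by simp
  have close: "norm (y t - z t) \<le> integral {0..T} (excess w) * exp (2 * M * T)" if t: "t \<in> {0..T}" for t
  proof -
    have "norm (y t - z t) \<le> (norm (y 0 - z 0) + integral {0..T} (excess w)) * exp (integral {0..T} (\<lambda>_. 2 * M))"
    proof (rule gronwall[where w = "\<lambda>t. y t - z t" and S = "S \<union> Sz" and k = "\<lambda>t. G t (y t) - F t (z t) (u t)"])
      show "continuous_on {0..T} (\<lambda>t. y t - z t)" by (intro continuous_intros y z_cont)
      show "pcw T UNIV (\<lambda>_. 2 * M)" by (rule continuous_pcw(1)) auto
      fix s assume s: "s \<in> {0<..<T} - (S \<union> Sz)"
      show "((\<lambda>t. y t - z t) has_vector_derivative G s (y s) - F s (z s) (u s)) (at s)"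
        by (intro has_vector_derivative_diff yd Sz) (use s in auto)
      have "R s (z s) = z s" using radial_id[OF r(1), of 0] r by (simp add: R_def)
      then have "G s (z s) = F s (z s) (w s)" by (simp add: G_def)
      moreover have "norm (G s (y s) - G s (z s)) \<le> 2 * M * norm (y s - z s)" by (rule G_lip) (use s in auto)
      ultimately show "norm (G s (y s) - F s (z s) (u s)) \<le> 2 * M * norm (y s - z s) + excess w s"
        unfolding excess_def using norm_triangle_ineq[of "G s (y s) - G s (z s)" "G s (z s) - F s (z s) (u s)"] by simp
    qed (use S Sz r t excess_integrable[OF w(1)] in \<open>auto simp: excess_def\<close>)
    then show ?thesis using y0 T_pos by (simp add: mult.commute mult.left_commute mult.assoc)
  qed
  have GF: "G t (y t) = F t (y t) (w t)" if "t \<in> {0..T}" for t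
    using close[OF that] small radial_id[OF r(1), of "y t - z t"] by (simp add: G_def R_def)
  have "y ` {0..T} \<subseteq> \<Omega>"
  proof
    fix \<xi> assume "\<xi> \<in> y ` {0..T}"
    then obtain t where t: "t \<in> {0..T}" "\<xi> = y t" by auto
    then have "y t \<in> cball (z t) r" using close[OF t(1)] small by (simp add: dist_norm norm_minus_commute)
    then show "\<xi> \<in> \<Omega>" using ball t by blast
  qed
  from PC1_I[OF this S(1) y(1) yd G_pcw[OF y(1)]]
  have "y \<in> PC1 T \<Omega>" "\<And>t. t \<in> {0..T} \<Longrightarrow> ext_deriv T y t = G t (y t)" by auto
  then show ?thesis using GF y0 close by auto
qed

section \<open>Needle variations\<close>

text \<open>The displacement of the endpoint per unit length of a needle: the jump of the velocity
  at the needle time, transported to T.\<close>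

definition needle_effect :: "real \<times> 'y \<Rightarrow> 'e" where
  "needle_effect i = P (fst i) (F (fst i) (z (fst i)) (snd i) - F (fst i) (z (fst i)) (u (fst i)))"

text \<open>Needles at the same time are placed side by side: the interval of the needle \<open>i\<close> is shifted by
  the total length of the needles preceding it in an enumeration of \<open>N\<close>. The expansion of the endpoint
  comes from integrating the derivative of $P(t)(y(t)-z(t))$.\<close>

lemma needle_variations:
  assumes N: "finite N" "N \<subseteq> {0..<T} \<times> U"
  shows "\<exists>\<rho>>0. \<exists>K ya wa.
    (\<forall>a. (\<forall>i\<in>N. 0 \<le> a i) \<and> sum a N < \<rho> \<longrightarrow> ya a \<in> PC1 T \<Omega> \<and> wa a \<in> NPC0R T U \<and>
      (\<forall>t\<in>{0..T}. ext_deriv T (ya a) t = F t (ya a t) (wa a t)) \<and> ya a 0 = z 0 \<and>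
      (\<forall>t\<in>{0..T}. norm (ya a t - z t) \<le> K * sum a N)) \<and>
    (\<forall>b a. (\<forall>i\<in>N. 0 \<le> a i) \<and> sum a N < \<rho> \<and> (\<forall>n::nat. (\<forall>i\<in>N. 0 \<le> b n i) \<and> sum (b n) N < \<rho>) \<and>
      (\<forall>i\<in>N. (\<lambda>n. b n i) \<longlonglongrightarrow> a i) \<longrightarrow> (\<lambda>n. ya (b n) T) \<longlonglongrightarrow> ya a T) \<and>
    (\<forall>b. (\<forall>n::nat. (\<forall>i\<in>N. 0 \<le> b n i) \<and> 0 < sum (b n) N \<and> sum (b n) N < \<rho>) \<and> (\<lambda>n. sum (b n) N) \<longlonglongrightarrow> 0 \<longrightarrow>
      (\<lambda>n. (1 / sum (b n) N) *\<^sub>R (ya (b n) T - z T - (\<Sum>i\<in>N. b n i *\<^sub>R needle_effect i))) \<longlonglongrightarrow> 0)"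
proof -
  obtain h :: "real \<times> 'y \<Rightarrow> nat" where h: "inj_on h N"
    using finite_imp_inj_to_nat_seg[OF N(1)] by (elim exE conjE)
  define before where "before i = {j \<in> N. h j < h i}" for i
  define c where "c a i = fst i + sum a (before i)" for a i
  define d where "d a i = c a i + a i" for a i
  \<comment> \<open>Half the least distance from the needle times to T and between different needle
    times. Shifts below \<rho>0 cannot bring needles at different times into contact nor push one
    beyond T.\<close>
  obtain \<rho>0 where \<rho>0: "\<rho>0 > 0" "\<And>i. i \<in> N \<Longrightarrow> \<rho>0 < T - fst i"
      "\<And>i j. i \<in> N \<Longrightarrow> j \<in> N \<Longrightarrow> fst i \<noteq> fst j \<Longrightarrow> \<rho>0 < \<bar>fst i - fst j\<bar>"
  proof -
    define D where "D = insert 1 ((\<lambda>i. T - fst i) ` N \<union> ((\<lambda>(i, j). \<bar>fst i - fst j\<bar>) ` (N \<times> N) - {0}))"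
    have D: "finite D" "D \<noteq> {}" "\<And>x. x \<in> D \<Longrightarrow> 0 < x" using N by (auto simp: D_def)
    then have "0 < Min D" by simp
    have lt: "Min D / 2 < x" if "x \<in> D" for x
      using Min_le[OF D(1) that] \<open>0 < Min D\<close> by linarith
    show ?thesis
    proof (rule that[of "Min D / 2"])
      show "Min D / 2 < T - fst i" if "i \<in> N" for i by (rule lt) (use that in \<open>auto simp: D_def\<close>)
      show "Min D / 2 < \<bar>fst i - fst j\<bar>" if "i \<in> N" "j \<in> N" "fst i \<noteq> fst j" for i j
        by (rule lt) (use that in \<open>force simp: D_def\<close>)
    qed (use \<open>0 < Min D\<close> in simp)
  qed
  obtain C0 where C0: "compact C0" "C0 \<subseteq> U" "u ` {0..T} \<subseteq> C0" using pcw_compact_range[OF u_pcw] by metis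
  \<comment> \<open>All values ever taken by the modified controls lie in this compact set, so
    radius, Lipschitz constant and bounds are fixed before the needle lengths are chosen.\<close>
  define C where "C = C0 \<union> snd ` N"
  have C: "compact C" "C \<subseteq> U" "u ` {0..T} \<subseteq> C" "\<And>i. i \<in> N \<Longrightarrow> snd i \<in> C"
    using C0 N finite_imp_compact[of "snd ` N"] compact_Un[OF C0(1), of "snd ` N"] by (auto simp: C_def)
  have uC: "u t \<in> C" if "t \<in> {0..T}" for t using C(3) that by auto
  have "u 0 \<in> C" using uC T_pos by auto
  then obtain r M where r: "0 < r" "0 \<le> M"
    and ball: "\<And>t. t \<in> {0..T} \<Longrightarrow> cball (z t) r \<subseteq> \<Omega>"
    and lip: "\<And>t \<zeta> \<xi>1 \<xi>2. t \<in> {0..T} \<Longrightarrow> \<zeta> \<in> C \<Longrightarrow> \<xi>1 \<in> cball (z t) r \<Longrightarrow> \<xi>2 \<in> cball (z t) r \<Longrightarrow>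
        norm (F t \<xi>1 \<zeta> - F t \<xi>2 \<zeta>) \<le> M * norm (\<xi>1 - \<xi>2)"
    using F_lip[OF C(1,2)] by blast
  have bound: "\<exists>B>0. \<forall>t\<in>{0..T}. \<forall>\<zeta>\<in>C. norm (F t (y t) \<zeta>) \<le> B"
    if "continuous_on {0..T} y" "y ` {0..T} \<subseteq> \<Omega>" for y
  proof -
    have "compact ((\<lambda>x. F (fst x) (y (fst x)) (snd x)) ` ({0..T} \<times> C))" (is "compact ?I")
      by (intro compact_continuous_image continuous_on_subset[OF F_along_cont[OF that]] compact_Times C) (use C in auto)
    from compact_imp_bounded[OF this] obtain B where "B > 0" "\<forall>x\<in>?I. norm x \<le> B"
      unfolding bounded_pos by (elim exE conjE)
    then have "norm (F t (y t) \<zeta>) \<le> B" if "t \<in> {0..T}" "\<zeta> \<in> C" for t \<zeta>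
      using imageI[of "(t, \<zeta>)" "{0..T} \<times> C" "\<lambda>x. F (fst x) (y (fst x)) (snd x)"] that by simp
    then show ?thesis using \<open>B > 0\<close> by blast
  qed
  obtain B where B: "B > 0" "\<And>t \<zeta>. t \<in> {0..T} \<Longrightarrow> \<zeta> \<in> C \<Longrightarrow> norm (F t (z t) \<zeta>) \<le> B"
    using bound[OF z_cont] z_in by blast
  \<comment> \<open>The excess is at most 2 B on the needles and zero elsewhere, so its integral is
    at most 2 B times the total needle length; the exponential is the Gronwall factor.\<close>
  define K where "K = 2 * B * exp (2 * M * T)"
  have K: "K > 0" using B by (simp add: K_def)
  \<comment> \<open>The first bound keeps the needles disjoint, the second keeps the perturbed
    trajectory in the tube of radius r.\<close>
  define \<rho> where "\<rho> = min \<rho>0 (r / K)"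
  have \<rho>: "0 < \<rho>" "\<rho> \<le> \<rho>0" "\<rho> * K \<le> r" using \<rho>0 r K by (auto simp: \<rho>_def min_def field_simps)
  define adm where "adm a \<longleftrightarrow> (\<forall>i\<in>N. 0 \<le> a i) \<and> sum a N < \<rho>" for a :: "real \<times> 'y \<Rightarrow> real"
  have cd: "fst i \<le> c a i" "c a i \<le> d a i" "d a i \<le> fst i + sum a N" if "adm a" "i \<in> N" for a i
  proof -
    have a0: "\<And>i. i \<in> N \<Longrightarrow> 0 \<le> a i" using that by (auto simp: adm_def)
    show "fst i \<le> c a i" "c a i \<le> d a i" using a0 that by (auto simp: c_def d_def before_def intro!: sum_nonneg)
    have "sum a (before i) + a i = sum a (insert i (before i))"
      using N(1) by (simp add: before_def)
    also have "\<dots> \<le> sum a N" by (rule sum_mono2) (use N(1) a0 that in \<open>auto simp: before_def\<close>)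
    finally show "d a i \<le> fst i + sum a N" by (simp add: c_def d_def)
  qed
  have dT: "0 \<le> c a i" "d a i < T" if "adm a" "i \<in> N" for a i
    using cd[OF that] \<rho>0(2)[OF that(2)] that N(2) \<rho>(2) by (auto simp: adm_def)
  have disj: False if a: "adm a" and ij: "i \<in> N" "j \<in> N" "i \<noteq> j" "c a i \<le> t" "t < d a i" "c a j \<le> t" "t < d a j" for a i j t
  proof -
    have *: False if ij: "i \<in> N" "j \<in> N" "c a i \<le> t" "t < d a i" "c a j \<le> t" "t < d a j" "h j < h i" for i j
    proof (cases "fst i = fst j")
      case True
      have "sum a (before j) + a j = sum a (insert j (before j))" using N(1) by (simp add: before_def)
      also have "\<dots> \<le> sum a (before i)"
        by (rule sum_mono2) (use N(1) a ij in \<open>auto simp: before_def adm_def\<close>)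
      finally have "d a j \<le> c a i" using True by (simp add: c_def d_def)
      then show False using ij by simp
    next
      case False
      then have "\<rho>0 < \<bar>fst i - fst j\<bar>" using \<rho>0(3) ij by blast
      moreover have "sum a N < \<rho>0" using a \<rho> by (simp add: adm_def)
      ultimately show False using cd[OF a ij(1)] cd[OF a ij(2)] ij by linarith
    qed
    have "h i \<noteq> h j" using h ij by (auto dest: inj_onD)
    then show False using *[of i j] *[of j i] ij by (cases "h j < h i") auto
  qed
  define good where "good a w y \<longleftrightarrow> pcw T U w \<and> rcont T w \<and> w ` {0..T} \<subseteq> C \<and>
      (\<forall>i\<in>N. \<forall>t. c a i \<le> t \<and> t < d a i \<longrightarrow> w t = snd i) \<and>
      (\<forall>t. (\<forall>i\<in>N. \<not> (c a i \<le> t \<and> t < d a i)) \<longrightarrow> w t = u t) \<and>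
      y \<in> PC1 T \<Omega> \<and> (\<forall>t\<in>{0..T}. ext_deriv T y t = F t (y t) (w t)) \<and> y 0 = z 0 \<and>
      (\<forall>t\<in>{0..T}. norm (y t - z t) \<le> K * sum a N)" for a w y
  have "\<exists>w y. adm a \<longrightarrow> good a w y" for a
  proof (cases "adm a")
    case True
    have a0: "\<And>i. i \<in> N \<Longrightarrow> 0 \<le> a i" using True by (auto simp: adm_def)
    have "\<exists>w. pcw T U w \<and> rcont T w \<and> (\<forall>i\<in>N. \<forall>t. c a i \<le> t \<and> t < d a i \<longrightarrow> w t = snd i) \<and>
       (\<forall>t. (\<forall>i\<in>N. \<not> (c a i \<le> t \<and> t < d a i)) \<longrightarrow> w t = u t)"
    proof (rule needle_control_exists[OF u_pcw u_rcont N(1)])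
      show "snd i \<in> U" if "i \<in> N" for i using N(2) that by auto
      show "0 \<le> c a i \<and> c a i \<le> d a i \<and> d a i < T" if "i \<in> N" for i
        using cd[OF True that] dT[OF True that] by auto
    qed (rule disj[OF True])
    then obtain w where w: "pcw T U w" "rcont T w"
        "\<And>i t. i \<in> N \<Longrightarrow> c a i \<le> t \<Longrightarrow> t < d a i \<Longrightarrow> w t = snd i"
        "\<And>t. (\<And>i. i \<in> N \<Longrightarrow> \<not> (c a i \<le> t \<and> t < d a i)) \<Longrightarrow> w t = u t"
      by blast
    have wC: "w t \<in> C" if "t \<in> {0..T}" for t
      using w(3)[of _ t] w(4)[of t] C(3,4) that by (cases "\<exists>i\<in>N. c a i \<le> t \<and> t < d a i") fastforce+
    have "integral {0..T} (excess w) \<le> integral {0..T} (\<lambda>t. \<Sum>i\<in>N. (2 * B) * (if c a i \<le> t \<and> t < d a i then 1 else 0))"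
    proof (rule integral_le[OF excess_integrable[OF w(1)]])
      have "((\<lambda>t. \<Sum>i\<in>N. (2 * B) * (if c a i \<le> t \<and> t < d a i then 1 else 0)) has_integral (\<Sum>i\<in>N. 2 * B * (d a i - c a i))) {0..T}"
        using cd[OF True] dT[OF True] by (intro has_integral_sum N(1) has_integral_mult_right ramp(5)) (auto intro: less_imp_le)
      then show "(\<lambda>t. \<Sum>i\<in>N. (2 * B) * (if c a i \<le> t \<and> t < d a i then 1 else 0)) integrable_on {0..T}" by blast
      fix t assume t: "t \<in> {0..T}"
      show "excess w t \<le> (\<Sum>i\<in>N. (2 * B) * (if c a i \<le> t \<and> t < d a i then 1 else 0))"
      proof (cases "\<exists>i\<in>N. c a i \<le> t \<and> t < d a i")
        case True
        then obtain i where i: "i \<in> N" "c a i \<le> t" "t < d a i" by blast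
        have "excess w t \<le> B + B" unfolding excess_def
          by (rule order_trans[OF norm_triangle_ineq4 add_mono]) (use B(2)[OF t] wC[OF t] uC[OF t] in auto)
        also have "\<dots> = (2 * B) * (if c a i \<le> t \<and> t < d a i then 1 else 0)" using i by simp
        also have "\<dots> \<le> (\<Sum>i\<in>N. (2 * B) * (if c a i \<le> t \<and> t < d a i then 1 else 0))"
          by (rule member_le_sum) (use i N B in auto)
        finally show ?thesis .
      next
        case False
        then have "w t = u t" using w(4) by blast
        then show ?thesis using B by (auto simp: excess_def intro!: sum_nonneg)
      qed
    qed
    also have "\<dots> = (\<Sum>i\<in>N. 2 * B * (d a i - c a i))"
      using cd[OF True] dT[OF True]
      by (intro integral_unique has_integral_sum N(1) has_integral_mult_right ramp(5)) (auto intro: less_imp_le)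
    also have "\<dots> = 2 * B * sum a N" by (simp add: d_def sum_distrib_left)
    finally have ex: "integral {0..T} (excess w) * exp (2 * M * T) \<le> K * sum a N"
      by (simp add: K_def mult_right_mono mult.commute mult.left_commute)
    also have "K * sum a N \<le> \<rho> * K" using True K by (auto simp: adm_def mult.commute)
    also have "\<dots> \<le> r" by (rule \<rho>)
    finally have small: "integral {0..T} (excess w) * exp (2 * M * T) \<le> r" .
    have "\<exists>y. y \<in> PC1 T \<Omega> \<and> (\<forall>t\<in>{0..T}. ext_deriv T y t = F t (y t) (w t)) \<and> y 0 = z 0 \<and>
      (\<forall>t\<in>{0..T}. norm (y t - z t) \<le> integral {0..T} (excess w) * exp (2 * M * T))"
    proof (rule flow_exists[OF C(1,2) r _ _ w(1,2) _ small])
      show "cball (z t) r \<subseteq> \<Omega>" if "t \<in> {0..T}" for t by (rule ball[OF that])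
      show "norm (F t \<xi>1 \<zeta> - F t \<xi>2 \<zeta>) \<le> M * norm (\<xi>1 - \<xi>2)"
        if "t \<in> {0..T}" "\<zeta> \<in> C" "\<xi>1 \<in> cball (z t) r" "\<xi>2 \<in> cball (z t) r" for t \<zeta> \<xi>1 \<xi>2
        by (rule lip[OF that])
      show "w ` {0..T} \<subseteq> C" using wC by blast
    qed
    then obtain y where y: "y \<in> PC1 T \<Omega>" "\<forall>t\<in>{0..T}. ext_deriv T y t = F t (y t) (w t)" "y 0 = z 0"
      "\<forall>t\<in>{0..T}. norm (y t - z t) \<le> integral {0..T} (excess w) * exp (2 * M * T)"
      by blast
    have "norm (y t - z t) \<le> K * sum a N" if "t \<in> {0..T}" for t
      using y(4) that ex by (blast intro: order_trans)
    then have "good a w y" unfolding good_def using w y(1-3) wC by blast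
    then show ?thesis by blast
  qed auto
  then obtain wa ya where good: "\<And>a. adm a \<Longrightarrow> good a (wa a) (ya a)" by metis
  have w: "pcw T U (wa a)" "rcont T (wa a)" "t \<in> {0..T} \<Longrightarrow> wa a t \<in> C"
      "i \<in> N \<Longrightarrow> c a i \<le> t \<Longrightarrow> t < d a i \<Longrightarrow> wa a t = snd i"
      "(\<And>i. i \<in> N \<Longrightarrow> \<not> (c a i \<le> t \<and> t < d a i)) \<Longrightarrow> wa a t = u t" if "adm a" for a t i
    using good[OF that] unfolding good_def by blast+
  have y: "ya a \<in> PC1 T \<Omega>" "\<And>t. t \<in> {0..T} \<Longrightarrow> ext_deriv T (ya a) t = F t (ya a t) (wa a t)" "ya a 0 = z 0"
      "\<And>t. t \<in> {0..T} \<Longrightarrow> norm (ya a t - z t) \<le> K * sum a N" if "adm a" for a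
    using good[OF that] unfolding good_def by blast+
  have yc: "continuous_on {0..T} (ya a)" "ya a ` {0..T} \<subseteq> \<Omega>" if "adm a" for a
    using PC1_D(1,2)[OF y(1)[OF that]] by auto
  have y_ball: "ya a t \<in> cball (z t) r" if "adm a" "t \<in> {0..T}" for a t
  proof -
    have "K * sum a N \<le> \<rho> * K" using that K by (auto simp: adm_def mult.commute)
    then show ?thesis using y(4)[OF that] \<rho>(3) by (simp add: dist_norm norm_minus_commute)
  qed
  have yd: "\<exists>S. finite S \<and> (\<forall>t\<in>{0<..<T} - S. (ya a has_vector_derivative F t (ya a t) (wa a t)) (at t))" if "adm a" for a
    using PC1_D(5)[OF y(1)[OF that]] y(2)[OF that] by force
  \<comment> \<open>Off the finitely many ends of the limiting intervals, the controls for
    \<open>b n\<close> eventually agree with the control for a at each time. Dominated convergence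
    makes the difference of the fields along \<open>ya a\<close> small in mean, and Gronwall's
    inequality from the common initial point carries this to T.\<close>
  have continuity: "(\<lambda>n. ya (b n) T) \<longlonglongrightarrow> ya a T"
    if a: "adm a" and b: "\<And>n. adm (b n)" and lim: "\<And>i. i \<in> N \<Longrightarrow> (\<lambda>n. b n i) \<longlonglongrightarrow> a i" for b a
  proof -
    define g where "g n t = norm (F t (ya a t) (wa (b n) t) - F t (ya a t) (wa a t))" for n t
    obtain B' where B': "B' > 0" "\<And>t \<zeta>. t \<in> {0..T} \<Longrightarrow> \<zeta> \<in> C \<Longrightarrow> norm (F t (ya a t) \<zeta>) \<le> B'"
      using bound[OF yc[OF a]] by blast
    have g_int: "g n integrable_on {0..T}" for n
    proof (rule pcw_integrable)
      show "pcw T UNIV (g n)" unfolding g_def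
        by (rule pcw_map2(1)[OF F_along_pcw(1)[OF yc[OF a] w(1)[OF b]] F_along_pcw(1)[OF yc[OF a] w(1)[OF a]], where G = "\<lambda>a b. norm (a - b)"])
          (auto intro!: continuous_intros)
    qed
    have clim: "(\<lambda>n. c (b n) i) \<longlonglongrightarrow> c a i" "(\<lambda>n. d (b n) i) \<longlonglongrightarrow> d a i" if "i \<in> N" for i
      unfolding c_def d_def by (intro tendsto_intros lim that; simp add: before_def lim)+
    have "(\<lambda>n. integral {0..T} (g n)) \<longlonglongrightarrow> 0"
    proof (rule dominated_tendsto_0[OF g_int])
      show "finite (c a ` N \<union> d a ` N)" using N by simp
      show "\<bar>g n t\<bar> \<le> B' + B'" if t: "t \<in> {0..T}" for n t
        unfolding g_def abs_norm_cancel
        by (rule order_trans[OF norm_triangle_ineq4 add_mono]) (use B'(2)[OF t] w(3)[OF a t] w(3)[OF b t] in auto)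
      fix t assume t: "t \<in> {0..T} - (c a ` N \<union> d a ` N)"
      have "eventually (\<lambda>n. wa (b n) t = wa a t) sequentially"
      proof (cases "\<exists>i\<in>N. c a i \<le> t \<and> t < d a i")
        case True
        then obtain i where i: "i \<in> N" "c a i < t" "t < d a i" using t by (auto simp: less_le)
        have "eventually (\<lambda>n. c (b n) i < t) sequentially" "eventually (\<lambda>n. t < d (b n) i) sequentially"
          using order_tendstoD clim[OF i(1)] i by blast+
        then show ?thesis by eventually_elim (use w(4)[OF a i(1), of t] w(4)[OF b i(1), of _ t] i in auto)
      next
        case False
        have "eventually (\<lambda>n. \<not> (c (b n) i \<le> t \<and> t < d (b n) i)) sequentially" if i: "i \<in> N" for i
        proof -
          have "t < c a i \<or> d a i < t" using False t i by force
          then show ?thesis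
          proof
            assume "t < c a i"
            then have "eventually (\<lambda>n. t < c (b n) i) sequentially" using order_tendstoD(1) clim(1)[OF i] by blast
            then show ?thesis by eventually_elim auto
          next
            assume "d a i < t"
            then have "eventually (\<lambda>n. d (b n) i < t) sequentially" using order_tendstoD(2) clim(2)[OF i] by blast
            then show ?thesis by eventually_elim auto
          qed
        qed
        then have "eventually (\<lambda>n. \<forall>i\<in>N. \<not> (c (b n) i \<le> t \<and> t < d (b n) i)) sequentially"
          using N(1) by (simp add: eventually_ball_finite)
        then show ?thesis by eventually_elim (use w(5)[OF a, of t] w(5)[OF b, of _ t] False in auto)
      qed
      then have "eventually (\<lambda>n. g n t = 0) sequentially" by eventually_elim (simp add: g_def)
      then show "(\<lambda>n. g n t) \<longlonglongrightarrow> 0" by (rule tendsto_eventually)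
    qed
    then have lim0: "(\<lambda>n. (norm (ya (b n) 0 - ya a 0) + integral {0..T} (g n)) * exp (integral {0..T} (\<lambda>_. M))) \<longlonglongrightarrow> 0"
      using y(3)[OF a] y(3)[OF b] by (auto intro!: tendsto_eq_intros)
    have le: "norm (ya (b n) T - ya a T) \<le> (norm (ya (b n) 0 - ya a 0) + integral {0..T} (g n)) * exp (integral {0..T} (\<lambda>_. M))" for n
    proof -
      obtain S S' where S: "finite S" "\<forall>t\<in>{0<..<T} - S. (ya a has_vector_derivative F t (ya a t) (wa a t)) (at t)"
        using yd[OF a] by (elim exE conjE)
      obtain S' where S': "finite S'" "\<forall>t\<in>{0<..<T} - S'. (ya (b n) has_vector_derivative F t (ya (b n) t) (wa (b n) t)) (at t)"
        using yd[OF b[of n]] by (elim exE conjE)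
      show ?thesis
      proof (rule gronwall[where w = "\<lambda>t. ya (b n) t - ya a t" and S = "S \<union> S'" and k = "\<lambda>t. F t (ya (b n) t) (wa (b n) t) - F t (ya a t) (wa a t)"])
        show "continuous_on {0..T} (\<lambda>t. ya (b n) t - ya a t)" by (intro continuous_intros yc a b)
        show "pcw T UNIV (\<lambda>_. M)" by (rule continuous_pcw(1)) auto
        fix t assume t: "t \<in> {0<..<T} - (S \<union> S')"
        show "((\<lambda>t. ya (b n) t - ya a t) has_vector_derivative F t (ya (b n) t) (wa (b n) t) - F t (ya a t) (wa a t)) (at t)"
          by (intro has_vector_derivative_diff) (use S S' t in auto)
        have "norm (F t (ya (b n) t) (wa (b n) t) - F t (ya a t) (wa (b n) t)) \<le> M * norm (ya (b n) t - ya a t)"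
          by (rule lip) (use t w(3)[OF b, of t n] y_ball[OF a, of t] y_ball[OF b, of t] in auto)
        then show "norm (F t (ya (b n) t) (wa (b n) t) - F t (ya a t) (wa a t)) \<le> M * norm (ya (b n) t - ya a t) + g n t"
          unfolding g_def using norm_triangle_ineq[of "F t (ya (b n) t) (wa (b n) t) - F t (ya a t) (wa (b n) t)"
              "F t (ya a t) (wa (b n) t) - F t (ya a t) (wa a t)"] by simp
      qed (use S S' r g_int T_pos in \<open>auto simp: g_def\<close>)
    qed
    have "(\<lambda>n. ya (b n) T - ya a T) \<longlonglongrightarrow> 0"
      by (rule Lim_null_comparison[OF always_eventually[OF allI[OF le]] lim0])
    then show ?thesis by (simp only: LIM_zero_iff)
  qed
  obtain KP where KP: "KP > 0" "\<And>t. t \<in> {0..T} \<Longrightarrow> norm (P t) \<le> KP"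
    using pcw_bounded[OF continuous_pcw(1)[OF P_cont, of UNIV]] by auto
  obtain BA where BA: "BA > 0" "\<And>t. t \<in> {0..T} \<Longrightarrow> norm (A t (u t)) \<le> BA"
    using pcw_bounded[OF A_pcw] by auto
  obtain Sz where Sz: "finite Sz" "\<And>t. t \<in> {0<..<T} - Sz \<Longrightarrow> (z has_vector_derivative F t (z t) (u t)) (at t)"
    using PC1_D(5)[OF z_PC1] z_ode by force
  have expansion: "(\<lambda>n. (1 / sum (b n) N) *\<^sub>R (ya (b n) T - z T - (\<Sum>i\<in>N. b n i *\<^sub>R needle_effect i))) \<longlonglongrightarrow> 0"
    if b: "\<And>n. adm (b n)" and pos: "\<And>n. 0 < sum (b n) N" and s0: "(\<lambda>n. sum (b n) N) \<longlonglongrightarrow> 0" for b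
  proof -
    define s where "s = (\<lambda>n. sum (b n) N)"
    \<comment> \<open>The remainder of the linearisation in the state under the unperturbed control.
      Only its mean has to be small compared with the total needle length
      \<open>s n\<close>.\<close>
    define q where "q n t = norm (F t (ya (b n) t) (u t) - F t (z t) (u t) - A t (u t) (ya (b n) t - z t))" for n t
    have s: "0 < s n" "s \<longlonglongrightarrow> 0" for n using pos s0 by (auto simp: s_def)
    have ybound: "norm (ya (b n) t - z t) \<le> K * s n" if "t \<in> {0..T}" for n t
      using y(4)[OF b that] by (simp add: s_def)
    have zball: "z t \<in> cball (z t) r" for t using r by simp
    have lipz: "norm (F t (ya (b n) t) \<zeta> - F t (z t) \<zeta>) \<le> M * (K * s n)" if "t \<in> {0..T}" "\<zeta> \<in> C" for t \<zeta> n
      by (rule order_trans[OF lip[OF that y_ball[OF b that(1)] zball] mult_left_mono[OF ybound[OF that(1)] r(2)]])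
    have Abound: "norm (A t (u t) (ya (b n) t - z t)) \<le> BA * (K * s n)" if "t \<in> {0..T}" for t n
      by (rule order_trans[OF norm_blinfun mult_mono]) (use BA(1) BA(2)[OF that] ybound[OF that] in auto)
    have q_pcw: "pcw T UNIV (q n)" for n
    proof -
      have "continuous_on ({0..T} \<times> U) (\<lambda>x. norm (F (fst x) (ya (b n) (fst x)) (snd x) - F (fst x) (z (fst x)) (snd x)
         - (case x of (t, \<zeta>) \<Rightarrow> A t \<zeta>) (ya (b n) (fst x) - z (fst x))))"
        by (intro continuous_intros F_along_cont yc[OF b] z_cont bounded_bilinear.continuous_on[OF bounded_bilinear_blinfun_apply] A_cont
          continuous_on_compose2[OF yc(1)[OF b]] continuous_on_compose2[OF z_cont]) (use z_in in auto)
      from pcw_compose(1)[OF u_pcw this] show ?thesis unfolding q_def by simp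
    qed
    have q_int: "q n integrable_on {0..T}" for n by (rule pcw_integrable[OF q_pcw])
    \<comment> \<open>Differentiability at \<open>z t\<close> is pointwise in t with no uniformity;
      the Lipschitz tube bounds the quotients, so dominated convergence closes the gap.\<close>
    have "(\<lambda>n. integral {0..T} (\<lambda>t. (1 / s n) * q n t)) \<longlonglongrightarrow> 0"
    proof (rule dominated_tendsto_0)
      show "(\<lambda>t. (1 / s n) * q n t) integrable_on {0..T}" for n using q_int by (rule integrable_on_mult_right)
      show "\<bar>(1 / s n) * q n t\<bar> \<le> M * K + BA * K" if t: "t \<in> {0..T}" for n t
      proof -
        have "q n t \<le> M * (K * s n) + BA * (K * s n)"
          unfolding q_def by (rule order_trans[OF norm_triangle_ineq4 add_mono[OF lipz[OF t uC[OF t]] Abound[OF t]]])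
        then have "q n t \<le> (M * K + BA * K) * s n" by (simp add: algebra_simps)
        then show ?thesis using s(1)[of n] by (simp add: q_def abs_mult field_simps)
      qed
      fix t assume t: "t \<in> {0..T} - {}"
      then have t: "t \<in> {0..T}" by simp
      show "(\<lambda>n. (1 / s n) * q n t) \<longlonglongrightarrow> 0"
      proof (rule LIMSEQ_I)
        fix e :: real assume e: "0 < e"
        define e' where "e' = e / (2 * K)"
        have e': "e' > 0" using e K by (simp add: e'_def)
        have "((\<lambda>\<xi>. F t \<xi> (u t)) has_derivative A t (u t)) (at (z t))" by (rule F_deriv[OF t u_in[OF t]])
        then obtain \<delta> where \<delta>: "\<delta> > 0" "\<And>\<xi>. norm (\<xi> - z t) < \<delta> \<Longrightarrow>
            norm (F t \<xi> (u t) - F t (z t) (u t) - A t (u t) (\<xi> - z t)) \<le> e' * norm (\<xi> - z t)"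
          using e' unfolding has_derivative_at_alt by blast
        have "(\<lambda>n. K * s n) \<longlonglongrightarrow> 0" using s(2) by (auto intro!: tendsto_eq_intros)
        then have "eventually (\<lambda>n. K * s n < \<delta>) sequentially" using \<delta>(1) order_tendstoD(2) by blast
        then obtain n0 where n0: "\<And>n. n \<ge> n0 \<Longrightarrow> K * s n < \<delta>" unfolding eventually_sequentially by blast
        have "norm ((1 / s n) * q n t - 0) < e" if "n \<ge> n0" for n
        proof -
          have "q n t \<le> e' * norm (ya (b n) t - z t)"
            unfolding q_def by (rule \<delta>(2)) (use ybound[OF t, of n] n0[OF that] in linarith)
          also have "\<dots> \<le> e' * (K * s n)" by (rule mult_left_mono[OF ybound[OF t]]) (use e' in simp)
          also have "\<dots> = e / 2 * s n" using K by (simp add: e'_def)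
          finally have "(1 / s n) * q n t \<le> e / 2" using s(1)[of n] by (simp add: field_simps)
          moreover have "norm ((1 / s n) * q n t - 0) = (1 / s n) * q n t" using s(1)[of n] by (simp add: q_def)
          ultimately show ?thesis using e by linarith
        qed
        then show "\<exists>n0. \<forall>n\<ge>n0. norm ((1 / s n) * q n t - 0) < e" by blast
      qed
    qed auto
    then have Q: "(\<lambda>n. (1 / s n) * integral {0..T} (q n)) \<longlonglongrightarrow> 0" by simp
    define \<Delta> where "\<Delta> i t = P t (F t (z t) (snd i) - F t (z t) (u t))" for i :: "real \<times> 'y" and t
    define L where "L n = (1 / s n) *\<^sub>R (ya (b n) T - z T - (\<Sum>i\<in>N. b n i *\<^sub>R needle_effect i))" for n
    have bnd: "eventually (\<lambda>n. norm (L n) \<le> KP * ((1 / s n) * integral {0..T} (q n)) + (KP * (M * K + BA * K) * s n + e)) sequentially"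
      if e: "0 < e" for e
    proof -
      \<comment> \<open>A needle occupies times to the right of \<open>fst i\<close>, so
        right-continuity of the normalised control u suffices to replace the moving effect
        \<open>\<Delta>\<close> by its value at the needle time.\<close>
      have "\<exists>\<delta>>0. \<forall>t. fst i \<le> t \<and> t < fst i + \<delta> \<longrightarrow> norm (\<Delta> i t - needle_effect i) \<le> e" if i: "i \<in> N" for i
      proof -
        have i': "fst i \<in> {0..<T}" "snd i \<in> U" using i N(2) by auto
        have cs: "pcw T U (\<lambda>_. snd i)" "rcont T (\<lambda>_. snd i)"
          using continuous_pcw[of "\<lambda>_. snd i" U] i' by auto
        have zW: "z ` {0..T} \<subseteq> \<Omega>" using z_in by auto
        have "rcont T (\<lambda>t. F t (z t) (snd i) - F t (z t) (u t))"
          by (rule pcw_map2(2)[OF F_along_pcw(1)[OF z_cont zW cs(1)] F_along_pcw(1)[OF z_cont zW u_pcw]])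
            (auto intro!: continuous_intros F_along_pcw(2) z_cont zW cs u_pcw u_rcont)
        then have "((\<lambda>t. F t (z t) (snd i) - F t (z t) (u t)) \<longlongrightarrow> F (fst i) (z (fst i)) (snd i) - F (fst i) (z (fst i)) (u (fst i))) (at_right (fst i))"
          using i' by (auto simp: rcont_def)
        moreover have "(P \<longlongrightarrow> P (fst i)) (at_right (fst i))"
          using continuous_pcw(2)[OF P_cont, of UNIV] i' by (auto simp: rcont_def)
        ultimately have "(\<Delta> i \<longlongrightarrow> needle_effect i) (at_right (fst i))"
          unfolding \<Delta>_def needle_effect_def by (intro bounded_bilinear.tendsto[OF bounded_bilinear_blinfun_apply])
        then have "eventually (\<lambda>t. dist (\<Delta> i t) (needle_effect i) < e) (at_right (fst i))" using e by (rule tendstoD)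
        then obtain t1 where t1: "t1 > fst i" "\<And>t. fst i < t \<Longrightarrow> t < t1 \<Longrightarrow> dist (\<Delta> i t) (needle_effect i) < e"
          unfolding eventually_at_right_field by blast
        have "\<Delta> i (fst i) = needle_effect i" by (simp add: \<Delta>_def needle_effect_def)
        then have "norm (\<Delta> i t - needle_effect i) \<le> e" if "fst i \<le> t" "t < t1" for t
          using t1(2)[of t] that e by (cases "t = fst i") (auto simp: dist_norm)
        then show ?thesis using t1(1) by (intro exI[of _ "t1 - fst i"]) auto
      qed
      then obtain \<delta>f where \<delta>f: "\<And>i. i \<in> N \<Longrightarrow> 0 < \<delta>f i"
        "\<And>i t. i \<in> N \<Longrightarrow> fst i \<le> t \<Longrightarrow> t < fst i + \<delta>f i \<Longrightarrow> norm (\<Delta> i t - needle_effect i) \<le> e" by metis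
      have "eventually (\<lambda>n. \<forall>i\<in>N. s n < \<delta>f i) sequentially"
        using order_tendstoD(2)[OF s(2)] \<delta>f(1) N(1) by (simp add: eventually_ball_finite)
      then show ?thesis
      proof eventually_elim
        case (elim n)
        define I where "I i t \<longleftrightarrow> c (b n) i \<le> t \<and> t < d (b n) i" for i t
        define \<epsilon> where "\<epsilon> = KP * (M * K + BA * K) * s n + e"
        define \<beta> where "\<beta> t = KP * q n t + (\<Sum>i\<in>N. \<epsilon> * (if I i t then 1 else 0))" for t
        \<comment> \<open>The transported deviation minus the effects of the needles already passed.
          The terms with the linearised coefficient cancel in its derivative, and its increment over
          [0,T] is exactly the error of the expansion.\<close>
        define Y where "Y t = P t (ya (b n) t - z t) - (\<Sum>i\<in>N. ramp (c (b n) i) (d (b n) i) t *\<^sub>R needle_effect i)" for t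
        define k where "k t = P t (F t (ya (b n) t) (wa (b n) t) - F t (z t) (u t)) + (- (P t o\<^sub>L A t (u t))) (ya (b n) t - z t)
           - (\<Sum>i\<in>N. (if I i t then 1 else 0) *\<^sub>R needle_effect i)" for t
        have cdn: "0 \<le> c (b n) i" "c (b n) i \<le> d (b n) i" "d (b n) i \<le> T" if "i \<in> N" for i
          using cd[OF b that] dT[OF b that] less_imp_le by blast+
        obtain S where S: "finite S" "\<forall>t\<in>{0<..<T} - S. (ya (b n) has_vector_derivative F t (ya (b n) t) (wa (b n) t)) (at t)"
          using yd[OF b[of n]] by (elim exE conjE)
        define E where "E = S \<union> Sz \<union> SP \<union> (c (b n) ` N \<union> d (b n) ` N)"
        have E: "finite E" using S Sz SP N by (simp add: E_def)
        have \<beta>_has: "(\<beta> has_integral (KP * integral {0..T} (q n) + (\<Sum>i\<in>N. \<epsilon> * (d (b n) i - c (b n) i)))) {0..T}"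
          unfolding \<beta>_def I_def
          by (intro has_integral_add has_integral_mult_right has_integral_sum N(1) ramp(5) cdn integrable_integral q_int)
        have "norm (Y T - Y 0) \<le> integral {0..T} \<beta>"
        proof (rule norm_increment_le[OF E, where k = k and S' = E])
          have "continuous_on {0..T} (\<lambda>t. P t (ya (b n) t - z t))"
            by (intro bounded_bilinear.continuous_on[OF bounded_bilinear_blinfun_apply] P_cont continuous_intros yc[OF b] z_cont)
          moreover have "continuous_on {0..T} (\<lambda>t. \<Sum>i\<in>N. ramp (c (b n) i) (d (b n) i) t *\<^sub>R needle_effect i)"
            by (intro continuous_intros ramp(1) cdn)
          ultimately show "continuous_on {0..T} Y" unfolding Y_def by (rule continuous_on_diff)
          fix t assume t: "t \<in> {0<..<T} - E"
          have "((\<lambda>t. P t (ya (b n) t - z t)) has_vector_derivative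
              P t (F t (ya (b n) t) (wa (b n) t) - F t (z t) (u t)) + (- (P t o\<^sub>L A t (u t))) (ya (b n) t - z t)) (at t)"
            by (intro bounded_bilinear.has_vector_derivative[OF bounded_bilinear_blinfun_apply] P_deriv has_vector_derivative_diff)
              (use t S Sz in \<open>auto simp: E_def\<close>)
          moreover have "((\<lambda>t. \<Sum>i\<in>N. ramp (c (b n) i) (d (b n) i) t *\<^sub>R needle_effect i) has_vector_derivative
              (\<Sum>i\<in>N. (if I i t then 1 else 0) *\<^sub>R needle_effect i)) (at t)"
          proof (rule has_vector_derivative_sum)
            fix i assume i: "i \<in> N"
            have "(ramp (c (b n) i) (d (b n) i) has_vector_derivative (if I i t then 1 else 0)) (at t)"
              unfolding I_def by (rule ramp(4)[OF cdn[OF i]]) (use t i in \<open>auto simp: E_def\<close>)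
            from has_vector_derivative_scaleR[OF this[folded has_real_derivative_iff_has_vector_derivative]
                has_vector_derivative_const[of "needle_effect i"]]
            show "((\<lambda>t. ramp (c (b n) i) (d (b n) i) t *\<^sub>R needle_effect i) has_vector_derivative (if I i t then 1 else 0) *\<^sub>R needle_effect i) (at t)"
              by (cases "I i t") simp_all
          qed
          ultimately show "(Y has_vector_derivative k t) (at t)" unfolding Y_def k_def by (rule has_vector_derivative_diff)
        next
          show "\<beta> integrable_on {0..T}" using \<beta>_has by blast
          fix t assume "t \<in> {0<..<T} - E"
          then have t: "t \<in> {0..T}" by auto
          have \<epsilon>0: "0 \<le> \<epsilon>" unfolding \<epsilon>_def using KP r K BA s(1)[of n] e by simp
          show "norm (k t) \<le> \<beta> t"
          proof (cases "\<exists>i\<in>N. I i t")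
            case False
            then have "wa (b n) t = u t" using w(5)[OF b, of _ t] by (auto simp: I_def)
            then have k_eq: "k t = P t (F t (ya (b n) t) (u t) - F t (z t) (u t) - A t (u t) (ya (b n) t - z t))"
              using False by (simp add: k_def blinfun.minus_left blinfun.diff_right)
            have "norm (k t) \<le> KP * q n t" unfolding k_eq q_def
              by (rule order_trans[OF norm_blinfun mult_right_mono[OF KP(2)[OF t] norm_ge_zero]])
            then show ?thesis using False by (simp add: \<beta>_def)
          next
            case True
            then obtain i where i: "i \<in> N" "I i t" by blast
            \<comment> \<open>The intervals are disjoint, so exactly one summand is active and both
              sums collapse.\<close>
            have I_iff: "I j t \<longleftrightarrow> j = i" if "j \<in> N" for j
              using disj[OF b that i(1), of n t] i by (auto simp: I_def)
            have wi: "wa (b n) t = snd i" using w(4)[OF b i(1)] i(2) by (simp add: I_def)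
            have sum1: "(\<Sum>j\<in>N. (if I j t then 1 else 0) *\<^sub>R needle_effect j) = needle_effect i"
              using i N(1) I_iff by (subst sum.cong[OF refl, of N _ "\<lambda>j. if i = j then needle_effect j else 0"]) auto
            have "(\<Sum>j\<in>N. \<epsilon> * (if I j t then 1 else 0)) = \<epsilon>"
              using i N(1) I_iff by (subst sum.cong[OF refl, of N _ "\<lambda>j. if i = j then \<epsilon> else 0"]) auto
            then have \<beta>t: "\<epsilon> \<le> \<beta> t" unfolding \<beta>_def using KP by (simp add: q_def)
            \<comment> \<open>On a needle the crude Lipschitz bound of order \<open>s n\<close> is
              enough: the needles have total length \<open>s n\<close>, so this error contributes
              only to second order.\<close>
            have k_eq: "k t = P t (F t (ya (b n) t) (snd i) - F t (z t) (snd i) - A t (u t) (ya (b n) t - z t)) + (\<Delta> i t - needle_effect i)"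
              unfolding k_def sum1 wi \<Delta>_def by (simp add: blinfun.minus_left blinfun.diff_right)
            have "norm (P t (F t (ya (b n) t) (snd i) - F t (z t) (snd i) - A t (u t) (ya (b n) t - z t))) \<le> KP * (M * (K * s n) + BA * (K * s n))"
              by (rule order_trans[OF norm_blinfun mult_mono[OF KP(2)[OF t]
                   order_trans[OF norm_triangle_ineq4 add_mono[OF lipz[OF t C(4)[OF i(1)]] Abound[OF t]]]]])
                (use KP in auto)
            moreover have "norm (\<Delta> i t - needle_effect i) \<le> e"
              by (rule \<delta>f(2)[OF i(1)]) (use i(2) cd[OF b i(1), of n] elim i(1) in \<open>auto simp: I_def s_def\<close>)
            ultimately have "norm (k t) \<le> \<epsilon>"
              unfolding k_eq \<epsilon>_def by (intro order_trans[OF norm_triangle_ineq add_mono]) (auto simp: algebra_simps)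
            then show ?thesis using \<beta>t by simp
          qed
        qed (use T_pos E in auto)
        moreover have "integral {0..T} \<beta> = KP * integral {0..T} (q n) + \<epsilon> * s n"
          using integral_unique[OF \<beta>_has] by (simp add: d_def s_def sum_distrib_left)
        moreover have "Y T - Y 0 = ya (b n) T - z T - (\<Sum>i\<in>N. b n i *\<^sub>R needle_effect i)"
        proof -
          have "(\<Sum>i\<in>N. ramp (c (b n) i) (d (b n) i) T *\<^sub>R needle_effect i) = (\<Sum>i\<in>N. b n i *\<^sub>R needle_effect i)"
            using ramp(3)[OF cdn] by (intro sum.cong refl) (simp add: d_def)
          moreover have "(\<Sum>i\<in>N. ramp (c (b n) i) (d (b n) i) 0 *\<^sub>R needle_effect i) = 0"
            by (rule sum.neutral) (simp add: ramp(2)[OF cdn])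
          ultimately show ?thesis unfolding Y_def using y(3)[OF b, of n] P_T by (simp add: blinfun.zero_right)
        qed
        ultimately have "norm (L n) \<le> (1 / s n) * (KP * integral {0..T} (q n) + \<epsilon> * s n)"
          unfolding L_def using s(1)[of n] by (simp add: divide_right_mono)
        also have "\<dots> = KP * ((1 / s n) * integral {0..T} (q n)) + \<epsilon>"
          using s(1)[of n] by (simp add: field_simps)
        finally show ?case by (simp add: \<epsilon>_def)
      qed
    qed
    have "L \<longlonglongrightarrow> 0"
    proof (rule tendstoI)
      fix e :: real assume e: "0 < e"
      have "(\<lambda>n. KP * ((1 / s n) * integral {0..T} (q n)) + (KP * (M * K + BA * K) * s n + e / 2)) \<longlonglongrightarrow> KP * 0 + (KP * (M * K + BA * K) * 0 + e / 2)"
        by (intro tendsto_intros Q s)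
      then have "eventually (\<lambda>n. KP * ((1 / s n) * integral {0..T} (q n)) + (KP * (M * K + BA * K) * s n + e / 2) < e) sequentially"
        by (rule order_tendstoD(2)) (use e in simp)
      moreover have "eventually (\<lambda>n. norm (L n) \<le> KP * ((1 / s n) * integral {0..T} (q n)) + (KP * (M * K + BA * K) * s n + e / 2)) sequentially"
        by (rule bnd) (use e in simp)
      ultimately show "eventually (\<lambda>n. dist (L n) 0 < e) sequentially" by eventually_elim simp
    qed
    then show ?thesis unfolding L_def s_def .
  qed
  show ?thesis
  proof (rule exI[of _ \<rho>], rule conjI[OF \<rho>(1)], rule exI[of _ K], intro exI[of _ ya] exI[of _ wa] conjI allI impI)
    fix a assume "(\<forall>i\<in>N. 0 \<le> a i) \<and> sum a N < \<rho>"
    then have a: "adm a" by (simp add: adm_def)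
    show "ya a \<in> PC1 T \<Omega>" "\<forall>t\<in>{0..T}. ext_deriv T (ya a) t = F t (ya a t) (wa a t)" "ya a 0 = z 0"
      "\<forall>t\<in>{0..T}. norm (ya a t - z t) \<le> K * sum a N"
      using y[OF a] by auto
    show "wa a \<in> NPC0R T U" using w(1,2)[OF a] by (simp add: NPC0R_iff)
  next
    fix b a assume "(\<forall>i\<in>N. 0 \<le> a i) \<and> sum a N < \<rho> \<and> (\<forall>n::nat. (\<forall>i\<in>N. 0 \<le> b n i) \<and> sum (b n) N < \<rho>) \<and>
      (\<forall>i\<in>N. (\<lambda>n. b n i) \<longlonglongrightarrow> a i)"
    then show "(\<lambda>n. ya (b n) T) \<longlonglongrightarrow> ya a T" by (intro continuity) (auto simp: adm_def)
  next
    fix b assume "(\<forall>n::nat. (\<forall>i\<in>N. 0 \<le> b n i) \<and> 0 < sum (b n) N \<and> sum (b n) N < \<rho>) \<and> (\<lambda>n. sum (b n) N) \<longlonglongrightarrow> 0"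
    then show "(\<lambda>n. (1 / sum (b n) N) *\<^sub>R (ya (b n) T - z T - (\<Sum>i\<in>N. b n i *\<^sub>R needle_effect i))) \<longlonglongrightarrow> 0"
      by (intro expansion) (auto simp: adm_def)
  qed
qed

end

section \<open>Brouwer's theorem and the multiplier rule\<close>

text \<open>Bolzano-Weierstrass for families indexed by a finite set, refining the subsequence once
  for each index.\<close>

lemma finite_index_convergent_subseq:
  fixes x :: "nat \<Rightarrow> 'i \<Rightarrow> real"
  assumes "finite K" "\<And>i. i \<in> K \<Longrightarrow> \<exists>B. \<forall>n. \<bar>x n i\<bar> \<le> B"
  shows "\<exists>r l. strict_mono r \<and> (\<forall>i\<in>K. (\<lambda>n. x (r n) i) \<longlonglongrightarrow> l i)"
  using assms
proof (induction K)
  case empty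
  then show ?case by (intro exI[of _ id]) (auto simp: strict_mono_def)
next
  case (insert j K)
  then obtain r l where r: "strict_mono r" "\<And>i. i \<in> K \<Longrightarrow> (\<lambda>n. x (r n) i) \<longlonglongrightarrow> l i" by blast
  obtain B where "\<forall>n. \<bar>x n j\<bar> \<le> B" using insert.prems by blast
  then have "bounded (range (\<lambda>n. x (r n) j))" by (auto simp: bounded_iff)
  then obtain c r' where r': "strict_mono r'" "((\<lambda>n. x (r n) j) \<circ> r') \<longlonglongrightarrow> c"
    using bounded_imp_convergent_subsequence by blast
  have "(\<lambda>n. x ((r \<circ> r') n) i) \<longlonglongrightarrow> (l(j := c)) i" if "i \<in> insert j K" for i
  proof (cases "i = j")
    case True
    then show ?thesis using r'(2) by (simp add: o_def)
  next
    case False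
    then have "i \<in> K" using that by simp
    from LIMSEQ_subseq_LIMSEQ[OF r(2)[OF this] r'(1)] show ?thesis using False by (simp add: o_def)
  qed
  then show ?case using strict_mono_o[OF r(1) r'(1)] by blast
qed

text \<open>Brouwer's theorem for a cube whose dimension is a variable, since the number of equality
  constraints is one. Points are sequences of which only the first n entries count, and continuity
  is sequential. Kuhn's labelling lemma on grids of mesh 1/(k+1) gives small cubes carrying both
  labels in every coordinate, and these accumulate at a fixed point.\<close>

lemma brouwer_cube_nat:
  fixes G :: "(nat \<Rightarrow> real) \<Rightarrow> nat \<Rightarrow> real"
  assumes into: "\<And>x i. (\<And>j. j < n \<Longrightarrow> 0 \<le> x j \<and> x j \<le> 1) \<Longrightarrow> i < n \<Longrightarrow> 0 \<le> G x i \<and> G x i \<le> 1"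
    and cont: "\<And>x l i. (\<And>k j. j < n \<Longrightarrow> 0 \<le> x k j \<and> x k j \<le> 1) \<Longrightarrow> (\<And>j. j < n \<Longrightarrow> 0 \<le> l j \<and> l j \<le> 1) \<Longrightarrow>
       (\<And>j. j < n \<Longrightarrow> (\<lambda>k. x k j) \<longlonglongrightarrow> l j) \<Longrightarrow> i < n \<Longrightarrow> (\<lambda>k::nat. G (x k) i) \<longlonglongrightarrow> G l i"
  shows "\<exists>x. (\<forall>j<n. 0 \<le> x j \<and> x j \<le> 1) \<and> (\<forall>j<n. G x j = x j)"
proof -
  define pt where "pt p x = (\<lambda>j. real (x j) / real p)" for p :: nat and x :: "nat \<Rightarrow> nat"
  \<comment> \<open>Label 1 means that G moves the coordinate down. On the lower face the label is
    forced to 0 and on the upper face to 1, as Kuhn's lemma requires.\<close>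
  define lab where "lab p x i = (if x i = p \<or> (x i \<noteq> 0 \<and> G (pt p x) i < pt p x i) then 1 else 0 :: nat)" for p x i
  define kuhn where "kuhn k q \<longleftrightarrow> (\<forall>i<n. q i < Suc k) \<and> (\<forall>i<n. \<exists>r s. (\<forall>j<n. q j \<le> r j \<and> r j \<le> q j + 1) \<and>
      (\<forall>j<n. q j \<le> s j \<and> s j \<le> q j + 1) \<and> lab (Suc k) r i \<noteq> lab (Suc k) s i)" for k q
  have "\<exists>q. (\<forall>i<n. q i < p) \<and> (\<forall>i<n. \<exists>r s. (\<forall>j<n. q j \<le> r j \<and> r j \<le> q j + 1) \<and>
      (\<forall>j<n. q j \<le> s j \<and> s j \<le> q j + 1) \<and> lab p r i \<noteq> lab p s i)" if p: "0 < p" for p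
  proof -
    have "\<forall>x. (\<forall>i<n. x i \<le> p) \<longrightarrow> (\<forall>i<n. lab p x i = 0 \<or> lab p x i = 1)"
      "\<forall>x. (\<forall>i<n. x i \<le> p) \<longrightarrow> (\<forall>i<n. x i = 0 \<longrightarrow> lab p x i = 0)"
      "\<forall>x. (\<forall>i<n. x i \<le> p) \<longrightarrow> (\<forall>i<n. x i = p \<longrightarrow> lab p x i = 1)"
      using p by (auto simp: lab_def)
    from kuhn_lemma[OF p this] show ?thesis by metis
  qed
  then have "\<exists>q. kuhn k q" for k unfolding kuhn_def by simp
  then obtain q where "\<And>k. kuhn k (q k)" by metis
  then have q: "\<And>k i. i < n \<Longrightarrow> q k i < Suc k"
    "\<And>k i. i < n \<Longrightarrow> \<exists>r s. (\<forall>j<n. q k j \<le> r j \<and> r j \<le> q k j + 1) \<and>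
      (\<forall>j<n. q k j \<le> s j \<and> s j \<le> q k j + 1) \<and> lab (Suc k) r i \<noteq> lab (Suc k) s i"
    unfolding kuhn_def by blast+
  define ok where "ok k i r s \<longleftrightarrow> (\<forall>j<n. q k j \<le> r j \<and> r j \<le> q k j + 1) \<and> (\<forall>j<n. q k j \<le> s j \<and> s j \<le> q k j + 1) \<and>
      lab (Suc k) r i = 0 \<and> lab (Suc k) s i = 1" for k i r s
  have "\<exists>y. i < n \<longrightarrow> ok k i (fst y) (snd y)" for k i
  proof (cases "i < n")
    case True
    obtain r s where rs: "\<forall>j<n. q k j \<le> r j \<and> r j \<le> q k j + 1" "\<forall>j<n. q k j \<le> s j \<and> s j \<le> q k j + 1"
        "lab (Suc k) r i \<noteq> lab (Suc k) s i" using q(2)[OF True, of k] by (elim exE conjE)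
    have "lab (Suc k) x i = 0 \<or> lab (Suc k) x i = 1" for x by (simp add: lab_def)
    from this[of r] this[of s] rs(3) have "lab (Suc k) r i = 0 \<and> lab (Suc k) s i = 1 \<or> lab (Suc k) s i = 0 \<and> lab (Suc k) r i = 1"
      by auto
    then have "ok k i r s \<or> ok k i s r" using rs(1,2) unfolding ok_def by blast
    then show ?thesis by (metis fst_conv snd_conv)
  qed auto
  then have y: "\<exists>y. ok k i (fst y) (snd y)" if "i < n" for k i using that by simp
  define r s where "r k i = fst (SOME y. ok k i (fst y) (snd y))" and "s k i = snd (SOME y. ok k i (fst y) (snd y))" for k i
  have ok: "ok k i (r k i) (s k i)" if "i < n" for k i
    using someI_ex[OF y[OF that, of k]] by (simp add: r_def s_def)
  have rs: "\<And>k i j. i < n \<Longrightarrow> j < n \<Longrightarrow> q k j \<le> r k i j \<and> r k i j \<le> q k j + 1"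
    "\<And>k i j. i < n \<Longrightarrow> j < n \<Longrightarrow> q k j \<le> s k i j \<and> s k i j \<le> q k j + 1"
    "\<And>k i. i < n \<Longrightarrow> lab (Suc k) (r k i) i = 0" "\<And>k i. i < n \<Longrightarrow> lab (Suc k) (s k i) i = 1"
    using ok unfolding ok_def by blast+
  \<comment> \<open>The lower corners of the selected cubes. All vertices of a cube differ from its
    corner by at most one mesh width, so the vertices for both labels converge to the same
    limit.\<close>
  define X where "X k = pt (Suc k) (q k)" for k
  have X01: "0 \<le> X k j \<and> X k j \<le> 1" if "j < n" for k j
    using q(1)[OF that, of k] by (simp add: X_def pt_def)
  have "\<exists>\<sigma> l. strict_mono \<sigma> \<and> (\<forall>j\<in>{..<n}. (\<lambda>k. X (\<sigma> k) j) \<longlonglongrightarrow> l j)"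
    by (rule finite_index_convergent_subseq) (use X01 in \<open>auto intro!: exI[of _ 1]\<close>)
  then obtain \<sigma> l where \<sigma>: "strict_mono \<sigma>" "\<And>j. j < n \<Longrightarrow> (\<lambda>k. X (\<sigma> k) j) \<longlonglongrightarrow> l j" by auto
  have l01: "0 \<le> l j \<and> l j \<le> 1" if "j < n" for j
    using X01[OF that] \<sigma>(2)[OF that] by (auto intro: LIMSEQ_le_const LIMSEQ_le_const2)
  have near: "0 \<le> pt (Suc k) y j \<and> pt (Suc k) y j \<le> 1 \<and> \<bar>pt (Suc k) y j - X k j\<bar> \<le> 1 / real (Suc k)"
    if "j < n" "q k j \<le> y j \<and> y j \<le> q k j + 1" for k y j
  proof -
    have "y j \<le> Suc k" using that q(1)[OF that(1), of k] by simp
    moreover have "pt (Suc k) y j - X k j = (real (y j) - real (q k j)) / real (Suc k)"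
      by (simp add: X_def pt_def diff_divide_distrib)
    moreover have "\<bar>real (y j) - real (q k j)\<bar> \<le> 1" using that by auto
    ultimately show ?thesis by (auto simp: pt_def abs_divide divide_right_mono)
  qed
  have lim: "(\<lambda>k. pt (Suc (\<sigma> k)) (y (\<sigma> k)) j) \<longlonglongrightarrow> l j"
    if "j < n" "\<And>k. q k j \<le> y k j \<and> y k j \<le> q k j + 1" for y j
  proof -
    have "(\<lambda>k. 1 / real (Suc (\<sigma> k))) \<longlonglongrightarrow> 0"
      using LIMSEQ_subseq_LIMSEQ[OF LIMSEQ_inverse_real_of_nat \<sigma>(1)] by (simp add: o_def inverse_eq_divide)
    then have "(\<lambda>k. pt (Suc (\<sigma> k)) (y (\<sigma> k)) j - X (\<sigma> k) j) \<longlonglongrightarrow> 0"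
      by (rule Lim_null_comparison[rotated]) (use near[OF that(1), of "\<sigma> _" "y (\<sigma> _)"] that(2) in \<open>auto intro!: always_eventually\<close>)
    from tendsto_add[OF this \<sigma>(2)[OF that(1)]] show ?thesis by simp
  qed
  have "G l i = l i" if i: "i < n" for i
  proof (rule antisym)
    have R: "(\<lambda>k. G (pt (Suc (\<sigma> k)) (r (\<sigma> k) i)) i) \<longlonglongrightarrow> G l i"
      by (rule cont[OF _ l01 lim[where y = "\<lambda>k. r k i"] i]) (use near rs(1)[OF i] in auto)
    have S: "(\<lambda>k. G (pt (Suc (\<sigma> k)) (s (\<sigma> k) i)) i) \<longlonglongrightarrow> G l i"
      by (rule cont[OF _ l01 lim[where y = "\<lambda>k. s k i"] i]) (use near rs(2)[OF i] in auto)
    \<comment> \<open>Label 0 says that G does not decrease the coordinate, except on the lower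
      face, where the inequality holds because G maps into the cube. The vertices with label 1 give
      the reverse inequality in the same way.\<close>
    have "pt (Suc k) (r k i) i \<le> G (pt (Suc k) (r k i)) i" for k
    proof (cases "r k i i = 0")
      case True
      then show ?thesis using into[of "pt (Suc k) (r k i)" i] near rs(1)[OF i] i by (auto simp: pt_def)
    next
      case False
      then show ?thesis using rs(3)[OF i, of k] by (auto simp: lab_def split: if_splits)
    qed
    then show "l i \<le> G l i" using LIMSEQ_le[OF lim[OF i, of "\<lambda>k. r k i"] R] rs(1)[OF i i] by blast
    have "G (pt (Suc k) (s k i)) i \<le> pt (Suc k) (s k i) i" for k
    proof (cases "s k i i = Suc k")
      case True
      then show ?thesis using into[of "pt (Suc k) (s k i)" i] near rs(2)[OF i] i by (auto simp: pt_def)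
    next
      case False
      then show ?thesis using rs(4)[OF i, of k] by (auto simp: lab_def split: if_splits)
    qed
    then show "G l i \<le> l i" using LIMSEQ_le[OF S lim[OF i, of "\<lambda>k. s k i"]] rs(2)[OF i i] by blast
  qed
  then show ?thesis using l01 by blast
qed

text \<open>A functional separating a point from a cone is the limit of the differences between the point and
  a minimizing sequence in the cone.\<close>

lemma cone_functional_or_dense:
  fixes K :: "('i \<Rightarrow> real) set"
  assumes J: "finite J" and zero: "(\<lambda>_. 0) \<in> K"
    and add: "\<And>x y. x \<in> K \<Longrightarrow> y \<in> K \<Longrightarrow> (\<lambda>j. x j + y j) \<in> K"
    and scale: "\<And>x s. x \<in> K \<Longrightarrow> 0 \<le> s \<Longrightarrow> (\<lambda>j. s * x j) \<in> K"
  shows "(\<exists>c. (\<exists>j\<in>J. c j \<noteq> 0) \<and> (\<forall>x\<in>K. (\<Sum>j\<in>J. c j * x j) \<le> 0)) \<or>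
    (\<forall>v e. 0 < e \<longrightarrow> (\<exists>x\<in>K. \<forall>j\<in>J. \<bar>x j - v j\<bar> < e))"
proof (rule disjCI)
  assume "\<not> (\<forall>v e. 0 < e \<longrightarrow> (\<exists>x\<in>K. \<forall>j\<in>J. \<bar>x j - v j\<bar> < e))"
  then obtain v e where e: "0 < e" "\<And>x. x \<in> K \<Longrightarrow> \<exists>j\<in>J. e \<le> \<bar>x j - v j\<bar>" by (meson not_less)
  \<comment> \<open>The squared Euclidean distance to the point v, taken over the coordinates in J;
    v is a point that the cone does not approach.\<close>
  define D where "D x = (\<Sum>j\<in>J. (v j - x j)\<^sup>2)" for x
  have D_low: "e\<^sup>2 \<le> D x" if x: "x \<in> K" for x
  proof -
    obtain j where j: "j \<in> J" "e \<le> \<bar>x j - v j\<bar>" using e(2)[OF x] by blast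
    have "e\<^sup>2 \<le> (v j - x j)\<^sup>2" using j(2) e(1) by (metis abs_minus_commute abs_le_square_iff abs_of_pos)
    also have "\<dots> \<le> D x" unfolding D_def by (rule member_le_sum) (use j J in auto)
    finally show ?thesis .
  qed
  define m where "m = Inf (D ` K)"
  have bdd: "bdd_below (D ` K)" using D_low by (auto simp: bdd_below_def)
  have m_le: "m \<le> D x" if "x \<in> K" for x unfolding m_def by (rule cInf_lower[OF _ bdd]) (use that in simp)
  have m_pos: "0 < m"
  proof -
    have "e\<^sup>2 \<le> m" unfolding m_def by (rule cInf_greatest) (use zero D_low in auto)
    then show ?thesis using e(1) by (meson less_le_trans zero_less_power)
  qed
  have ex: "\<exists>x. x \<in> K \<and> D x < m + 1 / real (Suc n)" for n
  proof -
    have "D ` K \<noteq> {}" "Inf (D ` K) < m + 1 / real (Suc n)" using zero by (auto simp: m_def)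
    from cInf_lessD[OF this] show ?thesis by auto
  qed
  define x where "x n = (SOME x. x \<in> K \<and> D x < m + 1 / real (Suc n))" for n
  have x: "x n \<in> K" "D (x n) < m + 1 / real (Suc n)" for n
    using someI_ex[OF ex[of n]] by (auto simp: x_def)
  have Dlim: "(\<lambda>n. D (x n)) \<longlonglongrightarrow> m"
  proof (rule tendsto_sandwich[OF always_eventually always_eventually tendsto_const])
    show "\<forall>n. m \<le> D (x n)" using m_le x by blast
    show "\<forall>n. D (x n) \<le> m + 1 / real (Suc n)" using x(2) less_imp_le by blast
    show "(\<lambda>n. m + 1 / real (Suc n)) \<longlonglongrightarrow> m"
      using LIMSEQ_inverse_real_of_nat_add[of m] by (simp add: inverse_eq_divide)
  qed
  have "\<exists>B. \<forall>n. \<bar>v j - x n j\<bar> \<le> B" if "j \<in> J" for j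
  proof (intro exI allI)
    fix n
    have "(v j - x n j)\<^sup>2 \<le> D (x n)" unfolding D_def by (rule member_le_sum) (use that J in auto)
    also have "\<dots> \<le> m + 1" using x(2)[of n] by (rule less_imp_le[THEN order_trans]) simp
    also have "\<dots> \<le> (m + 1)\<^sup>2" using m_pos by (simp add: power2_eq_square)
    finally show "\<bar>v j - x n j\<bar> \<le> m + 1" using m_pos abs_le_square_iff[of "v j - x n j" "m + 1"] by simp
  qed
  then have "\<exists>r c. strict_mono r \<and> (\<forall>j\<in>J. (\<lambda>n. v j - x (r n) j) \<longlonglongrightarrow> c j)"
    by (rule finite_index_convergent_subseq[OF J, of "\<lambda>n j. v j - x n j"])
  then obtain r c where r: "strict_mono r"
    and c: "\<And>j. j \<in> J \<Longrightarrow> (\<lambda>n. v j - x (r n) j) \<longlonglongrightarrow> c j" by auto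
  have Dr: "(\<lambda>n. D (x (r n))) \<longlonglongrightarrow> m" using LIMSEQ_subseq_LIMSEQ[OF Dlim r] by (simp add: o_def)
  have "(\<lambda>n. D (x (r n))) \<longlonglongrightarrow> (\<Sum>j\<in>J. (c j)\<^sup>2)"
    unfolding D_def by (intro tendsto_sum tendsto_power c)
  then have cm: "(\<Sum>j\<in>J. (c j)\<^sup>2) = m" using Dr LIMSEQ_unique by blast
  have "\<exists>j\<in>J. c j \<noteq> 0"
  proof (rule ccontr)
    assume "\<not> ?thesis"
    then have "(\<Sum>j\<in>J. (c j)\<^sup>2) = 0" by simp
    then show False using cm m_pos by simp
  qed
  moreover have "(\<Sum>j\<in>J. c j * y j) \<le> 0" if y: "y \<in> K" for y
  proof (rule ccontr)
    assume "\<not> ?thesis"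
    then have pos: "0 < (\<Sum>j\<in>J. c j * y j)" (is "0 < ?p") by simp
    define Q where "Q = (\<Sum>j\<in>J. (y j)\<^sup>2)"
    have Q: "0 \<le> Q" unfolding Q_def by (intro sum_nonneg) auto
    \<comment> \<open>Moving from the minimizing sequence along s times y stays in the cone, so the
      distance cannot fall below m. In the limit 2 p \<le> s Q for the value p of the functional at
      y, which is impossible because this s makes s Q at most p.\<close>
    define s where "s = ?p / (Q + 1)"
    have s: "0 < s" unfolding s_def by (rule divide_pos_pos[OF pos]) (use Q in simp)
    have "m \<le> D (x (r n)) - 2 * s * (\<Sum>j\<in>J. (v j - x (r n) j) * y j) + s\<^sup>2 * Q" for n
    proof -
      have "m \<le> D (\<lambda>j. x (r n) j + s * y j)" by (intro m_le add scale x y) (use s in simp)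
      also have "\<dots> = D (x (r n)) - 2 * s * (\<Sum>j\<in>J. (v j - x (r n) j) * y j) + s\<^sup>2 * Q"
        unfolding D_def Q_def sum_distrib_left sum_subtractf[symmetric] sum.distrib[symmetric]
        by (rule sum.cong[OF refl]) (simp add: power2_eq_square algebra_simps)
      finally show ?thesis .
    qed
    moreover have "(\<lambda>n. D (x (r n)) - 2 * s * (\<Sum>j\<in>J. (v j - x (r n) j) * y j) + s\<^sup>2 * Q) \<longlonglongrightarrow> m - 2 * s * ?p + s\<^sup>2 * Q"
      by (intro tendsto_intros Dr c)
    ultimately have "m \<le> m - 2 * s * ?p + s\<^sup>2 * Q" by (intro LIMSEQ_le_const) auto
    then have "2 * s * ?p \<le> s\<^sup>2 * Q" by simp
    then have "2 * ?p \<le> s * Q" using s by (simp add: power2_eq_square)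
    also have "\<dots> \<le> ?p" unfolding s_def using Q pos by (simp add: field_simps)
    finally show False using pos by simp
  qed
  ultimately show "\<exists>c. (\<exists>j\<in>J. c j \<noteq> 0) \<and> (\<forall>x\<in>K. (\<Sum>j\<in>J. c j * x j) \<le> 0)" by blast
qed

lemma sum_real_mult_distrib: "(\<Sum>i\<in>N. (x * b i + y * c i) * (e i :: real)) = x * (\<Sum>i\<in>N. b i * e i) + y * (\<Sum>i\<in>N. c i * e i)"
  by (simp add: sum_distrib_left sum.distrib[symmetric] algebra_simps)

text \<open>If no multipliers exist, the cone generated by the needles and the slack directions is dense. Then
  finitely many needles reach, up to a small error, every direction $(1,\dots,1,\pm e_j)$, and Brouwer's
  theorem solves the equality constraints along nonnegative combinations of them.\<close>

lemma multiplier_rule: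
  fixes d :: "'i \<Rightarrow> nat + nat \<Rightarrow> real" and e0 :: "nat + nat \<Rightarrow> real" and m q :: nat
  defines "J \<equiv> {0..m} <+> {1..q}"
  assumes q: "1 \<le> q"
    and e0: "\<And>i. i \<in> {1..m} \<Longrightarrow> 0 \<le> e0 (Inl i)" "\<And>j. j \<in> {1..q} \<Longrightarrow> e0 (Inr j) = 0"
    and fam: "\<And>N. finite N \<Longrightarrow> N \<subseteq> I \<Longrightarrow> \<exists>\<rho>>0. \<exists>E.
      (\<forall>a. (\<forall>i\<in>N. 0 \<le> a i) \<and> sum a N < \<rho> \<longrightarrow> \<not> (e0 (Inl 0) < E a (Inl 0) \<and>
         (\<forall>i\<in>{1..m}. 0 \<le> E a (Inl i)) \<and> (\<forall>j\<in>{1..q}. E a (Inr j) = 0))) \<and>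
      (\<forall>b a. (\<forall>i\<in>N. 0 \<le> a i) \<and> sum a N < \<rho> \<and> (\<forall>n::nat. (\<forall>i\<in>N. 0 \<le> b n i) \<and> sum (b n) N < \<rho>) \<and>
         (\<forall>i\<in>N. (\<lambda>n. b n i) \<longlonglongrightarrow> a i) \<longrightarrow> (\<forall>j\<in>{1..q}. (\<lambda>n. E (b n) (Inr j)) \<longlonglongrightarrow> E a (Inr j))) \<and>
      (\<forall>b. (\<forall>n::nat. (\<forall>i\<in>N. 0 \<le> b n i) \<and> 0 < sum (b n) N \<and> sum (b n) N < \<rho>) \<and> (\<lambda>n. sum (b n) N) \<longlonglongrightarrow> 0 \<longrightarrow>
         (\<forall>k\<in>J. (\<lambda>n. (E (b n) k - e0 k - (\<Sum>i\<in>N. b n i * d i k)) / sum (b n) N) \<longlonglongrightarrow> 0))"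
  shows "\<exists>c. (\<exists>k\<in>J. c k \<noteq> 0) \<and> (\<forall>i\<in>{0..m}. 0 \<le> c (Inl i)) \<and> (\<forall>i\<in>{1..m}. c (Inl i) * e0 (Inl i) = 0) \<and>
     (\<forall>i\<in>I. (\<Sum>k\<in>J. c k * d i k) \<le> 0)"
proof -
  have J: "finite J" by (simp add: J_def)
  \<comment> \<open>Slack may be given away in the cost and in active constraints, has a free sign
    in inactive constraints, and is absent from equalities. Subtracting it makes the cone large
    enough for the separating functional to acquire the right signs and complementary
    slackness.\<close>
  define Sl where "Sl = {s :: nat + nat \<Rightarrow> real. (\<forall>j. s (Inr j) = 0) \<and>
     (\<forall>i\<le>m. i = 0 \<or> e0 (Inl i) = 0 \<longrightarrow> 0 \<le> s (Inl i))}"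
  define K where "K = {x. \<exists>N b s. finite N \<and> N \<subseteq> I \<and> (\<forall>i. 0 \<le> b i) \<and> (\<forall>i. i \<notin> N \<longrightarrow> b i = 0) \<and> s \<in> Sl \<and>
     x = (\<lambda>k. (\<Sum>i\<in>N. b i * d i k) - s k)}"
  have K_I: "(\<lambda>k. (\<Sum>i\<in>N. b i * d i k) - s k) \<in> K"
    if "finite N" "N \<subseteq> I" "\<And>i. 0 \<le> b i" "\<And>i. i \<notin> N \<Longrightarrow> b i = 0" "s \<in> Sl" for N b s
    unfolding K_def using that by blast
  have K_E: "\<exists>N b s. finite N \<and> N \<subseteq> I \<and> (\<forall>i. 0 \<le> b i) \<and> (\<forall>i. i \<notin> N \<longrightarrow> b i = 0) \<and> s \<in> Sl \<and>
     x = (\<lambda>k. (\<Sum>i\<in>N. b i * d i k) - s k)" if "x \<in> K" for x using that unfolding K_def by blast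
  have extend: "(\<Sum>i\<in>N. b i * d i k) = (\<Sum>i\<in>N'. b i * d i k)"
    if "finite N'" "N \<subseteq> N'" "\<forall>i. i \<notin> N \<longrightarrow> b i = 0" for N N' :: "'i set" and b k
    by (rule sum.mono_neutral_left) (use that in auto)
  have zeroK: "(\<lambda>_. 0) \<in> K" using K_I[of "{}" "\<lambda>_. 0" "\<lambda>_. 0"] by (simp add: Sl_def)
  have addK: "(\<lambda>k. x k + y k) \<in> K" if xy: "x \<in> K" "y \<in> K" for x y
  proof -
    obtain N b s where x: "finite N" "N \<subseteq> I" "\<forall>i. 0 \<le> b i" "\<forall>i. i \<notin> N \<longrightarrow> b i = 0" "s \<in> Sl"
      "x = (\<lambda>k. (\<Sum>i\<in>N. b i * d i k) - s k)" using K_E[OF xy(1)] by (elim exE conjE)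
    obtain N' b' s' where y: "finite N'" "N' \<subseteq> I" "\<forall>i. 0 \<le> b' i" "\<forall>i. i \<notin> N' \<longrightarrow> b' i = 0" "s' \<in> Sl"
      "y = (\<lambda>k. (\<Sum>i\<in>N'. b' i * d i k) - s' k)" using K_E[OF xy(2)] by (elim exE conjE)
    have "(\<lambda>k. x k + y k) = (\<lambda>k. (\<Sum>i\<in>N \<union> N'. (b i + b' i) * d i k) - (s k + s' k))"
    proof
      fix k
      show "x k + y k = (\<Sum>i\<in>N \<union> N'. (b i + b' i) * d i k) - (s k + s' k)"
      using extend[of "N \<union> N'" N b k] extend[of "N \<union> N'" N' b' k] x y
      by (simp add: sum.distrib algebra_simps)
    qed
    moreover have "(\<lambda>k. s k + s' k) \<in> Sl" using x y by (simp add: Sl_def)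
    ultimately show ?thesis
      using K_I[of "N \<union> N'" "\<lambda>i. b i + b' i" "\<lambda>k. s k + s' k"] x y by simp
  qed
  have scaleK: "(\<lambda>k. t * x k) \<in> K" if x: "x \<in> K" and t: "0 \<le> t" for x t
  proof -
    obtain N b s where x: "finite N" "N \<subseteq> I" "\<forall>i. 0 \<le> b i" "\<forall>i. i \<notin> N \<longrightarrow> b i = 0" "s \<in> Sl"
      "x = (\<lambda>k. (\<Sum>i\<in>N. b i * d i k) - s k)" using K_E[OF x] by (elim exE conjE)
    have "(\<lambda>k. t * s k) \<in> Sl" using x t by (simp add: Sl_def)
    then show ?thesis
      using K_I[of N "\<lambda>i. t * b i" "\<lambda>k. t * s k"] x t by (simp add: sum_distrib_left algebra_simps)
  qed
  show ?thesis
  proof (rule disjE[OF cone_functional_or_dense[OF J zeroK addK scaleK]])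
    assume "\<exists>c. (\<exists>j\<in>J. c j \<noteq> 0) \<and> (\<forall>x\<in>K. (\<Sum>j\<in>J. c j * x j) \<le> 0)"
    then obtain c where c: "\<exists>j\<in>J. c j \<noteq> 0" "\<forall>x\<in>K. (\<Sum>j\<in>J. c j * x j) \<le> 0" by (elim exE conjE)
    note c = c(1) c(2)[rule_format]
    have unit: "(\<Sum>j\<in>J. c j * (if j = k then t else 0)) = c k * t" if "k \<in> J" for k t
      using that J by (subst sum.cong[OF refl, of J _ "\<lambda>j. if k = j then c j * t else 0"]) auto
    \<comment> \<open>The functional is tested on one slack coordinate: a nonnegative amount gives
      the sign of its coefficient, amounts of both signs at an inactive constraint force the
      coefficient to vanish.\<close>
    have slack: "- (c (Inl i) * t) \<le> 0" if i: "i \<in> {0..m}" and t: "0 \<le> t \<or> (i \<noteq> 0 \<and> e0 (Inl i) \<noteq> 0)" for i t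
    proof -
      have "(\<lambda>k. if k = Inl i then t else 0) \<in> Sl" using t by (auto simp: Sl_def)
      from c(2)[OF K_I[of "{}" "\<lambda>_. 0", OF _ _ _ _ this]]
      have "(\<Sum>k\<in>J. c k * (if k = Inl i then - t else 0)) \<le> 0" by (simp add: if_distrib cong: if_cong)
      moreover have "Inl i \<in> J" using i by (auto simp: J_def)
      ultimately show ?thesis using unit[of "Inl i" "- t"] by simp
    qed
    have "0 \<le> c (Inl i)" if "i \<in> {0..m}" for i using slack[OF that, of 1] by simp
    moreover have "c (Inl i) * e0 (Inl i) = 0" if "i \<in> {1..m}" for i
      using slack[of i "-1"] slack[of i 1] that by auto
    moreover have "(\<Sum>k\<in>J. c k * d i k) \<le> 0" if "i \<in> I" for i
      using c(2)[OF K_I[of "{i}" "\<lambda>j. if j = i then 1 else 0" "\<lambda>_. 0"]] that by (simp add: Sl_def)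
    ultimately show ?thesis using c(1) by blast
  next
    assume "\<forall>v e. 0 < e \<longrightarrow> (\<exists>x\<in>K. \<forall>j\<in>J. \<bar>x j - v j\<bar> < e)"
    note dense = this[rule_format]
    \<comment> \<open>Each of the q packages contributes an error of at most
      \<open>\<epsilon>\<close> to an equality constraint; together they must not exceed
      1/8.\<close>
    define \<epsilon> where "\<epsilon> = 1 / (8 * real q)"
    have \<epsilon>: "0 < \<epsilon>" "real q * \<epsilon> = 1 / 8" "\<epsilon> \<le> 1 / 8" using q by (auto simp: \<epsilon>_def field_simps)
    \<comment> \<open>The target directions: gain 1 in the cost and in all inequalities, and +1 or
      -1 in a single equality. The index j starts at 0 while the equalities are numbered from 1,
      hence \<open>Suc j\<close>.\<close>
    define v where "v \<sigma> j k = (case k of Inl _ \<Rightarrow> 1 | Inr j' \<Rightarrow> if j' = Suc j then \<sigma> else 0)" for \<sigma> :: real and j :: nat and k :: "nat + nat"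
    define okN where "okN \<sigma> j = (\<lambda>(N, b, s). finite N \<and> N \<subseteq> I \<and> (\<forall>i. 0 \<le> b i) \<and> (\<forall>i. i \<notin> N \<longrightarrow> b i = 0) \<and> s \<in> Sl \<and>
       (\<forall>k\<in>J. \<bar>(\<Sum>i\<in>N. b i * d i k) - s k - v \<sigma> j k\<bar> < \<epsilon>))" for \<sigma> j
    have okN: "\<exists>p. okN \<sigma> j p" for \<sigma> j
    proof -
      obtain x where x: "x \<in> K" "\<forall>k\<in>J. \<bar>x k - v \<sigma> j k\<bar> < \<epsilon>" using dense[OF \<epsilon>(1), of "v \<sigma> j"] by (elim bexE)
      from K_E[OF x(1)] obtain N b s where "finite N" "N \<subseteq> I" "\<forall>i. 0 \<le> b i" "\<forall>i. i \<notin> N \<longrightarrow> b i = 0" "s \<in> Sl"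
        "x = (\<lambda>k. (\<Sum>i\<in>N. b i * d i k) - s k)" by (elim exE conjE)
      then show ?thesis using x(2) unfolding okN_def by (intro exI[of _ "(N, b, s)"]) simp
    qed
    define pp where "pp \<sigma> j = (SOME p. okN \<sigma> j p)" for \<sigma> j
    define NN b s where "NN \<sigma> j = fst (pp \<sigma> j)" and "b \<sigma> j = fst (snd (pp \<sigma> j))" and "s \<sigma> j = snd (snd (pp \<sigma> j))" for \<sigma> j
    have "okN \<sigma> j (NN \<sigma> j, b \<sigma> j, s \<sigma> j)" for \<sigma> j
      using someI_ex[OF okN[of \<sigma> j]] by (simp add: NN_def b_def s_def pp_def)
    then have NN: "\<And>\<sigma> j. finite (NN \<sigma> j)" "\<And>\<sigma> j. NN \<sigma> j \<subseteq> I"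
      and b: "\<And>\<sigma> j i. 0 \<le> b \<sigma> j i" "\<And>\<sigma> j i. i \<notin> NN \<sigma> j \<Longrightarrow> b \<sigma> j i = 0" and s: "\<And>\<sigma> j. s \<sigma> j \<in> Sl"
      and close: "\<And>\<sigma> j k. k \<in> J \<Longrightarrow> \<bar>(\<Sum>i\<in>NN \<sigma> j. b \<sigma> j i * d i k) - s \<sigma> j k - v \<sigma> j k\<bar> < \<epsilon>"
      by (auto simp: okN_def)
    define N where "N = (\<Union>j<q. NN 1 j \<union> NN (-1) j)"
    have N: "finite N" "N \<subseteq> I" unfolding N_def using NN by blast+
    define w where "w \<sigma> j k = (\<Sum>i\<in>N. b \<sigma> j i * d i k)" for \<sigma> j k
    have w: "\<bar>w \<sigma> j k - s \<sigma> j k - v \<sigma> j k\<bar> < \<epsilon>" if "k \<in> J" "j < q" "\<sigma> \<in> {1, -1}" for \<sigma> j k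
    proof -
      have "NN \<sigma> j \<subseteq> N" using that by (auto simp: N_def)
      from extend[OF N(1) this, of "b \<sigma> j" k] b(2) have "w \<sigma> j k = (\<Sum>i\<in>NN \<sigma> j. b \<sigma> j i * d i k)"
        by (simp add: w_def)
      then show ?thesis using close[OF that(1), of \<sigma> j] by simp
    qed
    have w_act: "1 / 2 \<le> w \<sigma> j (Inl i)" if "i \<in> {0..m}" "i = 0 \<or> e0 (Inl i) = 0" "j < q" "\<sigma> \<in> {1, -1}" for \<sigma> j i
    proof -
      have "0 \<le> s \<sigma> j (Inl i)" using s[of \<sigma> j] that by (auto simp: Sl_def)
      moreover have k: "Inl i \<in> J" using that by (auto simp: J_def)
      ultimately show ?thesis using w[OF k that(3,4)] \<epsilon>(3) by (simp add: v_def)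
    qed
    have w_eq: "\<bar>w \<sigma> j (Inr (Suc j')) - (if j' = j then \<sigma> else 0)\<bar> \<le> \<epsilon>" if "j' < q" "j < q" "\<sigma> \<in> {1, -1}" for \<sigma> j j'
    proof -
      have "s \<sigma> j (Inr (Suc j')) = 0" using s[of \<sigma> j] by (auto simp: Sl_def)
      moreover have k: "Inr (Suc j') \<in> J" using that by (auto simp: J_def)
      ultimately show ?thesis using w[OF k that(2,3)] by (simp add: v_def)
    qed
    obtain \<rho> E where \<rho>: "0 < \<rho>"
      and opt: "(\<forall>a. (\<forall>i\<in>N. 0 \<le> a i) \<and> sum a N < \<rho> \<longrightarrow> \<not> (e0 (Inl 0) < E a (Inl 0) \<and>
         (\<forall>i\<in>{1..m}. 0 \<le> E a (Inl i)) \<and> (\<forall>j\<in>{1..q}. E a (Inr j) = 0)))"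
      and cont0: "(\<forall>b a. (\<forall>i\<in>N. 0 \<le> a i) \<and> sum a N < \<rho> \<and> (\<forall>n::nat. (\<forall>i\<in>N. 0 \<le> b n i) \<and> sum (b n) N < \<rho>) \<and>
         (\<forall>i\<in>N. (\<lambda>n. b n i) \<longlonglongrightarrow> a i) \<longrightarrow> (\<forall>j\<in>{1..q}. (\<lambda>n. E (b n) (Inr j)) \<longlonglongrightarrow> E a (Inr j)))"
      and expa0: "(\<forall>b. (\<forall>n::nat. (\<forall>i\<in>N. 0 \<le> b n i) \<and> 0 < sum (b n) N \<and> sum (b n) N < \<rho>) \<and> (\<lambda>n. sum (b n) N) \<longlonglongrightarrow> 0 \<longrightarrow>
         (\<forall>k\<in>J. (\<lambda>n. (E (b n) k - e0 k - (\<Sum>i\<in>N. b n i * d i k)) / sum (b n) N) \<longlonglongrightarrow> 0))"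
      using fam[OF N] by (elim exE conjE)
    have cont: "(\<lambda>n. E (b n) (Inr j)) \<longlonglongrightarrow> E a (Inr j)"
      if "\<forall>i\<in>N. 0 \<le> a i" "sum a N < \<rho>" "\<forall>n::nat. (\<forall>i\<in>N. 0 \<le> b n i) \<and> sum (b n) N < \<rho>"
        "\<forall>i\<in>N. (\<lambda>n. b n i) \<longlonglongrightarrow> a i" "j \<in> {1..q}" for b a j
      using cont0[rule_format, of a b j] that by blast
    have expa: "(\<lambda>n. (E (b n) k - e0 k - (\<Sum>i\<in>N. b n i * d i k)) / sum (b n) N) \<longlonglongrightarrow> 0"
      if "\<forall>n::nat. (\<forall>i\<in>N. 0 \<le> b n i) \<and> 0 < sum (b n) N \<and> sum (b n) N < \<rho>" "(\<lambda>n. sum (b n) N) \<longlonglongrightarrow> 0" "k \<in> J" for b k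
      using expa0[rule_format, of b k] that by blast
    \<comment> \<open>The total weight of all packages bounds the weight of every mixture of them;
      the later A + 1 keeps denominators positive even if this weight is zero.\<close>
    define A where "A = (\<Sum>i\<in>N. \<Sum>j<q. b 1 j i + b (-1) j i)"
    have A: "0 \<le> A" unfolding A_def using b by (intro sum_nonneg) auto
    define \<eta> where "\<eta> = 1 / (8 * (A + 1))"
    have \<eta>: "0 < \<eta>" "\<eta> * (A + 1) = 1 / 8" using A by (auto simp: \<eta>_def field_simps)
    \<comment> \<open>The expansion is known only along sequences. If it failed to be uniform in the
      direction, a sequence of counterexamples with weights tending to zero would contradict
      it.\<close>
    have "\<exists>\<delta>>0. \<forall>a. (\<forall>i\<in>N. 0 \<le> a i) \<and> 0 < sum a N \<and> sum a N < \<delta> \<longrightarrow>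
        \<bar>E a k - e0 k - (\<Sum>i\<in>N. a i * d i k)\<bar> \<le> \<eta> * sum a N" if k: "k \<in> J" for k
    proof (rule ccontr)
      assume "\<not> ?thesis"
      then have neg: "\<And>\<delta>. 0 < \<delta> \<Longrightarrow> \<exists>a. (\<forall>i\<in>N. 0 \<le> a i) \<and> 0 < sum a N \<and> sum a N < \<delta> \<and>
         \<eta> * sum a N < \<bar>E a k - e0 k - (\<Sum>i\<in>N. a i * d i k)\<bar>" by (meson not_le)
      have ex: "\<forall>n. \<exists>a. (\<forall>i\<in>N. 0 \<le> a i) \<and> 0 < sum a N \<and> sum a N < min \<rho> (inverse (real (Suc n))) \<and>
         \<eta> * sum a N < \<bar>E a k - e0 k - (\<Sum>i\<in>N. a i * d i k)\<bar>"
        by (intro allI neg) (use \<rho> in simp)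
      from choice[OF ex] obtain a where a': "\<forall>n. (\<forall>i\<in>N. 0 \<le> a n i) \<and> 0 < sum (a n) N \<and>
         sum (a n) N < min \<rho> (inverse (real (Suc n))) \<and> \<eta> * sum (a n) N < \<bar>E (a n) k - e0 k - (\<Sum>i\<in>N. a n i * d i k)\<bar>"
        by (elim exE)
      then have a: "\<And>n i. i \<in> N \<Longrightarrow> 0 \<le> a n i" "\<And>n. 0 < sum (a n) N" "\<And>n. sum (a n) N < min \<rho> (inverse (real (Suc n)))"
         "\<And>n. \<eta> * sum (a n) N < \<bar>E (a n) k - e0 k - (\<Sum>i\<in>N. a n i * d i k)\<bar>" by blast+
      have "(\<lambda>n. sum (a n) N) \<longlonglongrightarrow> 0"
        by (rule tendsto_sandwich[OF always_eventually always_eventually tendsto_const LIMSEQ_inverse_real_of_nat])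
          (use a(2,3) in \<open>auto intro: less_imp_le\<close>)
      then have "(\<lambda>n. (E (a n) k - e0 k - (\<Sum>i\<in>N. a n i * d i k)) / sum (a n) N) \<longlonglongrightarrow> 0"
        by (intro expa k) (use a in auto)
      then have "eventually (\<lambda>n. \<bar>(E (a n) k - e0 k - (\<Sum>i\<in>N. a n i * d i k)) / sum (a n) N\<bar> < \<eta>) sequentially"
        using tendstoD[OF _ \<eta>(1)] by fastforce
      then obtain n where "\<bar>(E (a n) k - e0 k - (\<Sum>i\<in>N. a n i * d i k)) / sum (a n) N\<bar> < \<eta>"
        by (meson eventually_sequentially order_refl)
      then show False using a(2)[of n] a(4)[of n] by (simp add: abs_divide field_simps)
    qed
    then have "\<forall>k\<in>J. \<exists>\<delta>. 0 < \<delta> \<and> (\<forall>a. (\<forall>i\<in>N. 0 \<le> a i) \<and> 0 < sum a N \<and> sum a N < \<delta> \<longrightarrow>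
        \<bar>E a k - e0 k - (\<Sum>i\<in>N. a i * d i k)\<bar> \<le> \<eta> * sum a N)" by (intro ballI)
    from bchoice[OF this] obtain \<delta>f where "\<forall>k\<in>J. 0 < \<delta>f k \<and> (\<forall>a. (\<forall>i\<in>N. 0 \<le> a i) \<and> 0 < sum a N \<and> sum a N < \<delta>f k \<longrightarrow>
        \<bar>E a k - e0 k - (\<Sum>i\<in>N. a i * d i k)\<bar> \<le> \<eta> * sum a N)" by (elim exE)
    then have \<delta>f: "\<And>k. k \<in> J \<Longrightarrow> 0 < \<delta>f k" "\<And>k a. k \<in> J \<Longrightarrow> \<forall>i\<in>N. 0 \<le> a i \<Longrightarrow> 0 < sum a N \<Longrightarrow> sum a N < \<delta>f k \<Longrightarrow>
        \<bar>E a k - e0 k - (\<Sum>i\<in>N. a i * d i k)\<bar> \<le> \<eta> * sum a N" by simp_all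
    define Bd where "Bd = (\<Sum>i\<in>N. \<Sum>k\<in>J. \<bar>d i k\<bar>)"
    have Bd: "\<bar>d i k\<bar> \<le> Bd" if "i \<in> N" "k \<in> J" for i k
    proof -
      have "\<bar>d i k\<bar> \<le> (\<Sum>k\<in>J. \<bar>d i k\<bar>)" by (rule member_le_sum) (use that J in auto)
      also have "\<dots> \<le> Bd" unfolding Bd_def by (rule member_le_sum[of i]) (use that N in \<open>auto intro: sum_nonneg\<close>)
      finally show ?thesis .
    qed
    have Bd0: "0 \<le> Bd" unfolding Bd_def by (intro sum_nonneg) auto
    define Z where "Z = insert \<rho> (\<delta>f ` J \<union> ((\<lambda>i. e0 (Inl i) / (Bd + 1)) ` {i \<in> {1..m}. e0 (Inl i) \<noteq> 0}))"
    have Z: "finite Z" "Z \<noteq> {}" "\<And>x. x \<in> Z \<Longrightarrow> 0 < x"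
      using \<rho> \<delta>f(1) J e0(1) Bd0 by (auto simp: Z_def less_le)
    \<comment> \<open>The scale makes the total weight smaller than \<open>\<rho>\<close>, than
      every radius from the uniform expansion, and than the margin that an inactive constraint can
      lose.\<close>
    define \<tau> where "\<tau> = Min Z / (2 * (A + 1))"
    have MinZ: "0 < Min Z" using Z by simp
    have \<tau>: "0 < \<tau>" using MinZ A by (simp add: \<tau>_def)
    have \<tau>Z: "\<tau> * (A + 1) < x" if "x \<in> Z" for x
    proof -
      have "0 < 2 * (A + 1)" using A by simp
      then have "2 * (A + 1) \<noteq> 0" by (metis less_irrefl)
      from iffD1[OF nonzero_eq_divide_eq[OF this] \<tau>_def] have "\<tau> * (A + 1) = Min Z / 2" by (simp add: algebra_simps)
      then show ?thesis using Min_le[OF Z(1) that] MinZ by linarith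
    qed
    \<comment> \<open>The point y of the cube mixes, for each equality, the package pushing up with
      the one pushing down in the proportions y j and 1 - y j. To first order the j-th equality
      becomes \<open>\<tau>\<close> (2 y j - 1).\<close>
    define a where "a y i = \<tau> * (\<Sum>j<q. y j * b 1 j i + (1 - y j) * b (-1) j i)" for y :: "nat \<Rightarrow> real" and i
    have a0: "0 \<le> a y i" if "\<And>j. j < q \<Longrightarrow> 0 \<le> y j \<and> y j \<le> 1" for y :: "nat \<Rightarrow> real" and i
      unfolding a_def using \<tau> b that by (intro mult_nonneg_nonneg sum_nonneg add_nonneg_nonneg) auto
    have a_sum: "sum (a y) N \<le> \<tau> * (A + 1)" if "\<And>j. j < q \<Longrightarrow> 0 \<le> y j \<and> y j \<le> 1" for y :: "nat \<Rightarrow> real"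
    proof -
      have "sum (a y) N \<le> (\<Sum>i\<in>N. \<tau> * (\<Sum>j<q. b 1 j i + b (-1) j i))"
        unfolding a_def using \<tau> b that
        by (intro sum_mono mult_left_mono add_mono mult_left_le_one_le) auto
      also have "\<dots> = \<tau> * A" by (simp add: A_def sum_distrib_left)
      also have "\<dots> \<le> \<tau> * (A + 1)" using \<tau> by simp
      finally show ?thesis .
    qed
    have a_d: "(\<Sum>i\<in>N. a y i * d i k) = \<tau> * (\<Sum>j<q. y j * w 1 j k + (1 - y j) * w (-1) j k)" for y :: "nat \<Rightarrow> real" and k
    proof -
      have "(\<Sum>i\<in>N. a y i * d i k) = \<tau> * (\<Sum>i\<in>N. \<Sum>j<q. (y j * b 1 j i + (1 - y j) * b (-1) j i) * d i k)"
        by (simp add: a_def sum_distrib_left sum_distrib_right mult.assoc)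
      also have "(\<Sum>i\<in>N. \<Sum>j<q. (y j * b 1 j i + (1 - y j) * b (-1) j i) * d i k)
          = (\<Sum>j<q. \<Sum>i\<in>N. (y j * b 1 j i + (1 - y j) * b (-1) j i) * d i k)" by (rule sum.swap)
      also have "\<dots> = (\<Sum>j<q. y j * w 1 j k + (1 - y j) * w (-1) j k)"
        by (simp add: w_def sum_real_mult_distrib)
      finally show ?thesis .
    qed
    have d_act: "\<tau> / 2 \<le> (\<Sum>i\<in>N. a y i * d i (Inl i'))"
      if "i' \<in> {0..m}" "i' = 0 \<or> e0 (Inl i') = 0" "\<And>j. j < q \<Longrightarrow> 0 \<le> y j \<and> y j \<le> 1" for y :: "nat \<Rightarrow> real" and i'
    proof -
      have "1 / 2 \<le> y j * w 1 j (Inl i') + (1 - y j) * w (-1) j (Inl i')" if "j < q" for j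
      proof -
        have "y j * (1 / 2) + (1 - y j) * (1 / 2) \<le> y j * w 1 j (Inl i') + (1 - y j) * w (-1) j (Inl i')"
          using w_act[of i' j 1] w_act[of i' j "-1"] \<open>i' \<in> _\<close> \<open>i' = 0 \<or> _\<close> that \<open>\<And>j. j < q \<Longrightarrow> 0 \<le> y j \<and> y j \<le> 1\<close>
          by (intro add_mono mult_left_mono) auto
        then show ?thesis by (simp add: field_simps)
      qed
      then have "(\<Sum>j<q. 1 / 2) \<le> (\<Sum>j<q. y j * w 1 j (Inl i') + (1 - y j) * w (-1) j (Inl i'))"
        by (intro sum_mono) auto
      then have "1 / 2 \<le> (\<Sum>j<q. y j * w 1 j (Inl i') + (1 - y j) * w (-1) j (Inl i'))" using q by simp
      from mult_left_mono[OF this, of \<tau>] show ?thesis unfolding a_d using \<tau> by simp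
    qed
    have a_pos: "0 < sum (a y) N" if "\<And>j. j < q \<Longrightarrow> 0 \<le> y j \<and> y j \<le> 1" for y :: "nat \<Rightarrow> real"
    proof (rule ccontr)
      assume "\<not> ?thesis"
      then have "sum (a y) N = 0" using a0[of y, OF that] by (meson antisym_conv3 sum_nonneg not_less)
      then have "\<And>i. i \<in> N \<Longrightarrow> a y i = 0" using a0[of y, OF that] N(1) by (simp add: sum_nonneg_eq_0_iff)
      then show False using d_act[of 0 y] that \<tau> by simp
    qed
    have approx: "\<bar>E (a y) k - e0 k - (\<Sum>i\<in>N. a y i * d i k)\<bar> \<le> \<tau> / 8"
      if y: "\<And>j. j < q \<Longrightarrow> 0 \<le> y j \<and> y j \<le> 1" and k: "k \<in> J" for y :: "nat \<Rightarrow> real" and k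
    proof -
      have "\<bar>E (a y) k - e0 k - (\<Sum>i\<in>N. a y i * d i k)\<bar> \<le> \<eta> * sum (a y) N"
      proof (rule \<delta>f(2)[OF k])
        show "sum (a y) N < \<delta>f k" using a_sum[of y, OF y] \<tau>Z[of "\<delta>f k"] k by (simp add: Z_def)
      qed (use a0 a_pos y in auto)
      also have "\<dots> \<le> \<eta> * (\<tau> * (A + 1))" by (rule mult_left_mono[OF a_sum[of y, OF y]]) (use \<eta> in auto)
      also have "\<dots> = \<tau> / 8" using \<eta>(2) by (metis mult.commute mult.left_commute times_divide_eq_right mult.right_neutral)
      finally show ?thesis .
    qed
    have a_\<rho>: "sum (a y) N < \<rho>" if "\<And>j. j < q \<Longrightarrow> 0 \<le> y j \<and> y j \<le> 1" for y :: "nat \<Rightarrow> real"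
      using a_sum[of y, OF that] \<tau>Z[of \<rho>] by (simp add: Z_def)
    \<comment> \<open>The packages miss their targets by at most 1/8 in total, and the nonlinear
      remainder divided by \<open>\<tau>\<close> is again at most 1/8, well within the bound 1
      needed to stay in the cube.\<close>
    have eq_err: "\<bar>E (a y) (Inr (Suc j')) / \<tau> - (2 * y j' - 1)\<bar> \<le> 1"
      if y: "\<And>j. j < q \<Longrightarrow> 0 \<le> y j \<and> y j \<le> 1" and j': "j' < q" for y :: "nat \<Rightarrow> real" and j'
    proof -
      let ?k = "Inr (Suc j') :: nat + nat"
      have k: "?k \<in> J" using j' by (auto simp: J_def)
      define S where "S = (\<Sum>j<q. y j * w 1 j ?k + (1 - y j) * w (-1) j ?k)"
      have "(\<Sum>j<q. if j' = j then 2 * y j - 1 else 0) = 2 * y j' - 1" using j' by simp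
      then have "S - (2 * y j' - 1) = (\<Sum>j<q. y j * w 1 j ?k + (1 - y j) * w (-1) j ?k - (if j' = j then 2 * y j - 1 else 0))"
        unfolding S_def by (simp add: sum_subtractf)
      also have "\<bar>\<dots>\<bar> \<le> (\<Sum>j<q. \<epsilon>)"
      proof (rule order_trans[OF sum_abs sum_mono])
        fix j assume "j \<in> {..<q}"
        then have j: "j < q" by simp
        define x1 x2 where "x1 = w 1 j ?k - (if j' = j then 1 else 0)" and "x2 = w (-1) j ?k - (if j' = j then -1 else 0)"
        have x: "\<bar>x1\<bar> \<le> \<epsilon>" "\<bar>x2\<bar> \<le> \<epsilon>" using w_eq[OF j' j] by (auto simp: x1_def x2_def)
        have "y j * w 1 j ?k + (1 - y j) * w (-1) j ?k - (if j' = j then 2 * y j - 1 else 0) = y j * x1 + (1 - y j) * x2"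
          by (simp add: x1_def x2_def algebra_simps)
        also have "\<bar>\<dots>\<bar> \<le> y j * \<bar>x1\<bar> + (1 - y j) * \<bar>x2\<bar>"
          using y[of j] j by (intro order_trans[OF abs_triangle_ineq]) (simp add: abs_mult)
        also have "\<dots> \<le> y j * \<epsilon> + (1 - y j) * \<epsilon>"
          using y[of j] j x by (intro add_mono mult_left_mono) auto
        also have "\<dots> = \<epsilon>" by (simp add: algebra_simps)
        finally show "\<bar>y j * w 1 j ?k + (1 - y j) * w (-1) j ?k - (if j' = j then 2 * y j - 1 else 0)\<bar> \<le> \<epsilon>" .
      qed
      finally have 1: "\<bar>S - (2 * y j' - 1)\<bar> \<le> 1 / 8" using \<epsilon>(2) by simp
      have "\<bar>E (a y) ?k - \<tau> * S\<bar> \<le> \<tau> / 8"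
        using approx[of y, OF y k] e0(2)[of "Suc j'"] j' by (simp add: a_d S_def)
      then have "\<bar>E (a y) ?k / \<tau> - S\<bar> \<le> 1 / 8" using \<tau> by (simp add: abs_le_iff field_simps)
      then show ?thesis using 1 by linarith
    qed
    \<comment> \<open>A Newton-like step: since E / \<open>\<tau>\<close> is close to 2 y - 1, the
      value of G is 1/2 up to an error of at most 1/2, hence in the cube. Its fixed points are the
      zeros of the equality constraints.\<close>
    define G where "G y j = y j - E (a y) (Inr (Suc j)) / (2 * \<tau>)" for y :: "nat \<Rightarrow> real" and j
    have "\<exists>y. (\<forall>j<q. 0 \<le> y j \<and> y j \<le> 1) \<and> (\<forall>j<q. G y j = y j)"
    proof (rule brouwer_cube_nat)
      fix y :: "nat \<Rightarrow> real" and i assume y: "\<And>j. j < q \<Longrightarrow> 0 \<le> y j \<and> y j \<le> 1" and i: "i < q"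
      have "E (a y) (Inr (Suc i)) / (2 * \<tau>) = (E (a y) (Inr (Suc i)) / \<tau>) / 2" by simp
      then show "0 \<le> G y i \<and> G y i \<le> 1" using eq_err[of y, OF y i] unfolding G_def by linarith
    next
      fix x :: "nat \<Rightarrow> nat \<Rightarrow> real" and l i
      assume x: "\<And>k j. j < q \<Longrightarrow> 0 \<le> x k j \<and> x k j \<le> 1" and l: "\<And>j. j < q \<Longrightarrow> 0 \<le> l j \<and> l j \<le> 1"
        and lim: "\<And>j. j < q \<Longrightarrow> (\<lambda>k. x k j) \<longlonglongrightarrow> l j" and i: "i < q"
      have "(\<lambda>k. a (x k) n) \<longlonglongrightarrow> a l n" for n
        unfolding a_def by (intro tendsto_intros lim) auto
      then have "(\<lambda>k. E (a (x k)) (Inr (Suc i))) \<longlonglongrightarrow> E (a l) (Inr (Suc i))"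
        by (intro cont) (use a0[of "x _", OF x] a0[of l, OF l] a_\<rho>[of "x _", OF x] a_\<rho>[of l, OF l] i in auto)
      then show "(\<lambda>k. G (x k) i) \<longlonglongrightarrow> G l i" unfolding G_def using \<tau> by (intro tendsto_intros lim i) auto
    qed
    then obtain y where y: "\<And>j. j < q \<Longrightarrow> 0 \<le> y j \<and> y j \<le> 1" "\<And>j. j < q \<Longrightarrow> G y j = y j" by blast
    have "e0 (Inl 0) < E (a y) (Inl 0) \<and> (\<forall>i\<in>{1..m}. 0 \<le> E (a y) (Inl i)) \<and> (\<forall>j\<in>{1..q}. E (a y) (Inr j) = 0)"
    proof (intro conjI)
      show "e0 (Inl 0) < E (a y) (Inl 0)"
      proof -
        have "Inl 0 \<in> J" by (auto simp: J_def)
        from abs_le_D2[OF approx[of y, OF y(1) this]]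
        have "- (E (a y) (Inl 0) - e0 (Inl 0) - (\<Sum>i\<in>N. a y i * d i (Inl 0))) \<le> \<tau> / 8" .
        moreover have "\<tau> / 2 \<le> (\<Sum>i\<in>N. a y i * d i (Inl 0))" using d_act[of 0 y] y(1) by simp
        ultimately show ?thesis using \<tau> by argo
      qed
      show "\<forall>j\<in>{1..q}. E (a y) (Inr j) = 0"
      proof
        fix j assume "j \<in> {1..q}"
        then obtain j' where "j = Suc j'" "j' < q" by (cases j) auto
        then show "E (a y) (Inr j) = 0" using y(2)[of j'] \<tau> by (simp add: G_def)
      qed
      show "\<forall>i\<in>{1..m}. 0 \<le> E (a y) (Inl i)"
      proof
        fix i assume i: "i \<in> {1..m}"
        then have k: "Inl i \<in> J" by (auto simp: J_def)
        show "0 \<le> E (a y) (Inl i)"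
        proof (cases "e0 (Inl i) = 0")
          case True
          moreover have "- (E (a y) (Inl i) - e0 (Inl i) - (\<Sum>i'\<in>N. a y i' * d i' (Inl i))) \<le> \<tau> / 8"
            by (rule abs_le_D2[OF approx[of y, OF y(1) k]])
          moreover have "\<tau> / 2 \<le> (\<Sum>i'\<in>N. a y i' * d i' (Inl i))" using d_act[of i y] y(1) i True by simp
          ultimately show ?thesis using \<tau> by argo
        next
          case False
          \<comment> \<open>An inactive constraint need not improve: its total change is at most
            \<open>\<tau>\<close> (A + 1) (Bd + 1), which the choice of \<open>\<tau>\<close> keeps
            below its slack.\<close>
          have "\<bar>\<Sum>i'\<in>N. a y i' * d i' (Inl i)\<bar> \<le> (\<Sum>i'\<in>N. a y i' * Bd)"
            by (rule order_trans[OF sum_abs sum_mono]) (use a0[of y, OF y(1)] Bd k in \<open>auto simp: abs_mult intro!: mult_left_mono\<close>)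
          also have "\<dots> \<le> \<tau> * (A + 1) * Bd"
            unfolding sum_distrib_right[symmetric] by (rule mult_right_mono[OF a_sum[of y, OF y(1)] Bd0])
          finally have "- (\<Sum>i'\<in>N. a y i' * d i' (Inl i)) \<le> \<tau> * (A + 1) * Bd" by (rule abs_le_D2)
          moreover have "\<tau> / 8 \<le> \<tau> * (A + 1)" using \<tau> A by (simp add: algebra_simps)
          moreover have "\<tau> * (A + 1) < e0 (Inl i) / (Bd + 1)" by (rule \<tau>Z) (use i False in \<open>auto simp: Z_def\<close>)
          then have "\<tau> * (A + 1) * (Bd + 1) < e0 (Inl i)" using Bd0 by (simp add: pos_less_divide_eq)
          then have "\<tau> * (A + 1) * Bd + \<tau> * (A + 1) < e0 (Inl i)" by (simp add: algebra_simps)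
          moreover have "- (E (a y) (Inl i) - e0 (Inl i) - (\<Sum>i'\<in>N. a y i' * d i' (Inl i))) \<le> \<tau> / 8"
            by (rule abs_le_D2[OF approx[of y, OF y(1) k]])
          ultimately show ?thesis by argo
        qed
      qed
    qed
    moreover have "\<forall>i\<in>N. 0 \<le> a y i" "sum (a y) N < \<rho>" using a0 a_\<rho> y(1) by auto
    ultimately show ?thesis using opt by blast
  qed
qed

section \<open>Gateaux and Hadamard differentials\<close>

lemma has_gateaux_unique:
  assumes "has_gateaux F D a" "has_gateaux F D' a"
  shows "D = D'"
  using assms unfolding has_gateaux_def has_right_variation_def
  by (intro blinfun_eqI) (meson tendsto_unique trivial_limit_at_right_real)

lemma DG_eq: "has_gateaux F D a \<Longrightarrow> DG F a = D"
  unfolding DG_def using has_gateaux_unique by blast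

lemma DH_eq: "has_hadamard F D a \<Longrightarrow> DH F a = D"
  unfolding DH_def by (rule the_equality) (auto intro: has_gateaux_unique simp: has_hadamard_def)

lemma hadamard_differentiable_iff: "hadamard_differentiable F a \<longleftrightarrow> has_hadamard F (DH F a) a"
  unfolding hadamard_differentiable_def using DH_eq by blast

lemma DF_eq: "(F has_derivative blinfun_apply D) (at a) \<Longrightarrow> DF F a = D"
  unfolding DF_def by (rule the_equality) (auto dest: has_derivative_unique simp: blinfun_apply_inject)

lemma differentiable_DF:
  assumes "F differentiable (at a)"
  shows "(F has_derivative DF F a) (at a)"
proof -
  obtain D where D: "(F has_derivative D) (at a)" using assms by (auto simp: differentiable_def)
  then have "D = blinfun_apply (Blinfun D)" by (simp add: bounded_linear_Blinfun_apply has_derivative_bounded_linear)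
  then show ?thesis using D DF_eq by metis
qed

lemma has_derivative_imp_gateaux:
  assumes "(F has_derivative blinfun_apply D) (at a)"
  shows "has_gateaux F D a"
  unfolding has_gateaux_def has_right_variation_def
proof
  fix v
  show "((\<lambda>\<theta>. (1 / \<theta>) *\<^sub>R (F (a + \<theta> *\<^sub>R v) - F a)) \<longlongrightarrow> D v) (at_right 0)"
  proof (rule tendstoI)
    fix e :: real assume e: "0 < e"
    define e' where "e' = e / (norm v + 1)"
    have nv: "0 < norm v + 1" by (simp add: add_nonneg_pos)
    have e': "0 < e'" "e' * norm v < e"
      using e nv by (auto simp: e'_def field_simps)
    obtain \<delta> where \<delta>: "\<delta> > 0" "\<And>y. norm (y - a) < \<delta> \<Longrightarrow> norm (F y - F a - D (y - a)) \<le> e' * norm (y - a)"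
      using assms e'(1) unfolding has_derivative_at_alt by blast
    have "eventually (\<lambda>\<theta>. \<theta> < \<delta> / (norm v + 1)) (at_right 0)"
      unfolding eventually_at_right_field using \<delta>(1) nv by (intro exI[of _ "\<delta> / (norm v + 1)"]) auto
    moreover have "eventually (\<lambda>\<theta>. 0 < \<theta>) (at_right (0::real))" by (simp add: eventually_at_filter)
    ultimately show "eventually (\<lambda>\<theta>. dist ((1 / \<theta>) *\<^sub>R (F (a + \<theta> *\<^sub>R v) - F a)) (D v) < e) (at_right 0)"
    proof eventually_elim
      case (elim \<theta>)
      have "\<theta> * norm v \<le> \<theta> * (norm v + 1)" using elim by simp
      also have "\<dots> < \<delta>" using elim nv by (simp add: field_simps)
      finally have "norm (F (a + \<theta> *\<^sub>R v) - F a - D (\<theta> *\<^sub>R v)) \<le> e' * (\<theta> * norm v)"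
        using \<delta>(2)[of "a + \<theta> *\<^sub>R v"] elim by simp
      then have "(1 / \<theta>) * norm (F (a + \<theta> *\<^sub>R v) - F a - \<theta> *\<^sub>R D v) \<le> e' * norm v"
        using elim by (simp add: blinfun.scaleR_right field_simps)
      moreover have "(1 / \<theta>) *\<^sub>R (F (a + \<theta> *\<^sub>R v) - F a) - D v = (1 / \<theta>) *\<^sub>R (F (a + \<theta> *\<^sub>R v) - F a - \<theta> *\<^sub>R D v)"
        using elim by (simp add: scaleR_diff_right)
      ultimately show ?case using e'(2) elim by (simp add: dist_norm)
    qed
  qed
qed

lemma hadamard_seq:
  assumes "has_hadamard F D a" "filterlim \<theta> (at_right 0) G" "(w \<longlongrightarrow> v) G"
  shows "((\<lambda>n. (1 / \<theta> n) *\<^sub>R (F (a + \<theta> n *\<^sub>R w n) - F a)) \<longlongrightarrow> D v) G"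
proof -
  have "((\<lambda>(\<theta>, w). (1 / \<theta>) *\<^sub>R (F (a + \<theta> *\<^sub>R w) - F a)) \<longlongrightarrow> D v) (at_right 0 \<times>\<^sub>F nhds v)"
    using assms(1) by (simp add: has_hadamard_def)
  from filterlim_compose[OF this filterlim_Pair[OF assms(2,3)]] show ?thesis by simp
qed

text \<open>The map j is affine with linear part i, so convergent directions go to convergent
  directions. Inserting a variable into one slot of a product is such a map, which makes all partial
  differentials instances of this.\<close>

lemma has_hadamard_affine:
  fixes i :: "'b::real_normed_vector \<Rightarrow>\<^sub>L 'a::real_normed_vector"
  assumes F: "has_hadamard F D (j a)" and j: "\<And>\<theta> w. j (a + \<theta> *\<^sub>R w) = j a + \<theta> *\<^sub>R i w"
  shows "has_hadamard (\<lambda>a. F (j a)) (D o\<^sub>L i) a"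
proof -
  have "((\<lambda>(\<theta>, w). (1 / \<theta>) *\<^sub>R (F (j (a + \<theta> *\<^sub>R w)) - F (j a))) \<longlongrightarrow> (D o\<^sub>L i) v) (at_right 0 \<times>\<^sub>F nhds v)" for v
  proof -
    have f: "filterlim fst (at_right 0) (at_right (0::real) \<times>\<^sub>F nhds v)" by (rule filterlim_fst)
    have s: "((\<lambda>p. i (snd p)) \<longlongrightarrow> i v) (at_right (0::real) \<times>\<^sub>F nhds v)"
      by (intro blinfun.tendsto tendsto_const filterlim_snd)
    show ?thesis using hadamard_seq[OF F f s] by (simp add: j case_prod_unfold)
  qed
  moreover have "has_gateaux (\<lambda>a. F (j a)) (D o\<^sub>L i) a"
    using F unfolding has_hadamard_def has_gateaux_def has_right_variation_def by (simp add: j)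
  ultimately show ?thesis by (simp add: has_hadamard_def)
qed

text \<open>Hadamard differentiability says something only along convergent directions; this
  criterion permits passing to a subsequence on which the direction converges.\<close>

lemma tendsto_0_subseqI:
  fixes x :: "nat \<Rightarrow> 'a::real_normed_vector"
  assumes "\<And>r :: nat \<Rightarrow> nat. strict_mono r \<Longrightarrow> \<exists>r' :: nat \<Rightarrow> nat. strict_mono r' \<and> (\<lambda>n. x (r (r' n))) \<longlonglongrightarrow> 0"
  shows "x \<longlonglongrightarrow> 0"
proof (rule ccontr)
  assume "\<not> ?thesis"
  then obtain e where e: "0 < e" "\<not> eventually (\<lambda>n. norm (x n) < e) sequentially"
    unfolding tendsto_iff by (auto simp: dist_norm)
  have "infinite {n. e \<le> norm (x n)}"
  proof
    assume "finite {n. e \<le> norm (x n)}"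
    then obtain n0 where "\<forall>n\<in>{n. e \<le> norm (x n)}. n < n0" using finite_nat_set_iff_bounded by blast
    then have "eventually (\<lambda>n. norm (x n) < e) sequentially"
      unfolding eventually_sequentially by (intro exI[of _ n0]) (auto simp: not_le[symmetric])
    then show False using e by blast
  qed
  from infinite_enumerate[OF this] obtain r :: "nat \<Rightarrow> nat" where "strict_mono r \<and> (\<forall>n. r n \<in> {n. e \<le> norm (x n)})"
    by (elim exE)
  then have r: "strict_mono r" "\<And>n. e \<le> norm (x (r n))" by auto
  from assms[OF r(1)] obtain r' where "(\<lambda>n. x (r (r' n))) \<longlonglongrightarrow> 0" by blast
  then have "eventually (\<lambda>n. norm (x (r (r' n))) < e) sequentially"
    using e(1) by (auto simp: tendsto_iff dist_norm)
  then show False using r(2) by (auto simp: eventually_sequentially not_le[symmetric])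
qed

section \<open>Multipliers for a problem with endpoint cost\<close>

context control_system
begin

text \<open>Each endpoint functional is composed with the needle family. The multiplier rule then
  sees real-valued data only, and an admissible needle perturbation with a larger endpoint cost is
  excluded by optimality.\<close>

lemma mayer_multipliers:
  fixes \<Phi> :: "nat + nat \<Rightarrow> 'e \<Rightarrow> real" and D :: "nat + nat \<Rightarrow> 'e \<Rightarrow>\<^sub>L real" and m q :: nat
  defines "J \<equiv> {0..m} <+> {1..q}"
  assumes q: "1 \<le> q" and D: "\<And>k. k \<in> J \<Longrightarrow> has_hadamard (\<Phi> k) (D k) (z T)"
    and cont: "\<And>j. j \<in> {1..q} \<Longrightarrow> \<exists>N. open N \<and> z T \<in> N \<and> continuous_on N (\<Phi> (Inr j))"
    and ineq: "\<And>i. i \<in> {1..m} \<Longrightarrow> 0 \<le> \<Phi> (Inl i) (z T)" and eq: "\<And>j. j \<in> {1..q} \<Longrightarrow> \<Phi> (Inr j) (z T) = 0"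
    and opt: "\<And>y w. y \<in> PC1 T \<Omega> \<Longrightarrow> w \<in> NPC0R T U \<Longrightarrow> \<forall>t\<in>{0..T}. ext_deriv T y t = F t (y t) (w t) \<Longrightarrow> y 0 = z 0 \<Longrightarrow>
      \<forall>i\<in>{1..m}. 0 \<le> \<Phi> (Inl i) (y T) \<Longrightarrow> \<forall>j\<in>{1..q}. \<Phi> (Inr j) (y T) = 0 \<Longrightarrow> \<Phi> (Inl 0) (y T) \<le> \<Phi> (Inl 0) (z T)"
  shows "\<exists>c. (\<exists>k\<in>J. c k \<noteq> 0) \<and> (\<forall>i\<in>{0..m}. 0 \<le> c (Inl i)) \<and> (\<forall>i\<in>{1..m}. c (Inl i) * \<Phi> (Inl i) (z T) = 0) \<and>
     (\<forall>i\<in>{0..<T} \<times> U. (\<Sum>k\<in>J. c k * D k (needle_effect i)) \<le> 0)"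
proof (rule multiplier_rule[where q = q and m = m and ?e0.0 = "\<lambda>k. \<Phi> k (z T)" and I = "{0..<T} \<times> U"
      and d = "\<lambda>i k. D k (needle_effect i)", folded J_def, OF q])
  show "0 \<le> \<Phi> (Inl i) (z T)" if "i \<in> {1..m}" for i by (rule ineq[OF that])
  show "\<Phi> (Inr j) (z T) = 0" if "j \<in> {1..q}" for j by (rule eq[OF that])
next
  fix N :: "(real \<times> 'y) set" assume N: "finite N" "N \<subseteq> {0..<T} \<times> U"
  obtain \<rho> K ya wa where \<rho>: "0 < \<rho>"
    and adm: "\<forall>a. (\<forall>i\<in>N. 0 \<le> a i) \<and> sum a N < \<rho> \<longrightarrow> ya a \<in> PC1 T \<Omega> \<and> wa a \<in> NPC0R T U \<and>
      (\<forall>t\<in>{0..T}. ext_deriv T (ya a) t = F t (ya a t) (wa a t)) \<and> ya a 0 = z 0 \<and>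
      (\<forall>t\<in>{0..T}. norm (ya a t - z t) \<le> K * sum a N)"
    and con: "\<forall>b a. (\<forall>i\<in>N. 0 \<le> a i) \<and> sum a N < \<rho> \<and> (\<forall>n::nat. (\<forall>i\<in>N. 0 \<le> b n i) \<and> sum (b n) N < \<rho>) \<and>
      (\<forall>i\<in>N. (\<lambda>n. b n i) \<longlonglongrightarrow> a i) \<longrightarrow> (\<lambda>n. ya (b n) T) \<longlonglongrightarrow> ya a T"
    and ex: "\<forall>b. (\<forall>n::nat. (\<forall>i\<in>N. 0 \<le> b n i) \<and> 0 < sum (b n) N \<and> sum (b n) N < \<rho>) \<and> (\<lambda>n. sum (b n) N) \<longlonglongrightarrow> 0 \<longrightarrow>
      (\<lambda>n. (1 / sum (b n) N) *\<^sub>R (ya (b n) T - z T - (\<Sum>i\<in>N. b n i *\<^sub>R needle_effect i))) \<longlonglongrightarrow> 0"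
    using needle_variations[OF N] by (elim exE conjE)
  have "\<forall>j. \<exists>\<delta>>0. j \<in> {1..q} \<longrightarrow> continuous_on (ball (z T) \<delta>) (\<Phi> (Inr j))"
  proof
    fix j show "\<exists>\<delta>>0. j \<in> {1..q} \<longrightarrow> continuous_on (ball (z T) \<delta>) (\<Phi> (Inr j))"
    proof (cases "j \<in> {1..q}")
      case True
      obtain N' where N': "open N'" "z T \<in> N'" "continuous_on N' (\<Phi> (Inr j))" using cont[OF True] by blast
      then obtain \<delta> where "\<delta> > 0" "ball (z T) \<delta> \<subseteq> N'" using open_contains_ball by blast
      then show ?thesis using continuous_on_subset[OF N'(3)] by blast
    qed (auto intro: exI[of _ 1])
  qed
  from choice[OF this] obtain \<delta>f where \<delta>f: "\<forall>j. 0 < \<delta>f j \<and> (j \<in> {1..q} \<longrightarrow> continuous_on (ball (z T) (\<delta>f j)) (\<Phi> (Inr j)))"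
    by (elim exE)
  define \<delta> where "\<delta> = Min (insert 1 (\<delta>f ` {1..q}))"
  have \<delta>: "0 < \<delta>" unfolding \<delta>_def using \<delta>f by auto
  have \<delta>_le: "\<delta> \<le> \<delta>f j" if "j \<in> {1..q}" for j
    unfolding \<delta>_def by (rule Min_le) (use that in auto)
  \<comment> \<open>Besides admissibility this keeps the perturbed endpoint in a ball on which all
    equality constraints are continuous; the sign of K is not recorded, hence its absolute
    value.\<close>
  define \<rho>' where "\<rho>' = min \<rho> (\<delta> / (\<bar>K\<bar> + 1))"
  have \<rho>': "0 < \<rho>'" "\<rho>' \<le> \<rho>" using \<rho> \<delta> by (auto simp: \<rho>'_def)
  have near: "ya a T \<in> ball (z T) \<delta>" if a: "\<forall>i\<in>N. 0 \<le> a i" "sum a N < \<rho>'" for a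
  proof -
    have "norm (ya a T - z T) \<le> K * sum a N" using adm[rule_format, of a] a \<rho>' T_pos by auto
    also have "\<dots> \<le> (\<bar>K\<bar> + 1) * sum a N" using a by (intro mult_right_mono sum_nonneg) auto
    also have "\<dots> < (\<bar>K\<bar> + 1) * (\<delta> / (\<bar>K\<bar> + 1))" using a by (intro mult_strict_left_mono) (auto simp: \<rho>'_def)
    also have "\<dots> = \<delta>" by simp
    finally show ?thesis by (simp add: dist_norm norm_minus_commute)
  qed
  show "\<exists>\<rho>>0. \<exists>E.
      (\<forall>a. (\<forall>i\<in>N. 0 \<le> a i) \<and> sum a N < \<rho> \<longrightarrow> \<not> (\<Phi> (Inl 0) (z T) < E a (Inl 0) \<and>
         (\<forall>i\<in>{1..m}. 0 \<le> E a (Inl i)) \<and> (\<forall>j\<in>{1..q}. E a (Inr j) = 0))) \<and>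
      (\<forall>b a. (\<forall>i\<in>N. 0 \<le> a i) \<and> sum a N < \<rho> \<and> (\<forall>n::nat. (\<forall>i\<in>N. 0 \<le> b n i) \<and> sum (b n) N < \<rho>) \<and>
         (\<forall>i\<in>N. (\<lambda>n. b n i) \<longlonglongrightarrow> a i) \<longrightarrow> (\<forall>j\<in>{1..q}. (\<lambda>n. E (b n) (Inr j)) \<longlonglongrightarrow> E a (Inr j))) \<and>
      (\<forall>b. (\<forall>n::nat. (\<forall>i\<in>N. 0 \<le> b n i) \<and> 0 < sum (b n) N \<and> sum (b n) N < \<rho>) \<and> (\<lambda>n. sum (b n) N) \<longlonglongrightarrow> 0 \<longrightarrow>
         (\<forall>k\<in>J. (\<lambda>n. (E (b n) k - \<Phi> k (z T) - (\<Sum>i\<in>N. b n i * D k (needle_effect i))) / sum (b n) N) \<longlonglongrightarrow> 0))"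
  proof (rule exI[of _ \<rho>'], rule conjI[OF \<rho>'(1)], rule exI[of _ "\<lambda>a k. \<Phi> k (ya a T)"], intro conjI allI impI ballI)
    fix a assume a: "(\<forall>i\<in>N. 0 \<le> a i) \<and> sum a N < \<rho>'"
    then have "ya a \<in> PC1 T \<Omega>" "wa a \<in> NPC0R T U" "\<forall>t\<in>{0..T}. ext_deriv T (ya a) t = F t (ya a t) (wa a t)" "ya a 0 = z 0"
      using adm[rule_format, of a] \<rho>' by auto
    from opt[OF this] show "\<not> (\<Phi> (Inl 0) (z T) < \<Phi> (Inl 0) (ya a T) \<and>
         (\<forall>i\<in>{1..m}. 0 \<le> \<Phi> (Inl i) (ya a T)) \<and> (\<forall>j\<in>{1..q}. \<Phi> (Inr j) (ya a T) = 0))" by force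
  next
    fix b a j assume h: "(\<forall>i\<in>N. 0 \<le> a i) \<and> sum a N < \<rho>' \<and> (\<forall>n::nat. (\<forall>i\<in>N. 0 \<le> b n i) \<and> sum (b n) N < \<rho>') \<and>
         (\<forall>i\<in>N. (\<lambda>n. b n i) \<longlonglongrightarrow> a i)" and j: "j \<in> {1..q}"
    have sub: "ball (z T) \<delta> \<subseteq> ball (z T) (\<delta>f j)" using \<delta>_le[OF j] by (simp add: subset_ball)
    have c1: "continuous_on (ball (z T) \<delta>) (\<Phi> (Inr j))"
      using continuous_on_subset[OF _ sub] \<delta>f j by blast
    have c2: "(\<lambda>n. ya (b n) T) \<longlonglongrightarrow> ya a T"
      using con[rule_format, of a b] h \<rho>'(2) by (meson order_less_le_trans)
    have c3: "ya a T \<in> ball (z T) \<delta>" "\<And>n. ya (b n) T \<in> ball (z T) \<delta>" using near h by blast+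
    show "(\<lambda>n. \<Phi> (Inr j) (ya (b n) T)) \<longlonglongrightarrow> \<Phi> (Inr j) (ya a T)"
      by (rule continuous_on_tendsto_compose[OF c1 c2 c3(1)]) (use c3(2) in simp)
  next
    fix b :: "nat \<Rightarrow> real \<times> 'y \<Rightarrow> real" and k
    assume h: "(\<forall>n::nat. (\<forall>i\<in>N. 0 \<le> b n i) \<and> 0 < sum (b n) N \<and> sum (b n) N < \<rho>') \<and> (\<lambda>n. sum (b n) N) \<longlonglongrightarrow> 0"
      and k: "k \<in> J"
    define s where "s = (\<lambda>n. sum (b n) N)"
    have s: "0 < s n" "s \<longlonglongrightarrow> 0" for n using h by (auto simp: s_def)
    have b0: "0 \<le> b n i" "b n i \<le> s n" if "i \<in> N" for n i
      using h that member_le_sum[of i N "b n"] N(1) by (auto simp: s_def)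
    have h\<rho>: "\<forall>n. (\<forall>i\<in>N. 0 \<le> b n i) \<and> 0 < sum (b n) N \<and> sum (b n) N < \<rho>"
      using h \<rho>'(2) by (meson order_less_le_trans)
    have L: "(\<lambda>n. (1 / s n) *\<^sub>R (ya (b n) T - z T - (\<Sum>i\<in>N. b n i *\<^sub>R needle_effect i))) \<longlonglongrightarrow> 0"
      using ex[rule_format, of b] h h\<rho> unfolding s_def by blast
    define X where "X n = (\<Phi> k (ya (b n) T) - \<Phi> k (z T) - (\<Sum>i\<in>N. b n i * D k (needle_effect i))) / s n" for n
    have "X \<longlonglongrightarrow> 0"
    \<comment> \<open>The weights divided by their sum lie in [0,1], so along a subsequence they
      converge, and with them the direction of the endpoint displacement. Only there can the
      Hadamard differential be applied.\<close>
    proof (rule tendsto_0_subseqI)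
      fix r :: "nat \<Rightarrow> nat" assume r: "strict_mono r"
      have "\<exists>r' l. strict_mono r' \<and> (\<forall>i\<in>N. (\<lambda>n. b (r (r' n)) i / s (r (r' n))) \<longlonglongrightarrow> l i)"
      proof (rule finite_index_convergent_subseq[OF N(1), of "\<lambda>n i. b (r n) i / s (r n)"], intro exI[of _ 1] allI)
        fix i n assume "i \<in> N"
        then show "\<bar>b (r n) i / s (r n)\<bar> \<le> 1" using b0[of i "r n"] s(1)[of "r n"] by (simp add: abs_divide)
      qed
      then obtain r' l where r': "strict_mono r'" and l: "\<And>i. i \<in> N \<Longrightarrow> (\<lambda>n. b (r (r' n)) i / s (r (r' n))) \<longlonglongrightarrow> l i"
        by blast
      define \<sigma> where "\<sigma> = r \<circ> r'"
      have \<sigma>: "strict_mono \<sigma>" unfolding \<sigma>_def by (rule strict_mono_o[OF r r'])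
      have lim_s: "filterlim (\<lambda>n. s (\<sigma> n)) (at_right 0) sequentially"
        unfolding filterlim_at using LIMSEQ_subseq_LIMSEQ[OF s(2) \<sigma>] s(1)
        by (auto simp: o_def less_imp_neq[symmetric])
      define v where "v = (\<Sum>i\<in>N. l i *\<^sub>R needle_effect i)"
      have sum_lim: "(\<lambda>n. \<Sum>i\<in>N. (b (\<sigma> n) i / s (\<sigma> n)) *\<^sub>R needle_effect i) \<longlonglongrightarrow> v"
        unfolding v_def \<sigma>_def o_def by (intro tendsto_sum tendsto_scaleR l tendsto_const)
      have "(\<lambda>n. (1 / s (\<sigma> n)) *\<^sub>R (ya (b (\<sigma> n)) T - z T - (\<Sum>i\<in>N. b (\<sigma> n) i *\<^sub>R needle_effect i))) \<longlonglongrightarrow> 0"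
        using LIMSEQ_subseq_LIMSEQ[OF L \<sigma>] by (simp add: o_def)
      from tendsto_add[OF this sum_lim]
      have w: "(\<lambda>n. (1 / s (\<sigma> n)) *\<^sub>R (ya (b (\<sigma> n)) T - z T)) \<longlonglongrightarrow> v"
        by (simp add: scaleR_diff_right scaleR_sum_right)
      have "(\<lambda>n. (1 / s (\<sigma> n)) *\<^sub>R (\<Phi> k (ya (b (\<sigma> n)) T) - \<Phi> k (z T))) \<longlonglongrightarrow> D k v"
        using hadamard_seq[OF D[OF k] lim_s w] s(1) by (simp add: less_imp_neq[symmetric])
      moreover have "(\<lambda>n. D k (\<Sum>i\<in>N. (b (\<sigma> n) i / s (\<sigma> n)) *\<^sub>R needle_effect i)) \<longlonglongrightarrow> D k v"
        by (intro blinfun.tendsto tendsto_const sum_lim)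
      ultimately have "(\<lambda>n. (1 / s (\<sigma> n)) *\<^sub>R (\<Phi> k (ya (b (\<sigma> n)) T) - \<Phi> k (z T))
          - D k (\<Sum>i\<in>N. (b (\<sigma> n) i / s (\<sigma> n)) *\<^sub>R needle_effect i)) \<longlonglongrightarrow> D k v - D k v" by (rule tendsto_diff)
      then have "(\<lambda>n. X (\<sigma> n)) \<longlonglongrightarrow> 0"
        by (simp add: X_def blinfun.sum_right blinfun.scaleR_right diff_divide_distrib sum_divide_distrib)
      then show "\<exists>r'. strict_mono r' \<and> (\<lambda>n. X (r (r' n))) \<longlonglongrightarrow> 0" using r' by (auto simp: \<sigma>_def)
    qed
    then show "(\<lambda>n. (\<Phi> k (ya (b n) T) - \<Phi> k (z T) - (\<Sum>i\<in>N. b n i * D k (needle_effect i))) / sum (b n) N) \<longlonglongrightarrow> 0"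
      unfolding X_def s_def .
  qed
qed

end

section \<open>From Gateaux differentials to local Lipschitz bounds\<close>

lemma compact_insert_limit:
  fixes f :: "nat \<Rightarrow> 'a::topological_space"
  assumes "f \<longlonglongrightarrow> l"
  shows "compact (insert l (range f))"
proof (rule compactI)
  fix C assume C: "\<forall>t\<in>C. open t" "insert l (range f) \<subseteq> \<Union>C"
  then obtain S where S: "S \<in> C" "l \<in> S" by blast
  then have "eventually (\<lambda>n. f n \<in> S) sequentially" using C(1) assms topological_tendstoD by blast
  then obtain N where N: "\<And>n. N \<le> n \<Longrightarrow> f n \<in> S" unfolding eventually_sequentially by blast
  have "\<forall>n. \<exists>t. t \<in> C \<and> f n \<in> t" using C(2) by blast
  from choice[OF this] obtain t where t: "\<forall>n. t n \<in> C \<and> f n \<in> t n" by (elim exE)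
  have "insert l (range f) \<subseteq> \<Union>(insert S (t ` {..<N}))"
  proof -
    have "f n \<in> \<Union>(insert S (t ` {..<N}))" for n
      using N[of n] t by (cases "N \<le> n") auto
    then show ?thesis using S by auto
  qed
  then show "\<exists>C'\<subseteq>C. finite C' \<and> insert l (range f) \<subseteq> \<Union>C'"
    using S t by (intro exI[of _ "insert S (t ` {..<N})"]) auto
qed

text \<open>Linearity of the differential turns the right variation in the direction -v into the
  left derivative in the direction v, so the one-sided definition already yields two-sided
  derivatives along lines.\<close>

lemma gateaux_two_sided:
  assumes "has_gateaux F D a"
  shows "((\<lambda>\<theta>. F (a + \<theta> *\<^sub>R v)) has_vector_derivative D v) (at 0)"
proof -
  define g where "g = (\<lambda>h. (1 / h) *\<^sub>R (F (a + h *\<^sub>R v) - F a))"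
  have R: "(g \<longlongrightarrow> D v) (at_right 0)"
    using assms by (simp add: has_gateaux_def has_right_variation_def g_def)
  have "((\<lambda>h. - ((1 / h) *\<^sub>R (F (a + h *\<^sub>R (- v)) - F a))) \<longlongrightarrow> - D (- v)) (at_right 0)"
    using assms by (intro tendsto_minus) (simp only: has_gateaux_def has_right_variation_def)
  then have "((\<lambda>h. g (- h)) \<longlongrightarrow> D v) (at_right 0)" by (simp add: g_def blinfun.minus_right)
  then have "(g \<longlongrightarrow> D v) (at_left 0)" by (simp add: filterlim_at_left_to_right)
  then have "(g \<longlongrightarrow> D v) (at 0)" using R by (simp add: filterlim_at_split)
  then have L: "((\<lambda>h. norm (g h - D v)) \<longlongrightarrow> 0) (at 0)"
    using Lim_null tendsto_norm_zero by blast
  have "((\<lambda>h. norm (F (a + (0 + h) *\<^sub>R v) - F (a + 0 *\<^sub>R v) - h *\<^sub>R D v) / norm h) \<longlongrightarrow> 0) (at 0)"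
  proof (rule Lim_transform_eventually[OF L])
    have "norm (g h - D v) = norm (F (a + (0 + h) *\<^sub>R v) - F (a + 0 *\<^sub>R v) - h *\<^sub>R D v) / norm h" if "h \<noteq> 0" for h
    proof -
      have "g h - D v = (1 / h) *\<^sub>R (F (a + h *\<^sub>R v) - F a - h *\<^sub>R D v)"
        using that by (simp add: g_def scaleR_diff_right)
      then show ?thesis by (simp add: divide_inverse mult.commute)
    qed
    then show "eventually (\<lambda>h. norm (g h - D v) = norm (F (a + (0 + h) *\<^sub>R v) - F (a + 0 *\<^sub>R v) - h *\<^sub>R D v) / norm h) (at 0)"
      by (auto simp: eventually_at_filter)
  qed
  then show ?thesis
    unfolding has_vector_derivative_def has_derivative_at by (simp add: bounded_linear_scaleR_left)
qed

text \<open>The mean value inequality along a segment, where only directional derivatives in the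
  direction of the segment matter.\<close>

lemma gateaux_segment_bound:
  fixes F :: "'a::real_normed_vector \<Rightarrow> 'b::real_normed_vector"
  assumes gat: "\<And>s. s \<in> {0..1} \<Longrightarrow> has_gateaux F (D s) (a + s *\<^sub>R v)"
    and bound: "\<And>s. s \<in> {0..1} \<Longrightarrow> norm (D s v) \<le> B"
  shows "norm (F (a + v) - F a) \<le> B"
proof -
  define g where "g s = F (a + s *\<^sub>R v)" for s
  have "(g has_derivative (\<lambda>h. h *\<^sub>R D s v)) (at s within {0..1})" if s: "s \<in> {0..1}" for s
  proof -
    have "((\<lambda>\<theta>. F (a + s *\<^sub>R v + \<theta> *\<^sub>R v)) has_vector_derivative D s v) (at ((\<lambda>r. r - s) s))"
      using gateaux_two_sided[OF gat[OF s], of v] by simp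
    moreover have "((\<lambda>r. r - s) has_vector_derivative 1) (at s)"
      unfolding has_real_derivative_iff_has_vector_derivative[symmetric] by (auto intro!: derivative_eq_intros)
    ultimately have "((\<lambda>\<theta>. F (a + s *\<^sub>R v + \<theta> *\<^sub>R v)) \<circ> (\<lambda>r. r - s) has_vector_derivative 1 *\<^sub>R D s v) (at s)"
      by (intro vector_diff_chain_at)
    moreover have "(\<lambda>\<theta>. F (a + s *\<^sub>R v + \<theta> *\<^sub>R v)) \<circ> (\<lambda>r. r - s) = g"
      by (auto simp: g_def algebra_simps)
    ultimately have "(g has_vector_derivative D s v) (at s)" by simp
    then show ?thesis unfolding has_vector_derivative_def by (rule has_derivative_at_withinI)
  qed
  moreover have "onorm (\<lambda>h. h *\<^sub>R D s v) \<le> B" if "s \<in> {0..1}" for s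
    using bound[OF that] by (intro onorm_le order_trans[OF _ mult_right_mono[OF bound[OF that]]]) (auto simp: mult.commute)
  ultimately have "norm (g 1 - g 0) \<le> B * norm (1 - 0 :: real)"
    by (intro differentiable_bound[of "{0..1}"]) auto
  then show ?thesis by (simp add: g_def)
qed

context pos_time
begin

text \<open>If the differentials were unbounded near the trajectory, they would be unbounded on a convergent
  sequence together with its limit, which is a compact set.\<close>

lemma local_lipschitz_near_trajectory:
  fixes \<phi> :: "real \<Rightarrow> 'x::real_normed_vector \<Rightarrow> 'y::metric_space \<Rightarrow> 'b::real_normed_vector"
  assumes x: "continuous_on {0..T} x" "x ` {0..T} \<subseteq> \<Omega>" and \<Omega>: "open \<Omega>"
    and gat: "\<And>t \<xi> \<zeta>. t \<in> {0..T} \<Longrightarrow> \<xi> \<in> \<Omega> \<Longrightarrow> \<zeta> \<in> U \<Longrightarrow> gateaux_differentiable (\<lambda>\<xi>'. \<phi> t \<xi>' \<zeta>) \<xi>"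
    and bdd: "\<And>K. K \<noteq> {} \<Longrightarrow> compact K \<Longrightarrow> K \<subseteq> \<Omega> \<times> U \<Longrightarrow>
         bdd_above ((\<lambda>(t, \<xi>, \<zeta>). norm (DG (\<lambda>\<xi>'. \<phi> t \<xi>' \<zeta>) \<xi>)) ` ({0..T} \<times> K))"
    and C: "compact C" "C \<subseteq> U"
  shows "\<exists>r>0. \<exists>M\<ge>0. \<forall>t\<in>{0..T}. cball (x t) r \<subseteq> \<Omega> \<and>
    (\<forall>\<zeta>\<in>C. \<forall>\<xi>1\<in>cball (x t) r. \<forall>\<xi>2\<in>cball (x t) r. norm (\<phi> t \<xi>1 \<zeta> - \<phi> t \<xi>2 \<zeta>) \<le> M * norm (\<xi>1 - \<xi>2))"
proof -
  define X where "X = x ` {0..T}"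
  have X: "compact X" "X \<subseteq> \<Omega>" unfolding X_def using x by (auto intro: compact_continuous_image)
  obtain r0 where r0: "0 < r0" "(\<Union>a\<in>X. cball a r0) \<subseteq> \<Omega>"
    using compact_subset_open_imp_cball_epsilon_subset[OF X(1) \<Omega> X(2)] by blast
  define N where "N t \<xi> \<zeta> = norm (DG (\<lambda>\<xi>'. \<phi> t \<xi>' \<zeta>) \<xi>)" for t \<xi> \<zeta>
  \<comment> \<open>Radius and bound depend on the same n, so failure for every n yields points
    approaching the trajectory with unbounded differentials. The centre a ranges over the whole
    range of x independently of t; no limit of the times is taken, since the bound on a compact set
    is uniform in t.\<close>
  have "\<exists>n::nat. \<forall>t\<in>{0..T}. \<forall>a\<in>X. \<forall>\<zeta>\<in>C. \<forall>\<xi>\<in>cball a (r0 / real (Suc n)). N t \<xi> \<zeta> \<le> real n"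
  proof (rule ccontr)
    assume "\<not> ?thesis"
    then have "\<forall>n. \<exists>p. fst p \<in> {0..T} \<and> fst (snd p) \<in> X \<and> fst (snd (snd p)) \<in> C \<and>
        snd (snd (snd p)) \<in> cball (fst (snd p)) (r0 / real (Suc n)) \<and> \<not> N (fst p) (snd (snd (snd p))) (fst (snd (snd p))) \<le> real n"
      by (metis fst_conv snd_conv)
    from choice[OF this] obtain p where p: "\<forall>n. fst (p n) \<in> {0..T} \<and> fst (snd (p n)) \<in> X \<and> fst (snd (snd (p n))) \<in> C \<and>
        snd (snd (snd (p n))) \<in> cball (fst (snd (p n))) (r0 / real (Suc n)) \<and>
        \<not> N (fst (p n)) (snd (snd (snd (p n)))) (fst (snd (snd (p n)))) \<le> real n" by (elim exE)
    define tt aa zz xx where "tt n = fst (p n)" and "aa n = fst (snd (p n))" and "zz n = fst (snd (snd (p n)))"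
      and "xx n = snd (snd (snd (p n)))" for n
    have q: "tt n \<in> {0..T}" "aa n \<in> X" "zz n \<in> C" "dist (aa n) (xx n) \<le> r0 / real (Suc n)" "real n < N (tt n) (xx n) (zz n)" for n
      using p[rule_format, of n] by (auto simp: tt_def aa_def zz_def xx_def)
    have sc: "seq_compact (X \<times> C)" by (intro compact_imp_seq_compact compact_Times X C)
    obtain l r where l: "l \<in> X \<times> C" "strict_mono r" "((\<lambda>n. (aa n, zz n)) \<circ> r) \<longlonglongrightarrow> l"
      by (rule seq_compactE[OF sc, of "\<lambda>n. (aa n, zz n)"]) (use q(2,3) in auto)
    have la: "(\<lambda>n. aa (r n)) \<longlonglongrightarrow> fst l" "(\<lambda>n. zz (r n)) \<longlonglongrightarrow> snd l"
      using tendsto_fst[OF l(3)] tendsto_snd[OF l(3)] by (auto simp: o_def)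
    have "(\<lambda>n. r0 / real (Suc n)) \<longlonglongrightarrow> 0"
      using tendsto_mult_right_zero[OF LIMSEQ_inverse_real_of_nat, of r0] by (simp add: divide_inverse)
    from LIMSEQ_subseq_LIMSEQ[OF this l(2)] have "(\<lambda>n. r0 / real (Suc (r n))) \<longlonglongrightarrow> 0" by (simp add: o_def)
    then have "(\<lambda>n. dist (xx (r n)) (aa (r n))) \<longlonglongrightarrow> 0"
      by (rule Lim_null_comparison[rotated]) (use q(4) in \<open>auto intro!: always_eventually simp: dist_commute\<close>)
    then have "(\<lambda>n. xx (r n) - aa (r n)) \<longlonglongrightarrow> 0" unfolding dist_norm by (rule tendsto_norm_zero_cancel)
    from tendsto_add[OF this la(1)] have "(\<lambda>n. xx (r n)) \<longlonglongrightarrow> fst l" by simp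
    from tendsto_Pair[OF this la(2)] have lim: "(\<lambda>n. (xx (r n), zz (r n))) \<longlonglongrightarrow> l" by simp
    define K where "K = insert l (range (\<lambda>n. (xx (r n), zz (r n))))"
    have "xx n \<in> \<Omega>" for n
    proof -
      have "r0 / real (Suc n) \<le> r0" using r0(1) by (simp add: divide_le_eq)
      then have "xx n \<in> cball (aa n) r0" using q(4)[of n] by simp
      then show ?thesis using r0(2) q(2) by blast
    qed
    then have "K \<subseteq> \<Omega> \<times> U" unfolding K_def using l(1) X C q(3) by auto
    moreover have "compact K" unfolding K_def by (rule compact_insert_limit[OF lim])
    ultimately have "bdd_above ((\<lambda>(t, \<xi>, \<zeta>). N t \<xi> \<zeta>) ` ({0..T} \<times> K))"
      unfolding N_def by (intro bdd) (auto simp: K_def)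
    then obtain B where B: "\<And>y. y \<in> (\<lambda>(t, \<xi>, \<zeta>). N t \<xi> \<zeta>) ` ({0..T} \<times> K) \<Longrightarrow> y \<le> B" unfolding bdd_above_def by blast
    obtain n :: nat where n: "B < real n" using reals_Archimedean2 by blast
    have "N (tt (r n)) (xx (r n)) (zz (r n)) \<in> (\<lambda>(t, \<xi>, \<zeta>). N t \<xi> \<zeta>) ` ({0..T} \<times> K)"
      using q(1)[of "r n"] by (intro image_eqI[of _ _ "(tt (r n), xx (r n), zz (r n))"]) (auto simp: K_def)
    from B[OF this] have "real (r n) < B" using q(5)[of "r n"] by linarith
    moreover have "n \<le> r n" by (rule seq_suble[OF l(2)])
    ultimately show False using n by linarith
  qed
  then obtain n where n: "\<And>t a \<zeta> \<xi>. t \<in> {0..T} \<Longrightarrow> a \<in> X \<Longrightarrow> \<zeta> \<in> C \<Longrightarrow> \<xi> \<in> cball a (r0 / real (Suc n)) \<Longrightarrow> N t \<xi> \<zeta> \<le> real n"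
    by blast
  define r where "r = r0 / real (Suc n)"
  have r: "0 < r" "r \<le> r0" using r0(1) by (auto simp: r_def divide_le_eq)
  have ball: "cball (x t) r \<subseteq> \<Omega>" if "t \<in> {0..T}" for t
  proof -
    have "cball (x t) r \<subseteq> cball (x t) r0" using r by (simp add: subset_cball)
    also have "\<dots> \<subseteq> \<Omega>" using r0(2) that unfolding X_def by blast
    finally show ?thesis .
  qed
  have "norm (\<phi> t \<xi>1 \<zeta> - \<phi> t \<xi>2 \<zeta>) \<le> real n * norm (\<xi>1 - \<xi>2)"
    if t: "t \<in> {0..T}" and \<zeta>: "\<zeta> \<in> C" and \<xi>: "\<xi>1 \<in> cball (x t) r" "\<xi>2 \<in> cball (x t) r" for t \<zeta> \<xi>1 \<xi>2
  proof -
    define p where "p s = \<xi>2 + s *\<^sub>R (\<xi>1 - \<xi>2)" for s :: real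
    have p: "p s \<in> cball (x t) r" if "s \<in> {0..1}" for s
    proof -
      have "p s = (1 - s) *\<^sub>R \<xi>2 + s *\<^sub>R \<xi>1" by (simp add: p_def algebra_simps)
      then show ?thesis using convexD[OF convex_cball \<xi>(2,1), of "1 - s" s] that by simp
    qed
    have "norm (\<phi> t (\<xi>2 + (\<xi>1 - \<xi>2)) \<zeta> - \<phi> t \<xi>2 \<zeta>) \<le> real n * norm (\<xi>1 - \<xi>2)"
    proof (rule gateaux_segment_bound[where F = "\<lambda>\<xi>. \<phi> t \<xi> \<zeta>" and D = "\<lambda>s. DG (\<lambda>\<xi>'. \<phi> t \<xi>' \<zeta>) (p s)"])
      fix s :: real assume s: "s \<in> {0..1}"
      have "gateaux_differentiable (\<lambda>\<xi>'. \<phi> t \<xi>' \<zeta>) (p s)"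
        by (rule gat) (use t \<zeta> C p[OF s] ball[OF t] in auto)
      then show "has_gateaux (\<lambda>\<xi>. \<phi> t \<xi> \<zeta>) (DG (\<lambda>\<xi>'. \<phi> t \<xi>' \<zeta>) (p s)) (\<xi>2 + s *\<^sub>R (\<xi>1 - \<xi>2))"
        unfolding gateaux_differentiable_def p_def using DG_eq by metis
      have "N t (p s) \<zeta> \<le> real n" by (rule n[OF t _ \<zeta>]) (use t p[OF s] in \<open>auto simp: X_def r_def\<close>)
      then show "norm (DG (\<lambda>\<xi>'. \<phi> t \<xi>' \<zeta>) (p s) (\<xi>1 - \<xi>2)) \<le> real n * norm (\<xi>1 - \<xi>2)"
        unfolding N_def by (intro order_trans[OF norm_blinfun mult_right_mono]) auto
    qed
    then show ?thesis by simp
  qed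
  then show ?thesis using r(1) ball by (intro exI[of _ r] conjI exI[of _ "real n"]) auto
qed

section \<open>Measurability and integrals on [0,T]\<close>

lemma pcw_borel_measurable:
  fixes f :: "real \<Rightarrow> 'a::metric_space"
  assumes "pcw T W f"
  shows "f \<in> borel_measurable (m1 T)"
proof -
  obtain S where S: "finite S" "\<And>t. t \<in> {0<..<T} - S \<Longrightarrow> isCont f t"
    using assms unfolding pcw_def by blast
  \<comment> \<open>Extending by a constant outside [0,T] gives a function on the line that is
    continuous off a finite set and hence Borel.\<close>
  define g where "g t = (if t \<in> {0..T} then f t else f 0)" for t
  have "continuous_on (- (S \<union> {0, T})) g"
  proof (rule continuous_at_imp_continuous_on, rule ballI)
    fix t assume t: "t \<in> - (S \<union> {0, T})"
    then consider "t < 0" | "0 < t" "t < T" | "T < t" by fastforce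
    then show "isCont g t"
    proof cases
      case 1
      have "eventually (\<lambda>s. s \<in> {..<0}) (nhds t)" using 1 by (intro eventually_nhds_in_open) auto
      then have "eventually (\<lambda>s. g s = f 0) (nhds t)" by eventually_elim (auto simp: g_def)
      from isCont_cong[OF this] show ?thesis by simp
    next
      case 2
      have "eventually (\<lambda>s. s \<in> {0<..<T}) (nhds t)" using 2 by (intro eventually_nhds_in_open) auto
      then have "eventually (\<lambda>s. g s = f s) (nhds t)" by eventually_elim (auto simp: g_def)
      from isCont_cong[OF this] show ?thesis using S(2)[of t] t 2 by simp
    next
      case 3
      have "eventually (\<lambda>s. s \<in> {T<..}) (nhds t)" using 3 by (intro eventually_nhds_in_open) auto
      then have "eventually (\<lambda>s. g s = f 0) (nhds t)" by eventually_elim (auto simp: g_def)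
      from isCont_cong[OF this] show ?thesis by simp
    qed
  qed
  then have "g \<in> borel_measurable borel"
    by (rule borel_measurable_continuous_countable_exceptions[rotated]) (use S in \<open>auto intro: countable_finite\<close>)
  then have "g \<in> borel_measurable (m1 T)" unfolding m1_def by (simp add: measurable_restrict_space1)
  then show ?thesis
    by (rule measurable_cong[THEN iffD1, rotated]) (auto simp: g_def m1_def space_restrict_space)
qed

lemma space_m1 [simp]: "space (m1 T) = {0..T}"
  by (simp add: m1_def space_restrict_space)

lemma finite_measure_m1: "finite_measure (m1 T)"
  unfolding m1_def by (rule finite_measureI) (use T_pos in \<open>simp add: emeasure_restrict_space space_restrict_space\<close>)

lemma m1_integrable_pcw:
  fixes f :: "real \<Rightarrow> real"
  assumes "pcw T W f"
  shows "integrable (m1 T) f"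
proof -
  obtain B where "\<And>t. t \<in> {0..T} \<Longrightarrow> norm (f t) \<le> B" using pcw_bounded[OF assms] by metis
  then have "AE t in m1 T. norm (f t) \<le> B" by (intro AE_I2) simp
  then show ?thesis
    by (rule finite_measure.integrable_const_bound[OF finite_measure_m1 _ pcw_borel_measurable[OF assms]])
qed

text \<open>Trajectories are handled with the gauge integral, the objective and its differential
  with the Lebesgue integral; this passes between them.\<close>

lemma m1_integral_eq:
  fixes f :: "real \<Rightarrow> real"
  assumes "integrable (m1 T) f"
  shows "f integrable_on {0..T}" "integral {0..T} f = (\<integral>t. f t \<partial>(m1 T))"
proof -
  have "set_integrable lborel {0..T} f"
    using assms unfolding m1_def set_integrable_def by (subst (asm) integrable_restrict_space) auto
  from set_borel_integral_eq_integral[OF this]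
  show "f integrable_on {0..T}" "integral {0..T} f = (\<integral>t. f t \<partial>(m1 T))"
    unfolding m1_def set_lebesgue_integral_def by (auto simp: integral_restrict_space)
qed

end

section \<open>Injections and projections of a product as bounded linear maps\<close>

definition inlB :: "'a::real_normed_vector \<Rightarrow>\<^sub>L ('a \<times> 'b::real_normed_vector)" where "inlB = Blinfun (\<lambda>a. (a, 0))"
definition inrB :: "'b::real_normed_vector \<Rightarrow>\<^sub>L ('a::real_normed_vector \<times> 'b)" where "inrB = Blinfun (\<lambda>b. (0, b))"
definition fstB :: "('a::real_normed_vector \<times> 'b::real_normed_vector) \<Rightarrow>\<^sub>L 'a" where "fstB = Blinfun fst"
definition sndB :: "('a::real_normed_vector \<times> 'b::real_normed_vector) \<Rightarrow>\<^sub>L 'b" where "sndB = Blinfun snd"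

lemma pair_blinfuns [simp]: "inlB a = (a, 0)" "inrB b = (0, b)" "fstB p = fst p" "sndB p = snd p"
  unfolding inlB_def inrB_def fstB_def sndB_def
  by (simp_all add: bounded_linear_Blinfun_apply bounded_linear_fst bounded_linear_snd bounded_linear_Pair bounded_linear_ident bounded_linear_zero)

section \<open>The maximum principle at a fixed parameter\<close>

text \<open>Everything that concerns one value of the parameter. Independence of the endpoint
  functionals is required at this very value; for parameters near \<pi>0 it is obtained by
  perturbation from (CVT1).\<close>

locale bolza_optimum = pos_time T for T :: real +
  fixes \<Omega> :: "'x::banach set" and U :: "'y::real_normed_vector set" and \<xi>0 :: 'x and m q :: nat
    and f0 :: "real \<Rightarrow> 'x \<Rightarrow> 'y \<Rightarrow> 'z \<Rightarrow> real" and f :: "real \<Rightarrow> 'x \<Rightarrow> 'y \<Rightarrow> 'z \<Rightarrow> 'x"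
    and g h :: "nat \<Rightarrow> 'x \<Rightarrow> 'z \<Rightarrow> real" and \<pi> :: 'z and x :: "real \<Rightarrow> 'x" and u :: "real \<Rightarrow> 'y"
  assumes \<Omega>: "open \<Omega>" and U: "open U" and q: "1 \<le> q"
    and sol: "bolza_solution T \<Omega> U \<xi>0 m q f0 f g h \<pi> x u"
    and f0_cont: "continuous_on ({0..T} \<times> \<Omega> \<times> U) (\<lambda>(t, \<xi>, \<zeta>). f0 t \<xi> \<zeta> \<pi>)"
    and f0_gat: "\<And>t \<xi> \<zeta>. t \<in> {0..T} \<Longrightarrow> \<xi> \<in> \<Omega> \<Longrightarrow> \<zeta> \<in> U \<Longrightarrow> gateaux_differentiable (\<lambda>\<xi>'. f0 t \<xi>' \<zeta> \<pi>) \<xi>"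
    and f0_bdd: "\<And>K. K \<noteq> {} \<Longrightarrow> compact K \<Longrightarrow> K \<subseteq> \<Omega> \<times> U \<Longrightarrow>
         bdd_above ((\<lambda>(t, \<xi>, \<zeta>). norm (DG (\<lambda>\<xi>'. f0 t \<xi>' \<zeta> \<pi>) \<xi>)) ` ({0..T} \<times> K))"
    and f0_diff: "\<And>t \<zeta>. t \<in> {0..T} \<Longrightarrow> \<zeta> \<in> U \<Longrightarrow> (\<lambda>\<xi>. f0 t \<xi> \<zeta> \<pi>) differentiable (at (x t))"
    and f0_DF: "continuous_on ({0..T} \<times> U) (\<lambda>(t, \<zeta>). DF (\<lambda>\<xi>. f0 t \<xi> \<zeta> \<pi>) (x t))"
    and f_cont: "continuous_on ({0..T} \<times> \<Omega> \<times> U) (\<lambda>(t, \<xi>, \<zeta>). f t \<xi> \<zeta> \<pi>)"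
    and f_gat: "\<And>t \<xi> \<zeta>. t \<in> {0..T} \<Longrightarrow> \<xi> \<in> \<Omega> \<Longrightarrow> \<zeta> \<in> U \<Longrightarrow> gateaux_differentiable (\<lambda>\<xi>'. f t \<xi>' \<zeta> \<pi>) \<xi>"
    and f_bdd: "\<And>K. K \<noteq> {} \<Longrightarrow> compact K \<Longrightarrow> K \<subseteq> \<Omega> \<times> U \<Longrightarrow>
         bdd_above ((\<lambda>(t, \<xi>, \<zeta>). norm (DG (\<lambda>\<xi>'. f t \<xi>' \<zeta> \<pi>) \<xi>)) ` ({0..T} \<times> K))"
    and f_diff: "\<And>t \<zeta>. t \<in> {0..T} \<Longrightarrow> \<zeta> \<in> U \<Longrightarrow> (\<lambda>\<xi>. f t \<xi> \<zeta> \<pi>) differentiable (at (x t))"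
    and f_DF: "continuous_on ({0..T} \<times> U) (\<lambda>(t, \<zeta>). DF (\<lambda>\<xi>. f t \<xi> \<zeta> \<pi>) (x t))"
    and g_had: "\<And>i. i \<in> {0..m} \<Longrightarrow> hadamard_differentiable (\<lambda>\<xi>. g i \<xi> \<pi>) (x T)"
    and h_had: "\<And>j. j \<in> {1..q} \<Longrightarrow> hadamard_differentiable (\<lambda>\<xi>. h j \<xi> \<pi>) (x T)"
    and h_cont: "\<And>j. j \<in> {1..q} \<Longrightarrow> \<exists>N. open N \<and> x T \<in> N \<and> N \<subseteq> \<Omega> \<and> continuous_on N (\<lambda>\<xi>. h j \<xi> \<pi>)"
    and f0_had: "hadamard_differentiable (\<lambda>\<zeta>. f0 T (x T) \<zeta> \<pi>) (u T)"
    and f_had: "hadamard_differentiable (\<lambda>\<zeta>. f T (x T) \<zeta> \<pi>) (u T)"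
    and indep: "lin_indep_family ({1..m} <+> {1..q})
         (\<lambda>k. DH (\<lambda>\<xi>. (case k of Inl i \<Rightarrow> g i | Inr j \<Rightarrow> h j) \<xi> \<pi>) (x T) o\<^sub>L DH (\<lambda>\<zeta>. f T (x T) \<zeta> \<pi>) (u T))"
begin

definition "Dg i = DH (\<lambda>\<xi>. g i \<xi> \<pi>) (x T)"
definition "Dh j = DH (\<lambda>\<xi>. h j \<xi> \<pi>) (x T)"
definition "A0 t \<zeta> = DF (\<lambda>\<xi>. f0 t \<xi> \<zeta> \<pi>) (x t)"
definition "A t \<zeta> = DF (\<lambda>\<xi>. f t \<xi> \<zeta> \<pi>) (x t)"

lemma A0_deriv: "t \<in> {0..T} \<Longrightarrow> \<zeta> \<in> U \<Longrightarrow> ((\<lambda>\<xi>. f0 t \<xi> \<zeta> \<pi>) has_derivative A0 t \<zeta>) (at (x t))"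
  unfolding A0_def by (rule differentiable_DF[OF f0_diff])

lemma A_deriv: "t \<in> {0..T} \<Longrightarrow> \<zeta> \<in> U \<Longrightarrow> ((\<lambda>\<xi>. f t \<xi> \<zeta> \<pi>) has_derivative A t \<zeta>) (at (x t))"
  unfolding A_def by (rule differentiable_DF[OF f_diff])

lemma A_cont: "continuous_on ({0..T} \<times> U) (\<lambda>(t, \<zeta>). A t \<zeta>)" "continuous_on ({0..T} \<times> U) (\<lambda>(t, \<zeta>). A0 t \<zeta>)"
  using f_DF f0_DF unfolding A_def A0_def by auto

lemma x_PC1: "x \<in> PC1 T \<Omega>" and u_NPC: "u \<in> NPC0R T U"
  and x_ode: "t \<in> {0..T} \<Longrightarrow> ext_deriv T x t = f t (x t) (u t) \<pi>" and x_0: "x 0 = \<xi>0"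
  and g_feas: "i \<in> {1..m} \<Longrightarrow> 0 \<le> g i (x T) \<pi>" and h_feas: "j \<in> {1..q} \<Longrightarrow> h j (x T) \<pi> = 0"
  and optimal: "(y, w) \<in> bolza_admissible T \<Omega> U \<xi>0 m q f g h \<pi> \<Longrightarrow>
    bolza_objective T f0 g \<pi> y w \<le> bolza_objective T f0 g \<pi> x u"
  using sol unfolding bolza_solution_def bolza_admissible_def by auto

lemma x_cont: "continuous_on {0..T} x" and x_in: "t \<in> {0..T} \<Longrightarrow> x t \<in> \<Omega>"
  using PC1_D(1,2)[OF x_PC1] by auto

lemma u_pcw: "pcw T U u" and u_rcont: "rcont T u" and u_in: "t \<in> {0..T} \<Longrightarrow> u t \<in> U"
  using u_NPC by (auto simp: NPC0R_iff pcw_def)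

lemma f_along_cont:
  assumes "continuous_on {0..T} y" "y ` {0..T} \<subseteq> \<Omega>"
  shows "continuous_on ({0..T} \<times> U) (\<lambda>z. f (fst z) (y (fst z)) (snd z) \<pi>)"
    "continuous_on ({0..T} \<times> U) (\<lambda>z. f0 (fst z) (y (fst z)) (snd z) \<pi>)"
proof -
  have p: "continuous_on ({0..T} \<times> U) (\<lambda>z. (fst z, y (fst z), snd z))"
    by (intro continuous_intros continuous_on_compose2[OF assms(1)]) auto
  have i: "(\<lambda>z. (fst z, y (fst z), snd z)) ` ({0..T} \<times> U) \<subseteq> {0..T} \<times> \<Omega> \<times> U" using assms by auto
  show "continuous_on ({0..T} \<times> U) (\<lambda>z. f (fst z) (y (fst z)) (snd z) \<pi>)"
    using continuous_on_compose2[OF f_cont p i] by simp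
  show "continuous_on ({0..T} \<times> U) (\<lambda>z. f0 (fst z) (y (fst z)) (snd z) \<pi>)"
    using continuous_on_compose2[OF f0_cont p i] by simp
qed

lemma f_along_pcw:
  assumes "continuous_on {0..T} y" "y ` {0..T} \<subseteq> \<Omega>" "pcw T U w"
  shows "pcw T UNIV (\<lambda>t. f t (y t) (w t) \<pi>)" "rcont T w \<Longrightarrow> rcont T (\<lambda>t. f t (y t) (w t) \<pi>)"
    "pcw T UNIV (\<lambda>t. f0 t (y t) (w t) \<pi>)" "rcont T w \<Longrightarrow> rcont T (\<lambda>t. f0 t (y t) (w t) \<pi>)"
  using pcw_compose(1,2)[OF assms(3) f_along_cont(1)[OF assms(1,2)]]
    pcw_compose(1,2)[OF assms(3) f_along_cont(2)[OF assms(1,2)]] by auto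

lemma A_pcw: "pcw T UNIV (\<lambda>t. A t (u t))" "rcont T (\<lambda>t. A t (u t))"
   "pcw T UNIV (\<lambda>t. A0 t (u t))" "rcont T (\<lambda>t. A0 t (u t))"
  using pcw_compose(1,2)[OF u_pcw A_cont(1)] pcw_compose(1,2)[OF u_pcw A_cont(2)] u_rcont by auto

text \<open>In the Mayer form of the problem the running cost is an additional real state.\<close>

definition FE :: "real \<Rightarrow> 'x \<times> real \<Rightarrow> 'y \<Rightarrow> 'x \<times> real" where
  "FE t z \<zeta> = (f t (fst z) \<zeta> \<pi>, f0 t (fst z) \<zeta> \<pi>)"
definition "zE t = (x t, integral {0..t} (\<lambda>s. f0 s (x s) (u s) \<pi>))"
text \<open>The accumulated cost does not act back on the state, so the column belonging to it is
  zero. This is what makes the cost component of the extended costate constant.\<close>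

definition AX :: "real \<Rightarrow> 'y \<Rightarrow> ('x \<times> real) \<Rightarrow>\<^sub>L ('x \<times> real)" where
  "AX t \<zeta> = (inlB o\<^sub>L (A t \<zeta> o\<^sub>L fstB)) + (inrB o\<^sub>L (A0 t \<zeta> o\<^sub>L fstB))"

lemma AX_apply [simp]: "AX t \<zeta> v = (A t \<zeta> (fst v), A0 t \<zeta> (fst v))"
  by (simp add: AX_def blinfun.add_left)

lemma AX_pcw: "pcw T UNIV (\<lambda>t. AX t (u t))"
proof -
  have "continuous_on ({0..T} \<times> U) (\<lambda>(t, \<zeta>). AX t \<zeta>)"
    using A_cont unfolding AX_def split_def
    by (intro continuous_intros bounded_bilinear.continuous_on[OF bounded_bilinear_blinfun_compose]) auto
  from pcw_compose(1)[OF u_pcw this] show ?thesis by simp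
qed

lemma zE_PC1: "zE \<in> PC1 T (\<Omega> \<times> UNIV)" and zE_ode: "t \<in> {0..T} \<Longrightarrow> ext_deriv T zE t = FE t (zE t) (u t)"
proof -
  have xW: "x ` {0..T} \<subseteq> \<Omega>" using x_in by auto
  note pc = f_along_pcw[OF x_cont xW u_pcw]
  obtain S1 where S1: "finite S1" "\<forall>t\<in>{0<..<T} - S1. (x has_vector_derivative ext_deriv T x t) (at t)"
    using PC1_D(5)[OF x_PC1] by (elim exE conjE)
  obtain S2 where S2: "finite S2" "\<forall>t\<in>{0<..<T} - S2. ((\<lambda>t. integral {0..t} (\<lambda>s. f0 s (x s) (u s) \<pi>)) has_vector_derivative f0 t (x t) (u t) \<pi>) (at t)"
    using integral_pcw_antiderivative(2)[OF pc(3)] by (elim exE conjE)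
  have FE: "FE t (zE t) (u t) = (f t (x t) (u t) \<pi>, f0 t (x t) (u t) \<pi>)" for t by (simp add: FE_def zE_def)
  have d: "(zE has_vector_derivative FE t (zE t) (u t)) (at t)" if "t \<in> {0<..<T} - (S1 \<union> S2)" for t
    unfolding FE unfolding zE_def
    using bspec[OF S1(2), of t] bspec[OF S2(2), of t] x_ode[of t] that
    by (intro has_vector_derivative_Pair) simp_all
  have c: "continuous_on {0..T} zE" unfolding zE_def
    by (intro continuous_intros x_cont integral_pcw_antiderivative(1)[OF pc(3)])
  have k: "pcw T UNIV (\<lambda>t. FE t (zE t) (u t))" "rcont T (\<lambda>t. FE t (zE t) (u t))"
    unfolding FE using pcw_Pair[OF pc(1,3)] rcont_Pair[OF pc(2)[OF u_rcont] pc(4)[OF u_rcont]] by simp_all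
  have W: "zE ` {0..T} \<subseteq> \<Omega> \<times> UNIV" using x_in by (auto simp: zE_def)
  show "zE \<in> PC1 T (\<Omega> \<times> UNIV)" "t \<in> {0..T} \<Longrightarrow> ext_deriv T zE t = FE t (zE t) (u t)"
    using PC1_I[OF W finite_UnI[OF S1(1) S2(1)] c d k] by auto
qed

lemma FE_cont: "continuous_on ({0..T} \<times> (\<Omega> \<times> UNIV) \<times> U) (\<lambda>(t, z, \<zeta>). FE t z \<zeta>)"
proof -
  have p: "continuous_on ({0..T} \<times> (\<Omega> \<times> (UNIV :: real set)) \<times> U) (\<lambda>p. (fst p, fst (fst (snd p)), snd (snd p)))"
    by (intro continuous_intros)
  have i: "(\<lambda>p. (fst p, fst (fst (snd p)), snd (snd p))) ` ({0..T} \<times> (\<Omega> \<times> (UNIV :: real set)) \<times> U) \<subseteq> {0..T} \<times> \<Omega> \<times> U"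
    by auto
  from continuous_on_Pair[OF continuous_on_compose2[OF f_cont p i] continuous_on_compose2[OF f0_cont p i]]
  show ?thesis by (simp add: FE_def split_def)
qed

lemma FE_lip:
  assumes C: "compact C" "C \<subseteq> U" "C \<noteq> {}"
  shows "\<exists>r>0. \<exists>M\<ge>0. \<forall>t\<in>{0..T}. cball (zE t) r \<subseteq> \<Omega> \<times> UNIV \<and>
    (\<forall>\<zeta>\<in>C. \<forall>z1\<in>cball (zE t) r. \<forall>z2\<in>cball (zE t) r. norm (FE t z1 \<zeta> - FE t z2 \<zeta>) \<le> M * norm (z1 - z2))"
proof -
  have xW: "x ` {0..T} \<subseteq> \<Omega>" using x_in by auto
  have "\<exists>r>0. \<exists>M\<ge>0. \<forall>t\<in>{0..T}. cball (x t) r \<subseteq> \<Omega> \<and>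
    (\<forall>\<zeta>\<in>C. \<forall>\<xi>1\<in>cball (x t) r. \<forall>\<xi>2\<in>cball (x t) r. norm (f t \<xi>1 \<zeta> \<pi> - f t \<xi>2 \<zeta> \<pi>) \<le> M * norm (\<xi>1 - \<xi>2))"
    by (rule local_lipschitz_near_trajectory[OF x_cont xW \<Omega> _ _ C(1,2)]; (rule f_gat f_bdd); assumption)
  then obtain r1 M1 where 1: "r1 > 0" "M1 \<ge> 0" "\<forall>t\<in>{0..T}. cball (x t) r1 \<subseteq> \<Omega> \<and>
    (\<forall>\<zeta>\<in>C. \<forall>\<xi>1\<in>cball (x t) r1. \<forall>\<xi>2\<in>cball (x t) r1. norm (f t \<xi>1 \<zeta> \<pi> - f t \<xi>2 \<zeta> \<pi>) \<le> M1 * norm (\<xi>1 - \<xi>2))"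
    by (elim exE conjE)
  have "\<exists>r>0. \<exists>M\<ge>0. \<forall>t\<in>{0..T}. cball (x t) r \<subseteq> \<Omega> \<and>
    (\<forall>\<zeta>\<in>C. \<forall>\<xi>1\<in>cball (x t) r. \<forall>\<xi>2\<in>cball (x t) r. norm (f0 t \<xi>1 \<zeta> \<pi> - f0 t \<xi>2 \<zeta> \<pi>) \<le> M * norm (\<xi>1 - \<xi>2))"
    by (rule local_lipschitz_near_trajectory[OF x_cont xW \<Omega> _ _ C(1,2)]; (rule f0_gat f0_bdd); assumption)
  then obtain r2 M2 where 2: "r2 > 0" "M2 \<ge> 0" "\<forall>t\<in>{0..T}. cball (x t) r2 \<subseteq> \<Omega> \<and>
    (\<forall>\<zeta>\<in>C. \<forall>\<xi>1\<in>cball (x t) r2. \<forall>\<xi>2\<in>cball (x t) r2. norm (f0 t \<xi>1 \<zeta> \<pi> - f0 t \<xi>2 \<zeta> \<pi>) \<le> M2 * norm (\<xi>1 - \<xi>2))"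
    by (elim exE conjE)
  define r where "r = min r1 r2"
  have b: "fst z \<in> cball (x t) r1 \<and> fst z \<in> cball (x t) r2" if "z \<in> cball (zE t) r" for z t
    using that dist_fst_le[of "zE t" z] by (auto simp: zE_def r_def)
  show ?thesis
  proof (rule exI[of _ r], rule conjI, simp add: r_def 1(1) 2(1), rule exI[of _ "M1 + M2"], intro conjI ballI)
    show "0 \<le> M1 + M2" using 1 2 by auto
    fix t assume t: "t \<in> {0..T}"
    show "cball (zE t) r \<subseteq> \<Omega> \<times> UNIV"
    proof
      fix z assume "z \<in> cball (zE t) r"
      then have "fst z \<in> \<Omega>" using b 1(3) t by blast
      then show "z \<in> \<Omega> \<times> UNIV" by (cases z) auto
    qed
    fix \<zeta> z1 z2 assume z: "\<zeta> \<in> C" "z1 \<in> cball (zE t) r" "z2 \<in> cball (zE t) r"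
    have "norm (FE t z1 \<zeta> - FE t z2 \<zeta>) \<le> norm (f t (fst z1) \<zeta> \<pi> - f t (fst z2) \<zeta> \<pi>) + norm (f0 t (fst z1) \<zeta> \<pi> - f0 t (fst z2) \<zeta> \<pi>)"
      unfolding FE_def diff_Pair by (rule norm_Pair_le)
    also have "\<dots> \<le> M1 * norm (fst z1 - fst z2) + M2 * norm (fst z1 - fst z2)"
      using 1(3) 2(3) t z b by (intro add_mono) auto
    also have "\<dots> = (M1 + M2) * norm (fst (z1 - z2))" by (simp add: algebra_simps)
    also have "\<dots> \<le> (M1 + M2) * norm (z1 - z2)"
    proof (rule mult_left_mono)
      show "norm (fst (z1 - z2)) \<le> norm (z1 - z2)" by (metis norm_fst_le prod.collapse)
    qed (use 1(2) 2(2) in simp)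
    finally show "norm (FE t z1 \<zeta> - FE t z2 \<zeta>) \<le> (M1 + M2) * norm (z1 - z2)" .
  qed
qed

lemma FE_deriv:
  assumes t: "t \<in> {0..T}" and \<zeta>: "\<zeta> \<in> U"
  shows "((\<lambda>z. FE t z \<zeta>) has_derivative AX t \<zeta>) (at (zE t))"
proof -
  have "((\<lambda>z. f t (fst z) \<zeta> \<pi>) has_derivative (\<lambda>v. A t \<zeta> (fst v))) (at (zE t))"
    by (rule has_derivative_compose[where f = fst and g = "\<lambda>\<xi>. f t \<xi> \<zeta> \<pi>"])
      (use A_deriv[OF t \<zeta>] in \<open>auto simp: zE_def intro!: derivative_eq_intros\<close>)
  moreover have "((\<lambda>z. f0 t (fst z) \<zeta> \<pi>) has_derivative (\<lambda>v. A0 t \<zeta> (fst v))) (at (zE t))"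
    by (rule has_derivative_compose[where f = fst and g = "\<lambda>\<xi>. f0 t \<xi> \<zeta> \<pi>"])
      (use A0_deriv[OF t \<zeta>] in \<open>auto simp: zE_def intro!: derivative_eq_intros\<close>)
  ultimately have "((\<lambda>z. FE t z \<zeta>) has_derivative (\<lambda>v. (A t \<zeta> (fst v), A0 t \<zeta> (fst v)))) (at (zE t))"
    unfolding FE_def by (rule has_derivative_Pair)
  moreover have "(\<lambda>v. (A t \<zeta> (fst v), A0 t \<zeta> (fst v))) = blinfun_apply (AX t \<zeta>)" by auto
  ultimately show ?thesis by simp
qed

lemma AX_cont: "continuous_on ({0..T} \<times> U) (\<lambda>(t, \<zeta>). AX t \<zeta>)"
  using A_cont unfolding AX_def split_def
  by (intro continuous_intros bounded_bilinear.continuous_on[OF bounded_bilinear_blinfun_compose]) auto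

text \<open>The second coordinate starts at zero and integrates the running cost, so its final value
  is the integral in the objective; an endpoint comparison in the extended problem becomes a
  comparison of objectives.\<close>

lemma objective_eq:
  assumes y: "y \<in> PC1 T (\<Omega> \<times> UNIV)" and w: "w \<in> NPC0R T U"
    and ode: "\<forall>t\<in>{0..T}. ext_deriv T y t = FE t (y t) (w t)" and y0: "y 0 = zE 0"
  shows "(\<lambda>t. fst (y t)) \<in> PC1 T \<Omega>" "\<forall>t\<in>{0..T}. ext_deriv T (\<lambda>t. fst (y t)) t = f t (fst (y t)) (w t) \<pi>"
    "bolza_objective T f0 g \<pi> (\<lambda>t. fst (y t)) w = snd (y T) + g 0 (fst (y T)) \<pi>"
proof -
  have wp: "pcw T U w" "rcont T w" using w by (auto simp: NPC0R_iff)
  have yc: "continuous_on {0..T} (\<lambda>t. fst (y t))" by (intro continuous_intros PC1_D(1)[OF y])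
  have yW: "(\<lambda>t. fst (y t)) ` {0..T} \<subseteq> \<Omega>" using PC1_D(2)[OF y] by auto
  note pc = f_along_pcw[OF yc yW wp(1)]
  obtain S where S: "finite S" "\<forall>t\<in>{0<..<T} - S. (y has_vector_derivative ext_deriv T y t) (at t)"
    using PC1_D(5)[OF y] by (elim exE conjE)
  have d1: "((\<lambda>t. fst (y t)) has_vector_derivative f t (fst (y t)) (w t) \<pi>) (at t)"
    and d2: "((\<lambda>t. snd (y t)) has_vector_derivative f0 t (fst (y t)) (w t) \<pi>) (at t)"
    if "t \<in> {0<..<T} - S" for t
  proof -
    have d: "(y has_vector_derivative FE t (y t) (w t)) (at t)" using S(2) ode that by force
    from bounded_linear.has_vector_derivative[OF bounded_linear_fst d]
    show "((\<lambda>t. fst (y t)) has_vector_derivative f t (fst (y t)) (w t) \<pi>) (at t)" by (simp add: FE_def)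
    from bounded_linear.has_vector_derivative[OF bounded_linear_snd d]
    show "((\<lambda>t. snd (y t)) has_vector_derivative f0 t (fst (y t)) (w t) \<pi>) (at t)" by (simp add: FE_def)
  qed
  show "(\<lambda>t. fst (y t)) \<in> PC1 T \<Omega>" "\<forall>t\<in>{0..T}. ext_deriv T (\<lambda>t. fst (y t)) t = f t (fst (y t)) (w t) \<pi>"
    using PC1_I[OF yW S(1) yc d1 pc(1) pc(2)[OF wp(2)]] by auto
  have "continuous_on {0..T} (\<lambda>t. snd (y t))" by (intro continuous_intros PC1_D(1)[OF y])
  from antiderivative_eq_integral[OF S(1) this d2, of 0 T] T_pos
  have "((\<lambda>t. f0 t (fst (y t)) (w t) \<pi>) has_integral snd (y T) - snd (y 0)) {0..T}" by simp
  then have "integral {0..T} (\<lambda>t. f0 t (fst (y t)) (w t) \<pi>) = snd (y T)"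
    using y0 by (auto simp: zE_def dest: integral_unique)
  then show "bolza_objective T f0 g \<pi> (\<lambda>t. fst (y t)) w = snd (y T) + g 0 (fst (y T)) \<pi>"
    unfolding bolza_objective_def using m1_integral_eq(2)[OF m1_integrable_pcw[OF pc(3)]] by simp
qed

definition \<Phi> :: "nat + nat \<Rightarrow> 'x \<times> real \<Rightarrow> real" where
  "\<Phi> k z = (case k of Inl i \<Rightarrow> (if i = 0 then snd z else 0) + g i (fst z) \<pi> | Inr j \<Rightarrow> h j (fst z) \<pi>)"
definition D\<Phi> :: "nat + nat \<Rightarrow> ('x \<times> real) \<Rightarrow>\<^sub>L real" where
  "D\<Phi> k = (case k of Inl i \<Rightarrow> (if i = 0 then sndB else 0) + (Dg i o\<^sub>L fstB) | Inr j \<Rightarrow> Dh j o\<^sub>L fstB)"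

lemma g_hadamard: "i \<in> {0..m} \<Longrightarrow> has_hadamard (\<lambda>\<xi>. g i \<xi> \<pi>) (Dg i) (x T)"
  and h_hadamard: "j \<in> {1..q} \<Longrightarrow> has_hadamard (\<lambda>\<xi>. h j \<xi> \<pi>) (Dh j) (x T)"
  using g_had h_had by (auto simp: hadamard_differentiable_iff Dg_def Dh_def)

lemma \<Phi>_hadamard:
  assumes "k \<in> {0..m} <+> {1..q}"
  shows "has_hadamard (\<Phi> k) (D\<Phi> k) (zE T)"
proof -
  have fst_z: "fst (zE T) = x T" by (simp add: zE_def)
  have g: "has_hadamard (\<lambda>z. g i (fst z) \<pi>) (Dg i o\<^sub>L fstB) (zE T)" if "i \<in> {0..m}" for i
    by (rule has_hadamard_affine[where j = fst and F = "\<lambda>\<xi>. g i \<xi> \<pi>"]) (use g_hadamard[OF that] fst_z in auto)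
  have h: "has_hadamard (\<lambda>z. h j (fst z) \<pi>) (Dh j o\<^sub>L fstB) (zE T)" if "j \<in> {1..q}" for j
    by (rule has_hadamard_affine[where j = fst and F = "\<lambda>\<xi>. h j \<xi> \<pi>"]) (use h_hadamard[OF that] fst_z in auto)
  have g0: "has_hadamard (\<lambda>z. snd z + g 0 (fst z) \<pi>) (sndB + (Dg 0 o\<^sub>L fstB)) (zE T)"
  proof -
    have g': "has_hadamard (\<lambda>z. g 0 (fst z) \<pi>) (Dg 0 o\<^sub>L fstB) (zE T)" by (rule g) simp
    have "((\<lambda>(\<theta>, w). (1 / \<theta>) *\<^sub>R (snd (zE T + \<theta> *\<^sub>R w) + g 0 (fst (zE T + \<theta> *\<^sub>R w)) \<pi> - (snd (zE T) + g 0 (fst (zE T)) \<pi>)))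
        \<longlongrightarrow> snd v + (Dg 0 o\<^sub>L fstB) v) (at_right 0 \<times>\<^sub>F nhds v)" for v
    proof -
      have "((\<lambda>p. snd (snd p)) \<longlongrightarrow> snd v) (at_right (0::real) \<times>\<^sub>F nhds v)"
        by (intro tendsto_snd filterlim_snd)
      moreover have "((\<lambda>(\<theta>, w). (1 / \<theta>) *\<^sub>R (g 0 (fst (zE T + \<theta> *\<^sub>R w)) \<pi> - g 0 (fst (zE T)) \<pi>))
        \<longlongrightarrow> (Dg 0 o\<^sub>L fstB) v) (at_right 0 \<times>\<^sub>F nhds v)"
        using g' unfolding has_hadamard_def by blast
      ultimately have L: "((\<lambda>p. snd (snd p) + (case p of (\<theta>, w) \<Rightarrow> (1 / \<theta>) *\<^sub>R (g 0 (fst (zE T + \<theta> *\<^sub>R w)) \<pi> - g 0 (fst (zE T)) \<pi>)))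
        \<longlongrightarrow> snd v + (Dg 0 o\<^sub>L fstB) v) (at_right 0 \<times>\<^sub>F nhds v)" by (rule tendsto_add)
      have f1: "filterlim fst (at_right 0) (at_right (0::real) \<times>\<^sub>F nhds v)" by (rule filterlim_fst)
      have "eventually (\<lambda>\<theta>. \<theta> \<noteq> 0) (at_right (0::real))" by (simp add: eventually_at_filter)
      then have "eventually (\<lambda>p. fst p \<noteq> 0) (at_right (0::real) \<times>\<^sub>F nhds v)"
        using f1 unfolding filterlim_iff by blast
      then show ?thesis
        by (intro Lim_transform_eventually[OF L]) (auto elim!: eventually_mono simp: field_simps)
    qed
    moreover have "has_gateaux (\<lambda>z. snd z + g 0 (fst z) \<pi>) (sndB + (Dg 0 o\<^sub>L fstB)) (zE T)"
      unfolding has_gateaux_def has_right_variation_def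
    proof
      fix v
      have "((\<lambda>\<theta>. (1 / \<theta>) *\<^sub>R (g 0 (fst (zE T + \<theta> *\<^sub>R v)) \<pi> - g 0 (fst (zE T)) \<pi>)) \<longlongrightarrow> (Dg 0 o\<^sub>L fstB) v) (at_right 0)"
        using g' by (simp add: has_hadamard_def has_gateaux_def has_right_variation_def)
      from tendsto_add[OF tendsto_const[of "snd v"] this]
      have L: "((\<lambda>\<theta>. snd v + (1 / \<theta>) *\<^sub>R (g 0 (fst (zE T + \<theta> *\<^sub>R v)) \<pi> - g 0 (fst (zE T)) \<pi>)) \<longlongrightarrow> snd v + (Dg 0 o\<^sub>L fstB) v) (at_right 0)" .
      have "eventually (\<lambda>\<theta>. \<theta> \<noteq> 0) (at_right (0::real))" by (simp add: eventually_at_filter)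
      then have "((\<lambda>\<theta>. (1 / \<theta>) *\<^sub>R (snd (zE T + \<theta> *\<^sub>R v) + g 0 (fst (zE T + \<theta> *\<^sub>R v)) \<pi> - (snd (zE T) + g 0 (fst (zE T)) \<pi>)))
          \<longlongrightarrow> snd v + (Dg 0 o\<^sub>L fstB) v) (at_right 0)"
        by (intro Lim_transform_eventually[OF L]) (auto elim!: eventually_mono simp: field_simps)
      then show "((\<lambda>\<theta>. (1 / \<theta>) *\<^sub>R (snd (zE T + \<theta> *\<^sub>R v) + g 0 (fst (zE T + \<theta> *\<^sub>R v)) \<pi> - (snd (zE T) + g 0 (fst (zE T)) \<pi>)))
          \<longlongrightarrow> (sndB + (Dg 0 o\<^sub>L fstB)) v) (at_right 0)" by (simp add: blinfun.add_left)
    qed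
    ultimately show ?thesis by (simp add: has_hadamard_def blinfun.add_left)
  qed
  show ?thesis
  proof (cases k)
    case (Inl i)
    then have "i \<in> {0..m}" using assms by auto
    then show ?thesis using g[of i] g0 Inl by (cases "i = 0") (auto simp: \<Phi>_def[abs_def] D\<Phi>_def)
  next
    case (Inr j)
    then have "j \<in> {1..q}" using assms by auto
    then show ?thesis using h[of j] Inr by (auto simp: \<Phi>_def[abs_def] D\<Phi>_def)
  qed
qed

text \<open>The outcome of the multiplier rule before it is rewritten through a costate. The
  resolvent stays a parameter, so that the condition is visibly preserved when c is multiplied by a
  positive number.\<close>

definition multipliers :: "(nat + nat \<Rightarrow> real) \<Rightarrow> (real \<Rightarrow> ('x \<times> real) \<Rightarrow>\<^sub>L ('x \<times> real)) \<Rightarrow> real set \<Rightarrow> bool" where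
  "multipliers c P S \<longleftrightarrow> continuous_on {0..T} P \<and> P T = id_blinfun \<and> finite S \<and>
    (\<forall>t\<in>{0<..<T} - S. (P has_vector_derivative - (P t o\<^sub>L AX t (u t))) (at t)) \<and>
    (\<exists>k\<in>{0..m} <+> {1..q}. c k \<noteq> 0) \<and> (\<forall>i\<in>{0..m}. 0 \<le> c (Inl i)) \<and> (\<forall>i\<in>{1..m}. c (Inl i) * g i (x T) \<pi> = 0) \<and>
    (\<forall>t\<in>{0..<T}. \<forall>v\<in>U. (\<Sum>k\<in>{0..m} <+> {1..q}. c k * D\<Phi> k (P t (FE t (zE t) v - FE t (zE t) (u t)))) \<le> 0)"

lemma multipliers_exist: "\<exists>c P S. multipliers c P S"
proof -
  obtain P S where P: "continuous_on {0..T} P" "P T = id_blinfun" "finite S"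
    "\<And>t. t \<in> {0<..<T} - S \<Longrightarrow> (P has_vector_derivative - (P t o\<^sub>L AX t (u t))) (at t)"
    using adjoint_resolvent_exists[OF AX_pcw] by blast
  interpret cs: control_system T "\<Omega> \<times> UNIV" U FE zE u AX P S
    by unfold_locales (fact T_pos FE_cont FE_deriv AX_cont zE_PC1 u_NPC zE_ode P | erule (2) FE_lip)+
  have fz: "fst (zE T) = x T" by (simp add: zE_def)
  have "\<exists>c. (\<exists>k\<in>{0..m} <+> {1..q}. c k \<noteq> 0) \<and> (\<forall>i\<in>{0..m}. 0 \<le> c (Inl i)) \<and> (\<forall>i\<in>{1..m}. c (Inl i) * \<Phi> (Inl i) (zE T) = 0) \<and>
     (\<forall>i\<in>{0..<T} \<times> U. (\<Sum>k\<in>{0..m} <+> {1..q}. c k * D\<Phi> k (cs.needle_effect i)) \<le> 0)"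
  proof (rule cs.mayer_multipliers[OF q \<Phi>_hadamard])
    show "\<exists>N. open N \<and> zE T \<in> N \<and> continuous_on N (\<Phi> (Inr j))" if j: "j \<in> {1..q}" for j
    proof -
      obtain N where N: "open N" "x T \<in> N" "continuous_on N (\<lambda>\<xi>. h j \<xi> \<pi>)" using h_cont[OF j] by blast
      have "continuous_on (N \<times> UNIV) (\<lambda>z :: 'x \<times> real. h j (fst z) \<pi>)"
        by (rule continuous_on_compose2[OF N(3)]) (auto intro: continuous_intros)
      then show ?thesis using N fz
        by (intro exI[of _ "N \<times> UNIV"]) (auto simp: \<Phi>_def[abs_def] zE_def intro: open_Times)
    qed
    show "0 \<le> \<Phi> (Inl i) (zE T)" if "i \<in> {1..m}" for i using g_feas[OF that] that by (auto simp: \<Phi>_def fz)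
    show "\<Phi> (Inr j) (zE T) = 0" if "j \<in> {1..q}" for j using h_feas[OF that] by (simp add: \<Phi>_def fz)
    fix y w assume y: "y \<in> PC1 T (\<Omega> \<times> UNIV)" "w \<in> NPC0R T U" "\<forall>t\<in>{0..T}. ext_deriv T y t = FE t (y t) (w t)" "y 0 = zE 0"
      and gi: "\<forall>i\<in>{1..m}. 0 \<le> \<Phi> (Inl i) (y T)" and hj: "\<forall>j\<in>{1..q}. \<Phi> (Inr j) (y T) = 0"
    note oe = objective_eq[OF y]
    have "\<forall>i\<in>{1..m}. 0 \<le> g i (fst (y T)) \<pi>"
    proof
      fix i assume i: "i \<in> {1..m}"
      then show "0 \<le> g i (fst (y T)) \<pi>" using bspec[OF gi i] by (simp add: \<Phi>_def)
    qed
    moreover have "\<forall>j\<in>{1..q}. h j (fst (y T)) \<pi> = 0" using hj by (simp add: \<Phi>_def)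
    moreover have "fst (y 0) = \<xi>0" using y(4) x_0 by (simp add: zE_def)
    ultimately have "((\<lambda>t. fst (y t)), w) \<in> bolza_admissible T \<Omega> U \<xi>0 m q f g h \<pi>"
      using oe(1,2) y(2) by (simp add: bolza_admissible_def)
    from optimal[OF this]
    have "snd (y T) + g 0 (fst (y T)) \<pi> \<le> bolza_objective T f0 g \<pi> x u" by (simp add: oe(3))
    moreover have "bolza_objective T f0 g \<pi> (\<lambda>t. fst (zE t)) u = snd (zE T) + g 0 (fst (zE T)) \<pi>"
      by (rule objective_eq(3)[OF zE_PC1 u_NPC]) (simp_all add: zE_ode)
    moreover have "(\<lambda>t. fst (zE t)) = x" by (simp add: zE_def)
    ultimately show "\<Phi> (Inl 0) (y T) \<le> \<Phi> (Inl 0) (zE T)" by (simp add: \<Phi>_def)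
  qed auto
  then obtain c where c: "\<exists>k\<in>{0..m} <+> {1..q}. c k \<noteq> 0" "\<forall>i\<in>{0..m}. 0 \<le> c (Inl i)"
    "\<forall>i\<in>{1..m}. c (Inl i) * \<Phi> (Inl i) (zE T) = 0"
    "\<forall>i\<in>{0..<T} \<times> U. (\<Sum>k\<in>{0..m} <+> {1..q}. c k * D\<Phi> k (cs.needle_effect i)) \<le> 0" by (elim exE conjE)
  have "c (Inl i) * g i (x T) \<pi> = 0" if i: "i \<in> {1..m}" for i
    using bspec[OF c(3) i] i by (auto simp: \<Phi>_def fz)
  moreover have "(\<Sum>k\<in>{0..m} <+> {1..q}. c k * D\<Phi> k (P t (FE t (zE t) v - FE t (zE t) (u t)))) \<le> 0"
    if "t \<in> {0..<T}" "v \<in> U" for t v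
    using bspec[OF c(4), of "(t, v)"] that by (simp add: cs.needle_effect_def)
  ultimately have "multipliers c P S" unfolding multipliers_def using P c(1,2) by blast
  then show ?thesis by blast
qed

section \<open>From multipliers to Pontryagin triples\<close>

lemma DF_hamiltonian:
  assumes "t \<in> {0..T}" "\<zeta> \<in> U"
  shows "DF (\<lambda>\<xi>. hamiltonian f0 f \<pi> t \<xi> \<zeta> p l) (x t) = (p o\<^sub>L A t \<zeta>) + l *\<^sub>R A0 t \<zeta>"
proof (rule DF_eq)
  have "((\<lambda>\<xi>. p (f t \<xi> \<zeta> \<pi>) + l * f0 t \<xi> \<zeta> \<pi>) has_derivative (\<lambda>v. p (A t \<zeta> v) + l * A0 t \<zeta> v)) (at (x t))"
    by (intro has_derivative_add bounded_linear.has_derivative[OF blinfun.bounded_linear_right]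
        has_derivative_mult_right A_deriv A0_deriv assms)
  moreover have "blinfun_apply ((p o\<^sub>L A t \<zeta>) + l *\<^sub>R A0 t \<zeta>) = (\<lambda>v. p (A t \<zeta> v) + l * A0 t \<zeta> v)"
    by (auto simp: blinfun.add_left blinfun.scaleR_left)
  ultimately show "((\<lambda>\<xi>. hamiltonian f0 f \<pi> t \<xi> \<zeta> p l) has_derivative blinfun_apply ((p o\<^sub>L A t \<zeta>) + l *\<^sub>R A0 t \<zeta>)) (at (x t))"
    by (simp add: hamiltonian_def)
qed

lemma hamiltonian_along_cont:
  assumes "continuous_on {0..T} p"
  shows "continuous_on ({0..T} \<times> U) (\<lambda>z. hamiltonian f0 f \<pi> (fst z) (x (fst z)) (snd z) (p (fst z)) l)"
  unfolding hamiltonian_def using x_in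
  by (intro continuous_intros bounded_bilinear.continuous_on[OF bounded_bilinear_blinfun_apply]
      f_along_cont x_cont continuous_on_compose2[OF assms]) auto

text \<open>At a jump of the control both of its one-sided values maximize the Hamiltonian.\<close>

lemma hamiltonian_continuous:
  assumes p: "continuous_on {0..T} p"
    and max: "\<forall>t\<in>{0..T}. \<forall>\<zeta>\<in>U. hamiltonian f0 f \<pi> t (x t) \<zeta> (p t) l \<le> hamiltonian f0 f \<pi> t (x t) (u t) (p t) l"
  shows "continuous_on {0..T} (\<lambda>t. hamiltonian f0 f \<pi> t (x t) (u t) (p t) l)"
proof -
  define H where "H z = hamiltonian f0 f \<pi> (fst z) (x (fst z)) (snd z) (p (fst z)) l" for z
  have Hc: "continuous_on ({0..T} \<times> U) H" unfolding H_def by (rule hamiltonian_along_cont[OF p])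
  have max: "H (t, \<zeta>) \<le> H (t, u t)" if "t \<in> {0..T}" "\<zeta> \<in> U" for t \<zeta> using max that by (simp add: H_def)
  have rc: "rcont T (\<lambda>t. H (t, u t))" by (rule pcw_compose(2)[OF u_pcw Hc u_rcont])
  have left: "((\<lambda>t. H (t, u t)) \<longlongrightarrow> H (t, u t)) (at_left t)" if t: "t \<in> {0<..T}" for t
  proof -
    have nb: "at_left t \<noteq> bot" by simp
    have ev: "eventually (\<lambda>s. s \<in> {0..T}) (at_left t)"
      unfolding eventually_at_left_field using t by (intro exI[of _ 0]) auto
    have key: "((\<lambda>s. H (s, w s)) \<longlongrightarrow> H (t, l)) (at_left t)"
      if "(w \<longlongrightarrow> l) (at_left t)" "l \<in> U" "\<And>s. s \<in> {0..T} \<Longrightarrow> w s \<in> U" for w l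
    proof (rule continuous_on_tendsto_compose[OF Hc])
      show "((\<lambda>s. (s, w s)) \<longlongrightarrow> (t, l)) (at_left t)" by (intro tendsto_Pair that tendsto_ident_at)
      show "\<forall>\<^sub>F s in at_left t. (s, w s) \<in> {0..T} \<times> U" using ev by eventually_elim (use that in auto)
    qed (use t that in auto)
    obtain l where l: "l \<in> U" "(u \<longlongrightarrow> l) (at_left t)" using u_pcw t unfolding pcw_def by blast
    have L: "((\<lambda>s. H (s, u s)) \<longlongrightarrow> H (t, l)) (at_left t)" by (rule key[OF l(2,1) u_in])
    have ut: "u t \<in> U" using u_in t by auto
    have C: "((\<lambda>s. H (s, u t)) \<longlongrightarrow> H (t, u t)) (at_left t)" by (rule key[OF tendsto_const ut ut])
    \<comment> \<open>Maximality before t against the constant value \<open>u t\<close> passes to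
      the limit; the opposite inequality is maximality at t against the value l, which belongs to
      U.\<close>
    have "H (t, u t) \<le> H (t, l)"
      by (rule tendsto_le[OF nb L C]) (use ev in \<open>eventually_elim, use max ut in auto\<close>)
    moreover have "H (t, l) \<le> H (t, u t)" using max l t by auto
    ultimately show ?thesis using L by simp
  qed
  have "continuous_on {0..T} (\<lambda>t. H (t, u t))"
  proof (rule continuous_on_IccI[OF _ _ _ T_pos])
    show "((\<lambda>t. H (t, u t)) \<longlongrightarrow> H (0, u 0)) (at_right 0)" using rc T_pos by (simp add: rcont_def)
    show "((\<lambda>t. H (t, u t)) \<longlongrightarrow> H (T, u T)) (at_left T)" by (rule left) (use T_pos in simp)
    show "(\<lambda>t. H (t, u t)) \<midarrow>t\<rightarrow> H (t, u t)" if "0 < t" "t < T" for t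
      using left[of t] rc that by (auto simp: filterlim_at_split rcont_def)
  qed
  then show ?thesis by (simp add: H_def)
qed

text \<open>The combined endpoint functional, pulled back by the resolvent, is a costate of the
  extended system. Its cost component is the constant \<open>c0\<close>, its state component is p,
  and the equation of the resolvent becomes the adjoint equation. The needle inequalities are the
  maximum condition before T.\<close>

lemma triple_of_multipliers:
  assumes "multipliers c P S"
  shows "\<exists>p. pontryagin_triple T U m q f0 f g h \<pi> x u (\<lambda>i. c (Inl i)) (\<lambda>j. c (Inr j)) p"
proof -
  note M = assms[unfolded multipliers_def]
  define J :: "(nat + nat) set" where "J = {0..m} <+> {1..q}"
  have J: "finite J" by (simp add: J_def)
  define L where "L = (\<Sum>k\<in>J. c k *\<^sub>R D\<Phi> k)"
  define pE where "pE t = L o\<^sub>L P t" for t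
  define p where "p t = pE t o\<^sub>L inlB" for t
  define c0 where "c0 = c (Inl 0)"
  have L_apply: "L v = (\<Sum>k\<in>J. c k * D\<Phi> k v)" for v
    by (simp add: L_def blinfun.sum_left blinfun.scaleR_left)
  have sumJ: "(\<Sum>k\<in>J. F k) = (\<Sum>i\<in>{0..m}. F (Inl i)) + (\<Sum>j\<in>{1..q}. F (Inr j))" for F :: "nat + nat \<Rightarrow> 'b::comm_monoid_add"
    unfolding J_def by (simp add: sum.Plus)
  have L01: "L (0, 1) = c0"
  proof -
    have "(\<Sum>i\<in>{0..m}. c (Inl i) * D\<Phi> (Inl i) (0, 1)) = (\<Sum>i\<in>{0..m}. if 0 = i then c0 else 0)"
      by (rule sum.cong) (auto simp: D\<Phi>_def blinfun.add_left blinfun.zero_right c0_def)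
    then show ?thesis unfolding L_apply sumJ by (simp add: D\<Phi>_def blinfun.zero_right)
  qed
  have Pc: "continuous_on {0..T} P" and PT: "P T = id_blinfun" and S: "finite S"
    and Pd: "\<And>t. t \<in> {0<..<T} - S \<Longrightarrow> (P has_vector_derivative - (P t o\<^sub>L AX t (u t))) (at t)" using M by auto
  have pEc: "continuous_on {0..T} pE" unfolding pE_def
    by (intro bounded_bilinear.continuous_on[OF bounded_bilinear_blinfun_compose] continuous_intros Pc)
  have pEd: "(pE has_vector_derivative (L o\<^sub>L (- (P t o\<^sub>L AX t (u t))))) (at t)" if "t \<in> {0<..<T} - S" for t
    unfolding pE_def
    by (rule bounded_linear.has_vector_derivative[OF bounded_bilinear.bounded_linear_right[OF bounded_bilinear_blinfun_compose] Pd[OF that]])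
  \<comment> \<open>The coefficient of the linearised extended system annihilates the direction (0,
    1), so this component has derivative zero off a finite set and keeps its terminal value.\<close>
  have const: "pE t (0, 1) = c0" if t: "t \<in> {0..T}" for t
  proof -
    have bl: "bounded_linear (\<lambda>Q :: ('x \<times> real) \<Rightarrow>\<^sub>L real. Q (0, 1))" by (rule blinfun.bounded_linear_left)
    have "((\<lambda>t. pE t (0, 1)) has_vector_derivative 0) (at t)" if "t \<in> {0<..<T} - S" for t
    proof -
      have z: "AX t (u t) (0, 1) = 0" by (simp add: blinfun.zero_right zero_prod_def)
      from bounded_linear.has_vector_derivative[OF bl pEd[OF that]]
      show ?thesis by (simp only: blinfun_apply_blinfun_compose blinfun.minus_left blinfun.minus_right z blinfun.zero_right minus_zero)
    qed
    moreover have "continuous_on {0..T} (\<lambda>t. pE t (0, 1))"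
      by (intro bounded_bilinear.continuous_on[OF bounded_bilinear_blinfun_apply] continuous_intros pEc)
    ultimately have "((\<lambda>_. 0) has_integral (pE T (0, 1) - pE t (0, 1))) {t..T}"
      using t by (intro antiderivative_eq_integral[OF S]) auto
    then have "pE T (0, 1) - pE t (0, 1) = 0" using has_integral_0 has_integral_unique by blast
    then show ?thesis using L01 PT by (simp add: pE_def)
  qed
  have pE_apply: "pE t (a, b) = p t a + c0 * b" if "t \<in> {0..T}" for t a b
  proof -
    have "(a, b) = (a, 0) + b *\<^sub>R ((0, 1) :: 'x \<times> real)" by simp
    then have "pE t (a, b) = pE t (a, 0) + b * pE t (0, 1)" by (simp only: blinfun.add_right blinfun.scaleR_right real_scaleR_def)
    then show ?thesis using const[OF that] by (simp add: p_def)
  qed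
  define k where "k t = - ((p t o\<^sub>L A t (u t)) + c0 *\<^sub>R A0 t (u t))" for t
  have pc: "continuous_on {0..T} p" unfolding p_def
    by (intro bounded_bilinear.continuous_on[OF bounded_bilinear_blinfun_compose] continuous_intros pEc)
  have pd: "(p has_vector_derivative k t) (at t)" if "t \<in> {0<..<T} - S" for t
  proof -
    have "(p has_vector_derivative ((L o\<^sub>L (- (P t o\<^sub>L AX t (u t)))) o\<^sub>L inlB)) (at t)"
      unfolding p_def
      by (rule bounded_linear.has_vector_derivative[OF bounded_bilinear.bounded_linear_left[OF bounded_bilinear_blinfun_compose] pEd[OF that]])
    moreover have "((L o\<^sub>L (- (P t o\<^sub>L AX t (u t)))) o\<^sub>L inlB) = k t"
    proof (rule blinfun_eqI)
      fix w
      have "((L o\<^sub>L (- (P t o\<^sub>L AX t (u t)))) o\<^sub>L inlB) w = - pE t (A t (u t) w, A0 t (u t) w)"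
        by (simp add: pE_def blinfun.minus_left blinfun.minus_right)
      also have "\<dots> = k t w" using that
        by (simp add: pE_apply k_def blinfun.minus_left blinfun.add_left blinfun.scaleR_left blinfun.diff_left)
      finally show "((L o\<^sub>L (- (P t o\<^sub>L AX t (u t)))) o\<^sub>L inlB) w = k t w" .
    qed
    ultimately show ?thesis by simp
  qed
  have k: "pcw T UNIV k" "rcont T k"
  proof -
    have c: "continuous_on UNIV (\<lambda>z :: ('x \<Rightarrow>\<^sub>L real) \<times> ('x \<Rightarrow>\<^sub>L 'x) \<times> ('x \<Rightarrow>\<^sub>L real). - ((fst z o\<^sub>L fst (snd z)) + c0 *\<^sub>R snd (snd z)))"
      by (intro continuous_intros bounded_bilinear.continuous_on[OF bounded_bilinear_blinfun_compose])
    have pp: "pcw T UNIV p" "rcont T p" using continuous_pcw[OF pc] by auto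
    have t3: "pcw T UNIV (\<lambda>t. (p t, A t (u t), A0 t (u t)))" "rcont T (\<lambda>t. (p t, A t (u t), A0 t (u t)))"
      using pcw_Pair[OF pp(1) pcw_Pair[OF A_pcw(1,3)]] rcont_Pair[OF pp(2) rcont_Pair[OF A_pcw(2,4)]] by auto
    show "pcw T UNIV k" "rcont T k" unfolding k_def using pcw_map[OF t3(1) c] t3(2) by simp_all
  qed
  have "p ` {0..T} \<subseteq> UNIV" by simp
  note pPC = PC1_I[OF this S pc pd k]
  have max: "hamiltonian f0 f \<pi> t (x t) v (p t) c0 \<le> hamiltonian f0 f \<pi> t (x t) (u t) (p t) c0"
    if t: "t \<in> {0..<T}" and v: "v \<in> U" for t v
  proof -
    have "pE t (FE t (zE t) v - FE t (zE t) (u t)) \<le> 0"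
      using M t v by (simp add: pE_def L_apply J_def)
    moreover have "FE t (zE t) v - FE t (zE t) (u t) = (f t (x t) v \<pi> - f t (x t) (u t) \<pi>, f0 t (x t) v \<pi> - f0 t (x t) (u t) \<pi>)"
      by (simp add: FE_def zE_def)
    ultimately show ?thesis using pE_apply t by (simp add: hamiltonian_def blinfun.diff_right algebra_simps)
  qed
  \<comment> \<open>Needles exist only at times before T. At T the maximum condition follows by left
    limits, because u is left-continuous there.\<close>
  have maxT: "hamiltonian f0 f \<pi> t (x t) v (p t) c0 \<le> hamiltonian f0 f \<pi> t (x t) (u t) (p t) c0"
    if t: "t \<in> {0..T}" and v: "v \<in> U" for t v
  proof (cases "t = T")
    case True
    have Hc: "continuous_on ({0..T} \<times> U) (\<lambda>z. hamiltonian f0 f \<pi> (fst z) (x (fst z)) (snd z) (p (fst z)) c0)"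
      by (rule hamiltonian_along_cont[OF pc])
    have "rcont T (\<lambda>t. hamiltonian f0 f \<pi> t (x t) (u t) (p t) c0)"
      using pcw_compose(2)[OF u_pcw Hc u_rcont] by simp
    moreover have "rcont T (\<lambda>t. hamiltonian f0 f \<pi> t (x t) v (p t) c0)"
    proof -
      have "pcw T U (\<lambda>_. v)" "rcont T (\<lambda>_. v)" using continuous_pcw[of "\<lambda>_. v" U] v by auto
      from pcw_compose(2)[OF this(1) Hc this(2)] show ?thesis by simp
    qed
    ultimately have lim: "((\<lambda>t. hamiltonian f0 f \<pi> t (x t) (u t) (p t) c0) \<longlongrightarrow> hamiltonian f0 f \<pi> T (x T) (u T) (p T) c0) (at_left T)"
      "((\<lambda>t. hamiltonian f0 f \<pi> t (x t) v (p t) c0) \<longlongrightarrow> hamiltonian f0 f \<pi> T (x T) v (p T) c0) (at_left T)"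
      unfolding rcont_def by auto
    have "eventually (\<lambda>t. t \<in> {0..<T}) (at_left T)"
      unfolding eventually_at_left_field using T_pos by (intro exI[of _ 0]) auto
    then have "eventually (\<lambda>t. hamiltonian f0 f \<pi> t (x t) v (p t) c0 \<le> hamiltonian f0 f \<pi> t (x t) (u t) (p t) c0) (at_left T)"
      by eventually_elim (use max v in auto)
    from tendsto_le[OF _ lim this] show ?thesis using True by simp
  qed (use max t v in auto)
  have "(\<Sum>i\<in>{0..m}. c (Inl i) *\<^sub>R DH (\<lambda>\<xi>. g i \<xi> \<pi>) (x T)) + (\<Sum>j\<in>{1..q}. c (Inr j) *\<^sub>R DH (\<lambda>\<xi>. h j \<xi> \<pi>) (x T)) = p T"
  proof (rule blinfun_eqI)
    fix w
    have "p T w = L (w, 0)" by (simp add: p_def pE_def PT)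
    also have "\<dots> = (\<Sum>i\<in>{0..m}. c (Inl i) * Dg i w) + (\<Sum>j\<in>{1..q}. c (Inr j) * Dh j w)"
    proof -
      have "D\<Phi> (Inl i) (w, 0) = Dg i w" "D\<Phi> (Inr j) (w, 0) = Dh j w" for i j
        by (simp_all add: D\<Phi>_def blinfun.add_left)
      then show ?thesis unfolding L_apply sumJ by simp
    qed
    finally show "((\<Sum>i\<in>{0..m}. c (Inl i) *\<^sub>R DH (\<lambda>\<xi>. g i \<xi> \<pi>) (x T)) + (\<Sum>j\<in>{1..q}. c (Inr j) *\<^sub>R DH (\<lambda>\<xi>. h j \<xi> \<pi>) (x T))) w = p T w"
      by (simp add: blinfun.add_left blinfun.sum_left blinfun.scaleR_left Dg_def Dh_def)
  qed
  moreover have "\<forall>t\<in>{0..T}. ext_deriv T p t = - DF (\<lambda>\<xi>. hamiltonian f0 f \<pi> t \<xi> (u t) (p t) c0) (x t)"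
    using pPC(2) by (simp add: DF_hamiltonian u_in k_def)
  moreover have "(\<exists>i\<in>{0..m}. c (Inl i) \<noteq> 0) \<or> (\<exists>j\<in>{1..q}. c (Inr j) \<noteq> 0)"
  proof -
    obtain k where "k \<in> {0..m} <+> {1..q}" "c k \<noteq> 0" using M by blast
    then show ?thesis by (cases k) auto
  qed
  moreover have "continuous_on {0..T} (\<lambda>t. hamiltonian f0 f \<pi> t (x t) (u t) (p t) c0)"
    by (rule hamiltonian_continuous[OF pc]) (use maxT in blast)
  ultimately have "pontryagin_triple T U m q f0 f g h \<pi> x u (\<lambda>i. c (Inl i)) (\<lambda>j. c (Inr j)) p"
    unfolding pontryagin_triple_def c0_def[symmetric] using pPC(1) M maxT by blast
  then show ?thesis by blast
qed

section \<open>Stationarity in the control, normality and uniqueness\<close>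

definition "f\<zeta> = DH (\<lambda>\<zeta>. f T (x T) \<zeta> \<pi>) (u T)"
definition "f0\<zeta> = DH (\<lambda>\<zeta>. f0 T (x T) \<zeta> \<pi>) (u T)"

definition endpoint_functional :: "nat + nat \<Rightarrow> 'y \<Rightarrow>\<^sub>L real" where
  "endpoint_functional k = (case k of Inl i \<Rightarrow> Dg i | Inr j \<Rightarrow> Dh j) o\<^sub>L f\<zeta>"

lemma endpoint_functional_indep:
  assumes "(\<Sum>k\<in>{1..m} <+> {1..q}. c k *\<^sub>R endpoint_functional k) = 0" "k \<in> {1..m} <+> {1..q}"
  shows "c k = 0"
proof -
  have eq: "(\<lambda>k. DH (\<lambda>\<xi>. (case k of Inl i \<Rightarrow> g i | Inr j \<Rightarrow> h j) \<xi> \<pi>) (x T) o\<^sub>L DH (\<lambda>\<zeta>. f T (x T) \<zeta> \<pi>) (u T)) = endpoint_functional"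
    by (auto simp: endpoint_functional_def Dg_def Dh_def f\<zeta>_def fun_eq_iff split: sum.split)
  show ?thesis using indep[unfolded eq] assms unfolding lin_indep_family_def by blast
qed

text \<open>As U is open, small moves of the control value in the directions v and -v are both
  allowed, and a maximum has nonpositive derivative in each of them. Evaluated at any time, this
  later removes the unknown variation of the control.\<close>

lemma triple_stationary_at:
  assumes triple: "pontryagin_triple T U m q f0 f g h \<pi> x u l \<mu> p" and t: "t \<in> {0..T}"
    and D1: "has_hadamard (\<lambda>\<zeta>. f t (x t) \<zeta> \<pi>) D1 (u t)" and D2: "has_hadamard (\<lambda>\<zeta>. f0 t (x t) \<zeta> \<pi>) D2 (u t)"
  shows "p t (D1 v) + l 0 * D2 v = 0"
proof -
  note M = triple[unfolded pontryagin_triple_def]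
  define H where "H \<zeta> = hamiltonian f0 f \<pi> t (x t) \<zeta> (p t) (l 0)" for \<zeta>
  have max: "H \<zeta> \<le> H (u t)" if "\<zeta> \<in> U" for \<zeta> using M t that by (simp add: H_def)
  have le: "p t (D1 v) + l 0 * D2 v \<le> 0" for v
  proof -
    have "((\<lambda>\<theta>. (1 / \<theta>) *\<^sub>R (f t (x t) (u t + \<theta> *\<^sub>R v) \<pi> - f t (x t) (u t) \<pi>)) \<longlongrightarrow> D1 v) (at_right 0)"
      "((\<lambda>\<theta>. (1 / \<theta>) *\<^sub>R (f0 t (x t) (u t + \<theta> *\<^sub>R v) \<pi> - f0 t (x t) (u t) \<pi>)) \<longlongrightarrow> D2 v) (at_right 0)"
      using D1 D2 unfolding has_hadamard_def has_gateaux_def has_right_variation_def by blast+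
    then have "((\<lambda>\<theta>. p t ((1 / \<theta>) *\<^sub>R (f t (x t) (u t + \<theta> *\<^sub>R v) \<pi> - f t (x t) (u t) \<pi>))
       + l 0 * ((1 / \<theta>) *\<^sub>R (f0 t (x t) (u t + \<theta> *\<^sub>R v) \<pi> - f0 t (x t) (u t) \<pi>))) \<longlongrightarrow> p t (D1 v) + l 0 * D2 v) (at_right 0)"
      by (intro tendsto_intros)
    then have L: "((\<lambda>\<theta>. (1 / \<theta>) * (H (u t + \<theta> *\<^sub>R v) - H (u t))) \<longlongrightarrow> p t (D1 v) + l 0 * D2 v) (at_right 0)"
      by (simp add: H_def hamiltonian_def blinfun.scaleR_right blinfun.diff_right
          diff_divide_distrib add_divide_distrib algebra_simps)
    have "((\<lambda>\<theta>. u t + \<theta> *\<^sub>R v) \<longlongrightarrow> u t) (at_right 0)" by (auto intro!: tendsto_eq_intros)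
    then have "eventually (\<lambda>\<theta>. u t + \<theta> *\<^sub>R v \<in> U) (at_right 0)"
      using U u_in[OF t] topological_tendstoD by blast
    moreover have "eventually (\<lambda>\<theta>. 0 < \<theta>) (at_right (0::real))" by (simp add: eventually_at_filter)
    ultimately have "eventually (\<lambda>\<theta>. (1 / \<theta>) * (H (u t + \<theta> *\<^sub>R v) - H (u t)) \<le> 0) (at_right 0)"
      by eventually_elim (use max in \<open>auto intro!: divide_nonpos_pos\<close>)
    then show ?thesis using tendsto_upperbound[OF L] by simp
  qed
  show ?thesis using le[of v] le[of "- v"] by (simp add: blinfun.minus_right)
qed

text \<open>Inserting the terminal condition for the costate into stationarity at T gives a linear
  equation for the multipliers of the constraints, with the cost on the right-hand side scaled by
  \<open>l 0\<close>. Its homogeneous case excludes abnormal triples, and the difference of two such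
  equations gives uniqueness.\<close>

lemma triple_stationary:
  assumes "pontryagin_triple T U m q f0 f g h \<pi> x u l \<mu> p"
  shows "(\<Sum>k\<in>{1..m} <+> {1..q}. (case k of Inl i \<Rightarrow> l i | Inr j \<Rightarrow> \<mu> j) *\<^sub>R endpoint_functional k) = - (l 0 *\<^sub>R ((Dg 0 o\<^sub>L f\<zeta>) + f0\<zeta>))"
proof -
  note M = assms[unfolded pontryagin_triple_def]
  have stat: "p T (f\<zeta> v) + l 0 * f0\<zeta> v = 0" for v
    by (rule triple_stationary_at[OF assms])
      (use T_pos f_had f0_had in \<open>auto simp: hadamard_differentiable_iff f\<zeta>_def f0\<zeta>_def\<close>)
  have pT: "p T = (\<Sum>i\<in>{0..m}. l i *\<^sub>R Dg i) + (\<Sum>j\<in>{1..q}. \<mu> j *\<^sub>R Dh j)" using M by (simp add: Dg_def Dh_def)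
  show ?thesis
  proof (rule blinfun_eqI)
    fix v
    have "{0..m} = insert 0 {1..m}" by auto
    then have "(\<Sum>i\<in>{0..m}. l i * Dg i (f\<zeta> v)) = l 0 * Dg 0 (f\<zeta> v) + (\<Sum>i\<in>{1..m}. l i * Dg i (f\<zeta> v))" by simp
    moreover note stat[of v]
    ultimately have "(\<Sum>i\<in>{1..m}. l i * Dg i (f\<zeta> v)) + (\<Sum>j\<in>{1..q}. \<mu> j * Dh j (f\<zeta> v)) = - (l 0 * (Dg 0 (f\<zeta> v) + f0\<zeta> v))"
      unfolding pT by (simp add: blinfun.add_left blinfun.sum_left blinfun.scaleR_left algebra_simps)
    then show "(\<Sum>k\<in>{1..m} <+> {1..q}. (case k of Inl i \<Rightarrow> l i | Inr j \<Rightarrow> \<mu> j) *\<^sub>R endpoint_functional k) v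
        = (- (l 0 *\<^sub>R ((Dg 0 o\<^sub>L f\<zeta>) + f0\<zeta>))) v"
      by (simp add: sum.Plus endpoint_functional_def blinfun.add_left blinfun.sum_left blinfun.scaleR_left blinfun.minus_left)
  qed
qed

theorem normal_triple_exists:
  "\<exists>l \<mu> p. pontryagin_triple T U m q f0 f g h \<pi> x u l \<mu> p \<and> l 0 = 1"
proof -
  obtain c P S where c: "multipliers c P S" using multipliers_exist by blast
  obtain p where p: "pontryagin_triple T U m q f0 f g h \<pi> x u (\<lambda>i. c (Inl i)) (\<lambda>j. c (Inr j)) p"
    using triple_of_multipliers[OF c] by blast
  have c0: "c (Inl 0) \<noteq> 0"
  proof
    assume z: "c (Inl 0) = 0"
    have "(\<Sum>k\<in>{1..m} <+> {1..q}. (case k of Inl i \<Rightarrow> c (Inl i) | Inr j \<Rightarrow> c (Inr j)) *\<^sub>R endpoint_functional k) = 0"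
      using triple_stationary[OF p] z by simp
    from endpoint_functional_indep[OF this]
    have z': "(case k of Inl i \<Rightarrow> c (Inl i) | Inr j \<Rightarrow> c (Inr j)) = 0" if "k \<in> {1..m} <+> {1..q}" for k using that by blast
    have "c (Inl i) = 0" if "i \<in> {0..m}" for i 
    proof (cases "i = 0")
      case False
      then have "i \<in> {1..m}" using that by simp
      from z'[OF InlI[OF this]] show ?thesis by simp
    qed (use z in simp)
    moreover have "c (Inr j) = 0" if "j \<in> {1..q}" for j using z'[OF InrI, of j] that by auto
    ultimately show False using p unfolding pontryagin_triple_def by blast
  qed
  obtain P: "continuous_on {0..T} P" "P T = id_blinfun" "finite S"
      "\<forall>t\<in>{0<..<T} - S. (P has_vector_derivative - (P t o\<^sub>L AX t (u t))) (at t)"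
    and nz: "\<exists>k\<in>{0..m} <+> {1..q}. c k \<noteq> 0" and nn: "\<forall>i\<in>{0..m}. 0 \<le> c (Inl i)"
    and comp: "\<forall>i\<in>{1..m}. c (Inl i) * g i (x T) \<pi> = 0"
    and ineq: "\<forall>t\<in>{0..<T}. \<forall>v\<in>U. (\<Sum>k\<in>{0..m} <+> {1..q}. c k * D\<Phi> k (P t (FE t (zE t) v - FE t (zE t) (u t)))) \<le> 0"
    using c unfolding multipliers_def by (elim conjE)
  have pos: "0 < c (Inl 0)" using c0 bspec[OF nn, of 0] by simp
  \<comment> \<open>The multipliers are normalised rather than the triple, so the costate belonging
    to the scaled multipliers is obtained by the same construction once more.\<close>
  define c' where "c' k = c k / c (Inl 0)" for k
  have sum: "(\<Sum>k\<in>J. c' k * F k) = (\<Sum>k\<in>J. c k * F k) / c (Inl 0)" for F and J :: "(nat + nat) set"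
    by (simp add: c'_def sum_divide_distrib)
  have "multipliers c' P S"
    unfolding multipliers_def sum
  proof (intro conjI P)
    show "\<exists>k\<in>{0..m} <+> {1..q}. c' k \<noteq> 0" using nz pos by (simp add: c'_def)
    show "\<forall>i\<in>{0..m}. 0 \<le> c' (Inl i)" using nn pos by (simp add: c'_def)
    show "\<forall>i\<in>{1..m}. c' (Inl i) * g i (x T) \<pi> = 0" using comp by (simp add: c'_def)
    show "\<forall>t\<in>{0..<T}. \<forall>v\<in>U. (\<Sum>k\<in>{0..m} <+> {1..q}. c k * D\<Phi> k (P t (FE t (zE t) v - FE t (zE t) (u t)))) / c (Inl 0) \<le> 0"
      using ineq pos by (blast intro: divide_nonpos_pos)
  qed
  from triple_of_multipliers[OF this] obtain p' where
    "pontryagin_triple T U m q f0 f g h \<pi> x u (\<lambda>i. c' (Inl i)) (\<lambda>j. c' (Inr j)) p'" by blast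
  moreover have "c' (Inl 0) = 1" using pos by (simp add: c'_def)
  ultimately show ?thesis by blast
qed

lemma triple_adjoint:
  assumes "pontryagin_triple T U m q f0 f g h \<pi> x u l \<mu> p"
  shows "continuous_on {0..T} p" "\<exists>S. finite S \<and> (\<forall>t\<in>{0<..<T} - S.
      (p has_vector_derivative - ((p t o\<^sub>L A t (u t)) + l 0 *\<^sub>R A0 t (u t))) (at t))"
    "p T = (\<Sum>i\<in>{0..m}. l i *\<^sub>R Dg i) + (\<Sum>j\<in>{1..q}. \<mu> j *\<^sub>R Dh j)"
proof -
  note M = assms[unfolded pontryagin_triple_def]
  have p: "p \<in> PC1 T UNIV" using M by blast
  show "continuous_on {0..T} p" by (rule PC1_D(1)[OF p])
  show "p T = (\<Sum>i\<in>{0..m}. l i *\<^sub>R Dg i) + (\<Sum>j\<in>{1..q}. \<mu> j *\<^sub>R Dh j)" using M by (simp add: Dg_def Dh_def)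
  have "ext_deriv T p t = - ((p t o\<^sub>L A t (u t)) + l 0 *\<^sub>R A0 t (u t))" if "t \<in> {0..T}" for t
    using M that by (simp add: DF_hamiltonian u_in)
  then show "\<exists>S. finite S \<and> (\<forall>t\<in>{0<..<T} - S. (p has_vector_derivative - ((p t o\<^sub>L A t (u t)) + l 0 *\<^sub>R A0 t (u t))) (at t))"
    using PC1_D(5)[OF p] by force
qed

text \<open>Two normal triples have constraint multipliers solving the same linear equation, so
  independence makes these equal. The costates then share the terminal value and the linear adjoint
  equation, and the backward Gronwall estimate with zero source makes them agree.\<close>

theorem normal_triple_unique:
  assumes 1: "pontryagin_triple T U m q f0 f g h \<pi> x u l \<mu> p" "l 0 = 1"
    and 2: "pontryagin_triple T U m q f0 f g h \<pi> x u l' \<mu>' p'" "l' 0 = 1"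
  shows "\<forall>i\<in>{0..m}. l' i = l i" "\<forall>j\<in>{1..q}. \<mu>' j = \<mu> j" "\<forall>t\<in>{0..T}. p' t = p t"
proof -
  define d where "d k = (case k of Inl i \<Rightarrow> l i | Inr j \<Rightarrow> \<mu> j) - (case k of Inl i \<Rightarrow> l' i | Inr j \<Rightarrow> \<mu>' j)" for k
  have "(\<Sum>k\<in>{1..m} <+> {1..q}. d k *\<^sub>R endpoint_functional k) = 0"
    using triple_stationary[OF 1(1)] triple_stationary[OF 2(1)] 1(2) 2(2)
    by (simp add: d_def scaleR_diff_left sum_subtractf)
  from endpoint_functional_indep[OF this] have d: "d k = 0" if "k \<in> {1..m} <+> {1..q}" for k using that by blast
  show l: "\<forall>i\<in>{0..m}. l' i = l i"
  proof
    fix i assume "i \<in> {0..m}"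
    then have "i = 0 \<or> i \<in> {1..m}" by auto
    then show "l' i = l i" using d[OF InlI, of i] 1(2) 2(2) by (auto simp: d_def)
  qed
  show \<mu>: "\<forall>j\<in>{1..q}. \<mu>' j = \<mu> j"
  proof
    fix j assume "j \<in> {1..q}"
    then show "\<mu>' j = \<mu> j" using d[OF InrI, of j] by (auto simp: d_def)
  qed
  note a = triple_adjoint[OF 1(1)] and b = triple_adjoint[OF 2(1)]
  obtain S1 where S1: "finite S1" "\<forall>t\<in>{0<..<T} - S1. (p has_vector_derivative - ((p t o\<^sub>L A t (u t)) + l 0 *\<^sub>R A0 t (u t))) (at t)"
    using a(2) by (elim exE conjE)
  obtain S2 where S2: "finite S2" "\<forall>t\<in>{0<..<T} - S2. (p' has_vector_derivative - ((p' t o\<^sub>L A t (u t)) + l' 0 *\<^sub>R A0 t (u t))) (at t)"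
    using b(2) by (elim exE conjE)
  have pT: "p' T = p T" unfolding a(3) b(3) using l \<mu> by simp
  show "\<forall>t\<in>{0..T}. p' t = p t"
  proof
    fix t assume t: "t \<in> {0..T}"
    have "norm (p' t - p t) \<le> (norm (p' T - p T) + integral {0..T} (\<lambda>_. 0)) * exp (integral {0..T} (\<lambda>t. norm (A t (u t))))"
    proof (rule gronwall_backward[of "S1 \<union> S2" "\<lambda>t. p' t - p t" "\<lambda>t. - ((p' t - p t) o\<^sub>L A t (u t))" "\<lambda>t. norm (A t (u t))" "\<lambda>_. 0"])
      show "pcw T UNIV (\<lambda>t. norm (A t (u t)))" by (rule pcw_map(1)[OF A_pcw(1)]) (intro continuous_intros)
      show "continuous_on {0..T} (\<lambda>t. p' t - p t)" by (intro continuous_intros a b)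
      fix s assume s: "s \<in> {0<..<T} - (S1 \<union> S2)"
      have "((\<lambda>t. p' t - p t) has_vector_derivative - ((p' s o\<^sub>L A s (u s)) + l' 0 *\<^sub>R A0 s (u s)) - - ((p s o\<^sub>L A s (u s)) + l 0 *\<^sub>R A0 s (u s))) (at s)"
        by (rule has_vector_derivative_diff) (use S1 S2 s in auto)
      moreover have "- ((p' s o\<^sub>L A s (u s)) + l' 0 *\<^sub>R A0 s (u s)) - - ((p s o\<^sub>L A s (u s)) + l 0 *\<^sub>R A0 s (u s)) = - ((p' s - p s) o\<^sub>L A s (u s))"
        using 1(2) 2(2) by (intro blinfun_eqI) (simp add: blinfun.minus_left blinfun.add_left blinfun.diff_left)
      ultimately show "((\<lambda>t. p' t - p t) has_vector_derivative - ((p' s - p s) o\<^sub>L A s (u s))) (at s)" by simp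
      show "norm (- ((p' s - p s) o\<^sub>L A s (u s))) \<le> norm (A s (u s)) * norm (p' s - p s) + 0"
        using norm_blinfun_compose[of "p' s - p s" "A s (u s)"] by (simp add: mult.commute)
    qed (use S1 S2 t in auto)
    then show "p' t = p t" using pT by simp
  qed
qed

end

section \<open>Partial differentials and continuous Gateaux differentials\<close>

lemma has_hadamard_imp_gateaux: "has_hadamard F D a \<Longrightarrow> has_gateaux F D a"
  by (simp add: has_hadamard_def)

definition emb1 :: "'a::real_normed_vector \<Rightarrow>\<^sub>L ('a \<times> 'b::real_normed_vector \<times> 'c::real_normed_vector)" where "emb1 = inlB"
definition emb2 :: "'b::real_normed_vector \<Rightarrow>\<^sub>L ('a::real_normed_vector \<times> 'b \<times> 'c::real_normed_vector)" where "emb2 = inrB o\<^sub>L inlB"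
definition emb3 :: "'c::real_normed_vector \<Rightarrow>\<^sub>L ('a::real_normed_vector \<times> 'b::real_normed_vector \<times> 'c)" where "emb3 = inrB o\<^sub>L inrB"
definition emb13 :: "('a::real_normed_vector \<times> 'c::real_normed_vector) \<Rightarrow>\<^sub>L ('a \<times> 'b::real_normed_vector \<times> 'c)" where
  "emb13 = (emb1 o\<^sub>L fstB) + (emb3 o\<^sub>L sndB)"

lemma emb_apply [simp]: "emb1 a = (a, 0, 0)" "emb2 b = (0, b, 0)" "emb3 c = (0, 0, c)" "emb13 p = (fst p, 0, snd p)"
  by (simp_all add: emb1_def emb2_def emb3_def emb13_def blinfun.add_left zero_prod_def)

lemma has_hadamard_partials:
  fixes F :: "'a::real_normed_vector \<Rightarrow> 'b::real_normed_vector \<Rightarrow> 'c::real_normed_vector \<Rightarrow> 'd::real_normed_vector"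
  assumes H: "has_hadamard (\<lambda>(\<xi>, \<zeta>, \<pi>). F \<xi> \<zeta> \<pi>) D (a, b, c)"
  shows "has_hadamard (\<lambda>\<xi>. F \<xi> b c) (D o\<^sub>L emb1) a" "has_hadamard (\<lambda>\<zeta>. F a \<zeta> c) (D o\<^sub>L emb2) b"
    "has_hadamard (\<lambda>\<pi>. F a b \<pi>) (D o\<^sub>L emb3) c" "has_hadamard (\<lambda>(\<xi>, \<pi>). F \<xi> b \<pi>) (D o\<^sub>L emb13) (a, c)"
proof -
  note A = has_hadamard_affine[where F = "\<lambda>(\<xi>, \<zeta>, \<pi>). F \<xi> \<zeta> \<pi>" and D = D]
  show "has_hadamard (\<lambda>\<xi>. F \<xi> b c) (D o\<^sub>L emb1) a"
    using A[where j = "\<lambda>\<xi>. (\<xi>, b, c)" and i = emb1 and a = a] H by simp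
  show "has_hadamard (\<lambda>\<zeta>. F a \<zeta> c) (D o\<^sub>L emb2) b"
    using A[where j = "\<lambda>\<zeta>. (a, \<zeta>, c)" and i = emb2 and a = b] H by simp
  show "has_hadamard (\<lambda>\<pi>. F a b \<pi>) (D o\<^sub>L emb3) c"
    using A[where j = "\<lambda>\<pi>. (a, b, \<pi>)" and i = emb3 and a = c] H by simp
  show "has_hadamard (\<lambda>(\<xi>, \<pi>). F \<xi> b \<pi>) (D o\<^sub>L emb13) (a, c)"
    using A[where j = "\<lambda>p. (fst p, b, snd p)" and i = emb13 and a = "(a, c)"] H by (simp add: split_def)
qed

lemma has_hadamard_partials2:
  fixes F :: "'a::real_normed_vector \<Rightarrow> 'c::real_normed_vector \<Rightarrow> 'd::real_normed_vector"
  assumes H: "has_hadamard (\<lambda>(\<xi>, \<pi>). F \<xi> \<pi>) D (a, c)"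
  shows "has_hadamard (\<lambda>\<xi>. F \<xi> c) (D o\<^sub>L inlB) a" "has_hadamard (\<lambda>\<pi>. F a \<pi>) (D o\<^sub>L inrB) c"
proof -
  note A = has_hadamard_affine[where F = "\<lambda>(\<xi>, \<pi>). F \<xi> \<pi>" and D = D]
  show "has_hadamard (\<lambda>\<xi>. F \<xi> c) (D o\<^sub>L inlB) a"
    using A[where j = "\<lambda>\<xi>. (\<xi>, c)" and i = inlB and a = a] H by simp
  show "has_hadamard (\<lambda>\<pi>. F a \<pi>) (D o\<^sub>L inrB) c"
    using A[where j = "\<lambda>\<pi>. (a, \<pi>)" and i = inrB and a = c] H by simp
qed

section \<open>Operator norms, independent families and Gateaux differentials\<close>

lemma norm_inlB_le: "norm (D o\<^sub>L inlB) \<le> norm D" and norm_inrB_le: "norm (D o\<^sub>L inrB) \<le> norm D"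
  by (rule norm_blinfun_bound; simp; metis norm_blinfun norm_Pair1 norm_Pair2)+

text \<open>The operator norm need not be attained on the unit ball, but a vector reaching half of
  it exists and is enough to deduce norm convergence from convergence along chosen unit
  directions.\<close>

lemma blinfun_norm_half_attained:
  fixes D :: "'a::real_normed_vector \<Rightarrow>\<^sub>L 'b::real_normed_vector"
  shows "\<exists>\<delta>. norm \<delta> \<le> 1 \<and> norm D \<le> 2 * norm (D \<delta>)"
proof (cases "norm D = 0")
  case True
  then show ?thesis by (intro exI[of _ 0]) simp
next
  case False
  have "\<exists>x. norm D / 2 * norm x < norm (D x)"
  proof (rule ccontr)
    assume "\<not> ?thesis"
    then have "norm D \<le> norm D / 2" by (intro norm_blinfun_bound) (auto simp: not_less)
    then show False using False by simp
  qed
  then obtain x where x: "norm D / 2 * norm x < norm (D x)" by blast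
  then have nx: "0 < norm x" by (metis blinfun.zero_right less_irrefl mult_zero_right norm_zero zero_less_norm_iff)
  define \<delta> where "\<delta> = (1 / norm x) *\<^sub>R x"
  have "norm \<delta> = 1" using nx by (simp add: \<delta>_def)
  moreover have "norm (D \<delta>) = norm (D x) / norm x" using nx by (simp add: \<delta>_def blinfun.scaleR_right)
  moreover have "norm D / 2 < norm (D x) / norm x" using x nx by (simp add: pos_less_divide_eq)
  then have "norm D \<le> 2 * (norm (D x) / norm x)" by argo
  ultimately show ?thesis by (intro exI[of _ \<delta>]) simp
qed

text \<open>Otherwise coefficient vectors with absolute sum 1 would give combinations tending to
  zero. A convergent subsequence of the coefficients would produce a nontrivial vanishing
  combination, since the absolute sum stays 1 in the limit.\<close>

lemma independent_lower_bound:
  fixes E :: "'k \<Rightarrow> 'a::real_normed_vector"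
  assumes K: "finite K" and indep: "\<And>c. (\<Sum>k\<in>K. c k *\<^sub>R E k) = 0 \<Longrightarrow> \<forall>k\<in>K. c k = 0"
  shows "\<exists>\<kappa>>0. \<forall>c. \<kappa> * (\<Sum>k\<in>K. \<bar>c k\<bar>) \<le> norm (\<Sum>k\<in>K. c k *\<^sub>R E k)"
proof (rule ccontr)
  assume "\<not> ?thesis"
  then have neg: "\<And>\<kappa>. 0 < \<kappa> \<Longrightarrow> \<exists>c. norm (\<Sum>k\<in>K. c k *\<^sub>R E k) < \<kappa> * (\<Sum>k\<in>K. \<bar>c k\<bar>)" by (meson not_less)
  have "\<forall>n. \<exists>c. (\<Sum>k\<in>K. \<bar>c k\<bar>) = 1 \<and> norm (\<Sum>k\<in>K. c k *\<^sub>R E k) < inverse (real (Suc n))"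
  proof
    fix n
    obtain c where c: "norm (\<Sum>k\<in>K. c k *\<^sub>R E k) < inverse (real (Suc n)) * (\<Sum>k\<in>K. \<bar>c k\<bar>)"
      using neg[of "inverse (real (Suc n))"] by auto
    define s where "s = (\<Sum>k\<in>K. \<bar>c k\<bar>)"
    have "0 \<le> s" unfolding s_def by (intro sum_nonneg) simp
    moreover have "s \<noteq> 0" using c by (auto simp: s_def)
    ultimately have s: "0 < s" by simp
    have "(\<Sum>k\<in>K. (c k / s) *\<^sub>R E k) = (1 / s) *\<^sub>R (\<Sum>k\<in>K. c k *\<^sub>R E k)"
      by (simp add: scaleR_sum_right)
    then have "norm (\<Sum>k\<in>K. (c k / s) *\<^sub>R E k) < inverse (real (Suc n))"
      using c s by (simp add: s_def[symmetric] field_simps)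
    moreover have "(\<Sum>k\<in>K. \<bar>c k / s\<bar>) = 1"
      using s by (simp add: abs_divide s_def[symmetric] flip: sum_divide_distrib)
    ultimately show "\<exists>c. (\<Sum>k\<in>K. \<bar>c k\<bar>) = 1 \<and> norm (\<Sum>k\<in>K. c k *\<^sub>R E k) < inverse (real (Suc n))"
      by (intro exI[of _ "\<lambda>k. c k / s"]) simp
  qed
  from choice[OF this] obtain c where c: "\<forall>n. (\<Sum>k\<in>K. \<bar>c n k\<bar>) = 1 \<and> norm (\<Sum>k\<in>K. c n k *\<^sub>R E k) < inverse (real (Suc n))"
    by (elim exE)
  have "\<exists>r l. strict_mono r \<and> (\<forall>k\<in>K. (\<lambda>n. c (r n) k) \<longlonglongrightarrow> l k)"
  proof (rule finite_index_convergent_subseq[OF K, of c], intro exI[of _ 1] allI)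
    fix k n assume "k \<in> K"
    then have "\<bar>c n k\<bar> \<le> (\<Sum>k\<in>K. \<bar>c n k\<bar>)" using K by (intro member_le_sum) auto
    then show "\<bar>c n k\<bar> \<le> 1" using c by simp
  qed
  then obtain r l where r: "strict_mono r" and l: "\<And>k. k \<in> K \<Longrightarrow> (\<lambda>n. c (r n) k) \<longlonglongrightarrow> l k" by blast
  have "(\<lambda>n. \<Sum>k\<in>K. \<bar>c (r n) k\<bar>) \<longlonglongrightarrow> (\<Sum>k\<in>K. \<bar>l k\<bar>)" by (intro tendsto_sum tendsto_rabs l)
  then have one: "(\<Sum>k\<in>K. \<bar>l k\<bar>) = 1" using c by (simp add: LIMSEQ_const_iff)
  have L1: "(\<lambda>n. \<Sum>k\<in>K. c (r n) k *\<^sub>R E k) \<longlonglongrightarrow> (\<Sum>k\<in>K. l k *\<^sub>R E k)"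
    by (intro tendsto_sum tendsto_scaleR l tendsto_const)
  have "(\<lambda>n. inverse (real (Suc (r n)))) \<longlonglongrightarrow> 0"
    using LIMSEQ_subseq_LIMSEQ[OF LIMSEQ_inverse_real_of_nat r] by (simp add: o_def)
  then have L2: "(\<lambda>n. \<Sum>k\<in>K. c (r n) k *\<^sub>R E k) \<longlonglongrightarrow> 0"
    by (rule Lim_null_comparison[rotated]) (use c in \<open>auto intro!: always_eventually less_imp_le\<close>)
  have "\<forall>k\<in>K. l k = 0" by (rule indep) (rule LIMSEQ_unique[OF L1 L2])
  then show False using one by simp
qed

text \<open>A perturbation of size \<kappa>/2 in every vector uses up at most half of the bound.
  This carries independence from \<pi>0 to a whole neighbourhood with one constant.\<close>

lemma perturbed_lower_bound:
  fixes E E' :: "'k \<Rightarrow> 'a::real_normed_vector"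
  assumes "\<And>c. \<kappa> * (\<Sum>k\<in>K. \<bar>c k\<bar>) \<le> norm (\<Sum>k\<in>K. c k *\<^sub>R E k)" and "\<And>k. k \<in> K \<Longrightarrow> norm (E' k - E k) \<le> \<kappa> / 2"
  shows "\<kappa> / 2 * (\<Sum>k\<in>K. \<bar>c k\<bar>) \<le> norm (\<Sum>k\<in>K. c k *\<^sub>R E' k)"
proof -
  have "norm (\<Sum>k\<in>K. c k *\<^sub>R (E' k - E k)) \<le> (\<Sum>k\<in>K. \<bar>c k\<bar> * (\<kappa> / 2))"
    by (rule sum_norm_le) (use assms(2) in \<open>auto intro!: mult_left_mono simp del: times_divide_eq_right\<close>)
  also have "\<dots> = \<kappa> / 2 * (\<Sum>k\<in>K. \<bar>c k\<bar>)" by (simp add: sum_distrib_left mult.commute)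
  finally have 1: "norm (\<Sum>k\<in>K. c k *\<^sub>R (E' k - E k)) \<le> \<kappa> / 2 * (\<Sum>k\<in>K. \<bar>c k\<bar>)" .
  have "(\<Sum>k\<in>K. c k *\<^sub>R E k) = (\<Sum>k\<in>K. c k *\<^sub>R E' k) - (\<Sum>k\<in>K. c k *\<^sub>R (E' k - E k))"
    by (simp add: scaleR_diff_right sum_subtractf)
  then have "norm (\<Sum>k\<in>K. c k *\<^sub>R E k) \<le> norm (\<Sum>k\<in>K. c k *\<^sub>R E' k) + norm (\<Sum>k\<in>K. c k *\<^sub>R (E' k - E k))"
    using norm_triangle_ineq4 by metis
  then show ?thesis using 1 assms(1)[of c] by (simp add: field_simps)
qed

text \<open>The mean value inequality is applied to F minus its candidate linearisation at a: along
  short segments the differential of this difference is small in operator norm, by continuity of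
  D.\<close>

lemma gateaux_C1_has_derivative:
  fixes F :: "'a::real_normed_vector \<Rightarrow> 'b::real_normed_vector"
  assumes W: "open W" and gat: "\<And>y. y \<in> W \<Longrightarrow> has_gateaux F (D y) y" and cont: "continuous_on W D" and a: "a \<in> W"
  shows "(F has_derivative D a) (at a)"
  unfolding has_derivative_at_alt
proof (intro conjI allI impI)
  show "bounded_linear (D a)" by (rule blinfun.bounded_linear_right)
  fix e :: real assume e: "0 < e"
  obtain d1 where d1: "0 < d1" "ball a d1 \<subseteq> W" using W a open_contains_ball by blast
  obtain d2 where d2: "0 < d2" "\<And>y. y \<in> W \<Longrightarrow> dist y a < d2 \<Longrightarrow> dist (D y) (D a) < e"
    using cont a e unfolding continuous_on_iff by metis
  show "\<exists>d>0. \<forall>y. norm (y - a) < d \<longrightarrow> norm (F y - F a - D a (y - a)) \<le> e * norm (y - a)"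
  proof (intro exI[of _ "min d1 d2"] conjI allI impI)
    fix y assume y: "norm (y - a) < min d1 d2"
    define v where "v = y - a"
    define G where "G z = F z - D a z" for z
    have "norm (G (a + v) - G a) \<le> e * norm v"
    proof (rule gateaux_segment_bound[where D = "\<lambda>s. D (a + s *\<^sub>R v) - D a"])
      fix s :: real assume s: "s \<in> {0..1}"
      have "norm (s *\<^sub>R v) \<le> 1 * norm v" unfolding norm_scaleR by (rule mult_right_mono) (use s in auto)
      then have near: "dist (a + s *\<^sub>R v) a < d1" "dist (a + s *\<^sub>R v) a < d2" using y by (auto simp: dist_norm v_def)
      then have inW: "a + s *\<^sub>R v \<in> W" using d1(2) by (auto simp: dist_commute)
      show "has_gateaux G (D (a + s *\<^sub>R v) - D a) (a + s *\<^sub>R v)"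
        unfolding has_gateaux_def has_right_variation_def
      proof
        fix w
        have L: "((\<lambda>\<theta>. (1 / \<theta>) *\<^sub>R (F (a + s *\<^sub>R v + \<theta> *\<^sub>R w) - F (a + s *\<^sub>R v)) - D a w) \<longlongrightarrow> D (a + s *\<^sub>R v) w - D a w) (at_right 0)"
          by (intro tendsto_diff tendsto_const)
            (use gat[OF inW] in \<open>simp add: has_gateaux_def has_right_variation_def\<close>)
        have ev: "eventually (\<lambda>\<theta>. \<theta> \<noteq> 0) (at_right (0::real))" by (simp add: eventually_at_filter)
        show "((\<lambda>\<theta>. (1 / \<theta>) *\<^sub>R (G (a + s *\<^sub>R v + \<theta> *\<^sub>R w) - G (a + s *\<^sub>R v))) \<longlongrightarrow> (D (a + s *\<^sub>R v) - D a) w) (at_right 0)"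
          unfolding blinfun.diff_left
          by (intro Lim_transform_eventually[OF L] eventually_mono[OF ev])
            (simp add: G_def blinfun.add_right blinfun.scaleR_right scaleR_diff_right scaleR_add_right)
      qed
      have "norm (D (a + s *\<^sub>R v) - D a) \<le> e" using d2(2)[OF inW near(2)] by (simp add: dist_norm)
      then show "norm ((D (a + s *\<^sub>R v) - D a) v) \<le> e * norm v"
        by (intro order_trans[OF norm_blinfun mult_right_mono]) auto
    qed
    then show "norm (F y - F a - D a (y - a)) \<le> e * norm (y - a)"
      by (simp add: G_def v_def blinfun.diff_right algebra_simps)
  qed (use d1 d2 in auto)
qed

section \<open>Linear combinations, norms and measurable pairings on [0,T]\<close>

context pos_time
begin

lemma PC1_linear_combination:
  fixes y z :: "real \<Rightarrow> 'a::banach"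
  assumes y: "y \<in> PC1 T A" and z: "z \<in> PC1 T B"
  shows "(\<lambda>t. a *\<^sub>R y t + b *\<^sub>R z t) \<in> PC1 T UNIV"
    "t \<in> {0..T} \<Longrightarrow> ext_deriv T (\<lambda>t. a *\<^sub>R y t + b *\<^sub>R z t) t = a *\<^sub>R ext_deriv T y t + b *\<^sub>R ext_deriv T z t"
proof -
  obtain S1 where S1: "finite S1" "\<forall>t\<in>{0<..<T} - S1. (y has_vector_derivative ext_deriv T y t) (at t)"
    using PC1_D(5)[OF y] by (elim exE conjE)
  obtain S2 where S2: "finite S2" "\<forall>t\<in>{0<..<T} - S2. (z has_vector_derivative ext_deriv T z t) (at t)"
    using PC1_D(5)[OF z] by (elim exE conjE)
  have c: "continuous_on {0..T} (\<lambda>t. a *\<^sub>R y t + b *\<^sub>R z t)" by (intro continuous_intros PC1_D(1)[OF y] PC1_D(1)[OF z])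
  have d: "((\<lambda>t. a *\<^sub>R y t + b *\<^sub>R z t) has_vector_derivative a *\<^sub>R ext_deriv T y t + b *\<^sub>R ext_deriv T z t) (at t)"
    if "t \<in> {0<..<T} - (S1 \<union> S2)" for t
    by (intro has_vector_derivative_add bounded_linear.has_vector_derivative[OF bounded_linear_scaleR_right]) (use S1 S2 that in auto)
  have "continuous_on UNIV (\<lambda>p :: 'a \<times> 'a. a *\<^sub>R fst p + b *\<^sub>R snd p)" by (intro continuous_intros)
  note k = pcw_map2[OF PC1_D(3)[OF y] PC1_D(3)[OF z] this]
  have W: "(\<lambda>t. a *\<^sub>R y t + b *\<^sub>R z t) ` {0..T} \<subseteq> UNIV" by simp
  note P = PC1_I[OF W finite_UnI[OF S1(1) S2(1)] c d k(1) k(2)[OF PC1_D(4)[OF y] PC1_D(4)[OF z]]]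
  show "(\<lambda>t. a *\<^sub>R y t + b *\<^sub>R z t) \<in> PC1 T UNIV" by (rule P(1)) auto
  show "t \<in> {0..T} \<Longrightarrow> ext_deriv T (\<lambda>t. a *\<^sub>R y t + b *\<^sub>R z t) t = a *\<^sub>R ext_deriv T y t + b *\<^sub>R ext_deriv T z t"
    by (rule P(2)) auto
qed

lemma sup_norm_upper:
  fixes f :: "real \<Rightarrow> 'a::real_normed_vector"
  assumes "pcw T W f"
  shows "t \<in> {0..T} \<Longrightarrow> norm (f t) \<le> sup_norm T f" "0 \<le> sup_norm T f"
proof -
  obtain B where "\<And>t. t \<in> {0..T} \<Longrightarrow> norm (f t) \<le> B" using pcw_bounded[OF assms] by metis
  then have b: "bdd_above ((\<lambda>t. norm (f t)) ` {0..T})" by (rule bdd_aboveI2)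
  show u: "norm (f t) \<le> sup_norm T f" if "t \<in> {0..T}" for t unfolding sup_norm_def by (rule cSUP_upper[OF that b])
  have "norm (f 0) \<le> sup_norm T f" by (rule u) (use T_pos in simp)
  then show "0 \<le> sup_norm T f" using norm_ge_zero order_trans by blast
qed

lemma PC1_norm_upper:
  fixes y :: "real \<Rightarrow> 'a::banach"
  assumes y: "y \<in> PC1 T W" and t: "t \<in> {0..T}"
  shows "norm (y t) \<le> PC1_norm T y" "norm (ext_deriv T y t) \<le> PC1_norm T y"
proof -
  have 1: "pcw T UNIV y" by (rule continuous_pcw(1)[OF PC1_D(1)[OF y]]) simp
  note 2 = PC1_D(3)[OF y]
  show "norm (y t) \<le> PC1_norm T y" "norm (ext_deriv T y t) \<le> PC1_norm T y"
    unfolding PC1_norm_def using sup_norm_upper[OF 1] sup_norm_upper[OF 2] t by (simp_all add: add_increasing add_increasing2)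
qed

text \<open>The values lie in a nonseparable space, but $p(t)y(t)$ is a limit of functions $p(t_n(t))y(t)$
  where $t_n$ takes countably many values.\<close>

lemma m1_measurable_pairing:
  fixes p :: "real \<Rightarrow> 'a::real_normed_vector \<Rightarrow>\<^sub>L real"
  assumes p: "continuous_on {0..T} p" and y: "y \<in> borel_measurable (m1 T)"
  shows "(\<lambda>t. p t (y t)) \<in> borel_measurable (m1 T)"
proof -
  define r where "r n t = T * (real_of_int \<lfloor>t * real (Suc n) / T\<rfloor> / real (Suc n))" for n t
  show ?thesis
  proof (rule borel_measurable_LIMSEQ_real[where u = "\<lambda>n t. p (r n t) (y t)"])
    show "(\<lambda>t. p (r n t) (y t)) \<in> borel_measurable (m1 T)" for n
    proof -
      have "(\<lambda>t. p (T * (real_of_int \<lfloor>t * real (Suc n) / T\<rfloor> / real (Suc n))) (y t)) \<in> borel_measurable (m1 T)"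
      proof (rule measurable_compose_countable[where f = "\<lambda>i t. p (T * (real_of_int i / real (Suc n))) (y t)"
            and g = "\<lambda>t. \<lfloor>t * real (Suc n) / T\<rfloor>"])
        show "(\<lambda>t. p (T * (real_of_int i / real (Suc n))) (y t)) \<in> borel_measurable (m1 T)" for i
        proof -
          have "blinfun_apply (p (T * (real_of_int i / real (Suc n)))) \<in> borel_measurable borel"
            by (intro borel_measurable_continuous_onI continuous_intros)
          from measurable_compose[OF y this] show ?thesis .
        qed
        have "(\<lambda>t. \<lfloor>t * real (Suc n) / T\<rfloor>) \<in> measurable lborel (count_space UNIV)" by measurable
        then show "(\<lambda>t. \<lfloor>t * real (Suc n) / T\<rfloor>) \<in> measurable (m1 T) (count_space UNIV)"
          unfolding m1_def by (rule measurable_restrict_space1)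
      qed
      then show ?thesis by (simp add: r_def)
    qed
    fix t assume "t \<in> space (m1 T)"
    then have t: "t \<in> {0..T}" by simp
    have bounds: "t - T / real (Suc n) \<le> r n t \<and> r n t \<le> t \<and> 0 \<le> r n t" for n
    proof -
      define s where "s = t * real (Suc n) / T"
      have "real_of_int \<lfloor>s\<rfloor> \<le> s" "s - 1 \<le> real_of_int \<lfloor>s\<rfloor>" "0 \<le> real_of_int \<lfloor>s\<rfloor>"
        using t T_pos by (auto simp: s_def)
      then have "T * (real_of_int \<lfloor>s\<rfloor> / real (Suc n)) \<le> T * (s / real (Suc n))" "T * ((s - 1) / real (Suc n)) \<le> T * (real_of_int \<lfloor>s\<rfloor> / real (Suc n))"
        "0 \<le> T * (real_of_int \<lfloor>s\<rfloor> / real (Suc n))"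
        using T_pos by (auto intro!: mult_left_mono divide_right_mono mult_nonneg_nonneg)
      moreover have "T * (s / real (Suc n)) = t" using T_pos by (simp add: s_def)
      moreover have "T * ((s - 1) / real (Suc n)) = t - T / real (Suc n)"
        using T_pos by (simp add: s_def diff_divide_distrib right_diff_distrib)
      ultimately show ?thesis by (simp add: r_def s_def)
    qed
    have "(\<lambda>n. t - T / real (Suc n)) \<longlonglongrightarrow> t - T * 0"
      using tendsto_diff[OF tendsto_const tendsto_mult[OF tendsto_const LIMSEQ_inverse_real_of_nat]] by (simp add: divide_inverse)
    then have "(\<lambda>n. t - T / real (Suc n)) \<longlonglongrightarrow> t" by simp
    then have "(\<lambda>n. r n t) \<longlonglongrightarrow> t"
      by (rule tendsto_sandwich[OF _ _ _ tendsto_const, rotated 2]) (use bounds in \<open>auto intro!: always_eventually\<close>)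
    then have "(\<lambda>n. p (r n t)) \<longlonglongrightarrow> p t"
      by (rule continuous_on_tendsto_compose[OF p]) (use bounds t in \<open>auto intro!: always_eventually intro: order_trans\<close>)
    then show "(\<lambda>n. p (r n t) (y t)) \<longlonglongrightarrow> p t (y t)" by (intro blinfun.tendsto tendsto_const)
  qed
qed

lemma m1_measurable_iff: "f \<in> borel_measurable (m1 T) \<longleftrightarrow> f \<in> borel_measurable (restrict_space borel {0..T})"
proof -
  have "sets (m1 T) = sets (restrict_space borel {0..T})" unfolding m1_def by (simp add: sets_restrict_space)
  from measurable_cong_sets[OF this refl] show ?thesis by auto
qed

end

section \<open>Dependence of the triple on the parameter\<close>

text \<open>\<open>N t\<close> stands for the ball in (IC3), and \<open>lower_bound\<close> for the independence (CVT1) made uniform in \<open>\<pi>\<close>.\<close>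

locale bolza_family = pos_time T for T :: real +
  fixes \<Omega> :: "'x::banach set" and U :: "'y::real_normed_vector set" and \<xi>0 :: 'x and m q :: nat
    and f0 :: "real \<Rightarrow> 'x \<Rightarrow> 'y \<Rightarrow> 'z::real_normed_vector \<Rightarrow> real" and f :: "real \<Rightarrow> 'x \<Rightarrow> 'y \<Rightarrow> 'z \<Rightarrow> 'x"
    and g h :: "nat \<Rightarrow> 'x \<Rightarrow> 'z \<Rightarrow> real" and W :: "'z set" and x :: "'z \<Rightarrow> real \<Rightarrow> 'x" and u :: "'z \<Rightarrow> real \<Rightarrow> 'y"
    and \<kappa> c :: "real \<Rightarrow> real" and N :: "real \<Rightarrow> ('x \<times> 'y \<times> 'z) set" and \<epsilon> :: real
  assumes W: "open W"
    and opt: "\<And>\<pi>. \<pi> \<in> W \<Longrightarrow> bolza_optimum T \<Omega> U \<xi>0 m q f0 f g h \<pi> (x \<pi>) (u \<pi>)"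
    and x_var: "\<And>\<pi> \<delta>. \<pi> \<in> W \<Longrightarrow> path_variation_exists (PC1 T UNIV) (PC1_norm T) x \<pi> \<delta>"
    and u_var: "\<And>\<pi> \<delta>. \<pi> \<in> W \<Longrightarrow> path_variation_exists (NPC0R T UNIV) (sup_norm T) u \<pi> \<delta>"
    and \<kappa>: "integrable (m1 T) \<kappa>"
    and N: "\<And>t. t \<in> {0..T} \<Longrightarrow> open (N t)" "\<And>\<pi> t. \<pi> \<in> W \<Longrightarrow> t \<in> {0..T} \<Longrightarrow> (x \<pi> t, u \<pi> t, \<pi>) \<in> N t"
    and f0_lip: "\<And>t \<xi>1 \<zeta>1 \<pi>1 \<xi>2 \<zeta>2 \<pi>2. t \<in> {0..T} \<Longrightarrow> (\<xi>1, \<zeta>1, \<pi>1) \<in> N t \<Longrightarrow> (\<xi>2, \<zeta>2, \<pi>2) \<in> N t \<Longrightarrow>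
         \<bar>f0 t \<xi>1 \<zeta>1 \<pi>1 - f0 t \<xi>2 \<zeta>2 \<pi>2\<bar> \<le> \<kappa> t * (norm (\<xi>1 - \<xi>2) + norm (\<zeta>1 - \<zeta>2) + norm (\<pi>1 - \<pi>2))"
    and f0_had: "\<And>\<pi> t. \<pi> \<in> W \<Longrightarrow> t \<in> {0..T} \<Longrightarrow>
         hadamard_differentiable (\<lambda>(\<xi>, \<zeta>, \<pi>'). f0 t \<xi> \<zeta> \<pi>') (x \<pi> t, u \<pi> t, \<pi>)"
    and f_had: "\<And>\<pi> t. \<pi> \<in> W \<Longrightarrow> t \<in> {0..T} \<Longrightarrow>
         hadamard_differentiable (\<lambda>(\<xi>, \<zeta>, \<pi>'). f t \<xi> \<zeta> \<pi>') (x \<pi> t, u \<pi> t, \<pi>)"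
    and f0_DH_cont: "\<And>t. t \<in> {0..T} \<Longrightarrow> continuous_on W (\<lambda>\<pi>. DH (\<lambda>(\<xi>, \<pi>'). f0 t \<xi> (u \<pi> t) \<pi>') (x \<pi> t, \<pi>))"
    and f_DH_cont: "\<And>t. t \<in> {0..T} \<Longrightarrow> continuous_on W (\<lambda>\<pi>. DH (\<lambda>(\<xi>, \<pi>'). f t \<xi> (u \<pi> t) \<pi>') (x \<pi> t, \<pi>))"
    and f0_meas: "\<And>\<pi>. \<pi> \<in> W \<Longrightarrow> (\<lambda>t. DH (\<lambda>\<pi>'. f0 t (x \<pi> t) (u \<pi> t) \<pi>') \<pi>) \<in> borel_measurable (m1 T)"
    and f_meas: "\<And>\<pi>. \<pi> \<in> W \<Longrightarrow> (\<lambda>t. DH (\<lambda>\<pi>'. f t (x \<pi> t) (u \<pi> t) \<pi>') \<pi>) \<in> borel_measurable (m1 T)"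
    and c: "integrable (m1 T) c"
    and f_DH_le: "\<And>\<pi> t. \<pi> \<in> W \<Longrightarrow> t \<in> {0..T} \<Longrightarrow> norm (DH (\<lambda>(\<xi>, \<pi>'). f t \<xi> (u \<pi> t) \<pi>') (x \<pi> t, \<pi>)) \<le> c t"
    and endpoint_had: "\<And>k \<pi>. k \<in> {0..m} <+> {1..q} \<Longrightarrow> \<pi> \<in> W \<Longrightarrow>
         hadamard_differentiable (\<lambda>(\<xi>, \<pi>'). (case k of Inl i \<Rightarrow> g i | Inr j \<Rightarrow> h j) \<xi> \<pi>') (x \<pi> T, \<pi>)"
    and endpoint_DH_cont: "\<And>k. k \<in> {0..m} <+> {1..q} \<Longrightarrow>
         continuous_on W (\<lambda>\<pi>. DH (\<lambda>(\<xi>, \<pi>'). (case k of Inl i \<Rightarrow> g i | Inr j \<Rightarrow> h j) \<xi> \<pi>') (x \<pi> T, \<pi>))"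
    and endpoint_control_cont: "\<And>k. k \<in> {0..m} <+> {1..q} \<Longrightarrow>
         continuous_on W (\<lambda>\<pi>. DH (\<lambda>\<xi>. (case k of Inl i \<Rightarrow> g i | Inr j \<Rightarrow> h j) \<xi> \<pi>) (x \<pi> T)
              o\<^sub>L DH (\<lambda>\<zeta>. f T (x \<pi> T) \<zeta> \<pi>) (u \<pi> T))"
    and f0_control_cont: "continuous_on W (\<lambda>\<pi>. DH (\<lambda>\<zeta>. f0 T (x \<pi> T) \<zeta> \<pi>) (u \<pi> T))"
    and \<epsilon>_pos: "0 < \<epsilon>"
    and lower_bound: "\<And>\<pi> b. \<pi> \<in> W \<Longrightarrow> \<epsilon> * (\<Sum>k\<in>{1..m} <+> {1..q}. \<bar>b k\<bar>) \<le> norm (\<Sum>k\<in>{1..m} <+> {1..q}.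
         b k *\<^sub>R (DH (\<lambda>\<xi>. (case k of Inl i \<Rightarrow> g i | Inr j \<Rightarrow> h j) \<xi> \<pi>) (x \<pi> T)
              o\<^sub>L DH (\<lambda>\<zeta>. f T (x \<pi> T) \<zeta> \<pi>) (u \<pi> T)))"
begin

abbreviation "K \<equiv> {0..m} <+> {1..q}"
abbreviation "endpoint k \<equiv> (case k of Inl i \<Rightarrow> g i | Inr j \<Rightarrow> h j)"

text \<open>All partial differentials of f0, f and the endpoint data are read off from the three
  joint differentials introduced here, so splitting a direction into its state, control and
  parameter parts is mere linearity.\<close>

definition "J0 \<pi> t = DH (\<lambda>(\<xi>, \<zeta>, \<pi>'). f0 t \<xi> \<zeta> \<pi>') (x \<pi> t, u \<pi> t, \<pi>)"
definition "JF \<pi> t = DH (\<lambda>(\<xi>, \<zeta>, \<pi>'). f t \<xi> \<zeta> \<pi>') (x \<pi> t, u \<pi> t, \<pi>)"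
definition "JE \<pi> k = DH (\<lambda>(\<xi>, \<pi>'). endpoint k \<xi> \<pi>') (x \<pi> T, \<pi>)"

lemma J_had:
  assumes "\<pi> \<in> W" "t \<in> {0..T}"
  shows "has_hadamard (\<lambda>(\<xi>, \<zeta>, \<pi>'). f0 t \<xi> \<zeta> \<pi>') (J0 \<pi> t) (x \<pi> t, u \<pi> t, \<pi>)"
    "has_hadamard (\<lambda>(\<xi>, \<zeta>, \<pi>'). f t \<xi> \<zeta> \<pi>') (JF \<pi> t) (x \<pi> t, u \<pi> t, \<pi>)"
  using f0_had[OF assms] f_had[OF assms] by (simp_all add: hadamard_differentiable_iff J0_def JF_def)

lemma JE_had:
  assumes "\<pi> \<in> W" "k \<in> K"
  shows "has_hadamard (\<lambda>(\<xi>, \<pi>'). endpoint k \<xi> \<pi>') (JE \<pi> k) (x \<pi> T, \<pi>)"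
  using endpoint_had[OF assms(2,1)] by (simp add: hadamard_differentiable_iff JE_def)

lemma J_parts:
  assumes "\<pi> \<in> W" "t \<in> {0..T}"
  shows "DH (\<lambda>\<pi>'. f0 t (x \<pi> t) (u \<pi> t) \<pi>') \<pi> = J0 \<pi> t o\<^sub>L emb3"
    "DH (\<lambda>\<pi>'. f t (x \<pi> t) (u \<pi> t) \<pi>') \<pi> = JF \<pi> t o\<^sub>L emb3"
    "DH (\<lambda>(\<xi>, \<pi>'). f0 t \<xi> (u \<pi> t) \<pi>') (x \<pi> t, \<pi>) = J0 \<pi> t o\<^sub>L emb13"
    "DH (\<lambda>(\<xi>, \<pi>'). f t \<xi> (u \<pi> t) \<pi>') (x \<pi> t, \<pi>) = JF \<pi> t o\<^sub>L emb13"
    "DH (\<lambda>\<zeta>. f0 t (x \<pi> t) \<zeta> \<pi>) (u \<pi> t) = J0 \<pi> t o\<^sub>L emb2"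
    "DH (\<lambda>\<zeta>. f t (x \<pi> t) \<zeta> \<pi>) (u \<pi> t) = JF \<pi> t o\<^sub>L emb2"
  using J_had[OF assms, THEN has_hadamard_partials(3)] J_had[OF assms, THEN has_hadamard_partials(4)]
    J_had[OF assms, THEN has_hadamard_partials(2)] by (simp_all add: DH_eq)

text \<open>The Frechet differential in the state and the restriction of the joint Hadamard
  differential are both Gateaux differentials of the same map, hence equal.\<close>

lemma state_parts:
  assumes "\<pi> \<in> W" "t \<in> {0..T}"
  shows "bolza_optimum.A0 f0 \<pi> (x \<pi>) t (u \<pi> t) = J0 \<pi> t o\<^sub>L emb1"
    "bolza_optimum.A f \<pi> (x \<pi>) t (u \<pi> t) = JF \<pi> t o\<^sub>L emb1"
proof -
  interpret bolza_optimum T \<Omega> U \<xi>0 m q f0 f g h \<pi> "x \<pi>" "u \<pi>" by (rule opt[OF assms(1)])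
  note J = J_had[OF assms, THEN has_hadamard_partials(1), THEN has_hadamard_imp_gateaux]
  show "A0 t (u \<pi> t) = J0 \<pi> t o\<^sub>L emb1" "A t (u \<pi> t) = JF \<pi> t o\<^sub>L emb1"
    using has_gateaux_unique[OF has_derivative_imp_gateaux[OF A0_deriv] J(1)] has_gateaux_unique[OF has_derivative_imp_gateaux[OF A_deriv] J(2)]
      assms(2) u_in by blast+
qed

lemma endpoint_parts:
  assumes "\<pi> \<in> W" "k \<in> K"
  shows "DH (\<lambda>\<xi>. endpoint k \<xi> \<pi>) (x \<pi> T) = JE \<pi> k o\<^sub>L inlB"
    "DH (\<lambda>\<pi>'. endpoint k (x \<pi> T) \<pi>') \<pi> = JE \<pi> k o\<^sub>L inrB"
  using JE_had[OF assms, THEN has_hadamard_partials2(1)] JE_had[OF assms, THEN has_hadamard_partials2(2)] by (simp_all add: DH_eq)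

text \<open>The Lipschitz bound on the open set \<open>N t\<close> around the graph passes to
  difference quotients and so to the differential. This is the source of the integrable majorants
  for the cost.\<close>

lemma J0_le:
  assumes "\<pi> \<in> W" "t \<in> {0..T}"
  shows "\<bar>J0 \<pi> t (a, b, d)\<bar> \<le> \<kappa> t * (norm a + norm b + norm d)"
proof -
  let ?z = "(x \<pi> t, u \<pi> t, \<pi>)"
  have "((\<lambda>\<theta>. (1 / \<theta>) *\<^sub>R ((\<lambda>(\<xi>, \<zeta>, \<pi>'). f0 t \<xi> \<zeta> \<pi>') (?z + \<theta> *\<^sub>R (a, b, d)) - (\<lambda>(\<xi>, \<zeta>, \<pi>'). f0 t \<xi> \<zeta> \<pi>') ?z)) \<longlongrightarrow> J0 \<pi> t (a, b, d)) (at_right 0)"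
    using J_had(1)[OF assms] unfolding has_hadamard_def has_gateaux_def has_right_variation_def by blast
  then have L: "((\<lambda>\<theta>. \<bar>(1 / \<theta>) * (f0 t (x \<pi> t + \<theta> *\<^sub>R a) (u \<pi> t + \<theta> *\<^sub>R b) (\<pi> + \<theta> *\<^sub>R d) - f0 t (x \<pi> t) (u \<pi> t) \<pi>)\<bar>) \<longlongrightarrow> \<bar>J0 \<pi> t (a, b, d)\<bar>) (at_right 0)"
    by (intro tendsto_rabs) simp
  have "((\<lambda>\<theta>. ?z + \<theta> *\<^sub>R (a, b, d)) \<longlongrightarrow> ?z + 0 *\<^sub>R (a, b, d)) (at_right 0)" by (intro tendsto_intros)
  then have "((\<lambda>\<theta>. (x \<pi> t + \<theta> *\<^sub>R a, u \<pi> t + \<theta> *\<^sub>R b, \<pi> + \<theta> *\<^sub>R d)) \<longlongrightarrow> ?z) (at_right 0)" by (simp add: zero_prod_def)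
  then have "eventually (\<lambda>\<theta>. (x \<pi> t + \<theta> *\<^sub>R a, u \<pi> t + \<theta> *\<^sub>R b, \<pi> + \<theta> *\<^sub>R d) \<in> N t) (at_right 0)"
    using topological_tendstoD[OF _ N(1)[OF assms(2)] N(2)[OF assms]] by blast
  moreover have "eventually (\<lambda>\<theta>. 0 < \<theta>) (at_right (0::real))" by (simp add: eventually_at_filter)
  ultimately have "eventually (\<lambda>\<theta>. \<bar>(1 / \<theta>) * (f0 t (x \<pi> t + \<theta> *\<^sub>R a) (u \<pi> t + \<theta> *\<^sub>R b) (\<pi> + \<theta> *\<^sub>R d) - f0 t (x \<pi> t) (u \<pi> t) \<pi>)\<bar>
      \<le> \<kappa> t * (norm a + norm b + norm d)) (at_right 0)"
  proof eventually_elim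
    case (elim \<theta>)
    have "\<bar>f0 t (x \<pi> t + \<theta> *\<^sub>R a) (u \<pi> t + \<theta> *\<^sub>R b) (\<pi> + \<theta> *\<^sub>R d) - f0 t (x \<pi> t) (u \<pi> t) \<pi>\<bar> \<le> \<kappa> t * (\<theta> * norm a + \<theta> * norm b + \<theta> * norm d)"
      using f0_lip[OF assms(2) elim(1) N(2)[OF assms]] elim(2) by simp
    also have "\<dots> = \<theta> * (\<kappa> t * (norm a + norm b + norm d))" by (simp add: algebra_simps)
    finally show ?case using elim(2) by (simp add: abs_mult field_simps)
  qed
  then show ?thesis by (rule tendsto_upperbound[OF L]) simp
qed

text \<open>Only the state and parameter parts enter the adjoint equation and the gradient. The
  locale records no sign for \<kappa>, hence its absolute value.\<close>

lemma J0_norm_le: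
  assumes "\<pi> \<in> W" "t \<in> {0..T}"
  shows "norm (J0 \<pi> t o\<^sub>L emb1) \<le> \<bar>\<kappa> t\<bar>" "norm (J0 \<pi> t o\<^sub>L emb3) \<le> \<bar>\<kappa> t\<bar>"
proof -
  have "\<bar>J0 \<pi> t (a, 0, d)\<bar> \<le> \<bar>\<kappa> t\<bar> * (norm a + norm d)" for a d
    using J0_le[OF assms, of a 0 d] by (simp add: order_trans[OF _ mult_right_mono[of "\<kappa> t" "\<bar>\<kappa> t\<bar>"]])
  from this[of _ 0] this[of 0]
  show "norm (J0 \<pi> t o\<^sub>L emb1) \<le> \<bar>\<kappa> t\<bar>" "norm (J0 \<pi> t o\<^sub>L emb3) \<le> \<bar>\<kappa> t\<bar>"
    by (auto intro!: norm_blinfun_bound)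
qed

text \<open>The continuity and domination hypotheses concern the differential joint in state and
  parameter; through this factorisation they pass to both parts.\<close>

lemma emb13_inl: "D o\<^sub>L emb1 = (D o\<^sub>L emb13) o\<^sub>L inlB" and emb13_inr: "D o\<^sub>L emb3 = (D o\<^sub>L emb13) o\<^sub>L inrB"
  by (auto intro!: blinfun_eqI)

lemma JF_norm_le:
  assumes "\<pi> \<in> W" "t \<in> {0..T}"
  shows "norm (JF \<pi> t o\<^sub>L emb1) \<le> c t" "norm (JF \<pi> t o\<^sub>L emb3) \<le> c t"
  unfolding emb13_inl emb13_inr
  using f_DH_le[OF assms] norm_inlB_le[of "JF \<pi> t o\<^sub>L emb13"] norm_inrB_le[of "JF \<pi> t o\<^sub>L emb13"] by (auto simp: J_parts[OF assms])

lemma J_seq: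
  assumes P: "\<And>n. P n \<in> W" "P \<longlonglongrightarrow> \<pi>" "\<pi> \<in> W" and t: "t \<in> {0..T}"
  shows "(\<lambda>n. J0 (P n) t o\<^sub>L emb1) \<longlonglongrightarrow> (J0 \<pi> t o\<^sub>L emb1)" "(\<lambda>n. J0 (P n) t o\<^sub>L emb3) \<longlonglongrightarrow> (J0 \<pi> t o\<^sub>L emb3)"
    "(\<lambda>n. JF (P n) t o\<^sub>L emb1) \<longlonglongrightarrow> (JF \<pi> t o\<^sub>L emb1)" "(\<lambda>n. JF (P n) t o\<^sub>L emb3) \<longlonglongrightarrow> (JF \<pi> t o\<^sub>L emb3)"
proof -
  have "(\<lambda>n. J0 (P n) t o\<^sub>L emb13) \<longlonglongrightarrow> (J0 \<pi> t o\<^sub>L emb13)" "(\<lambda>n. JF (P n) t o\<^sub>L emb13) \<longlonglongrightarrow> (JF \<pi> t o\<^sub>L emb13)"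
    using continuous_on_tendsto_compose[OF f0_DH_cont[OF t] P(2,3)] continuous_on_tendsto_compose[OF f_DH_cont[OF t] P(2,3)] P(1)
    by (simp_all add: J_parts[OF P(1) t] J_parts[OF P(3) t])
  then show "(\<lambda>n. J0 (P n) t o\<^sub>L emb1) \<longlonglongrightarrow> (J0 \<pi> t o\<^sub>L emb1)" "(\<lambda>n. J0 (P n) t o\<^sub>L emb3) \<longlonglongrightarrow> (J0 \<pi> t o\<^sub>L emb3)"
    "(\<lambda>n. JF (P n) t o\<^sub>L emb1) \<longlonglongrightarrow> (JF \<pi> t o\<^sub>L emb1)" "(\<lambda>n. JF (P n) t o\<^sub>L emb3) \<longlonglongrightarrow> (JF \<pi> t o\<^sub>L emb3)"
    unfolding emb13_inl emb13_inr
    by - (rule bounded_bilinear.tendsto[OF bounded_bilinear_blinfun_compose _ tendsto_const], assumption)+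
qed

lemma JE_seq:
  assumes P: "\<And>n. P n \<in> W" "P \<longlonglongrightarrow> \<pi>" "\<pi> \<in> W" and k: "k \<in> K"
  shows "(\<lambda>n. JE (P n) k) \<longlonglongrightarrow> JE \<pi> k"
  using continuous_on_tendsto_compose[OF endpoint_DH_cont[OF k] P(2,3)] P(1) by (simp add: JE_def)

text \<open>Both kinds of multipliers form one vector indexed by a sum type, so that all endpoint
  terms are a single sum over K. By uniqueness, the selected triple is determined on the relevant
  index sets.\<close>

definition "normal_triple \<pi> b p \<longleftrightarrow>
  pontryagin_triple T U m q f0 f g h \<pi> (x \<pi>) (u \<pi>) (\<lambda>i. b (Inl i)) (\<lambda>j. b (Inr j)) p \<and> b (Inl 0) = 1"
definition "multiplier \<pi> = fst (SOME bp. normal_triple \<pi> (fst bp) (snd bp))"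
definition "costate \<pi> = snd (SOME bp. normal_triple \<pi> (fst bp) (snd bp))"

lemma normal_triple:
  assumes "\<pi> \<in> W"
  shows "normal_triple \<pi> (multiplier \<pi>) (costate \<pi>)"
proof -
  interpret bolza_optimum T \<Omega> U \<xi>0 m q f0 f g h \<pi> "x \<pi>" "u \<pi>" by (rule opt[OF assms])
  obtain l \<mu> p where "pontryagin_triple T U m q f0 f g h \<pi> (x \<pi>) (u \<pi>) l \<mu> p" "l 0 = 1"
    using normal_triple_exists by blast
  then have "normal_triple \<pi> (case_sum l \<mu>) p" by (simp add: normal_triple_def)
  then have "\<exists>bp. normal_triple \<pi> (fst bp) (snd bp)" by (metis fst_conv snd_conv)
  from someI_ex[OF this] show ?thesis by (simp add: multiplier_def costate_def)
qed

lemma triple: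
  assumes "\<pi> \<in> W"
  shows "pontryagin_triple T U m q f0 f g h \<pi> (x \<pi>) (u \<pi>) (\<lambda>i. multiplier \<pi> (Inl i)) (\<lambda>j. multiplier \<pi> (Inr j)) (costate \<pi>)"
    "multiplier \<pi> (Inl 0) = 1"
  using normal_triple[OF assms] by (simp_all add: normal_triple_def)

lemma multiplier_stationary:
  assumes "\<pi> \<in> W"
  shows "(\<Sum>k\<in>{1..m} <+> {1..q}. multiplier \<pi> k *\<^sub>R (JE \<pi> k o\<^sub>L inlB o\<^sub>L (JF \<pi> T o\<^sub>L emb2))) =
    - ((JE \<pi> (Inl 0) o\<^sub>L inlB o\<^sub>L (JF \<pi> T o\<^sub>L emb2)) + (J0 \<pi> T o\<^sub>L emb2))"
proof -
  interpret bolza_optimum T \<Omega> U \<xi>0 m q f0 f g h \<pi> "x \<pi>" "u \<pi>" by (rule opt[OF assms])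
  have T: "T \<in> {0..T}" using T_pos by simp
  have case_eq: "(case k of Inl i \<Rightarrow> multiplier \<pi> (Inl i) | Inr j \<Rightarrow> multiplier \<pi> (Inr j)) = multiplier \<pi> k" for k
    by (cases k) simp_all
  have D: "endpoint_functional k = JE \<pi> k o\<^sub>L inlB o\<^sub>L (JF \<pi> T o\<^sub>L emb2)" if "k \<in> {1..m} <+> {1..q}" for k
  proof -
    have "k \<in> K" using that by (auto simp: Plus_def)
    from endpoint_parts(1)[OF assms this] show ?thesis by (auto simp: endpoint_functional_def f\<zeta>_def J_parts[OF assms T] Dg_def Dh_def split: sum.splits)
  qed
  have D0: "Dg 0 = JE \<pi> (Inl 0) o\<^sub>L inlB" using endpoint_parts(1)[OF assms, of "Inl 0"] by (simp add: Dg_def Plus_def)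
  have "(\<Sum>k\<in>{1..m} <+> {1..q}. multiplier \<pi> k *\<^sub>R endpoint_functional k) = - ((Dg 0 o\<^sub>L f\<zeta>) + f0\<zeta>)"
    using triple_stationary[OF triple(1)[OF assms]] triple(2)[OF assms] by (simp add: case_eq)
  then show ?thesis by (simp add: D D0 f\<zeta>_def f0\<zeta>_def J_parts[OF assms T])
qed

end

text \<open>Norm convergence is uniform on the unit ball, so the directions may vary with n without
  converging.\<close>

lemma blinfun_apply_diff_tendsto_0:
  fixes D :: "nat \<Rightarrow> 'a::real_normed_vector \<Rightarrow>\<^sub>L 'b::real_normed_vector"
  assumes D: "D \<longlonglongrightarrow> D'" and \<delta>: "\<And>n. norm (\<delta> n) \<le> 1"
  shows "(\<lambda>n. D n (\<delta> n) - D' (\<delta> n)) \<longlonglongrightarrow> 0"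
proof (rule Lim_null_comparison)
  have "norm (D n (\<delta> n) - D' (\<delta> n)) \<le> norm (D n - D')" for n
  proof -
    have "norm ((D n - D') (\<delta> n)) \<le> norm (D n - D') * norm (\<delta> n)" by (rule norm_blinfun)
    also have "\<dots> \<le> norm (D n - D') * 1" by (intro mult_left_mono \<delta>) simp
    finally show ?thesis by (simp add: blinfun.diff_left)
  qed
  then show "eventually (\<lambda>n. norm (D n (\<delta> n) - D' (\<delta> n)) \<le> norm (D n - D')) sequentially" by simp
  show "(\<lambda>n. norm (D n - D')) \<longlonglongrightarrow> 0" using D by (intro tendsto_norm_zero LIM_zero)
qed

context pos_time
begin

lemma m1_dominated_0:
  fixes F :: "nat \<Rightarrow> real \<Rightarrow> real"
  assumes "\<And>n. F n \<in> borel_measurable (m1 T)" "integrable (m1 T) w"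
    and "\<And>t. t \<in> {0..T} \<Longrightarrow> (\<lambda>n. F n t) \<longlonglongrightarrow> 0" "\<And>n t. t \<in> {0..T} \<Longrightarrow> \<bar>F n t\<bar> \<le> w t"
  shows "(\<lambda>n. \<integral>t. F n t \<partial>(m1 T)) \<longlonglongrightarrow> 0"
proof -
  have "(\<lambda>n. \<integral>t. F n t \<partial>(m1 T)) \<longlonglongrightarrow> (\<integral>t. 0 \<partial>(m1 T))"
    by (rule integral_dominated_convergence[where w = w]) (use assms in auto)
  then show ?thesis by simp
qed

end

section \<open>Convergence of multipliers and costates\<close>

context bolza_family
begin

lemma Inl_0_K: "Inl 0 \<in> K" and K1_K: "k \<in> {1..m} <+> {1..q} \<Longrightarrow> k \<in> K" and finite_K: "finite K"
  by (auto simp: Plus_def)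

lemma K_cases: "k \<in> K \<Longrightarrow> k = Inl 0 \<or> k \<in> {1..m} <+> {1..q}"
  by (auto simp: Plus_def)

lemma multiplier_seq:
  assumes P: "\<And>n. P n \<in> W" "P \<longlonglongrightarrow> \<pi>" "\<pi> \<in> W" and k: "k \<in> K"
  shows "(\<lambda>n. multiplier (P n) k) \<longlonglongrightarrow> multiplier \<pi> k"
proof -
  have T: "T \<in> {0..T}" using T_pos by simp
  let ?K1 = "{1..m} <+> {1..q}"
  define E where "E p k = JE p k o\<^sub>L inlB o\<^sub>L (JF p T o\<^sub>L emb2)" for p k
  define R where "R p = - (E p (Inl 0) + (J0 p T o\<^sub>L emb2))" for p
  have E_eq: "DH (\<lambda>\<xi>. endpoint k \<xi> p) (x p T) o\<^sub>L DH (\<lambda>\<zeta>. f T (x p T) \<zeta> p) (u p T) = E p k" if "p \<in> W" "k \<in> K" for p k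
    by (simp add: endpoint_parts[OF that] J_parts[OF that(1) T] E_def)
  have E_seq: "(\<lambda>n. E (P n) k) \<longlonglongrightarrow> E \<pi> k" if "k \<in> K" for k
    using continuous_on_tendsto_compose[OF endpoint_control_cont[OF that] P(2,3)] P(1) by (simp add: E_eq[OF P(1) that] E_eq[OF P(3) that])
  have "(\<lambda>n. J0 (P n) T o\<^sub>L emb2) \<longlonglongrightarrow> (J0 \<pi> T o\<^sub>L emb2)"
    using continuous_on_tendsto_compose[OF f0_control_cont P(2,3)] P(1) by (simp add: J_parts[OF P(1) T] J_parts[OF P(3) T])
  then have R_seq: "(\<lambda>n. R (P n)) \<longlonglongrightarrow> R \<pi>" unfolding R_def by (intro tendsto_minus tendsto_add E_seq Inl_0_K)
  have stat: "(\<Sum>k\<in>?K1. multiplier p k *\<^sub>R E p k) = R p" if "p \<in> W" for p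
    using multiplier_stationary[OF that] by (simp add: E_def R_def)
  define d where "d n k = multiplier (P n) k - multiplier \<pi> k" for n k
  \<comment> \<open>Subtracting the stationarity equations at \<open>P n\<close> and at \<pi> gives
    a linear equation for the difference of the multipliers, formed with the family at
    \<open>P n\<close>. Its right-hand side r involves only the fixed multipliers at \<pi> and tends
    to zero, and the uniform lower bound inverts the equation.\<close>
  define r where "r n = R (P n) - R \<pi> - (\<Sum>k\<in>?K1. multiplier \<pi> k *\<^sub>R (E (P n) k - E \<pi> k))" for n
  have sum: "(\<Sum>k\<in>?K1. d n k *\<^sub>R E (P n) k) = r n" for n
    by (simp add: d_def r_def scaleR_diff_left scaleR_diff_right sum_subtractf stat[OF P(1)] stat[OF P(3)] del: One_nat_def)
  have "r \<longlonglongrightarrow> R \<pi> - R \<pi> - (\<Sum>k\<in>?K1. multiplier \<pi> k *\<^sub>R (E \<pi> k - E \<pi> k))"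
    unfolding r_def by (intro tendsto_intros R_seq E_seq K1_K)
  then have r0: "(\<lambda>n. norm (r n) / \<epsilon>) \<longlonglongrightarrow> 0" using tendsto_divide[OF tendsto_norm_zero tendsto_const] \<epsilon>_pos by force
  have "\<epsilon> * (\<Sum>k\<in>?K1. \<bar>d n k\<bar>) \<le> norm (r n)" for n
    using lower_bound[OF P(1), of "d n" n] by (simp add: E_eq[OF P(1) K1_K] sum cong: sum.cong del: One_nat_def)
  then have le: "(\<Sum>k\<in>?K1. \<bar>d n k\<bar>) \<le> norm (r n) / \<epsilon>" for n using \<epsilon>_pos by (simp add: field_simps)
  show ?thesis
    using K_cases[OF k]
  proof
    assume "k = Inl 0"
    then show ?thesis by (simp add: triple(2) P)
  next
    assume k1: "k \<in> ?K1"
    have "norm (d n k) \<le> norm (r n) / \<epsilon>" for n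
      using order_trans[OF member_le_sum[OF k1, of "\<lambda>k. \<bar>d n k\<bar>"] le] by simp
    then have "(\<lambda>n. d n k) \<longlonglongrightarrow> 0" by (intro Lim_null_comparison[OF _ r0] always_eventually) simp
    then show ?thesis unfolding d_def by (rule LIM_zero_cancel)
  qed
qed

definition "A0 \<pi> t = bolza_optimum.A0 f0 \<pi> (x \<pi>) t (u \<pi> t)"
definition "A \<pi> t = bolza_optimum.A f \<pi> (x \<pi>) t (u \<pi> t)"

lemma A_eq:
  assumes "\<pi> \<in> W" "t \<in> {0..T}"
  shows "A0 \<pi> t = J0 \<pi> t o\<^sub>L emb1" "A \<pi> t = JF \<pi> t o\<^sub>L emb1"
  unfolding A0_def A_def by (rule state_parts[OF assms])+

lemma A_pcw:
  assumes "\<pi> \<in> W"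
  shows "pcw T UNIV (A0 \<pi>)" "pcw T UNIV (A \<pi>)"
  unfolding A0_def A_def using bolza_optimum.A_pcw(1,3)[OF opt[OF assms]] by auto

lemma costate_facts:
  assumes "\<pi> \<in> W"
  shows "continuous_on {0..T} (costate \<pi>)"
    "\<exists>S. finite S \<and> (\<forall>t\<in>{0<..<T} - S. (costate \<pi> has_vector_derivative - ((costate \<pi> t o\<^sub>L A \<pi> t) + A0 \<pi> t)) (at t))"
    "costate \<pi> T = (\<Sum>k\<in>K. multiplier \<pi> k *\<^sub>R (JE \<pi> k o\<^sub>L inlB))"
proof -
  interpret o: bolza_optimum T \<Omega> U \<xi>0 m q f0 f g h \<pi> "x \<pi>" "u \<pi>" by (rule opt[OF assms])
  note a = o.triple_adjoint[OF triple(1)[OF assms]]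
  show "continuous_on {0..T} (costate \<pi>)" by (rule a(1))
  show "\<exists>S. finite S \<and> (\<forall>t\<in>{0<..<T} - S. (costate \<pi> has_vector_derivative - ((costate \<pi> t o\<^sub>L A \<pi> t) + A0 \<pi> t)) (at t))"
    using a(2) triple(2)[OF assms] by (simp add: A_def A0_def)
  have "o.Dg i = JE \<pi> (Inl i) o\<^sub>L inlB" if "i \<in> {0..m}" for i
    using endpoint_parts(1)[OF assms InlI[OF that]] by (simp add: o.Dg_def)
  moreover have "o.Dh j = JE \<pi> (Inr j) o\<^sub>L inlB" if "j \<in> {1..q}" for j
    using endpoint_parts(1)[OF assms InrI[OF that]] by (simp add: o.Dh_def)
  ultimately show "costate \<pi> T = (\<Sum>k\<in>K. multiplier \<pi> k *\<^sub>R (JE \<pi> k o\<^sub>L inlB))"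
    using a(3) by (simp add: sum.Plus)
qed

lemma costate_bounded:
  assumes "\<pi> \<in> W"
  shows "\<exists>B>0. \<forall>t\<in>{0..T}. norm (costate \<pi> t) \<le> B"
  using pcw_bounded[OF continuous_pcw(1)[OF costate_facts(1)[OF assms] subset_UNIV]] by metis

text \<open>The difference of two costates solves an adjoint equation with coefficient
  \<open>A (P n)\<close>, a source made of coefficient differences, and a terminal value governed by
  the multipliers. The Gronwall factor is bounded through c uniformly in n, and the bound
  \<open>e n\<close> is uniform in time.\<close>

lemma costate_seq:
  assumes P: "\<And>n. P n \<in> W" "P \<longlonglongrightarrow> \<pi>" "\<pi> \<in> W"
  shows "\<exists>e. e \<longlonglongrightarrow> 0 \<and> (\<forall>n. \<forall>t\<in>{0..T}. norm (costate (P n) t - costate \<pi> t) \<le> e n)"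
proof -
  have T: "T \<in> {0..T}" using T_pos by simp
  obtain B where B: "0 < B" "\<And>t. t \<in> {0..T} \<Longrightarrow> norm (costate \<pi> t) \<le> B" using costate_bounded[OF P(3)] by blast
  \<comment> \<open>The coefficient differences are weighted by the limiting costate, which is
    bounded once and for all; no prior bound on the costates at \<open>P n\<close> is used.\<close>
  define \<gamma> where "\<gamma> n t = norm (costate \<pi> t) * norm (A (P n) t - A \<pi> t) + norm (A0 (P n) t - A0 \<pi> t)" for n t
  have \<gamma>_pcw: "pcw T UNIV (\<gamma> n)" for n
  proof -
    have c1: "continuous_on UNIV (\<lambda>z::('x \<Rightarrow>\<^sub>L 'x) \<times> ('x \<Rightarrow>\<^sub>L 'x). norm (fst z - snd z))"
      and c2: "continuous_on UNIV (\<lambda>z::('x \<Rightarrow>\<^sub>L real) \<times> ('x \<Rightarrow>\<^sub>L real). norm (fst z - snd z))"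
      and c3: "continuous_on UNIV (\<lambda>z::('x \<Rightarrow>\<^sub>L real) \<times> real. norm (fst z) * snd z)"
      and c4: "continuous_on UNIV (\<lambda>z::real \<times> real. fst z + snd z)"
      by (intro continuous_intros)+
    note p1 = pcw_map2(1)[OF A_pcw(2)[OF P(1)[of n]] A_pcw(2)[OF P(3)] c1]
    note p2 = pcw_map2(1)[OF A_pcw(1)[OF P(1)[of n]] A_pcw(1)[OF P(3)] c2]
    note p3 = pcw_map2(1)[OF continuous_pcw(1)[OF costate_facts(1)[OF P(3)] subset_UNIV] p1 c3]
    from pcw_map2(1)[OF p3 p2 c4] show ?thesis by (simp add: \<gamma>_def[abs_def])
  qed
  note \<gamma>_int = m1_integrable_pcw[OF \<gamma>_pcw]
  have "(\<lambda>n. \<integral>t. \<gamma> n t \<partial>(m1 T)) \<longlonglongrightarrow> 0"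
  proof (rule m1_dominated_0[where w = "\<lambda>t. B * (2 * c t) + 2 * \<bar>\<kappa> t\<bar>"])
    show "\<gamma> n \<in> borel_measurable (m1 T)" for n by (rule pcw_borel_measurable[OF \<gamma>_pcw])
    show "integrable (m1 T) (\<lambda>t. B * (2 * c t) + 2 * \<bar>\<kappa> t\<bar>)" using c \<kappa> by auto
    fix t assume t: "t \<in> {0..T}"
    have "(\<lambda>n. \<gamma> n t) \<longlonglongrightarrow> norm (costate \<pi> t) * norm (A \<pi> t - A \<pi> t) + norm (A0 \<pi> t - A0 \<pi> t)"
      unfolding \<gamma>_def using J_seq(1,3)[OF P t] by (intro tendsto_intros) (simp_all add: A_eq[OF P(1) t] A_eq[OF P(3) t])
    then show "(\<lambda>n. \<gamma> n t) \<longlonglongrightarrow> 0" by simp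
    fix n
    have "norm (A (P n) t - A \<pi> t) \<le> 2 * c t" "norm (A0 (P n) t - A0 \<pi> t) \<le> 2 * \<bar>\<kappa> t\<bar>"
      using norm_triangle_ineq4[of "A (P n) t" "A \<pi> t"] norm_triangle_ineq4[of "A0 (P n) t" "A0 \<pi> t"]
        J0_norm_le(1)[OF P(1)[of n] t] J0_norm_le(1)[OF P(3) t] JF_norm_le(1)[OF P(1)[of n] t] JF_norm_le(1)[OF P(3) t]
      unfolding A_eq[OF P(1) t] A_eq[OF P(3) t] by argo+
    then have "\<gamma> n t \<le> B * (2 * c t) + 2 * \<bar>\<kappa> t\<bar>" unfolding \<gamma>_def using B(1) B(2)[OF t] by (intro add_mono mult_mono) auto
    moreover have "0 \<le> \<gamma> n t" by (simp add: \<gamma>_def)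
    ultimately show "\<bar>\<gamma> n t\<bar> \<le> B * (2 * c t) + 2 * \<bar>\<kappa> t\<bar>" by simp
  qed
  then have \<gamma>0: "(\<lambda>n. integral {0..T} (\<gamma> n)) \<longlonglongrightarrow> 0" by (simp add: m1_integral_eq(2)[OF \<gamma>_int])
  have "(\<lambda>n. \<Sum>k\<in>K. multiplier (P n) k *\<^sub>R (JE (P n) k o\<^sub>L inlB)) \<longlonglongrightarrow> (\<Sum>k\<in>K. multiplier \<pi> k *\<^sub>R (JE \<pi> k o\<^sub>L inlB))"
    by (intro tendsto_sum tendsto_scaleR multiplier_seq[OF P] bounded_bilinear.tendsto[OF bounded_bilinear_blinfun_compose _ tendsto_const] JE_seq[OF P])
  then have "(\<lambda>n. costate (P n) T) \<longlonglongrightarrow> costate \<pi> T" by (simp add: costate_facts(3) P)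
  then have T0: "(\<lambda>n. norm (costate (P n) T - costate \<pi> T)) \<longlonglongrightarrow> 0" by (intro tendsto_norm_zero LIM_zero)
  define e where "e n = (norm (costate (P n) T - costate \<pi> T) + integral {0..T} (\<gamma> n)) * exp (integral {0..T} c)" for n
  have "e \<longlonglongrightarrow> (0 + 0) * exp (integral {0..T} c)" unfolding e_def by (intro tendsto_intros T0 \<gamma>0)
  then have e0: "e \<longlonglongrightarrow> 0" by simp
  have "norm (costate (P n) t - costate \<pi> t) \<le> e n" if t: "t \<in> {0..T}" for n t
  proof -
    obtain S1 where S1: "finite S1" "\<forall>t\<in>{0<..<T} - S1. (costate (P n) has_vector_derivative - ((costate (P n) t o\<^sub>L A (P n) t) + A0 (P n) t)) (at t)"
      using costate_facts(2)[OF P(1)[of n]] by (elim exE conjE)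
    obtain S2 where S2: "finite S2" "\<forall>t\<in>{0<..<T} - S2. (costate \<pi> has_vector_derivative - ((costate \<pi> t o\<^sub>L A \<pi> t) + A0 \<pi> t)) (at t)"
      using costate_facts(2)[OF P(3)] by (elim exE conjE)
    define w where "w t = costate (P n) t - costate \<pi> t" for t
    define k where "k t = - ((costate (P n) t o\<^sub>L A (P n) t) + A0 (P n) t) - - ((costate \<pi> t o\<^sub>L A \<pi> t) + A0 \<pi> t)" for t
    have wd: "(w has_vector_derivative k t) (at t)" if "t \<in> {0<..<T} - (S1 \<union> S2)" for t
      unfolding w_def k_def by (intro has_vector_derivative_diff) (use S1 S2 that in auto)
    have wc: "continuous_on {0..T} w" unfolding w_def by (intro continuous_intros costate_facts P)
    have \<beta>: "pcw T UNIV (\<lambda>t. norm (A (P n) t))"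
      by (rule pcw_map(1)[OF A_pcw(2)[OF P(1)]]) (intro continuous_intros)
    have kle: "norm (k t) \<le> norm (A (P n) t) * norm (w t) + \<gamma> n t" for t
    proof -
      \<comment> \<open>The product of costate and coefficient is split so that the moving
        coefficient acts on the difference of the costates, while the fixed costate meets the
        difference of the coefficients.\<close>
      have "k t = - ((w t o\<^sub>L A (P n) t) + (costate \<pi> t o\<^sub>L (A (P n) t - A \<pi> t)) + (A0 (P n) t - A0 \<pi> t))"
        by (rule blinfun_eqI) (simp add: k_def w_def blinfun.bilinear_simps)
      then have "norm (k t) = norm ((w t o\<^sub>L A (P n) t) + (costate \<pi> t o\<^sub>L (A (P n) t - A \<pi> t)) + (A0 (P n) t - A0 \<pi> t))"
        by (simp only: norm_minus_cancel)
      also have "\<dots> \<le> norm (w t o\<^sub>L A (P n) t) + norm (costate \<pi> t o\<^sub>L (A (P n) t - A \<pi> t)) + norm (A0 (P n) t - A0 \<pi> t)"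
        by (rule order_trans[OF norm_triangle_ineq add_right_mono[OF norm_triangle_ineq]])
      also have "\<dots> \<le> norm (w t) * norm (A (P n) t) + norm (costate \<pi> t) * norm (A (P n) t - A \<pi> t) + norm (A0 (P n) t - A0 \<pi> t)"
        by (intro add_mono norm_blinfun_compose order_refl)
      finally show ?thesis by (simp add: \<gamma>_def mult.commute)
    qed
    have "norm (w t) \<le> (norm (w T) + integral {0..T} (\<gamma> n)) * exp (integral {0..T} (\<lambda>t. norm (A (P n) t)))"
      by (rule gronwall_backward[OF finite_UnI[OF S1(1) S2(1)] wc wd \<beta> _ m1_integral_eq(1)[OF \<gamma>_int] _ kle t]) (auto simp: \<gamma>_def)
    also have "\<dots> \<le> (norm (w T) + integral {0..T} (\<gamma> n)) * exp (integral {0..T} c)"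
    proof (intro mult_left_mono add_nonneg_nonneg norm_ge_zero)
      show "exp (integral {0..T} (\<lambda>t. norm (A (P n) t))) \<le> exp (integral {0..T} c)"
        unfolding exp_le_cancel_iff by (rule integral_le[OF pcw_integrable[OF \<beta>] m1_integral_eq(1)[OF c]])
          (simp add: A_eq[OF P(1)] JF_norm_le[OF P(1)])
      show "0 \<le> integral {0..T} (\<gamma> n)" by (rule integral_nonneg[OF m1_integral_eq(1)[OF \<gamma>_int]]) (simp add: \<gamma>_def)
    qed
    finally show ?thesis by (simp add: w_def e_def)
  qed
  then show ?thesis using e0 by blast
qed

section \<open>The candidate differential and its continuity\<close>

lemma J_meas:
  assumes "\<pi> \<in> W"
  shows "(\<lambda>t. J0 \<pi> t (0, 0, \<delta>)) \<in> borel_measurable (m1 T)" "(\<lambda>t. JF \<pi> t (0, 0, \<delta>)) \<in> borel_measurable (m1 T)"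
proof -
  have m: "(\<lambda>D. blinfun_apply D \<delta>) \<in> borel_measurable borel" for \<delta> :: 'z
    by (intro borel_measurable_continuous_onI continuous_intros)
  have m': "(\<lambda>D :: 'z \<Rightarrow>\<^sub>L 'x. blinfun_apply D \<delta>) \<in> borel_measurable borel" for \<delta> :: 'z
    by (intro borel_measurable_continuous_onI continuous_intros)
  have "(\<lambda>t. DH (\<lambda>\<pi>'. f0 t (x \<pi> t) (u \<pi> t) \<pi>') \<pi> \<delta>) \<in> borel_measurable (m1 T)" by (rule measurable_compose[OF f0_meas[OF assms] m])
  then show "(\<lambda>t. J0 \<pi> t (0, 0, \<delta>)) \<in> borel_measurable (m1 T)"
    by (rule measurable_cong[THEN iffD1, rotated]) (simp add: J_parts[OF assms])
  have "(\<lambda>t. DH (\<lambda>\<pi>'. f t (x \<pi> t) (u \<pi> t) \<pi>') \<pi> \<delta>) \<in> borel_measurable (m1 T)" by (rule measurable_compose[OF f_meas[OF assms] m'])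
  then show "(\<lambda>t. JF \<pi> t (0, 0, \<delta>)) \<in> borel_measurable (m1 T)"
    by (rule measurable_cong[THEN iffD1, rotated]) (simp add: J_parts[OF assms])
qed

lemma J_param_le:
  assumes "\<pi> \<in> W" "t \<in> {0..T}"
  shows "\<bar>J0 \<pi> t (0, 0, \<delta>)\<bar> \<le> \<bar>\<kappa> t\<bar> * norm \<delta>" "norm (JF \<pi> t (0, 0, \<delta>)) \<le> c t * norm \<delta>"
proof -
  have "norm ((J0 \<pi> t o\<^sub>L emb3) \<delta>) \<le> \<bar>\<kappa> t\<bar> * norm \<delta>" "norm ((JF \<pi> t o\<^sub>L emb3) \<delta>) \<le> c t * norm \<delta>"
    by (rule order_trans[OF norm_blinfun mult_right_mono[OF J0_norm_le(2)[OF assms]]]; simp)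
      (rule order_trans[OF norm_blinfun mult_right_mono[OF JF_norm_le(2)[OF assms]]]; simp)
  then show "\<bar>J0 \<pi> t (0, 0, \<delta>)\<bar> \<le> \<bar>\<kappa> t\<bar> * norm \<delta>" "norm (JF \<pi> t (0, 0, \<delta>)) \<le> c t * norm \<delta>" by simp_all
qed

lemma J_integrable:
  assumes "\<pi> \<in> W"
  shows "integrable (m1 T) (\<lambda>t. J0 \<pi> t (0, 0, \<delta>))" "integrable (m1 T) (\<lambda>t. costate \<pi> t (JF \<pi> t (0, 0, \<delta>)))"
proof -
  obtain B where B: "0 < B" "\<And>t. t \<in> {0..T} \<Longrightarrow> norm (costate \<pi> t) \<le> B" using costate_bounded[OF assms] by blast
  have i: "integrable (m1 T) (\<lambda>t. \<bar>\<kappa> t\<bar> * norm \<delta>)" "integrable (m1 T) (\<lambda>t. B * (c t * norm \<delta>))"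
    using \<kappa> c by auto
  show "integrable (m1 T) (\<lambda>t. J0 \<pi> t (0, 0, \<delta>))"
    by (rule Bochner_Integration.integrable_bound[OF i(1) J_meas(1)[OF assms]], rule AE_I2)
      (use J_param_le(1)[OF assms] in \<open>auto simp: abs_mult\<close>)
  show "integrable (m1 T) (\<lambda>t. costate \<pi> t (JF \<pi> t (0, 0, \<delta>)))"
  proof (rule Bochner_Integration.integrable_bound[OF i(2) m1_measurable_pairing[OF costate_facts(1)[OF assms] J_meas(2)[OF assms]]], rule AE_I2)
    fix t assume "t \<in> space (m1 T)"
    then have t: "t \<in> {0..T}" by simp
    have "norm (costate \<pi> t (JF \<pi> t (0, 0, \<delta>))) \<le> norm (costate \<pi> t) * norm (JF \<pi> t (0, 0, \<delta>))" by (rule norm_blinfun)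
    also have "\<dots> \<le> B * (c t * norm \<delta>)" using B(2)[OF t] B(1) J_param_le(2)[OF assms t] by (intro mult_mono) auto
    finally show "norm (costate \<pi> t (JF \<pi> t (0, 0, \<delta>))) \<le> norm (B * (c t * norm \<delta>))" by simp
  qed
qed

text \<open>The right-hand side of the announced formula. The term of \<open>g 0\<close> belongs to
  the sum over K because its multiplier is 1.\<close>

definition "grad \<pi> \<delta> = (\<Sum>k\<in>K. multiplier \<pi> k * JE \<pi> k (0, \<delta>)) + (\<integral>t. J0 \<pi> t (0, 0, \<delta>) \<partial>(m1 T))
  + (\<integral>t. costate \<pi> t (JF \<pi> t (0, 0, \<delta>)) \<partial>(m1 T))"

lemma grad_bounded_linear:
  assumes "\<pi> \<in> W"
  shows "bounded_linear (grad \<pi>)"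
proof -
  obtain B where B: "0 < B" "\<And>t. t \<in> {0..T} \<Longrightarrow> norm (costate \<pi> t) \<le> B" using costate_bounded[OF assms] by blast
  note int = J_integrable[OF assms]
  have add0: "(0 :: 'x, a + b) = (0, a) + (0, b)" "(0 :: 'x, 0 :: 'y, a + b) = (0, 0, a) + (0, 0, b)" for a b :: 'z by simp_all
  have sc0: "(0 :: 'x, r *\<^sub>R a) = r *\<^sub>R (0, a)" "(0 :: 'x, 0 :: 'y, r *\<^sub>R a) = r *\<^sub>R (0, 0, a)" for r and a :: 'z by simp_all
  define C where "C = (\<Sum>k\<in>K. \<bar>multiplier \<pi> k\<bar> * norm (JE \<pi> k)) + (\<integral>t. \<bar>\<kappa> t\<bar> \<partial>(m1 T)) + (\<integral>t. B * c t \<partial>(m1 T))"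
  show ?thesis
  proof (rule bounded_linear_intro[where K = C])
    fix a b :: 'z
    show "grad \<pi> (a + b) = grad \<pi> a + grad \<pi> b"
      unfolding grad_def add0 blinfun.add_right
      using int[of a] int[of b] by (simp add: distrib_left sum.distrib del: add_Pair)
  next
    fix r and a :: 'z
    show "grad \<pi> (r *\<^sub>R a) = r *\<^sub>R grad \<pi> a"
      unfolding grad_def sc0 blinfun.scaleR_right
      by (simp add: sum_distrib_left distrib_left mult.left_commute del: scaleR_Pair)
  next
    fix a :: 'z
    have 1: "\<bar>\<Sum>k\<in>K. multiplier \<pi> k * JE \<pi> k (0, a)\<bar> \<le> (\<Sum>k\<in>K. \<bar>multiplier \<pi> k\<bar> * norm (JE \<pi> k)) * norm a"
      unfolding sum_distrib_right
    proof (rule order_trans[OF sum_abs sum_mono])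
      fix k
      have "\<bar>JE \<pi> k (0, a)\<bar> \<le> norm (JE \<pi> k) * norm a" using norm_blinfun[of "JE \<pi> k" "(0, a)"] by simp
      then show "\<bar>multiplier \<pi> k * JE \<pi> k (0, a)\<bar> \<le> \<bar>multiplier \<pi> k\<bar> * norm (JE \<pi> k) * norm a"
        by (simp add: abs_mult mult.assoc mult_left_mono)
    qed
    have 2: "\<bar>\<integral>t. J0 \<pi> t (0, 0, a) \<partial>(m1 T)\<bar> \<le> (\<integral>t. \<bar>\<kappa> t\<bar> \<partial>(m1 T)) * norm a"
    proof -
      have "\<bar>\<integral>t. J0 \<pi> t (0, 0, a) \<partial>(m1 T)\<bar> \<le> (\<integral>t. \<bar>\<kappa> t\<bar> * norm a \<partial>(m1 T))"
        by (rule integral_abs_bound_integral[OF int(1)]) (use \<kappa> J_param_le(1)[OF assms] in auto)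
      then show ?thesis by simp
    qed
    have 3: "\<bar>\<integral>t. costate \<pi> t (JF \<pi> t (0, 0, a)) \<partial>(m1 T)\<bar> \<le> (\<integral>t. B * c t \<partial>(m1 T)) * norm a"
    proof -
      have "\<bar>\<integral>t. costate \<pi> t (JF \<pi> t (0, 0, a)) \<partial>(m1 T)\<bar> \<le> (\<integral>t. B * c t * norm a \<partial>(m1 T))"
      proof (rule integral_abs_bound_integral[OF int(2)])
        fix t assume "t \<in> space (m1 T)"
        then have t: "t \<in> {0..T}" by simp
        have "norm (costate \<pi> t (JF \<pi> t (0, 0, a))) \<le> norm (costate \<pi> t) * norm (JF \<pi> t (0, 0, a))" by (rule norm_blinfun)
        also have "\<dots> \<le> B * (c t * norm a)" using B(2)[OF t] B(1) J_param_le(2)[OF assms t] by (intro mult_mono) auto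
        finally show "\<bar>costate \<pi> t (JF \<pi> t (0, 0, a))\<bar> \<le> B * c t * norm a" by (simp add: mult.assoc)
      qed (use c in auto)
      then show ?thesis by (simp add: mult.assoc)
    qed
    show "norm (grad \<pi> a) \<le> norm a * C"
      using 1 2 3 unfolding grad_def C_def by (simp add: algebra_simps)
  qed
qed

definition "gradB \<pi> = Blinfun (grad \<pi>)"

lemma gradB_apply: "\<pi> \<in> W \<Longrightarrow> gradB \<pi> \<delta> = grad \<pi> \<delta>"
  by (simp add: gradB_def bounded_linear_Blinfun_apply grad_bounded_linear)

text \<open>Along a sequence of parameters, unit directions are chosen that reach half the norm of
  the difference of the gradients. Each of the three terms, evaluated in these moving directions,
  tends to zero: the endpoint sum through its differentials, the integrals by dominated
  convergence.\<close>

lemma gradB_continuous: "continuous_on W gradB"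
  unfolding continuous_on_sequentially o_def
proof (intro allI ballI impI)
  fix P \<pi> assume \<pi>: "\<pi> \<in> W" and "(\<forall>n. P n \<in> W) \<and> P \<longlonglongrightarrow> \<pi>"
  then have P: "\<And>n. P n \<in> W" "P \<longlonglongrightarrow> \<pi>" "\<pi> \<in> W" by auto
  have "\<forall>n. \<exists>\<delta>. norm \<delta> \<le> 1 \<and> norm (gradB (P n) - gradB \<pi>) \<le> 2 * norm ((gradB (P n) - gradB \<pi>) \<delta>)"
    using blinfun_norm_half_attained by blast
  from choice[OF this] obtain \<delta> where \<delta>: "\<And>n. norm (\<delta> n) \<le> 1"
    and half: "\<And>n. norm (gradB (P n) - gradB \<pi>) \<le> 2 * norm ((gradB (P n) - gradB \<pi>) (\<delta> n))" by blast
  obtain B where B: "0 < B" "\<And>t. t \<in> {0..T} \<Longrightarrow> norm (costate \<pi> t) \<le> B" using costate_bounded[OF \<pi>] by blast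
  obtain e where e: "e \<longlonglongrightarrow> 0" "\<And>n t. t \<in> {0..T} \<Longrightarrow> norm (costate (P n) t - costate \<pi> t) \<le> e n"
    using costate_seq[OF P] by blast
  \<comment> \<open>A convergent sequence of errors is bounded, which bounds all the costates at
    \<open>P n\<close> at once and supplies the majorant for the last integral.\<close>
  obtain E where E: "0 < E" "\<And>n. \<bar>e n\<bar> \<le> E" using convergent_imp_Bseq[OF convergentI[OF e(1)]] by (auto simp: Bseq_def)
  have Bn: "norm (costate (P n) t) \<le> B + E" if "t \<in> {0..T}" for n t
    using e(2)[OF that, of n] E(2)[of n] B(2)[OF that] norm_triangle_sub[of "costate (P n) t" "costate \<pi> t"] by linarith
  define s1 where "s1 n = (\<Sum>k\<in>K. multiplier (P n) k * JE (P n) k (0, \<delta> n) - multiplier \<pi> k * JE \<pi> k (0, \<delta> n))" for n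
  define F2 where "F2 n t = J0 (P n) t (0, 0, \<delta> n) - J0 \<pi> t (0, 0, \<delta> n)" for n t
  define F3 where "F3 n t = costate (P n) t (JF (P n) t (0, 0, \<delta> n)) - costate \<pi> t (JF \<pi> t (0, 0, \<delta> n))" for n t
  have split: "(gradB (P n) - gradB \<pi>) (\<delta> n) = s1 n + (\<integral>t. F2 n t \<partial>(m1 T)) + (\<integral>t. F3 n t \<partial>(m1 T))" for n
    unfolding s1_def F2_def F3_def
    using J_integrable[OF P(1)[of n], of "\<delta> n"] J_integrable[OF \<pi>, of "\<delta> n"]
    by (simp add: blinfun.diff_left gradB_apply P grad_def sum_subtractf)
  have "(\<lambda>n. multiplier (P n) k * JE (P n) k (0, \<delta> n) - multiplier \<pi> k * JE \<pi> k (0, \<delta> n)) \<longlonglongrightarrow> 0" if k: "k \<in> K" for k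
    using blinfun_apply_diff_tendsto_0[OF tendsto_scaleR[OF multiplier_seq[OF P k] JE_seq[OF P k]], of "\<lambda>n. (0, \<delta> n)"] \<delta>
    by (simp add: blinfun.scaleR_left)
  from tendsto_sum[OF this] have s1: "s1 \<longlonglongrightarrow> 0" by (simp add: s1_def[abs_def])
  have s2: "(\<lambda>n. \<integral>t. F2 n t \<partial>(m1 T)) \<longlonglongrightarrow> 0"
  proof (rule m1_dominated_0[where w = "\<lambda>t. 2 * \<bar>\<kappa> t\<bar>"])
    show "F2 n \<in> borel_measurable (m1 T)" for n unfolding F2_def[abs_def] by (intro borel_measurable_diff J_meas P)
    show "integrable (m1 T) (\<lambda>t. 2 * \<bar>\<kappa> t\<bar>)" using \<kappa> by auto
    fix t assume t: "t \<in> {0..T}"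
    show "(\<lambda>n. F2 n t) \<longlonglongrightarrow> 0" using blinfun_apply_diff_tendsto_0[OF J_seq(2)[OF P t] \<delta>] by (simp add: F2_def)
    fix n
    have "\<bar>J0 p t (0, 0, \<delta> n)\<bar> \<le> \<bar>\<kappa> t\<bar>" if "p \<in> W" for p
      using order_trans[OF J_param_le(1)[OF that t] mult_left_mono[OF \<delta>[of n], of "\<bar>\<kappa> t\<bar>"]] by simp
    from this[OF P(1)[of n]] this[OF \<pi>] show "\<bar>F2 n t\<bar> \<le> 2 * \<bar>\<kappa> t\<bar>" by (simp add: F2_def)
  qed
  have s3: "(\<lambda>n. \<integral>t. F3 n t \<partial>(m1 T)) \<longlonglongrightarrow> 0"
  proof (rule m1_dominated_0[where w = "\<lambda>t. (B + E) * c t + B * c t"])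
    show "F3 n \<in> borel_measurable (m1 T)" for n unfolding F3_def[abs_def]
      by (intro borel_measurable_diff m1_measurable_pairing J_meas costate_facts P)
    show "integrable (m1 T) (\<lambda>t. (B + E) * c t + B * c t)" using c by auto
    fix t assume t: "t \<in> {0..T}"
    have "(\<lambda>n. costate (P n) t - costate \<pi> t) \<longlonglongrightarrow> 0"
      by (rule Lim_null_comparison[OF _ e(1)]) (use e(2)[OF t] in auto)
    then have "(\<lambda>n. costate (P n) t) \<longlonglongrightarrow> costate \<pi> t" by (rule LIM_zero_cancel)
    from bounded_bilinear.tendsto[OF bounded_bilinear_blinfun_compose this J_seq(4)[OF P t]]
    show "(\<lambda>n. F3 n t) \<longlonglongrightarrow> 0" using blinfun_apply_diff_tendsto_0[OF _ \<delta>] by (fastforce simp: F3_def)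
    fix n
    have J: "norm (JF p t (0, 0, \<delta> n)) \<le> c t" if "p \<in> W" for p
    proof -
      have "0 \<le> c t" using JF_norm_le(1)[OF that t] norm_ge_zero order_trans by blast
      from order_trans[OF J_param_le(2)[OF that t] mult_left_mono[OF \<delta>[of n] this]] show ?thesis by simp
    qed
    have "norm (costate (P n) t (JF (P n) t (0, 0, \<delta> n))) \<le> (B + E) * c t"
      by (rule order_trans[OF norm_blinfun mult_mono[OF Bn[OF t] J[OF P(1)]]]) (use B E in auto)
    moreover have "norm (costate \<pi> t (JF \<pi> t (0, 0, \<delta> n))) \<le> B * c t"
      by (rule order_trans[OF norm_blinfun mult_mono[OF B(2)[OF t] J[OF \<pi>]]]) (use B in auto)
    ultimately show "\<bar>F3 n t\<bar> \<le> (B + E) * c t + B * c t"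
      unfolding F3_def by (intro order_trans[OF abs_triangle_ineq4 add_mono]) auto
  qed
  have "(\<lambda>n. 2 * norm ((gradB (P n) - gradB \<pi>) (\<delta> n))) \<longlonglongrightarrow> 0"
    using tendsto_mult_right_zero[OF tendsto_norm_zero[OF tendsto_add_zero[OF tendsto_add_zero[OF s1 s2] s3]], of 2] unfolding split .
  then have "(\<lambda>n. gradB (P n) - gradB \<pi>) \<longlonglongrightarrow> 0"
    by (rule Lim_null_comparison[rotated]) (use half in auto)
  then show "(\<lambda>n. gradB (P n)) \<longlonglongrightarrow> gradB \<pi>" by (rule LIM_zero_cancel)
qed

section \<open>The differential of the value function\<close>

abbreviation "V \<equiv> bolza_value T \<Omega> U \<xi>0 m q f0 f g h"

lemma solution_facts:
  assumes "\<pi> \<in> W"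
  shows "x \<pi> \<in> PC1 T \<Omega>" "pcw T U (u \<pi>)" "x \<pi> 0 = \<xi>0" "t \<in> {0..T} \<Longrightarrow> ext_deriv T (x \<pi>) t = f t (x \<pi> t) (u \<pi> t) \<pi>"
    "pcw T UNIV (\<lambda>t. f0 t (x \<pi> t) (u \<pi> t) \<pi>)" "j \<in> {1..q} \<Longrightarrow> h j (x \<pi> T) \<pi> = 0"
    "V \<pi> = bolza_objective T f0 g \<pi> (x \<pi>) (u \<pi>)"
proof -
  interpret o: bolza_optimum T \<Omega> U \<xi>0 m q f0 f g h \<pi> "x \<pi>" "u \<pi>" by (rule opt[OF assms])
  show "x \<pi> \<in> PC1 T \<Omega>" "pcw T U (u \<pi>)" "x \<pi> 0 = \<xi>0" by (rule o.x_PC1 o.u_pcw o.x_0)+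
  show "t \<in> {0..T} \<Longrightarrow> ext_deriv T (x \<pi>) t = f t (x \<pi> t) (u \<pi> t) \<pi>" by (rule o.x_ode)
  show "pcw T UNIV (\<lambda>t. f0 t (x \<pi> t) (u \<pi> t) \<pi>)"
    by (rule o.f_along_pcw(3)[OF o.x_cont _ o.u_pcw]) (use o.x_in in auto)
  show "j \<in> {1..q} \<Longrightarrow> h j (x \<pi> T) \<pi> = 0" by (rule o.h_feas)
  have "(x \<pi>, u \<pi>) \<in> bolza_admissible T \<Omega> U \<xi>0 m q f g h \<pi>" using o.sol by (simp add: bolza_solution_def)
  then show "V \<pi> = bolza_objective T f0 g \<pi> (x \<pi>) (u \<pi>)"
    unfolding bolza_value_def by (intro cSup_eq_maximum) (auto intro: o.optimal intro!: image_eqI[of _ _ "(x \<pi>, u \<pi>)"])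
qed

text \<open>The value equals the objective along the selected solutions, so its quotient is a
  Hadamard quotient in the direction of the quotients of state, control and parameter. The limits v
  and w need not depend linearly on \<delta>; after the adjoint equation has been used, neither is
  left in the result.\<close>

lemma value_quotient_tendsto:
  assumes \<theta>: "\<And>n. 0 < \<theta> n" "\<theta> \<longlonglongrightarrow> 0" and P: "\<And>n. \<pi> + \<theta> n *\<^sub>R \<delta> \<in> W" and \<pi>: "\<pi> \<in> W"
  shows "(\<lambda>n. (1 / \<theta> n) * (V (\<pi> + \<theta> n *\<^sub>R \<delta>) - V \<pi>)) \<longlonglongrightarrow> grad \<pi> \<delta>"
proof -
  define p where "p n = \<pi> + \<theta> n *\<^sub>R \<delta>" for n
  have pW: "p n \<in> W" for n using P by (simp add: p_def)
  have "(\<lambda>n. \<pi> + \<theta> n *\<^sub>R \<delta>) \<longlonglongrightarrow> \<pi> + 0 *\<^sub>R \<delta>" by (intro tendsto_intros \<theta>(2))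
  then have p_lim: "p \<longlonglongrightarrow> \<pi>" by (simp add: p_def[abs_def])
  have T: "T \<in> {0..T}" "0 \<in> {0..T}" using T_pos by simp_all
  have \<theta>_right: "filterlim \<theta> (at_right 0) sequentially"
    unfolding filterlim_at using \<theta>(2) less_imp_neq[OF \<theta>(1), THEN not_sym] \<theta>(1) by simp
  obtain v where v: "v \<in> PC1 T UNIV"
    and v_lim: "((\<lambda>\<theta>. PC1_norm T (\<lambda>t. (1 / \<theta>) *\<^sub>R (x (\<pi> + \<theta> *\<^sub>R \<delta>) t - x \<pi> t) - v t)) \<longlongrightarrow> 0) (at_right 0)"
    using x_var[OF \<pi>, of \<delta>] unfolding path_variation_exists_def by blast
  obtain w where w: "w \<in> NPC0R T UNIV"
    and w_lim: "((\<lambda>\<theta>. sup_norm T (\<lambda>t. (1 / \<theta>) *\<^sub>R (u (\<pi> + \<theta> *\<^sub>R \<delta>) t - u \<pi> t) - w t)) \<longlongrightarrow> 0) (at_right 0)"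
    using u_var[OF \<pi>, of \<delta>] unfolding path_variation_exists_def by blast
  define vn where "vn n t = (1 / \<theta> n) *\<^sub>R (x (p n) t - x \<pi> t)" for n t
  define wn where "wn n t = (1 / \<theta> n) *\<^sub>R (u (p n) t - u \<pi> t)" for n t
  define a where "a n = PC1_norm T (\<lambda>t. vn n t - v t)" for n
  define b where "b n = sup_norm T (\<lambda>t. wn n t - w t)" for n
  have a0: "a \<longlonglongrightarrow> 0" using filterlim_compose[OF v_lim \<theta>_right] by (simp add: a_def[abs_def] vn_def p_def)
  have b0: "b \<longlonglongrightarrow> 0" using filterlim_compose[OF w_lim \<theta>_right] by (simp add: b_def[abs_def] wn_def p_def)
  \<comment> \<open>By linearity this quotient of f is the extended derivative of
    \<open>vn n\<close>, so the norm of \<open>PC1\<close> controls it together with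
    \<open>vn n\<close> itself.\<close>
  define fn where "fn n t = (1 / \<theta> n) *\<^sub>R (f t (x (p n) t) (u (p n) t) (p n) - f t (x \<pi> t) (u \<pi> t) \<pi>)" for n t
  have va: "norm (vn n t - v t) \<le> a n" "norm (fn n t - ext_deriv T v t) \<le> a n" if t: "t \<in> {0..T}" for n t
  proof -
    note l1 = PC1_linear_combination[OF solution_facts(1)[OF pW[of n]] solution_facts(1)[OF \<pi>], where a = "1 / \<theta> n" and b = "- (1 / \<theta> n)"]
    note l2 = PC1_linear_combination[OF l1(1) v, where a = 1 and b = "-1"]
    have eq: "(\<lambda>t. 1 *\<^sub>R ((1 / \<theta> n) *\<^sub>R x (p n) t + - (1 / \<theta> n) *\<^sub>R x \<pi> t) + (-1) *\<^sub>R v t) = (\<lambda>t. vn n t - v t)"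
      by (simp add: vn_def fun_eq_iff scaleR_diff_right)
    have "ext_deriv T (\<lambda>t. vn n t - v t) t = fn n t - ext_deriv T v t"
      using l2(2)[OF t] l1(2)[OF t] unfolding eq
      by (simp add: fn_def solution_facts(4)[OF pW t] solution_facts(4)[OF \<pi> t] scaleR_diff_right)
    then show "norm (vn n t - v t) \<le> a n" "norm (fn n t - ext_deriv T v t) \<le> a n"
      using PC1_norm_upper[OF l2(1)[unfolded eq] t] by (simp_all add: a_def)
  qed
  have w_pcw: "pcw T UNIV w" using w by (simp add: NPC0R_iff)
  have wb: "norm (wn n t - w t) \<le> b n" if t: "t \<in> {0..T}" for n t
  proof -
    have c1: "continuous_on UNIV (\<lambda>z :: 'y \<times> 'y. (1 / \<theta> n) *\<^sub>R (fst z - snd z))"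
      and c2: "continuous_on UNIV (\<lambda>z :: 'y \<times> 'y. fst z - snd z)" by (intro continuous_intros)+
    note u_pcw = pcw_mono[OF solution_facts(2) subset_UNIV]
    from pcw_map2(1)[OF pcw_map2(1)[OF u_pcw[OF pW[of n]] u_pcw[OF \<pi>] c1] w_pcw c2]
    have "pcw T UNIV (\<lambda>t. wn n t - w t)" by (simp add: wn_def)
    from sup_norm_upper(1)[OF this t] show ?thesis by (simp add: b_def)
  qed
  have vn_lim: "(\<lambda>n. vn n t) \<longlonglongrightarrow> v t" and fn_lim: "(\<lambda>n. fn n t) \<longlonglongrightarrow> ext_deriv T v t" if "t \<in> {0..T}" for t
    by (rule LIM_zero_cancel, rule Lim_null_comparison[OF _ a0], use va[OF that] in simp)+
  have wn_lim: "(\<lambda>n. wn n t) \<longlonglongrightarrow> w t" if "t \<in> {0..T}" for t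
    by (rule LIM_zero_cancel, rule Lim_null_comparison[OF _ b0], use wb[OF that] in simp)
  have arg: "(x \<pi> t, u \<pi> t, \<pi>) + \<theta> n *\<^sub>R (vn n t, wn n t, \<delta>) = (x (p n) t, u (p n) t, p n)" for n t
    using \<theta>(1)[of n] by (simp add: vn_def wn_def p_def)
  have dir: "(\<lambda>n. (vn n t, wn n t, \<delta>)) \<longlonglongrightarrow> (v t, w t, \<delta>)" if "t \<in> {0..T}" for t
    by (intro tendsto_Pair vn_lim wn_lim that tendsto_const)
  define qn where "qn n t = (1 / \<theta> n) * (f0 t (x (p n) t) (u (p n) t) (p n) - f0 t (x \<pi> t) (u \<pi> t) \<pi>)" for n t
  have f_lim: "(\<lambda>n. fn n t) \<longlonglongrightarrow> JF \<pi> t (v t, w t, \<delta>)" and q_lim: "(\<lambda>n. qn n t) \<longlonglongrightarrow> J0 \<pi> t (v t, w t, \<delta>)" if t: "t \<in> {0..T}" for t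
    using hadamard_seq[OF J_had(2)[OF \<pi> t] \<theta>_right dir[OF t]] hadamard_seq[OF J_had(1)[OF \<pi> t] \<theta>_right dir[OF t]]
    unfolding arg by (simp_all add: fn_def qn_def)
  \<comment> \<open>The quotient \<open>fn\<close> has two limits: the extended derivative of v, by
    convergence in \<open>PC1\<close>, and the Hadamard limit. Equating them gives the linearised
    equation without integrating any quotient of f.\<close>
  have v_ode: "ext_deriv T v t = JF \<pi> t (v t, w t, \<delta>)" if "t \<in> {0..T}" for t
    by (rule LIMSEQ_unique[OF fn_lim[OF that] f_lim[OF that]])
  have "vn n 0 = 0" for n by (simp add: vn_def solution_facts(3) pW \<pi>)
  then have v_0: "v 0 = 0" using vn_lim[OF T(2)] by (simp add: LIMSEQ_const_iff)

  have q_pcw: "pcw T UNIV (qn n)" for n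
  proof -
    have "continuous_on UNIV (\<lambda>z :: real \<times> real. (1 / \<theta> n) * (fst z - snd z))" by (intro continuous_intros)
    from pcw_map2(1)[OF solution_facts(5)[OF pW[of n]] solution_facts(5)[OF \<pi>] this] show ?thesis by (simp add: qn_def[abs_def])
  qed
  obtain Bv where Bv: "0 < Bv" "\<And>t. t \<in> {0..T} \<Longrightarrow> norm (v t) \<le> Bv"
    using pcw_bounded[OF continuous_pcw(1)[OF PC1_D(1)[OF v] subset_UNIV]] by metis
  obtain Bw where Bw: "0 < Bw" "\<And>t. t \<in> {0..T} \<Longrightarrow> norm (w t) \<le> Bw" using pcw_bounded[OF w_pcw] by metis
  obtain Ba where Ba: "\<And>n. \<bar>a n\<bar> \<le> Ba" using convergent_imp_Bseq[OF convergentI[OF a0]] by (auto simp: Bseq_def)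
  obtain Bb where Bb: "\<And>n. \<bar>b n\<bar> \<le> Bb" using convergent_imp_Bseq[OF convergentI[OF b0]] by (auto simp: Bseq_def)
  define C where "C = (Ba + Bv) + (Bb + Bw) + norm \<delta>"
  \<comment> \<open>Both solutions lie in the region of the Lipschitz bound, and the quotients of
    state and control are uniformly bounded; so a multiple of the absolute value of \<kappa>
    dominates.\<close>
  have q_le: "\<bar>qn n t\<bar> \<le> \<bar>\<kappa> t\<bar> * C" if t: "t \<in> {0..T}" for n t
  proof -
    have "norm (vn n t) \<le> Ba + Bv"
      using norm_triangle_sub[of "vn n t" "v t"] va(1)[OF t, of n] Ba[of n] Bv(2)[OF t] by linarith
    moreover have "norm (wn n t) \<le> Bb + Bw"
      using norm_triangle_sub[of "wn n t" "w t"] wb[OF t, of n] Bb[of n] Bw(2)[OF t] by linarith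
    ultimately have le: "norm (vn n t) + norm (wn n t) + norm \<delta> \<le> C" by (simp add: C_def)
    have "\<bar>f0 t (x (p n) t) (u (p n) t) (p n) - f0 t (x \<pi> t) (u \<pi> t) \<pi>\<bar>
        \<le> \<kappa> t * (norm (x (p n) t - x \<pi> t) + norm (u (p n) t - u \<pi> t) + norm (p n - \<pi>))"
      by (rule f0_lip[OF t N(2)[OF pW t] N(2)[OF \<pi> t]])
    also have "\<dots> = \<theta> n * (\<kappa> t * (norm (vn n t) + norm (wn n t) + norm \<delta>))"
    proof -
      have "norm (x (p n) t - x \<pi> t) = \<theta> n * norm (vn n t)" "norm (u (p n) t - u \<pi> t) = \<theta> n * norm (wn n t)"
        "norm (p n - \<pi>) = \<theta> n * norm \<delta>"
        using \<theta>(1)[of n] by (simp_all add: vn_def wn_def p_def)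
      then show ?thesis by (simp add: algebra_simps)
    qed
    finally have "\<bar>qn n t\<bar> \<le> \<kappa> t * (norm (vn n t) + norm (wn n t) + norm \<delta>)"
      using \<theta>(1)[of n] by (simp add: qn_def abs_mult field_simps)
    also have "\<dots> \<le> \<bar>\<kappa> t\<bar> * (norm (vn n t) + norm (wn n t) + norm \<delta>)" by (intro mult_right_mono) auto
    also have "\<dots> \<le> \<bar>\<kappa> t\<bar> * C" by (intro mult_left_mono le) auto
    finally show ?thesis .
  qed
  have J_m: "(\<lambda>t. J0 \<pi> t (v t, w t, \<delta>)) \<in> borel_measurable (m1 T)"
    by (rule borel_measurable_LIMSEQ_real[where u = qn, OF _ pcw_borel_measurable[OF q_pcw]]) (use q_lim in auto)
  have wi: "integrable (m1 T) (\<lambda>t. \<bar>\<kappa> t\<bar> * C)" using \<kappa> by auto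
  have q_ae: "AE t in m1 T. (\<lambda>n. qn n t) \<longlonglongrightarrow> J0 \<pi> t (v t, w t, \<delta>)" "\<And>n. AE t in m1 T. norm (qn n t) \<le> \<bar>\<kappa> t\<bar> * C"
    by (rule AE_I2; use q_lim q_le in simp)+
  note J_int = integrable_dominated_convergence[OF J_m pcw_borel_measurable[OF q_pcw] wi q_ae]
  note q_int_lim = integral_dominated_convergence[OF J_m pcw_borel_measurable[OF q_pcw] wi q_ae]

  define en where "en n k = (1 / \<theta> n) * (endpoint k (x (p n) T) (p n) - endpoint k (x \<pi> T) \<pi>)" for n k
  have e_lim: "(\<lambda>n. en n k) \<longlonglongrightarrow> JE \<pi> k (v T, \<delta>)" if "k \<in> K" for k
  proof -
    have d: "(\<lambda>n. (vn n T, \<delta>)) \<longlonglongrightarrow> (v T, \<delta>)" by (intro tendsto_Pair vn_lim T tendsto_const)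
    have a: "(x \<pi> T, \<pi>) + \<theta> n *\<^sub>R (vn n T, \<delta>) = (x (p n) T, p n)" for n
      using \<theta>(1)[of n] by (simp add: vn_def p_def)
    show ?thesis using hadamard_seq[OF JE_had[OF \<pi> that] \<theta>_right d] unfolding a by (simp add: en_def)
  qed
  have vanish: "multiplier \<pi> k * JE \<pi> k (v T, \<delta>) = 0" if "k \<in> {1..m} <+> {1..q}" for k
  proof (cases k)
    case (Inr j)
    then have j: "j \<in> {1..q}" using that by auto
    from Inr have "en n k = 0" for n by (simp add: en_def solution_facts(6)[OF pW j] solution_facts(6)[OF \<pi> j])
    then show ?thesis using e_lim[OF K1_K[OF that]] by (simp add: LIMSEQ_const_iff)
  next
    case (Inl i)
    then have i: "i \<in> {1..m}" using that by auto
    show ?thesis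
    proof (cases "multiplier \<pi> k = 0")
      case False
      have slack: "multiplier r (Inl i) * g i (x r T) r = 0" if "r \<in> W" for r
        using triple(1)[OF that] i unfolding pontryagin_triple_def by blast
      have "eventually (\<lambda>n. multiplier (p n) k \<noteq> 0) sequentially"
        by (rule tendsto_imp_eventually_ne[OF multiplier_seq[OF pW p_lim \<pi> K1_K[OF that]] False])
      then have "eventually (\<lambda>n. en n k = 0) sequentially"
        by (rule eventually_mono) (use slack[OF pW] slack[OF \<pi>] False Inl in \<open>auto simp: en_def\<close>)
      then have "(\<lambda>n. en n k) \<longlonglongrightarrow> 0" by (rule tendsto_eventually)
      from LIMSEQ_unique[OF this e_lim[OF K1_K[OF that]]] show ?thesis by simp
    qed simp
  qed
  \<comment> \<open>Since the constraint terms vanish, they may be added for free; this turns the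
    differential of the final cost into the terminal value of the costate plus explicit parameter
    terms.\<close>
  have "JE \<pi> (Inl 0) (v T, \<delta>) = (\<Sum>k\<in>K. multiplier \<pi> k * JE \<pi> k (v T, \<delta>))"
  proof -
    have "(\<Sum>k\<in>K - {Inl 0}. multiplier \<pi> k * JE \<pi> k (v T, \<delta>)) = 0"
      by (rule sum.neutral) (use vanish K_cases in blast)
    then show ?thesis by (simp add: sum.remove[OF finite_K Inl_0_K] triple(2)[OF \<pi>] del: One_nat_def)
  qed
  also have "\<dots> = costate \<pi> T (v T) + (\<Sum>k\<in>K. multiplier \<pi> k * JE \<pi> k (0, \<delta>))"
  proof -
    have "JE \<pi> k (v T, \<delta>) = JE \<pi> k (v T, 0) + JE \<pi> k (0, \<delta>)" for k by (simp flip: blinfun.add_right)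
    then show ?thesis
      by (simp add: costate_facts(3)[OF \<pi>] blinfun.sum_left blinfun.scaleR_left distrib_left sum.distrib)
  qed
  finally have end_eq: "JE \<pi> (Inl 0) (v T, \<delta>) = costate \<pi> T (v T) + (\<Sum>k\<in>K. multiplier \<pi> k * JE \<pi> k (0, \<delta>))" .

  define s where "s t = J0 \<pi> t (0, 0, \<delta>) + costate \<pi> t (JF \<pi> t (0, 0, \<delta>)) - J0 \<pi> t (v t, w t, \<delta>)" for t
  \<comment> \<open>The derivative of the costate applied to v: the state parts cancel by the
    adjoint equation against those of the dynamics, and the control part is replaced through
    stationarity of the Hamiltonian at t.\<close>
  have s_eq: "costate \<pi> t (JF \<pi> t (v t, w t, \<delta>)) - (costate \<pi> t (A \<pi> t (v t)) + A0 \<pi> t (v t)) = s t" if t: "t \<in> {0..T}" for t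
  proof -
    interpret o: bolza_optimum T \<Omega> U \<xi>0 m q f0 f g h \<pi> "x \<pi>" "u \<pi>" by (rule opt[OF \<pi>])
    have stat: "costate \<pi> t (JF \<pi> t (0, w t, 0)) + J0 \<pi> t (0, w t, 0) = 0"
      using o.triple_stationary_at[OF triple(1)[OF \<pi>] t has_hadamard_partials(2)[OF J_had(2)[OF \<pi> t]] has_hadamard_partials(2)[OF J_had(1)[OF \<pi> t]]]
      by (simp add: triple(2)[OF \<pi>])
    have dec: "(v t, w t, \<delta>) = (v t, 0, 0) + (0, w t, 0) + (0, 0, \<delta>)" by simp
    show ?thesis unfolding s_def A_eq[OF \<pi> t] dec using stat by (simp add: blinfun.add_right del: add_Pair)
  qed
  obtain S1 where S1: "finite S1" "\<forall>t\<in>{0<..<T} - S1. (v has_vector_derivative ext_deriv T v t) (at t)"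
    using PC1_D(5)[OF v] by (elim exE conjE)
  obtain S2 where S2: "finite S2" "\<forall>t\<in>{0<..<T} - S2. (costate \<pi> has_vector_derivative - ((costate \<pi> t o\<^sub>L A \<pi> t) + A0 \<pi> t)) (at t)"
    using costate_facts(2)[OF \<pi>] by (elim exE conjE)
  have "(s has_integral costate \<pi> T (v T) - costate \<pi> 0 (v 0)) {0..T}"
  proof (rule fundamental_theorem_of_calculus_interior_strong[OF finite_UnI[OF S1(1) S2(1)]])
    show "continuous_on {0..T} (\<lambda>t. costate \<pi> t (v t))" by (intro continuous_intros costate_facts \<pi> PC1_D(1)[OF v])
    fix t assume t: "t \<in> {0<..<T} - (S1 \<union> S2)"
    then have t': "t \<in> {0..T}" by simp
    have "((\<lambda>t. costate \<pi> t (v t)) has_vector_derivative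
        costate \<pi> t (ext_deriv T v t) + (- ((costate \<pi> t o\<^sub>L A \<pi> t) + A0 \<pi> t)) (v t)) (at t)"
      by (rule bounded_bilinear.has_vector_derivative[OF bounded_bilinear_blinfun_apply]) (use S1 S2 t in auto)
    moreover have "costate \<pi> t (ext_deriv T v t) + (- ((costate \<pi> t o\<^sub>L A \<pi> t) + A0 \<pi> t)) (v t) = s t"
      by (simp only: s_eq[OF t', symmetric] v_ode[OF t'] blinfun.minus_left blinfun.add_left blinfun_apply_blinfun_compose)
    ultimately show "((\<lambda>t. costate \<pi> t (v t)) has_vector_derivative s t) (at t)" by simp
  qed (use T_pos in simp)
  then have "integral {0..T} s = costate \<pi> T (v T)" by (simp add: v_0 integral_unique)
  moreover have "integrable (m1 T) s" unfolding s_def using J_integrable[OF \<pi>, of \<delta>] J_int by auto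
  from m1_integral_eq(2)[OF this] have "integral {0..T} s = (\<integral>t. J0 \<pi> t (0, 0, \<delta>) \<partial>(m1 T))
      + (\<integral>t. costate \<pi> t (JF \<pi> t (0, 0, \<delta>)) \<partial>(m1 T)) - (\<integral>t. J0 \<pi> t (v t, w t, \<delta>) \<partial>(m1 T))"
    unfolding s_def using J_integrable[OF \<pi>, of \<delta>] J_int by simp
  \<comment> \<open>As v vanishes at 0, integrating the identity for \<open>s\<close> trades the
    terminal pairing for integrals. Those containing v and w are exactly the limit of the running
    cost.\<close>
  ultimately have grad_eq: "grad \<pi> \<delta> = (\<integral>t. J0 \<pi> t (v t, w t, \<delta>) \<partial>(m1 T)) + JE \<pi> (Inl 0) (v T, \<delta>)"
    unfolding end_eq grad_def by simp
  have V_eq: "(1 / \<theta> n) * (V (p n) - V \<pi>) = (\<integral>t. qn n t \<partial>(m1 T)) + en n (Inl 0)" for n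
    using m1_integrable_pcw[OF solution_facts(5)[OF pW[of n]]] m1_integrable_pcw[OF solution_facts(5)[OF \<pi>]]
    by (simp add: solution_facts(7) pW \<pi> bolza_objective_def qn_def en_def diff_divide_distrib add_divide_distrib)
  have "(\<lambda>n. (1 / \<theta> n) * (V (p n) - V \<pi>)) \<longlonglongrightarrow> grad \<pi> \<delta>"
    unfolding V_eq grad_eq by (intro tendsto_add q_int_lim e_lim Inl_0_K)
  then show ?thesis by (simp add: p_def)
qed

text \<open>Right limits are tested on sequences, and W is open, so dropping finitely many terms
  keeps the perturbed parameters inside W.\<close>

lemma value_gateaux:
  assumes \<pi>: "\<pi> \<in> W"
  shows "has_gateaux V (gradB \<pi>) \<pi>"
  unfolding has_gateaux_def has_right_variation_def
proof
  fix \<delta>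
  show "((\<lambda>\<theta>. (1 / \<theta>) *\<^sub>R (V (\<pi> + \<theta> *\<^sub>R \<delta>) - V \<pi>)) \<longlongrightarrow> gradB \<pi> \<delta>) (at_right 0)"
    unfolding tendsto_at_iff_sequentially o_def
  proof (intro allI impI)
    fix X :: "nat \<Rightarrow> real" assume X: "\<forall>i. X i \<in> {0<..} - {0}" "X \<longlonglongrightarrow> 0"
    have "(\<lambda>n. \<pi> + X n *\<^sub>R \<delta>) \<longlonglongrightarrow> \<pi> + 0 *\<^sub>R \<delta>" by (intro tendsto_intros X)
    then have "eventually (\<lambda>n. \<pi> + X n *\<^sub>R \<delta> \<in> W) sequentially" using topological_tendstoD[OF _ W] \<pi> by fastforce
    then obtain n0 where n0: "\<And>n. n0 \<le> n \<Longrightarrow> \<pi> + X n *\<^sub>R \<delta> \<in> W" by (auto simp: eventually_sequentially)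
    have "(\<lambda>n. (1 / X (n + n0)) * (V (\<pi> + X (n + n0) *\<^sub>R \<delta>) - V \<pi>)) \<longlonglongrightarrow> grad \<pi> \<delta>"
      by (rule value_quotient_tendsto[OF _ LIMSEQ_ignore_initial_segment[OF X(2)] n0 \<pi>]) (use X in auto)
    from LIMSEQ_offset[OF this] show "(\<lambda>n. (1 / X n) *\<^sub>R (V (\<pi> + X n *\<^sub>R \<delta>) - V \<pi>)) \<longlonglongrightarrow> gradB \<pi> \<delta>"
      by (simp add: gradB_apply[OF \<pi>])
  qed
qed

lemma value_has_derivative: "\<pi> \<in> W \<Longrightarrow> (V has_derivative gradB \<pi>) (at \<pi>)"
  by (rule gateaux_C1_has_derivative[OF W value_gateaux gradB_continuous])

lemma DF_value: "\<pi> \<in> W \<Longrightarrow> DF V \<pi> = gradB \<pi>"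
  by (rule DF_eq[OF value_has_derivative])

lemma normal_triple_conclusion:
  assumes \<pi>: "\<pi> \<in> W"
  shows "\<exists>l \<mu> p.
       pontryagin_triple T U m q f0 f g h \<pi> (x \<pi>) (u \<pi>) l \<mu> p \<and> l 0 = 1 \<and>
       (\<forall>l' \<mu>' p'. pontryagin_triple T U m q f0 f g h \<pi> (x \<pi>) (u \<pi>) l' \<mu>' p' \<and> l' 0 = 1 \<longrightarrow>
          (\<forall>i\<in>{0..m}. l' i = l i) \<and> (\<forall>j\<in>{1..q}. \<mu>' j = \<mu> j) \<and> (\<forall>t\<in>{0..T}. p' t = p t)) \<and>
       (\<forall>\<delta>.
          integrable (m1 T) (\<lambda>t. DH (\<lambda>\<pi>'. f0 t (x \<pi> t) (u \<pi> t) \<pi>') \<pi> \<delta>) \<and>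
          integrable (m1 T) (\<lambda>t. p t (DH (\<lambda>\<pi>'. f t (x \<pi> t) (u \<pi> t) \<pi>') \<pi> \<delta>)) \<and>
          DF V \<pi> \<delta> =
            DH (\<lambda>\<pi>'. g 0 (x \<pi> T) \<pi>') \<pi> \<delta>
            + (\<Sum>i\<in>{1..m}. l i * DH (\<lambda>\<pi>'. g i (x \<pi> T) \<pi>') \<pi> \<delta>)
            + (\<Sum>j\<in>{1..q}. \<mu> j * DH (\<lambda>\<pi>'. h j (x \<pi> T) \<pi>') \<pi> \<delta>)
            + (\<integral>t. DH (\<lambda>\<pi>'. f0 t (x \<pi> t) (u \<pi> t) \<pi>') \<pi> \<delta> \<partial>(m1 T))
            + (\<integral>t. p t (DH (\<lambda>\<pi>'. f t (x \<pi> t) (u \<pi> t) \<pi>') \<pi> \<delta>) \<partial>(m1 T)))"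
proof (rule exI[of _ "\<lambda>i. multiplier \<pi> (Inl i)"], rule exI[of _ "\<lambda>j. multiplier \<pi> (Inr j)"], rule exI[of _ "costate \<pi>"],
    intro conjI triple[OF \<pi>] allI impI)
  fix l' \<mu>' p' assume "pontryagin_triple T U m q f0 f g h \<pi> (x \<pi>) (u \<pi>) l' \<mu>' p' \<and> l' 0 = 1"
  then have *: "pontryagin_triple T U m q f0 f g h \<pi> (x \<pi>) (u \<pi>) l' \<mu>' p'" "l' 0 = 1" by auto
  note unique = bolza_optimum.normal_triple_unique[OF opt[OF \<pi>] triple[OF \<pi>] *]
  show "\<forall>i\<in>{0..m}. l' i = multiplier \<pi> (Inl i)" "\<forall>j\<in>{1..q}. \<mu>' j = multiplier \<pi> (Inr j)" "\<forall>t\<in>{0..T}. p' t = costate \<pi> t"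
    by (rule unique)+
next
  fix \<delta>
  have J: "DH (\<lambda>\<pi>'. f0 t (x \<pi> t) (u \<pi> t) \<pi>') \<pi> \<delta> = J0 \<pi> t (0, 0, \<delta>)"
    "DH (\<lambda>\<pi>'. f t (x \<pi> t) (u \<pi> t) \<pi>') \<pi> \<delta> = JF \<pi> t (0, 0, \<delta>)" if "t \<in> space (m1 T)" for t
    using that by (simp_all add: J_parts[OF \<pi>])
  show "integrable (m1 T) (\<lambda>t. DH (\<lambda>\<pi>'. f0 t (x \<pi> t) (u \<pi> t) \<pi>') \<pi> \<delta>)"
    "integrable (m1 T) (\<lambda>t. costate \<pi> t (DH (\<lambda>\<pi>'. f t (x \<pi> t) (u \<pi> t) \<pi>') \<pi> \<delta>))"
    by (rule Bochner_Integration.integrable_cong[OF refl, THEN iffD2, rotated, OF J_integrable(1)[OF \<pi>, of \<delta>]], simp only: J)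
      (rule Bochner_Integration.integrable_cong[OF refl, THEN iffD2, rotated, OF J_integrable(2)[OF \<pi>, of \<delta>]], simp only: J)
  have int: "(\<integral>t. DH (\<lambda>\<pi>'. f0 t (x \<pi> t) (u \<pi> t) \<pi>') \<pi> \<delta> \<partial>(m1 T)) = (\<integral>t. J0 \<pi> t (0, 0, \<delta>) \<partial>(m1 T))"
    "(\<integral>t. costate \<pi> t (DH (\<lambda>\<pi>'. f t (x \<pi> t) (u \<pi> t) \<pi>') \<pi> \<delta>) \<partial>(m1 T)) = (\<integral>t. costate \<pi> t (JF \<pi> t (0, 0, \<delta>)) \<partial>(m1 T))"
    by (rule Bochner_Integration.integral_cong[OF refl], simp only: J)+
  have E: "DH (\<lambda>\<pi>'. g i (x \<pi> T) \<pi>') \<pi> \<delta> = JE \<pi> (Inl i) (0, \<delta>)" if "i \<in> {0..m}" for i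
    using endpoint_parts(2)[OF \<pi> InlI[OF that]] by simp
  have E': "DH (\<lambda>\<pi>'. h j (x \<pi> T) \<pi>') \<pi> \<delta> = JE \<pi> (Inr j) (0, \<delta>)" if "j \<in> {1..q}" for j
    using endpoint_parts(2)[OF \<pi> InrI[OF that]] by simp
  have "(\<Sum>k\<in>K. multiplier \<pi> k * JE \<pi> k (0, \<delta>)) = (\<Sum>i\<in>{0..m}. multiplier \<pi> (Inl i) * JE \<pi> (Inl i) (0, \<delta>))
      + (\<Sum>j\<in>{1..q}. multiplier \<pi> (Inr j) * JE \<pi> (Inr j) (0, \<delta>))" by (simp add: sum.Plus)
  also have "(\<Sum>i\<in>{0..m}. multiplier \<pi> (Inl i) * JE \<pi> (Inl i) (0, \<delta>)) =
      JE \<pi> (Inl 0) (0, \<delta>) + (\<Sum>i\<in>{1..m}. multiplier \<pi> (Inl i) * JE \<pi> (Inl i) (0, \<delta>))"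
    by (simp add: sum.atLeast_Suc_atMost triple(2)[OF \<pi>])
  finally show "DF V \<pi> \<delta> = DH (\<lambda>\<pi>'. g 0 (x \<pi> T) \<pi>') \<pi> \<delta>
            + (\<Sum>i\<in>{1..m}. multiplier \<pi> (Inl i) * DH (\<lambda>\<pi>'. g i (x \<pi> T) \<pi>') \<pi> \<delta>)
            + (\<Sum>j\<in>{1..q}. multiplier \<pi> (Inr j) * DH (\<lambda>\<pi>'. h j (x \<pi> T) \<pi>') \<pi> \<delta>)
            + (\<integral>t. DH (\<lambda>\<pi>'. f0 t (x \<pi> t) (u \<pi> t) \<pi>') \<pi> \<delta> \<partial>(m1 T))
            + (\<integral>t. costate \<pi> t (DH (\<lambda>\<pi>'. f t (x \<pi> t) (u \<pi> t) \<pi>') \<pi> \<delta>) \<partial>(m1 T))"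
    unfolding int DF_value[OF \<pi>] gradB_apply[OF \<pi>] grad_def by (simp add: E E')
qed

end

theorem corollary3p3:
  fixes T :: real
    and \<Omega> :: "'x::banach set" and U :: "'y::real_normed_vector set" and \<xi>0 :: 'x
    and m q :: nat
    and f0 :: "real \<Rightarrow> 'x \<Rightarrow> 'y \<Rightarrow> 'z::real_normed_vector \<Rightarrow> real"
    and f :: "real \<Rightarrow> 'x \<Rightarrow> 'y \<Rightarrow> 'z \<Rightarrow> 'x"
    and g h :: "nat \<Rightarrow> 'x \<Rightarrow> 'z \<Rightarrow> real"
    and \<pi>0 :: 'z and P :: "'z set"
    and x :: "'z \<Rightarrow> real \<Rightarrow> 'x" and u :: "'z \<Rightarrow> real \<Rightarrow> 'y"
    and \<Phi> :: "('x \<Rightarrow> 'z \<Rightarrow> real) set" and V :: "'z \<Rightarrow> real"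
  defines "\<Phi> \<equiv> g ` {0..m} \<union> h ` {1..q}"
    and "V \<equiv> bolza_value T \<Omega> U \<xi>0 m q f0 f g h"
  assumes T: "T > 0"
    and \<Omega>: "open \<Omega>" "\<Omega> \<noteq> {}" and U: "open U" "U \<noteq> {}" and \<xi>0: "\<xi>0 \<in> \<Omega>"
    and m: "m \<ge> 1" and q: "q \<ge> 1"
    and P: "open P" "\<pi>0 \<in> P"
    and SO: "\<forall>\<pi>\<in>P. bolza_solution T \<Omega> U \<xi>0 m q f0 f g h \<pi> (x \<pi>) (u \<pi>)"
    and SOter_cont: "path_continuous_at (PC1_norm T) x \<pi>0" "path_continuous_at (sup_norm T) u \<pi>0"
    and SOter_var: "\<forall>\<pi>\<in>P. \<forall>\<delta>. path_variation_exists (PC1 T UNIV) (PC1_norm T) x \<pi> \<delta>"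
      "\<forall>\<pi>\<in>P. \<forall>\<delta>. path_variation_exists (NPC0R T UNIV) (sup_norm T) u \<pi> \<delta>"
    and IC1: "continuous_on ({0..T} \<times> \<Omega> \<times> U \<times> P) (\<lambda>(t, \<xi>, \<zeta>, \<pi>). f0 t \<xi> \<zeta> \<pi>)"
      "\<forall>t\<in>{0..T}. \<forall>\<xi>\<in>\<Omega>. \<forall>\<zeta>\<in>U. \<forall>\<pi>\<in>P. gateaux_differentiable (\<lambda>\<xi>'. f0 t \<xi>' \<zeta> \<pi>) \<xi>"
      "\<forall>\<pi>\<in>P. \<forall>K. K \<noteq> {} \<and> compact K \<and> K \<subseteq> \<Omega> \<times> U \<longrightarrow>
         bdd_above ((\<lambda>(t, \<xi>, \<zeta>). norm (DG (\<lambda>\<xi>'. f0 t \<xi>' \<zeta> \<pi>) \<xi>)) ` ({0..T} \<times> K))"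
    and IC2: "\<forall>t\<in>{0..T}. hadamard_differentiable (\<lambda>(\<xi>, \<zeta>, \<pi>). f0 t \<xi> \<zeta> \<pi>) (x \<pi>0 t, u \<pi>0 t, \<pi>0)"
      "\<forall>\<pi>\<in>P. hadamard_differentiable (\<lambda>\<zeta>. f0 T (x \<pi> T) \<zeta> \<pi>) (u \<pi> T)"
      "continuous_on P (\<lambda>\<pi>. DH (\<lambda>\<zeta>. f0 T (x \<pi> T) \<zeta> \<pi>) (u \<pi> T))"
    and IC3: "\<exists>\<kappa> \<rho>. integrable (m1 T) \<kappa> \<and> (\<forall>t\<in>{0..T}. \<kappa> t \<ge> 0) \<and> \<rho> > 0 \<and>
      (\<forall>t\<in>{0..T}. \<forall>\<xi>1\<in>\<Omega>. \<forall>\<zeta>1\<in>U. \<forall>\<pi>1\<in>P. \<forall>\<xi>2\<in>\<Omega>. \<forall>\<zeta>2\<in>U. \<forall>\<pi>2\<in>P.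
         norm (\<xi>1 - x \<pi>0 t) + norm (\<zeta>1 - u \<pi>0 t) + norm (\<pi>1 - \<pi>0) < \<rho> \<and>
         norm (\<xi>2 - x \<pi>0 t) + norm (\<zeta>2 - u \<pi>0 t) + norm (\<pi>2 - \<pi>0) < \<rho> \<longrightarrow>
         \<bar>f0 t \<xi>1 \<zeta>1 \<pi>1 - f0 t \<xi>2 \<zeta>2 \<pi>2\<bar>
           \<le> \<kappa> t * (norm (\<xi>1 - \<xi>2) + norm (\<zeta>1 - \<zeta>2) + norm (\<pi>1 - \<pi>2)))"
    and IC4: "\<forall>t\<in>{0..T}. \<forall>\<zeta>\<in>U. \<forall>\<pi>\<in>P. (\<lambda>\<xi>. f0 t \<xi> \<zeta> \<pi>) differentiable (at (x \<pi> t))"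
      "\<forall>\<pi>\<in>P. continuous_on ({0..T} \<times> U) (\<lambda>(t, \<zeta>). DF (\<lambda>\<xi>. f0 t \<xi> \<zeta> \<pi>) (x \<pi> t))"
    and IC5: "\<forall>\<pi>\<in>P. \<forall>t\<in>{0..T}.
         hadamard_differentiable (\<lambda>(\<xi>, \<zeta>, \<pi>'). f0 t \<xi> \<zeta> \<pi>') (x \<pi> t, u \<pi> t, \<pi>)"
      "\<forall>t\<in>{0..T}. continuous_on P (\<lambda>\<pi>. DH (\<lambda>(\<xi>, \<pi>'). f0 t \<xi> (u \<pi> t) \<pi>') (x \<pi> t, \<pi>))"
    and IC6: "\<forall>\<pi>\<in>P. (\<lambda>t. DH (\<lambda>\<pi>'. f0 t (x \<pi> t) (u \<pi> t) \<pi>') \<pi>)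
         \<in> borel_measurable (restrict_space borel {0..T})"
    and V1: "\<forall>\<pi>\<in>P. continuous_on ({0..T} \<times> \<Omega> \<times> U) (\<lambda>(t, \<xi>, \<zeta>). f t \<xi> \<zeta> \<pi>)"
      "\<forall>t\<in>{0..T}. \<forall>\<xi>\<in>\<Omega>. \<forall>\<zeta>\<in>U. \<forall>\<pi>\<in>P. gateaux_differentiable (\<lambda>\<xi>'. f t \<xi>' \<zeta> \<pi>) \<xi>"
      "\<forall>\<pi>\<in>P. \<forall>K. K \<noteq> {} \<and> compact K \<and> K \<subseteq> \<Omega> \<times> U \<longrightarrow>
         bdd_above ((\<lambda>(t, \<xi>, \<zeta>). norm (DG (\<lambda>\<xi>'. f t \<xi>' \<zeta> \<pi>) \<xi>)) ` ({0..T} \<times> K))"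
    and V2: "\<forall>t\<in>{0..T}. hadamard_differentiable (\<lambda>(\<xi>, \<zeta>, \<pi>). f t \<xi> \<zeta> \<pi>) (x \<pi>0 t, u \<pi>0 t, \<pi>0)"
      "\<forall>\<pi>\<in>P. hadamard_differentiable (\<lambda>\<zeta>. f T (x \<pi> T) \<zeta> \<pi>) (u \<pi> T)"
    and V3: "\<forall>t\<in>{0..T}. \<forall>\<zeta>\<in>U. \<forall>\<pi>\<in>P. (\<lambda>\<xi>. f t \<xi> \<zeta> \<pi>) differentiable (at (x \<pi> t))"
      "\<forall>\<pi>\<in>P. continuous_on ({0..T} \<times> U) (\<lambda>(t, \<zeta>). DF (\<lambda>\<xi>. f t \<xi> \<zeta> \<pi>) (x \<pi> t))"
    and V4: "\<exists>c. integrable (m1 T) c \<and> (\<forall>t\<in>{0..T}. c t \<ge> 0) \<and>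
      (\<forall>t\<in>{0..T}. norm (DH (\<lambda>\<pi>. f t (x \<pi>0 t) (u \<pi>0 t) \<pi>) \<pi>0) \<le> c t)"
    and V5: "\<forall>\<pi>\<in>P. \<forall>t\<in>{0..T}.
         hadamard_differentiable (\<lambda>(\<xi>, \<zeta>, \<pi>'). f t \<xi> \<zeta> \<pi>') (x \<pi> t, u \<pi> t, \<pi>)"
      "\<forall>t\<in>{0..T}. continuous_on P (\<lambda>\<pi>. DH (\<lambda>(\<xi>, \<pi>'). f t \<xi> (u \<pi> t) \<pi>') (x \<pi> t, \<pi>))"
    and V6: "\<forall>\<pi>\<in>P. (\<lambda>t. DH (\<lambda>\<pi>'. f t (x \<pi> t) (u \<pi> t) \<pi>') \<pi>)
         \<in> borel_measurable (restrict_space borel {0..T})"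
      "\<exists>c. integrable (m1 T) c \<and> (\<forall>t\<in>{0..T}. c t \<ge> 0) \<and>
         (\<forall>t\<in>{0..T}. \<forall>\<pi>\<in>P. norm (DH (\<lambda>(\<xi>, \<pi>'). f t \<xi> (u \<pi> t) \<pi>') (x \<pi> t, \<pi>)) \<le> c t)"
    and CT1: "\<forall>\<phi>\<in>\<Phi>. hadamard_differentiable (\<lambda>(\<xi>, \<pi>). \<phi> \<xi> \<pi>) (x \<pi>0 T, \<pi>0) \<and>
         (\<forall>\<pi>\<in>P. hadamard_differentiable (\<lambda>\<xi>. \<phi> \<xi> \<pi>) (x \<pi> T))"
    and CT2: "\<forall>\<pi>\<in>P. \<forall>j\<in>{1..q}.
         \<exists>N. open N \<and> x \<pi> T \<in> N \<and> N \<subseteq> \<Omega> \<and> continuous_on N (\<lambda>\<xi>. h j \<xi> \<pi>)"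
    and CT3: "\<forall>\<phi>\<in>\<Phi>. \<forall>\<pi>\<in>P. hadamard_differentiable (\<lambda>(\<xi>, \<pi>'). \<phi> \<xi> \<pi>') (x \<pi> T, \<pi>)"
      "\<forall>\<phi>\<in>\<Phi>. continuous_on P (\<lambda>\<pi>. DH (\<lambda>(\<xi>, \<pi>'). \<phi> \<xi> \<pi>') (x \<pi> T, \<pi>))"
    and CVT1: "lin_indep_family ({1..m} <+> {1..q})
         (\<lambda>k. DH (\<lambda>\<xi>. (case k of Inl i \<Rightarrow> g i | Inr j \<Rightarrow> h j) \<xi> \<pi>0) (x \<pi>0 T)
              o\<^sub>L DH (\<lambda>\<zeta>. f T (x \<pi>0 T) \<zeta> \<pi>0) (u \<pi>0 T))"
    and CVT2: "\<forall>\<phi>\<in>\<Phi>. continuous_on P (\<lambda>\<pi>. DH (\<lambda>\<xi>. \<phi> \<xi> \<pi>) (x \<pi> T)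
              o\<^sub>L DH (\<lambda>\<zeta>. f T (x \<pi> T) \<zeta> \<pi>) (u \<pi> T))"
    and ESP: "\<exists>b :: ('y \<Rightarrow>\<^sub>L real) \<Rightarrow> ('y \<Rightarrow>\<^sub>L real) \<Rightarrow> real.
         is_inner_product b \<and> continuous_on UNIV (\<lambda>(v, w). b v w)"
  shows "\<exists>W. open W \<and> \<pi>0 \<in> W \<and> W \<subseteq> P \<and>
    (\<forall>\<pi>\<in>W. V differentiable (at \<pi>)) \<and> continuous_on W (DF V) \<and>
    (\<forall>\<pi>\<in>W. \<exists>l \<mu> p.
       pontryagin_triple T U m q f0 f g h \<pi> (x \<pi>) (u \<pi>) l \<mu> p \<and> l 0 = 1 \<and>
       (\<forall>l' \<mu>' p'. pontryagin_triple T U m q f0 f g h \<pi> (x \<pi>) (u \<pi>) l' \<mu>' p' \<and> l' 0 = 1 \<longrightarrow>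
          (\<forall>i\<in>{0..m}. l' i = l i) \<and> (\<forall>j\<in>{1..q}. \<mu>' j = \<mu> j) \<and> (\<forall>t\<in>{0..T}. p' t = p t)) \<and>
       (\<forall>\<delta>.
          integrable (m1 T) (\<lambda>t. DH (\<lambda>\<pi>'. f0 t (x \<pi> t) (u \<pi> t) \<pi>') \<pi> \<delta>) \<and>
          integrable (m1 T) (\<lambda>t. p t (DH (\<lambda>\<pi>'. f t (x \<pi> t) (u \<pi> t) \<pi>') \<pi> \<delta>)) \<and>
          DF V \<pi> \<delta> =
            DH (\<lambda>\<pi>'. g 0 (x \<pi> T) \<pi>') \<pi> \<delta>
            + (\<Sum>i\<in>{1..m}. l i * DH (\<lambda>\<pi>'. g i (x \<pi> T) \<pi>') \<pi> \<delta>)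
            + (\<Sum>j\<in>{1..q}. \<mu> j * DH (\<lambda>\<pi>'. h j (x \<pi> T) \<pi>') \<pi> \<delta>)
            + (\<integral>t. DH (\<lambda>\<pi>'. f0 t (x \<pi> t) (u \<pi> t) \<pi>') \<pi> \<delta> \<partial>(m1 T))
            + (\<integral>t. p t (DH (\<lambda>\<pi>'. f t (x \<pi> t) (u \<pi> t) \<pi>') \<pi> \<delta>) \<partial>(m1 T))))"
proof -
  interpret pos_time T by unfold_locales (rule T)
  have T_mem: "T \<in> {0..T}" using T by simp
  let ?K = "{0..m} <+> {1..q}" and ?K1 = "{1..m} <+> {1..q}"
  define \<phi> where "\<phi> k = (case k of Inl i \<Rightarrow> g i | Inr j \<Rightarrow> h j)" for k
  define E where "E \<pi> k = DH (\<lambda>\<xi>. \<phi> k \<xi> \<pi>) (x \<pi> T) o\<^sub>L DH (\<lambda>\<zeta>. f T (x \<pi> T) \<zeta> \<pi>) (u \<pi> T)" for \<pi> k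
  have \<phi>_mem: "\<phi> k \<in> \<Phi>" if "k \<in> ?K" for k using that by (auto simp: \<phi>_def \<Phi>_def)
  have K1: "k \<in> ?K" if "k \<in> ?K1" for k using that by (auto simp: Plus_def)
  have fin: "finite ?K1" by simp
  obtain \<kappa> \<rho> where \<kappa>: "integrable (m1 T) \<kappa>" and \<rho>: "\<rho> > 0" and lip: "\<forall>t\<in>{0..T}. \<forall>\<xi>1\<in>\<Omega>. \<forall>\<zeta>1\<in>U. \<forall>\<pi>1\<in>P. \<forall>\<xi>2\<in>\<Omega>. \<forall>\<zeta>2\<in>U. \<forall>\<pi>2\<in>P.
         norm (\<xi>1 - x \<pi>0 t) + norm (\<zeta>1 - u \<pi>0 t) + norm (\<pi>1 - \<pi>0) < \<rho> \<and>
         norm (\<xi>2 - x \<pi>0 t) + norm (\<zeta>2 - u \<pi>0 t) + norm (\<pi>2 - \<pi>0) < \<rho> \<longrightarrow>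
         \<bar>f0 t \<xi>1 \<zeta>1 \<pi>1 - f0 t \<xi>2 \<zeta>2 \<pi>2\<bar>
           \<le> \<kappa> t * (norm (\<xi>1 - \<xi>2) + norm (\<zeta>1 - \<zeta>2) + norm (\<pi>1 - \<pi>2))"
    using IC3 by (elim exE conjE)
  obtain c where c: "integrable (m1 T) c"
    and c_le: "\<forall>t\<in>{0..T}. \<forall>\<pi>\<in>P. norm (DH (\<lambda>(\<xi>, \<pi>'). f t \<xi> (u \<pi> t) \<pi>') (x \<pi> t, \<pi>)) \<le> c t"
    using V6(2) by (elim exE conjE)
  have x_PC1: "x \<pi> \<in> PC1 T \<Omega>" and u_NPC: "u \<pi> \<in> NPC0R T U" if "\<pi> \<in> P" for \<pi>
    using bspec[OF SO that] unfolding bolza_solution_def bolza_admissible_def by auto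
  have xu_in: "x \<pi> t \<in> \<Omega>" "u \<pi> t \<in> U" if "\<pi> \<in> P" "t \<in> {0..T}" for \<pi> t
    using PC1_D(2)[OF x_PC1[OF that(1)]] u_NPC[OF that(1)] that(2) by (auto simp: NPC0R_iff pcw_def)
  obtain \<epsilon> where \<epsilon>: "0 < \<epsilon>" "\<forall>b. \<epsilon> * (\<Sum>k\<in>?K1. \<bar>b k\<bar>) \<le> norm (\<Sum>k\<in>?K1. b k *\<^sub>R E \<pi>0 k)"
    using independent_lower_bound[OF fin, of "E \<pi>0"] CVT1 unfolding lin_indep_family_def E_def \<phi>_def by blast
  have E_cont: "continuous_on P (\<lambda>\<pi>. E \<pi> k)" if "k \<in> ?K" for k
    using bspec[OF CVT2 \<phi>_mem[OF that]] by (simp add: E_def)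
  define Q where "Q \<pi> \<longleftrightarrow> \<pi> \<in> P \<and> (\<forall>k\<in>?K1. norm (E \<pi> k - E \<pi>0 k) < \<epsilon> / 2) \<and> PC1_norm T (\<lambda>t. x \<pi> t - x \<pi>0 t) < \<rho> / 3 \<and>
      sup_norm T (\<lambda>t. u \<pi> t - u \<pi>0 t) < \<rho> / 3 \<and> norm (\<pi> - \<pi>0) < \<rho> / 3" for \<pi>
  have "eventually Q (at \<pi>0)"
    unfolding Q_def
  proof (intro eventually_conj eventually_ball_finite fin ballI)
    show "eventually (\<lambda>\<pi>. \<pi> \<in> P) (at \<pi>0)" using P by (rule eventually_at_in_open')
    show "eventually (\<lambda>\<pi>. norm (E \<pi> k - E \<pi>0 k) < \<epsilon> / 2) (at \<pi>0)" if "k \<in> ?K1" for k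
    proof -
      have "((\<lambda>\<pi>. E \<pi> k) \<longlongrightarrow> E \<pi>0 k) (at \<pi>0)"
        using E_cont[OF K1[OF that]] P(2) unfolding continuous_on_def at_within_open[OF P(2,1), symmetric] by blast
      from tendstoD[OF this, of "\<epsilon> / 2"] show ?thesis using \<epsilon>(1) by (simp add: dist_norm)
    qed
    show "eventually (\<lambda>\<pi>. PC1_norm T (\<lambda>t. x \<pi> t - x \<pi>0 t) < \<rho> / 3) (at \<pi>0)"
      by (rule order_tendstoD(2)[OF SOter_cont(1)[unfolded path_continuous_at_def]]) (use \<rho> in simp)
    show "eventually (\<lambda>\<pi>. sup_norm T (\<lambda>t. u \<pi> t - u \<pi>0 t) < \<rho> / 3) (at \<pi>0)"
      by (rule order_tendstoD(2)[OF SOter_cont(2)[unfolded path_continuous_at_def]]) (use \<rho> in simp)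
    show "eventually (\<lambda>\<pi>. norm (\<pi> - \<pi>0) < \<rho> / 3) (at \<pi>0)"
      using eventually_at_ball[of "\<rho> / 3" \<pi>0 UNIV] \<rho> by (simp add: dist_norm norm_minus_commute)
  qed
  \<comment> \<open>The continuity assumptions are limits over a punctured neighbourhood, so \<pi>0
    itself is treated separately each time \<open>Q\<close> is used.\<close>
  then obtain W where W: "open W" "\<pi>0 \<in> W" "\<And>\<pi>. \<pi> \<in> W \<Longrightarrow> \<pi> \<noteq> \<pi>0 \<Longrightarrow> Q \<pi>"
    unfolding eventually_at_topological by blast
  have WP: "\<pi> \<in> P" if "\<pi> \<in> W" for \<pi> using W(3)[OF that] P by (auto simp: Q_def)
  have E_near: "norm (E \<pi> k - E \<pi>0 k) \<le> \<epsilon> / 2" if "\<pi> \<in> W" "k \<in> ?K1" for \<pi> k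
    using W(3)[OF that(1)] \<epsilon>(1) that(2) by (cases "\<pi> = \<pi>0") (auto simp: Q_def intro: less_imp_le)
  \<comment> \<open>The sup norms are suprema of real numbers; they bound the pointwise distances
    because differences of piecewise continuous functions are bounded.\<close>
  have xu_near: "norm (x \<pi> t - x \<pi>0 t) + norm (u \<pi> t - u \<pi>0 t) + norm (\<pi> - \<pi>0) < \<rho>" if "\<pi> \<in> W" "t \<in> {0..T}" for \<pi> t
  proof (cases "\<pi> = \<pi>0")
    case False
    then have Q: "Q \<pi>" using W(3) that by blast
    have "(\<lambda>t. 1 *\<^sub>R x \<pi> t + (-1) *\<^sub>R x \<pi>0 t) \<in> PC1 T UNIV"
      by (rule PC1_linear_combination(1)[OF x_PC1[OF WP[OF that(1)]] x_PC1[OF P(2)]])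
    then have d: "(\<lambda>t. x \<pi> t - x \<pi>0 t) \<in> PC1 T UNIV" by simp
    note x_near = PC1_norm_upper(1)[OF this that(2)]
    have "continuous_on UNIV (\<lambda>z :: 'y \<times> 'y. fst z - snd z)" by (intro continuous_intros)
    from pcw_map2(1)[OF _ _ this, of "u \<pi>" "u \<pi>0"] u_NPC[OF WP[OF that(1)]] u_NPC[OF P(2)]
    have "pcw T UNIV (\<lambda>t. u \<pi> t - u \<pi>0 t)" by (auto simp: NPC0R_iff intro: pcw_mono)
    note u_near = sup_norm_upper(1)[OF this that(2)]
    show ?thesis using x_near u_near Q unfolding Q_def by linarith
  qed (use \<rho> in simp)
  have lower: "\<epsilon> / 2 * (\<Sum>k\<in>?K1. \<bar>b k\<bar>) \<le> norm (\<Sum>k\<in>?K1. b k *\<^sub>R E \<pi> k)" if "\<pi> \<in> W" for \<pi> b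
    by (rule perturbed_lower_bound[of \<epsilon> _ "E \<pi>0"]) (use \<epsilon>(2) E_near[OF that] in auto)
  have opt: "bolza_optimum T \<Omega> U \<xi>0 m q f0 f g h \<pi> (x \<pi>) (u \<pi>)" if "\<pi> \<in> W" for \<pi>
  proof
    note \<pi> = WP[OF that]
    show "open \<Omega>" "open U" "1 \<le> q" by (rule \<Omega> U q)+
    show "bolza_solution T \<Omega> U \<xi>0 m q f0 f g h \<pi> (x \<pi>) (u \<pi>)" using SO \<pi> by blast
    have lift: "continuous_on ({0..T} \<times> \<Omega> \<times> U) (\<lambda>(t, \<xi>, \<zeta>). (t, \<xi>, \<zeta>, \<pi>))"
      unfolding split_def by (intro continuous_intros)
    have range: "(\<lambda>(t, \<xi>, \<zeta>). (t, \<xi>, \<zeta>, \<pi>)) ` ({0..T} \<times> \<Omega> \<times> U) \<subseteq> {0..T} \<times> \<Omega> \<times> U \<times> P" using \<pi> by auto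
    show "continuous_on ({0..T} \<times> \<Omega> \<times> U) (\<lambda>(t, \<xi>, \<zeta>). f0 t \<xi> \<zeta> \<pi>)"
      using continuous_on_compose2[OF IC1(1) lift range] by (simp add: split_def)
    show "continuous_on ({0..T} \<times> \<Omega> \<times> U) (\<lambda>(t, \<xi>, \<zeta>). f t \<xi> \<zeta> \<pi>)" using V1(1) \<pi> by blast
    show "gateaux_differentiable (\<lambda>\<xi>'. f0 t \<xi>' \<zeta> \<pi>) \<xi>" "gateaux_differentiable (\<lambda>\<xi>'. f t \<xi>' \<zeta> \<pi>) \<xi>"
      if "t \<in> {0..T}" "\<xi> \<in> \<Omega>" "\<zeta> \<in> U" for t \<xi> \<zeta> using IC1(2) V1(2) \<pi> that by blast+
    show "bdd_above ((\<lambda>(t, \<xi>, \<zeta>). norm (DG (\<lambda>\<xi>'. f0 t \<xi>' \<zeta> \<pi>) \<xi>)) ` ({0..T} \<times> K))"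
      "bdd_above ((\<lambda>(t, \<xi>, \<zeta>). norm (DG (\<lambda>\<xi>'. f t \<xi>' \<zeta> \<pi>) \<xi>)) ` ({0..T} \<times> K))"
      if "K \<noteq> {}" "compact K" "K \<subseteq> \<Omega> \<times> U" for K
      by (rule bspec[OF IC1(3) \<pi>, THEN spec, THEN mp], use that in simp)
        (rule bspec[OF V1(3) \<pi>, THEN spec, THEN mp], use that in simp)
    show "(\<lambda>\<xi>. f0 t \<xi> \<zeta> \<pi>) differentiable (at (x \<pi> t))" "(\<lambda>\<xi>. f t \<xi> \<zeta> \<pi>) differentiable (at (x \<pi> t))"
      if "t \<in> {0..T}" "\<zeta> \<in> U" for t \<zeta> using IC4(1) V3(1) \<pi> that by blast+
    show "continuous_on ({0..T} \<times> U) (\<lambda>(t, \<zeta>). DF (\<lambda>\<xi>. f0 t \<xi> \<zeta> \<pi>) (x \<pi> t))"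
      "continuous_on ({0..T} \<times> U) (\<lambda>(t, \<zeta>). DF (\<lambda>\<xi>. f t \<xi> \<zeta> \<pi>) (x \<pi> t))" using IC4(2) V3(2) \<pi> by blast+
    show "hadamard_differentiable (\<lambda>\<xi>. g i \<xi> \<pi>) (x \<pi> T)" if "i \<in> {0..m}" for i using CT1 \<pi> that by (auto simp: \<Phi>_def)
    show "hadamard_differentiable (\<lambda>\<xi>. h j \<xi> \<pi>) (x \<pi> T)" if "j \<in> {1..q}" for j using CT1 \<pi> that by (auto simp: \<Phi>_def)
    show "\<exists>N. open N \<and> x \<pi> T \<in> N \<and> N \<subseteq> \<Omega> \<and> continuous_on N (\<lambda>\<xi>. h j \<xi> \<pi>)" if "j \<in> {1..q}" for j using CT2 \<pi> that by blast
    show "hadamard_differentiable (\<lambda>\<zeta>. f0 T (x \<pi> T) \<zeta> \<pi>) (u \<pi> T)" "hadamard_differentiable (\<lambda>\<zeta>. f T (x \<pi> T) \<zeta> \<pi>) (u \<pi> T)"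
      using IC2(2) V2(2) \<pi> by blast+
    \<comment> \<open>The lower bound at \<pi> gives back qualitative independence, which is the
      form required at a fixed parameter.\<close>
    have "b k = 0" if z: "(\<Sum>k\<in>?K1. b k *\<^sub>R E \<pi> k) = 0" and k: "k \<in> ?K1" for b k
    proof -
      have "\<epsilon> / 2 * (\<Sum>k\<in>?K1. \<bar>b k\<bar>) \<le> 0" using lower[OF \<open>\<pi> \<in> W\<close>, of b] unfolding z by simp
      then have "(\<Sum>k\<in>?K1. \<bar>b k\<bar>) \<le> 0" using \<epsilon>(1) by (simp add: mult_le_0_iff)
      moreover have "\<bar>b k\<bar> \<le> (\<Sum>k\<in>?K1. \<bar>b k\<bar>)" by (rule member_le_sum[OF k _ fin]) simp
      ultimately show ?thesis by simp
    qed
    then have "lin_indep_family ?K1 (E \<pi>)" unfolding lin_indep_family_def using fin by blast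
    then show "lin_indep_family ?K1 (\<lambda>k. DH (\<lambda>\<xi>. (case k of Inl i \<Rightarrow> g i | Inr j \<Rightarrow> h j) \<xi> \<pi>) (x \<pi> T) o\<^sub>L DH (\<lambda>\<zeta>. f T (x \<pi> T) \<zeta> \<pi>) (u \<pi> T))"
      by (simp only: E_def[abs_def] \<phi>_def)
  qed
  \<comment> \<open>The ball of (IC3) in the sum norm, taken inside \<Omega>, U and P. By the choice
    of W it contains the whole graph of every selected solution, so the single bound \<kappa> serves
    for all parameters in W.\<close>
  define N where "N t = (\<Omega> \<times> U \<times> P) \<inter>
      {z. norm (fst z - x \<pi>0 t) + norm (fst (snd z) - u \<pi>0 t) + norm (snd (snd z) - \<pi>0) < \<rho>}" for t
  interpret F: bolza_family T \<Omega> U \<xi>0 m q f0 f g h W x u \<kappa> c N "\<epsilon> / 2"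
  proof (rule bolza_family.intro[OF pos_time_axioms], rule bolza_family_axioms.intro)
    show "open W" by (rule W)
    show "bolza_optimum T \<Omega> U \<xi>0 m q f0 f g h \<pi> (x \<pi>) (u \<pi>)" if "\<pi> \<in> W" for \<pi> by (rule opt[OF that])
    show "path_variation_exists (PC1 T UNIV) (PC1_norm T) x \<pi> \<delta>" "path_variation_exists (NPC0R T UNIV) (sup_norm T) u \<pi> \<delta>"
      if "\<pi> \<in> W" for \<pi> \<delta> using SOter_var WP[OF that] by blast+
    show "integrable (m1 T) \<kappa>" "integrable (m1 T) c" by (rule \<kappa> c)+
    show "open (N t)" for t unfolding N_def
      by (intro open_Int open_Times \<Omega> U P open_Collect_less continuous_intros)
    show "(x \<pi> t, u \<pi> t, \<pi>) \<in> N t" if "\<pi> \<in> W" "t \<in> {0..T}" for \<pi> t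
      using xu_in[OF WP[OF that(1)] that(2)] WP[OF that(1)] xu_near[OF that] by (simp add: N_def)
    show "\<bar>f0 t \<xi>1 \<zeta>1 \<pi>1 - f0 t \<xi>2 \<zeta>2 \<pi>2\<bar> \<le> \<kappa> t * (norm (\<xi>1 - \<xi>2) + norm (\<zeta>1 - \<zeta>2) + norm (\<pi>1 - \<pi>2))"
      if "t \<in> {0..T}" "(\<xi>1, \<zeta>1, \<pi>1) \<in> N t" "(\<xi>2, \<zeta>2, \<pi>2) \<in> N t" for t \<xi>1 \<zeta>1 \<pi>1 \<xi>2 \<zeta>2 \<pi>2
      using lip that by (simp add: N_def)
    show "hadamard_differentiable (\<lambda>(\<xi>, \<zeta>, \<pi>'). f0 t \<xi> \<zeta> \<pi>') (x \<pi> t, u \<pi> t, \<pi>)"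
      "hadamard_differentiable (\<lambda>(\<xi>, \<zeta>, \<pi>'). f t \<xi> \<zeta> \<pi>') (x \<pi> t, u \<pi> t, \<pi>)" if "\<pi> \<in> W" "t \<in> {0..T}" for \<pi> t
      using IC5(1) V5(1) WP[OF that(1)] that(2) by blast+
    show "continuous_on W (\<lambda>\<pi>. DH (\<lambda>(\<xi>, \<pi>'). f0 t \<xi> (u \<pi> t) \<pi>') (x \<pi> t, \<pi>))"
      "continuous_on W (\<lambda>\<pi>. DH (\<lambda>(\<xi>, \<pi>'). f t \<xi> (u \<pi> t) \<pi>') (x \<pi> t, \<pi>))" if "t \<in> {0..T}" for t
      by (rule continuous_on_subset[of P]; use IC5(2) V5(2) that WP in blast)+
    show "(\<lambda>t. DH (\<lambda>\<pi>'. f0 t (x \<pi> t) (u \<pi> t) \<pi>') \<pi>) \<in> borel_measurable (m1 T)"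
      "(\<lambda>t. DH (\<lambda>\<pi>'. f t (x \<pi> t) (u \<pi> t) \<pi>') \<pi>) \<in> borel_measurable (m1 T)" if "\<pi> \<in> W" for \<pi>
      unfolding m1_measurable_iff using IC6 V6(1) WP[OF that] by blast+
    show "norm (DH (\<lambda>(\<xi>, \<pi>'). f t \<xi> (u \<pi> t) \<pi>') (x \<pi> t, \<pi>)) \<le> c t" if "\<pi> \<in> W" "t \<in> {0..T}" for \<pi> t
      using c_le WP[OF that(1)] that(2) by blast
    show "hadamard_differentiable (\<lambda>(\<xi>, \<pi>'). (case k of Inl i \<Rightarrow> g i | Inr j \<Rightarrow> h j) \<xi> \<pi>') (x \<pi> T, \<pi>)"
      if "k \<in> ?K" "\<pi> \<in> W" for k \<pi>
      using bspec[OF bspec[OF CT3(1) \<phi>_mem[OF that(1)]] WP[OF that(2)]] by (simp only: \<phi>_def)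
    show "continuous_on W (\<lambda>\<pi>. DH (\<lambda>(\<xi>, \<pi>'). (case k of Inl i \<Rightarrow> g i | Inr j \<Rightarrow> h j) \<xi> \<pi>') (x \<pi> T, \<pi>))"
      if "k \<in> ?K" for k
      using continuous_on_subset[OF bspec[OF CT3(2) \<phi>_mem[OF that]], of W] WP by (auto simp only: \<phi>_def)
    show "continuous_on W (\<lambda>\<pi>. DH (\<lambda>\<xi>. (case k of Inl i \<Rightarrow> g i | Inr j \<Rightarrow> h j) \<xi> \<pi>) (x \<pi> T) o\<^sub>L DH (\<lambda>\<zeta>. f T (x \<pi> T) \<zeta> \<pi>) (u \<pi> T))"
      if "k \<in> ?K" for k
      using continuous_on_subset[OF E_cont[OF that], of W] WP by (auto simp only: E_def \<phi>_def)
    show "continuous_on W (\<lambda>\<pi>. DH (\<lambda>\<zeta>. f0 T (x \<pi> T) \<zeta> \<pi>) (u \<pi> T))"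
      by (rule continuous_on_subset[OF IC2(3)]) (use WP in blast)
    show "0 < \<epsilon> / 2" using \<epsilon>(1) by simp
    show "\<epsilon> / 2 * (\<Sum>k\<in>?K1. \<bar>b k\<bar>) \<le> norm (\<Sum>k\<in>?K1. b k *\<^sub>R (DH (\<lambda>\<xi>. (case k of Inl i \<Rightarrow> g i | Inr j \<Rightarrow> h j) \<xi> \<pi>) (x \<pi> T)
         o\<^sub>L DH (\<lambda>\<zeta>. f T (x \<pi> T) \<zeta> \<pi>) (u \<pi> T)))" if "\<pi> \<in> W" for \<pi> b
      using lower[OF that, of b] by (simp only: E_def \<phi>_def)
  qed
  have "V differentiable (at \<pi>)" if "\<pi> \<in> W" for \<pi>
    using F.value_has_derivative[OF that] unfolding V_def differentiable_def by blast
  moreover have "continuous_on W (DF V)"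
    using F.gradB_continuous F.DF_value unfolding V_def by (simp cong: continuous_on_cong)
  ultimately show ?thesis
    using W(1,2) WP F.normal_triple_conclusion unfolding V_def by (intro exI[of _ W] conjI ballI subsetI) blast+
qed

end
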